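(* Let $(R,\mathfrak m)$ be a regular local ring with quotient field $F$ and $\dim R\ge 2$, let $\{(R_i,\mathfrak m_i)\}_{i\ge 0}$ be an infinite sequence of local quadratic transforms with $R_0=R$, and let $S=\bigcup_{i\ge 0}R_i$. The following are equivalent: (1) $S$ is a valuation ring; (2) $S$ has only finitely many height $1$ prime ideals; (3) either (a) $\dim S=1$, or (b) $\dim S=2$ and the boundary valuation ring $V$ of $S$ has value group $\mathbb Z\oplus G$, where $G$ is a subgroup of $\mathbb Q$ and the direct sum is ordered lexicographically.
   Context: A local quadratic transform of a regular local ring $(A,\mathfrak n)$ is a local ring $A[\mathfrak n/x]_{\mathfrak q}$ with $x\in\mathfrak n\setminus\mathfrak n^2$ and $\mathfrak q$ a prime ideal of $A[\mathfrak n/x]$ containing $\mathfrak n$. The sequence satisfies: for each $i\ge 0$, $R_{i+1}$ is a local quadratic transform of $R_i$, $R_i\subsetneq R_{i+1}$, and each $R_i$ is a regular local ring of dimension at least $2$ with maximal ideal $\mathfrak m_i$. $\mathrm{ord}_i$ is the order valuation of $R_i$ ($\mathrm{ord}_i(a)=\max\{n:a\in\mathfrak m_i^n\}$ for $0\ne a\in R_i$, extended to $F$ by $\mathrm{ord}_i(a/b)=\mathrm{ord}_i(a)-\mathrm{ord}_i(b)$), with valuation ring $V_i$. The boundary valuation ring of $S$ is the unique valuation ring $V$ with $R\subseteq V\subseteq F$ that is a limit point of $\{V_i\}$ in the patch topology (basic open sets $\{U: G\subseteq U, H\subseteq\mathfrak M_U\}$ for finite $G,H\subseteq F$, $\mathfrak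 M_U$ the maximal ideal of $U$); equivalently $V=\{q\in F:\mathrm{ord}_i(q)\ge 0\text{ for all } i\gg0\}$. *)

theory Defs
  imports Main "HOL-Library.Extended_Nat"
begin

text \<open>All rings are subrings of a fixed ambient field of type 'a (the quotient field F).\<close>

definition subring :: "'a::field set \<Rightarrow> bool" where
  "subring A \<longleftrightarrow> 0 \<in> A \<and> 1 \<in> A \<and> (\<forall>x\<in>A. \<forall>y\<in>A. x + y \<in> A \<and> x - y \<in> A \<and> x * y \<in> A)"

definition has_quotient_field :: "'a::field set \<Rightarrow> bool" where
  "has_quotient_field A \<longleftrightarrow> (\<forall>q. \<exists>a\<in>A. \<exists>b\<in>A. b \<noteq> 0 \<and> q = a / b)"

definition is_ideal :: "'a::field set \<Rightarrow> 'a set \<Rightarrow> bool" where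
  "is_ideal A I \<longleftrightarrow> I \<subseteq> A \<and> 0 \<in> I \<and> (\<forall>x\<in>I. \<forall>y\<in>I. x + y \<in> I)
     \<and> (\<forall>a\<in>A. \<forall>x\<in>I. a * x \<in> I)"

definition prime_ideal :: "'a::field set \<Rightarrow> 'a set \<Rightarrow> bool" where
  "prime_ideal A P \<longleftrightarrow> is_ideal A P \<and> P \<noteq> A \<and>
     (\<forall>a\<in>A. \<forall>b\<in>A. a * b \<in> P \<longrightarrow> a \<in> P \<or> b \<in> P)"

definition gen_ideal :: "'a::field set \<Rightarrow> 'a set \<Rightarrow> 'a set" where
  "gen_ideal A X = {(\<Sum>y\<in>Y. c y * y) | Y c. finite Y \<and> Y \<subseteq> X \<and> c ` Y \<subseteq> A}"

definition noetherian :: "'a::field set \<Rightarrow> bool" where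
  "noetherian A \<longleftrightarrow> (\<forall>I. is_ideal A I \<longrightarrow> (\<exists>X. finite X \<and> X \<subseteq> I \<and> gen_ideal A X = I))"

definition max_ideal :: "'a::field set \<Rightarrow> 'a set" where
  "max_ideal A = {x\<in>A. x = 0 \<or> inverse x \<notin> A}"

definition local_ring :: "'a::field set \<Rightarrow> bool" where
  "local_ring A \<longleftrightarrow> subring A \<and> is_ideal A (max_ideal A)"

definition prime_chain :: "'a::field set \<Rightarrow> (nat \<Rightarrow> 'a set) \<Rightarrow> nat \<Rightarrow> bool" where
  "prime_chain A p n \<longleftrightarrow> (\<forall>i\<le>n. prime_ideal A (p i)) \<and> (\<forall>i<n. p i \<subset> p (Suc i))"

definition krull_dim :: "'a::field set \<Rightarrow> enat" where
  "krull_dim A = Sup {enat n | n. \<exists>p. prime_chain A p n}"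

definition height :: "'a::field set \<Rightarrow> 'a set \<Rightarrow> enat" where
  "height A P = Sup {enat n | n. \<exists>p. prime_chain A p n \<and> p n = P}"

definition regular_local_ring :: "'a::field set \<Rightarrow> bool" where
  "regular_local_ring A \<longleftrightarrow> local_ring A \<and> noetherian A \<and> krull_dim A \<noteq> \<infinity> \<and>
     krull_dim A = enat (LEAST n. \<exists>X. finite X \<and> card X = n \<and> X \<subseteq> max_ideal A
                                  \<and> gen_ideal A X = max_ideal A)"

fun ideal_pow :: "'a::field set \<Rightarrow> 'a set \<Rightarrow> nat \<Rightarrow> 'a set" where
  "ideal_pow A I 0 = A"
| "ideal_pow A I (Suc n) = gen_ideal A {x * y | x y. x \<in> ideal_pow A I n \<and> y \<in> I}"

definition ring_adjoin :: "'a::field set \<Rightarrow> 'a set \<Rightarrow> 'a \<Rightarrow> 'a set" where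
  "ring_adjoin A I x = \<Inter>{B. subring B \<and> A \<subseteq> B \<and> (\<forall>a\<in>I. a / x \<in> B)}"

definition localize :: "'a::field set \<Rightarrow> 'a set \<Rightarrow> 'a set" where
  "localize B Q = {a / b | a b. a \<in> B \<and> b \<in> B \<and> b \<notin> Q}"

definition local_quadratic_transform :: "'a::field set \<Rightarrow> 'a set \<Rightarrow> bool" where
  "local_quadratic_transform A B \<longleftrightarrow>
     (\<exists>x Q. x \<in> max_ideal A \<and> x \<notin> ideal_pow A (max_ideal A) 2 \<and>
        prime_ideal (ring_adjoin A (max_ideal A) x) Q \<and> max_ideal A \<subseteq> Q \<and>
        B = localize (ring_adjoin A (max_ideal A) x) Q)"

definition ord :: "'a::field set \<Rightarrow> 'a \<Rightarrow> nat" where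
  "ord A a = (GREATEST n. a \<in> ideal_pow A (max_ideal A) n)"

definition ord_field :: "'a::field set \<Rightarrow> 'a \<Rightarrow> int" where
  "ord_field A q = (let (a, b) = (SOME (a, b). a \<in> A \<and> b \<in> A \<and> a \<noteq> 0 \<and> b \<noteq> 0 \<and> q = a / b)
                    in int (ord A a) - int (ord A b))"

definition boundary_valuation_ring :: "(nat \<Rightarrow> 'a::field set) \<Rightarrow> 'a set" where
  "boundary_valuation_ring R = {q. q = 0 \<or> (\<forall>\<^sub>F i in sequentially. ord_field (R i) q \<ge> 0)}"

definition valuation_ring :: "'a::field set \<Rightarrow> bool" where
  "valuation_ring V \<longleftrightarrow> subring V \<and> (\<forall>x. x \<noteq> 0 \<longrightarrow> x \<in> V \<or> inverse x \<in> V)"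

definition rat_subgroup :: "rat set \<Rightarrow> bool" where
  "rat_subgroup G \<longleftrightarrow> 0 \<in> G \<and> (\<forall>x\<in>G. \<forall>y\<in>G. x + y \<in> G \<and> - x \<in> G)"

definition lex_nonneg :: "int \<times> rat \<Rightarrow> bool" where
  "lex_nonneg z \<longleftrightarrow> fst z > 0 \<or> (fst z = 0 \<and> snd z \<ge> 0)"

text \<open>The value group of V (V a valuation ring of the field 'a) is order-isomorphic to
  Z (+) G ordered lexicographically: equivalently there is a surjective valuation
  v : F^* \<rightarrow> Z (+) G whose valuation ring is V.\<close>
definition value_group_is_Z_lex :: "'a::field set \<Rightarrow> rat set \<Rightarrow> bool" where
  "value_group_is_Z_lex V G \<longleftrightarrow> (\<exists>v :: 'a \<Rightarrow> int \<times> rat.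
     (\<forall>x y. x \<noteq> 0 \<longrightarrow> y \<noteq> 0 \<longrightarrow>
        v (x * y) = (fst (v x) + fst (v y), snd (v x) + snd (v y))) \<and>
     v ` (UNIV - {0}) = {z. snd z \<in> G} \<and>
     (\<forall>x. x \<noteq> 0 \<longrightarrow> (x \<in> V \<longleftrightarrow> lex_nonneg (v x))))"

end

theory Submission
  imports Defs "HOL-Library.Poly_Mapping"
begin

text \<open>
  Let \<open>x\<^sub>n\<close> be the element with \<open>m\<^sub>n R\<^sub>n\<^sub>+\<^sub>1 = x\<^sub>n R\<^sub>n\<^sub>+\<^sub>1\<close>, and let \<open>N\<close> be the maximal ideal of \<open>S\<close>.
  A Taylor expansion shows that the order of the transform \<open>f / x\<^sub>n\<^sup>r\<close>, \<open>r\<close> the order of \<open>f\<close> in \<open>R\<^sub>n\<close>,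
  is at most \<open>r\<close>, so the orders of the successive transforms of an element are eventually constant.
  For a prime \<open>P \<noteq> N\<close> of \<open>S\<close> the localization \<open>S\<^sub>P\<close> is a localization of some \<open>R\<^sub>j\<close>.

  If \<open>S\<close> is a valuation ring, every nonzero prime \<open>P \<noteq> N\<close> has height one, and bounding the orders of an
  element of \<open>P\<close> by those of \<open>f \<notin> P\<close> shows that \<open>f\<close> is a unit times a product of \<open>x\<^sub>n\<close>'s. If at
  least two exceptional divisors survived at every stage, their product would be divisible by all
  \<open>x\<^sub>n\<close>; so infinitely often only one survives, and the value group of \<open>S/P\<close> is an increasing union of
  cyclic groups, hence a subgroup of the rationals. In case (3)(b) the same comparison of orders, now with
  the boundary valuation \<open>v\<close>, shows that all primes other than \<open>N\<close> lie in the one defined by the positivity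
  of the integer component of \<open>v\<close>.

  Suppose that \<open>S\<close> has finitely many height one primes. An exceptional divisor surviving forever defines
  such a prime, so for large \<open>n\<close> the only prime containing \<open>x\<^sub>n\<close> is \<open>N\<close>, and by Krull's principal ideal theorem an
  element outside the height one primes other than \<open>N\<close> divides a power of \<open>x\<^sub>n\<close>. Following the orders of
  pairs of elements, any two such elements are comparable under divisibility, and there is at most
  one height one prime \<open>P \<noteq> N\<close>. Its localization is a discrete valuation ring because \<open>R\<^sub>j\<close> is
  completely integrally closed; together this makes \<open>S\<close> a valuation ring.
\<close>

text \<open>All rings are sets inside one field, so residue rings \<open>A/P\<close> do not occur;
  statements modulo a prime are congruences \<open>a - b * c \<in> P\<close>.

  The comparison of orders rests on one fact. If \<open>f\<close> can be divided once by each later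
  \<open>x n\<close> and still stays a nonunit, then every \<open>e\<close> has an exponent
  \<open>M\<close> such that \<open>e / f^M\<close> has negative order at all late stages. Such a
  quotient lies neither in \<open>S\<close> nor in the boundary valuation ring. Whenever it is known
  to lie there for other reasons, \<open>f\<close> must become a unit after finitely many divisions.

  For a pair, common powers of the \<open>x n\<close> are removed until the minimum of the two
  orders is a constant \<open>r\<close>. If \<open>r \<ge> 1\<close>, one element never loses its
  order, which is impossible for a divisor of a power of a late \<open>x n\<close>. So
  \<open>r = 0\<close>, one element has become a unit, and it divides the other.

  In the uniqueness of \<open>P\<close> the residue fields may be finite, so there need be no
  general linear combination of \<open>u\<close> and \<open>w\<close>. The identity
  \<open>u^2 + u w + w^2 = (u + w)^2 - u w\<close> replaces it: if the order of \<open>u + w\<close>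
  exceeds the common order \<open>r\<close> of \<open>u\<close> and \<open>w\<close>, then the
  quadratic expression has order exactly \<open>2 r\<close>.\<close>

lemma subringD:
  assumes "subring A"
  shows "0 \<in> A" "1 \<in> A"
    "\<And>x y. x \<in> A \<Longrightarrow> y \<in> A \<Longrightarrow> x + y \<in> A"
    "\<And>x y. x \<in> A \<Longrightarrow> y \<in> A \<Longrightarrow> x - y \<in> A"
    "\<And>x y. x \<in> A \<Longrightarrow> y \<in> A \<Longrightarrow> x * y \<in> A"
    "\<And>x. x \<in> A \<Longrightarrow> - x \<in> A"
proof -
  show "\<And>x. x \<in> A \<Longrightarrow> - x \<in> A"
    using assms unfolding subring_def by (metis diff_0)
qed (use assms in \<open>auto simp: subring_def\<close>)

lemma subring_power: "subring A \<Longrightarrow> x \<in> A \<Longrightarrow> x ^ n \<in> A"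
  by (induction n) (auto simp: subringD)

lemma subring_sum: "subring A \<Longrightarrow> (\<And>i. i \<in> I \<Longrightarrow> f i \<in> A) \<Longrightarrow> sum f I \<in> A"
  by (induction I rule: infinite_finite_induct) (auto simp: subringD)

lemma subring_prod: "subring A \<Longrightarrow> (\<And>i. i \<in> I \<Longrightarrow> f i \<in> A) \<Longrightarrow> prod f I \<in> A"
  by (induction I rule: infinite_finite_induct) (auto simp: subringD)

lemma idealD:
  assumes "subring A" "is_ideal A I"
  shows "0 \<in> I" "\<And>x. x \<in> I \<Longrightarrow> x \<in> A"
    "\<And>x y. x \<in> I \<Longrightarrow> y \<in> I \<Longrightarrow> x + y \<in> I"
    "\<And>x y. x \<in> I \<Longrightarrow> y \<in> I \<Longrightarrow> x - y \<in> I"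
    "\<And>x. x \<in> I \<Longrightarrow> - x \<in> I"
    "\<And>x y. x \<in> A \<Longrightarrow> y \<in> I \<Longrightarrow> x * y \<in> I"
    "\<And>x y. x \<in> I \<Longrightarrow> y \<in> A \<Longrightarrow> x * y \<in> I"
proof -
  show m: "\<And>x y. x \<in> A \<Longrightarrow> y \<in> I \<Longrightarrow> x * y \<in> I" using assms by (auto simp: is_ideal_def)
  then show "\<And>x y. x \<in> I \<Longrightarrow> y \<in> A \<Longrightarrow> x * y \<in> I" by (metis mult.commute)
  show u: "- x \<in> I" if "x \<in> I" for x
    using m[of "-1" x] that subringD[OF assms(1)] by simp
  show a: "\<And>x y. x \<in> I \<Longrightarrow> y \<in> I \<Longrightarrow> x + y \<in> I" using assms by (auto simp: is_ideal_def)
  show "\<And>x y. x \<in> I \<Longrightarrow> y \<in> I \<Longrightarrow> x - y \<in> I" using a u by (metis diff_conv_add_uminus)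
qed (use assms in \<open>auto simp: is_ideal_def\<close>)

lemma ideal_sum: "subring A \<Longrightarrow> is_ideal A I \<Longrightarrow> (\<And>i. i \<in> K \<Longrightarrow> f i \<in> I) \<Longrightarrow> sum f K \<in> I"
  by (induction K rule: infinite_finite_induct) (auto simp: idealD)

lemma ideal_self: "subring A \<Longrightarrow> is_ideal A A"
  by (auto simp: is_ideal_def subringD)

lemma ideal_zero: "subring A \<Longrightarrow> is_ideal A {0}"
  by (auto simp: is_ideal_def subringD)

lemma ideal_eq_ring: "subring A \<Longrightarrow> is_ideal A I \<Longrightarrow> 1 \<in> I \<Longrightarrow> I = A"
  by (auto simp: idealD) (metis idealD(6) mult.right_neutral)

lemma primeD:
  assumes "subring A" "prime_ideal A P"
  shows "is_ideal A P" "1 \<notin> P"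
    "\<And>a b. a \<in> A \<Longrightarrow> b \<in> A \<Longrightarrow> a * b \<in> P \<Longrightarrow> a \<in> P \<or> b \<in> P"
  using assms ideal_eq_ring[of A P] by (auto simp: prime_ideal_def)

lemma primeI:
  assumes "is_ideal A P" "1 \<notin> P" "1 \<in> A"
    "\<And>a b. a \<in> A \<Longrightarrow> b \<in> A \<Longrightarrow> a * b \<in> P \<Longrightarrow> a \<in> P \<or> b \<in> P"
  shows "prime_ideal A P"
  using assms by (auto simp: prime_ideal_def)

lemma prime_power:
  assumes "subring A" "prime_ideal A P" "a \<in> A" "a ^ n \<in> P"
  shows "a \<in> P"
  using assms(4)
proof (induction n)
  case 0 then show ?case using primeD[OF assms(1,2)] by simp
next
  case (Suc n)
  then show ?case using primeD(3)[OF assms(1,2,3), of "a ^ n"] subring_power[OF assms(1,3)] by auto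
qed

lemma prime_prod:
  assumes "subring A" "prime_ideal A P" "\<And>i. i \<in> I \<Longrightarrow> f i \<in> A" "prod f I \<in> P"
  shows "\<exists>i\<in>I. f i \<in> P"
  using assms(3,4)
proof (induction I rule: infinite_finite_induct)
  case (insert i I)
  have "f i * prod f I \<in> P" using insert by auto
  then have "f i \<in> P \<or> prod f I \<in> P"
    using insert subring_prod[OF assms(1), of I f] primeD(3)[OF assms(1,2), of "f i" "prod f I"] by auto
  then show ?case using insert by auto
qed (use primeD[OF assms(1,2)] in auto)

lemma prime_zero: "subring A \<Longrightarrow> prime_ideal A {0}"
  by (rule primeI) (auto simp: ideal_zero subringD)

subsection \<open>Generated ideals\<close>

lemma gen_idealI:
  "finite Y \<Longrightarrow> Y \<subseteq> X \<Longrightarrow> c ` Y \<subseteq> A \<Longrightarrow> (\<Sum>y\<in>Y. c y * y) \<in> gen_ideal A X"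
  unfolding gen_ideal_def by blast

lemma gen_ideal_ideal:
  assumes A: "subring A" and X: "X \<subseteq> A"
  shows "is_ideal A (gen_ideal A X)"
  unfolding is_ideal_def
proof (intro conjI ballI)
  show "gen_ideal A X \<subseteq> A"
    using X by (fastforce simp: gen_ideal_def intro!: subring_sum[OF A] subringD(5)[OF A])
  show "0 \<in> gen_ideal A X"
    by (auto simp: gen_ideal_def intro!: exI[of _ "{}"])
next
  fix x y assume "x \<in> gen_ideal A X" "y \<in> gen_ideal A X"
  then obtain Y c Z d where x: "x = (\<Sum>z\<in>Y. c z * z)" "finite Y" "Y \<subseteq> X" "c ` Y \<subseteq> A"
    and y: "y = (\<Sum>z\<in>Z. d z * z)" "finite Z" "Z \<subseteq> X" "d ` Z \<subseteq> A"
    unfolding gen_ideal_def by blast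
  let ?c = "\<lambda>z. (if z \<in> Y then c z else 0) + (if z \<in> Z then d z else 0)"
  have "(\<Sum>z\<in>Y. c z * z) = (\<Sum>z\<in>Y\<union>Z. (if z \<in> Y then c z else 0) * z)"
    by (rule sum.mono_neutral_cong_left) (use x y in auto)
  moreover have "(\<Sum>z\<in>Z. d z * z) = (\<Sum>z\<in>Y\<union>Z. (if z \<in> Z then d z else 0) * z)"
    by (rule sum.mono_neutral_cong_left) (use x y in auto)
  ultimately have "x + y = (\<Sum>z\<in>Y\<union>Z. ?c z * z)"
    using x y by (simp add: sum.distrib algebra_simps)
  moreover have "?c ` (Y \<union> Z) \<subseteq> A"
  proof (intro image_subsetI subringD(3)[OF A])
    fix z show "(if z \<in> Y then c z else 0) \<in> A" "(if z \<in> Z then d z else 0) \<in> A"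
      using x(4) y(4) subringD(1)[OF A] by auto
  qed
  moreover have "finite (Y \<union> Z)" "Y \<union> Z \<subseteq> X" using x y by auto
  ultimately show "x + y \<in> gen_ideal A X" using gen_idealI[of "Y \<union> Z" X ?c A] by simp
next
  fix a x assume a: "a \<in> A" and "x \<in> gen_ideal A X"
  then obtain Y c where x: "x = (\<Sum>z\<in>Y. c z * z)" "finite Y" "Y \<subseteq> X" "c ` Y \<subseteq> A"
    unfolding gen_ideal_def by blast
  have "a * x = (\<Sum>z\<in>Y. (a * c z) * z)" using x by (simp add: sum_distrib_left mult.assoc)
  moreover have "(\<lambda>z. a * c z) ` Y \<subseteq> A" using x a subringD[OF A] by auto
  ultimately show "a * x \<in> gen_ideal A X" using x(2,3) gen_idealI[of Y X "\<lambda>z. a * c z" A] by simp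
qed

lemma gen_ideal_superset:
  assumes "subring A" shows "X \<subseteq> gen_ideal A X"
proof
  fix x assume "x \<in> X"
  then show "x \<in> gen_ideal A X"
    using gen_idealI[of "{x}" X "\<lambda>_. 1" A] subringD(2)[OF assms] by auto
qed

lemma gen_ideal_least:
  assumes "subring A" "is_ideal A I" "X \<subseteq> I" shows "gen_ideal A X \<subseteq> I"
  using assms(3) by (fastforce simp: gen_ideal_def intro!: ideal_sum[OF assms(1,2)] idealD(6)[OF assms(1,2)])

definition ideal_add :: "'a::field set \<Rightarrow> 'a set \<Rightarrow> 'a set" where
  "ideal_add I J = {x + y | x y. x \<in> I \<and> y \<in> J}"

definition ideal_mul :: "'a::field set \<Rightarrow> 'a set \<Rightarrow> 'a set \<Rightarrow> 'a set" where
  "ideal_mul A I J = gen_ideal A {x * y | x y. x \<in> I \<and> y \<in> J}"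

definition principal :: "'a::field set \<Rightarrow> 'a \<Rightarrow> 'a set" where
  "principal A a = {a * r | r. r \<in> A}"

lemma ideal_addI: "x \<in> I \<Longrightarrow> y \<in> J \<Longrightarrow> x + y \<in> ideal_add I J"
  by (auto simp: ideal_add_def)

lemma ideal_addE: "z \<in> ideal_add I J \<Longrightarrow> (\<And>x y. x \<in> I \<Longrightarrow> y \<in> J \<Longrightarrow> z = x + y \<Longrightarrow> P) \<Longrightarrow> P"
  by (auto simp: ideal_add_def)

lemma ideal_add_ideal:
  assumes A: "subring A" and I: "is_ideal A I" and J: "is_ideal A J"
  shows "is_ideal A (ideal_add I J)"
  unfolding is_ideal_def
proof (intro conjI ballI)
  show "ideal_add I J \<subseteq> A"
    using idealD(2)[OF A I] idealD(2)[OF A J] by (auto simp: ideal_add_def subringD[OF A])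
  show "0 \<in> ideal_add I J"
    using ideal_addI[OF idealD(1)[OF A I] idealD(1)[OF A J]] by simp
next
  fix x y assume "x \<in> ideal_add I J" "y \<in> ideal_add I J"
  then obtain a b c d where "x = a + b" "y = c + d" "a \<in> I" "b \<in> J" "c \<in> I" "d \<in> J"
    by (auto simp: ideal_add_def)
  then show "x + y \<in> ideal_add I J"
    using ideal_addI[OF idealD(3)[OF A I] idealD(3)[OF A J], of a c b d] by (simp add: algebra_simps)
next
  fix r x assume "r \<in> A" "x \<in> ideal_add I J"
  then show "r * x \<in> ideal_add I J"
    by (elim ideal_addE) (auto simp: distrib_left intro!: ideal_addI idealD(6)[OF A I] idealD(6)[OF A J])
qed

lemma ideal_add_sup:
  assumes A: "subring A" and I: "is_ideal A I" and J: "is_ideal A J"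
  shows "I \<subseteq> ideal_add I J" "J \<subseteq> ideal_add I J"
  using ideal_addI[OF _ idealD(1)[OF A J], of _ I] ideal_addI[OF idealD(1)[OF A I], of _ J] by auto

lemma ideal_add_least:
  assumes A: "subring A" and K: "is_ideal A K" and "I \<subseteq> K" "J \<subseteq> K"
  shows "ideal_add I J \<subseteq> K"
  using assms idealD(3)[OF A K] by (auto simp: ideal_add_def)

lemma principal_ideal:
  assumes A: "subring A" and a: "a \<in> A"
  shows "is_ideal A (principal A a)"
  unfolding is_ideal_def
proof (intro conjI ballI)
  fix x y assume "x \<in> principal A a" "y \<in> principal A a"
  then show "x + y \<in> principal A a"
    by (auto simp: principal_def distrib_left[symmetric] subringD[OF A])
next
  fix r x assume "r \<in> A" "x \<in> principal A a"
  then show "r * x \<in> principal A a"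
    by (auto simp: principal_def mult.left_commute intro!: subringD[OF A])
qed (use a in \<open>auto simp: principal_def subringD[OF A] intro: exI[of _ 0]\<close>)

lemma principal_self: "subring A \<Longrightarrow> a \<in> principal A a"
  by (auto simp: principal_def subringD intro!: exI[of _ 1])

lemma principal_least:
  assumes "subring A" "is_ideal A I" "a \<in> I" shows "principal A a \<subseteq> I"
  using idealD(7)[OF assms] by (auto simp: principal_def)

lemma ideal_mul_sub: "subring A \<Longrightarrow> is_ideal A I \<Longrightarrow> is_ideal A J \<Longrightarrow>
    {x * y | x y. x \<in> I \<and> y \<in> J} \<subseteq> I \<inter> J"
  by (auto simp: idealD)

lemma ideal_mul_ideal:
  assumes "subring A" "is_ideal A I" "is_ideal A J"
  shows "is_ideal A (ideal_mul A I J)"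
proof -
  have "{x * y | x y. x \<in> I \<and> y \<in> J} \<subseteq> A" using ideal_mul_sub[OF assms] idealD(2)[OF assms(1,2)] by blast
  then show ?thesis unfolding ideal_mul_def by (rule gen_ideal_ideal[OF assms(1)])
qed

lemma ideal_mulI: "subring A \<Longrightarrow> x \<in> I \<Longrightarrow> y \<in> J \<Longrightarrow> x * y \<in> ideal_mul A I J"
  using gen_ideal_superset[of A "{x * y | x y. x \<in> I \<and> y \<in> J}"] by (auto simp: ideal_mul_def)

lemma ideal_mul_least:
  assumes "subring A" "is_ideal A K" "\<And>x y. x \<in> I \<Longrightarrow> y \<in> J \<Longrightarrow> x * y \<in> K"
  shows "ideal_mul A I J \<subseteq> K"
  unfolding ideal_mul_def by (rule gen_ideal_least[OF assms(1,2)]) (use assms(3) in auto)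

lemma ideal_pow_Suc: "ideal_pow A I (Suc n) = ideal_mul A (ideal_pow A I n) I"
  by (simp add: ideal_mul_def)

declare ideal_pow.simps(2)[simp del]

lemma ideal_pow_ideal: "subring A \<Longrightarrow> is_ideal A I \<Longrightarrow> is_ideal A (ideal_pow A I n)"
  by (induction n) (auto simp: ideal_self ideal_pow_Suc ideal_mul_ideal)

lemma ideal_pow_SucI: "subring A \<Longrightarrow> x \<in> ideal_pow A I n \<Longrightarrow> y \<in> I \<Longrightarrow> x * y \<in> ideal_pow A I (Suc n)"
  by (simp add: ideal_pow_Suc ideal_mulI)

lemma ideal_pow_1: "subring A \<Longrightarrow> is_ideal A I \<Longrightarrow> ideal_pow A I (Suc 0) = I"
proof
  assume a: "subring A" "is_ideal A I"
  show "ideal_pow A I (Suc 0) \<subseteq> I"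
    unfolding ideal_pow_Suc by (rule ideal_mul_least) (use a in \<open>auto simp: idealD\<close>)
  show "I \<subseteq> ideal_pow A I (Suc 0)"
    using ideal_pow_SucI[OF a(1), of 1 I 0] subringD[OF a(1)] by auto
qed

lemma ideal_pow_mult:
  assumes A: "subring A" and I: "is_ideal A I"
    and x: "x \<in> ideal_pow A I k" and y: "y \<in> ideal_pow A I n"
  shows "x * y \<in> ideal_pow A I (k + n)"
  using y
proof (induction n arbitrary: y)
  case 0
  then show ?case using idealD(7)[OF A ideal_pow_ideal[OF A I] x] by simp
next
  case (Suc n)
  let ?K = "{y \<in> A. x * y \<in> ideal_pow A I (k + Suc n)}"
  have "is_ideal A ?K"
    using subringD[OF A] idealD[OF A ideal_pow_ideal[OF A I, of "k + Suc n"]]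
    by (auto simp: is_ideal_def distrib_left mult.left_commute)
  moreover have "a * b \<in> ?K" if "a \<in> ideal_pow A I n" "b \<in> I" for a b
  proof -
    have "(x * a) * b \<in> ideal_pow A I (Suc (k + n))"
      using Suc.IH[OF that(1)] that(2) by (rule ideal_pow_SucI[OF A])
    moreover have "a * b \<in> A"
      using that idealD(2)[OF A I] idealD(2)[OF A ideal_pow_ideal[OF A I]] subringD(5)[OF A] by blast
    ultimately show ?thesis by (simp add: mult.assoc)
  qed
  ultimately have "ideal_mul A (ideal_pow A I n) I \<subseteq> ?K"
    by (rule ideal_mul_least[OF A])
  then show ?case using Suc.prems by (auto simp: ideal_pow_Suc)
qed

lemma ideal_pow_power: "subring A \<Longrightarrow> x \<in> I \<Longrightarrow> x ^ n \<in> ideal_pow A I n"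
proof (induction n)
  case (Suc n)
  then show ?case using ideal_pow_SucI[of A "x ^ n" I n x] by (simp add: mult.commute)
qed (auto simp: subringD)

lemma ideal_pow_antimono:
  assumes A: "subring A" and I: "is_ideal A I" and "k \<le> n"
  shows "ideal_pow A I n \<subseteq> ideal_pow A I k"
  using assms(3)
proof (induction n)
  case (Suc n)
  have "ideal_pow A I (Suc n) \<subseteq> ideal_pow A I n"
    unfolding ideal_pow_Suc
    by (rule ideal_mul_least[OF A ideal_pow_ideal[OF A I]])
      (use idealD(2)[OF A I] idealD(7)[OF A ideal_pow_ideal[OF A I]] in auto)
  then show ?case using Suc by (cases "k = Suc n") auto
qed auto

subsection \<open>Noetherian rings\<close>

lemma ideal_chain_Union:
  assumes "C \<noteq> {}" "\<And>I. I \<in> C \<Longrightarrow> is_ideal A I"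
    and ch: "\<And>I J. I \<in> C \<Longrightarrow> J \<in> C \<Longrightarrow> I \<subseteq> J \<or> J \<subseteq> I"
  shows "is_ideal A (\<Union>C)"
  unfolding is_ideal_def
proof (intro conjI ballI)
  fix x y assume "x \<in> \<Union>C" "y \<in> \<Union>C"
  then obtain I J where "I \<in> C" "J \<in> C" "x \<in> I" "y \<in> J" by blast
  moreover then obtain K where "K \<in> C" "x \<in> K" "y \<in> K" using ch by blast
  ultimately show "x + y \<in> \<Union>C" using assms(2)[of K] by (auto simp: is_ideal_def)
qed (use assms in \<open>fastforce simp: is_ideal_def\<close>)+

text \<open>Zorn's lemma applies because a finite generating set of the union of a chain already
  lies in one member, so the union is that member.\<close>

lemma noetherian_max:
  assumes A: "subring A" and N: "noetherian A" and P: "P I0" "\<And>I. P I \<Longrightarrow> is_ideal A I"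
  obtains M where "P M" "\<And>I. P I \<Longrightarrow> M \<subseteq> I \<Longrightarrow> I = M"
proof -
  define F where "F = Collect P"
  have F: "F \<noteq> {}" "\<And>I. I \<in> F \<Longrightarrow> is_ideal A I" using P by (auto simp: F_def)
  have "\<exists>M\<in>F. \<forall>X\<in>F. M \<subseteq> X \<longrightarrow> X = M"
  proof (rule subset_Zorn_nonempty[OF F(1)])
    fix C assume C: "C \<noteq> {}" "subset.chain F C"
    have ch: "\<And>I J. I \<in> C \<Longrightarrow> J \<in> C \<Longrightarrow> I \<subseteq> J \<or> J \<subseteq> I" "C \<subseteq> F"
      using C(2) by (auto simp: subset_chain_def)
    have id: "is_ideal A (\<Union>C)"
      by (rule ideal_chain_Union) (use C ch F in auto)
    then obtain X where X: "finite X" "X \<subseteq> \<Union>C" "gen_ideal A X = \<Union>C"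
      using N by (auto simp: noetherian_def)
    have "\<exists>I\<in>C. X \<subseteq> I"
      using X(1,2)
    proof (induction X)
      case empty then show ?case using C by auto
    next
      case (insert x X)
      then obtain I J where IJ: "I \<in> C" "X \<subseteq> I" "J \<in> C" "x \<in> J" by blast
      show ?case using ch(1)[OF IJ(1,3)]
      proof
        assume "I \<subseteq> J" then show ?thesis using IJ by (intro bexI[of _ J]) auto
      next
        assume "J \<subseteq> I" then show ?thesis using IJ by (intro bexI[of _ I]) auto
      qed
    qed
    then obtain I where "I \<in> C" "X \<subseteq> I" by blast
    then have "\<Union>C \<subseteq> I" using gen_ideal_least[OF A, of I X] X ch(2) F(2)
      by (metis subsetD)
    then show "\<Union>C \<in> F" using \<open>I \<in> C\<close> ch(2) by (metis Union_upper subset_antisym subsetD)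
  qed
  then show ?thesis using that by (auto simp: F_def)
qed

lemma noetherian_acc:
  assumes A: "subring A" and N: "noetherian A" and I: "\<And>n. is_ideal A (I n)" "\<And>n. I n \<subseteq> I (Suc n)"
  obtains n where "I (Suc n) = I n"
proof -
  obtain M where M: "M \<in> range I" "\<And>J. J \<in> range I \<Longrightarrow> M \<subseteq> J \<Longrightarrow> J = M"
    by (rule noetherian_max[OF A N, of "\<lambda>J. J \<in> range I" "I 0"]) (use I in auto)
  then show ?thesis using that I(2) by (metis rangeE rangeI)
qed

lemma noetherian_induct [consumes 3, case_names step]:
  assumes A: "subring A" and N: "noetherian A" and I: "is_ideal A I"
    and step: "\<And>I. is_ideal A I \<Longrightarrow> (\<And>J. is_ideal A J \<Longrightarrow> I \<subset> J \<Longrightarrow> P J) \<Longrightarrow> P I"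
  shows "P I"
proof (rule ccontr)
  assume "\<not> P I"
  with I have "is_ideal A I \<and> \<not> P I" by simp
  then obtain M where M: "is_ideal A M \<and> \<not> P M"
    "\<And>J. is_ideal A J \<and> \<not> P J \<Longrightarrow> M \<subseteq> J \<Longrightarrow> J = M"
    by (rule noetherian_max[OF A N, of "\<lambda>I. is_ideal A I \<and> \<not> P I" I]) auto
  then show False using step[of M] by blast
qed

text \<open>An ideal maximal among those containing \<open>I\<close> and missing \<open>M\<close> is
  prime: if \<open>a\<close> and \<open>b\<close> are outside it, then \<open>P + aA\<close> and
  \<open>P + bA\<close> both meet \<open>M\<close>, and the product of two such elements lies in
  \<open>P\<close> as soon as \<open>a * b\<close> does.\<close>

lemma prime_avoiding:
  assumes A: "subring A" and I: "is_ideal A I" and M: "M \<subseteq> A" "1 \<in> M"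
    "\<And>x y. x \<in> M \<Longrightarrow> y \<in> M \<Longrightarrow> x * y \<in> M" and dis: "I \<inter> M = {}"
  obtains P where "prime_ideal A P" "I \<subseteq> P" "P \<inter> M = {}"
proof -
  let ?F = "{J. is_ideal A J \<and> I \<subseteq> J \<and> J \<inter> M = {}}"
  have "\<exists>P\<in>?F. \<forall>X\<in>?F. P \<subseteq> X \<longrightarrow> X = P"
  proof (rule subset_Zorn_nonempty)
    show "?F \<noteq> {}" using I dis by auto
    fix C assume C: "C \<noteq> {}" "subset.chain ?F C"
    have "is_ideal A (\<Union>C)"
      by (rule ideal_chain_Union) (use C in \<open>auto simp: subset_chain_def\<close>)
    then show "\<Union>C \<in> ?F" using C by (auto simp: subset_chain_def)
  qed
  then obtain P where P: "is_ideal A P" "I \<subseteq> P" "P \<inter> M = {}"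
    and mx: "\<And>J. is_ideal A J \<Longrightarrow> I \<subseteq> J \<Longrightarrow> J \<inter> M = {} \<Longrightarrow> P \<subseteq> J \<Longrightarrow> J = P"
    by auto
  have hit: "\<exists>p\<in>P. \<exists>r\<in>A. p + a * r \<in> M" if a: "a \<in> A" "a \<notin> P" for a
  proof (rule ccontr)
    assume no: "\<not> ?thesis"
    let ?J = "ideal_add P (principal A a)"
    have J: "is_ideal A ?J" by (intro ideal_add_ideal principal_ideal A P a)
    have s: "P \<subseteq> ?J" "principal A a \<subseteq> ?J"
      using ideal_add_sup[OF A P(1) principal_ideal[OF A a(1)]] by auto
    have "?J \<inter> M = {}" using no by (auto simp: ideal_add_def principal_def)
    then have "?J = P" using mx[OF J] s P by auto
    then show False using s principal_self[OF A] a by auto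
  qed
  have "prime_ideal A P"
  proof (rule primeI[OF P(1)])
    show "1 \<notin> P" using P M by auto
    show "1 \<in> A" using subringD[OF A] by auto
    fix a b assume ab: "a \<in> A" "b \<in> A" "a * b \<in> P"
    show "a \<in> P \<or> b \<in> P"
    proof (rule ccontr)
      assume "\<not> ?thesis"
      then obtain p r q s where *: "p \<in> P" "r \<in> A" "p + a * r \<in> M" "q \<in> P" "s \<in> A" "q + b * s \<in> M"
        using hit ab by meson
      have "(p + a * r) * (q + b * s) = p * (q + b * s) + (a * r) * q + (r * s) * (a * b)"
        by (simp add: algebra_simps)
      moreover have "p * (q + b * s) \<in> P" "(a * r) * q \<in> P" "(r * s) * (a * b) \<in> P"
        using * ab M subringD[OF A] idealD[OF A P(1)] by auto
      ultimately have "(p + a * r) * (q + b * s) \<in> P" using idealD(3)[OF A P(1)] by metis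
      then show False using * M P by blast
    qed
  qed
  then show ?thesis using that P by auto
qed

lemma power_mem_if_all_primes:
  assumes A: "subring A" and I: "is_ideal A I" and a: "a \<in> A"
    and pr: "\<And>P. prime_ideal A P \<Longrightarrow> I \<subseteq> P \<Longrightarrow> a \<in> P"
  shows "\<exists>n. a ^ n \<in> I"
proof (rule ccontr)
  assume no: "\<not> ?thesis"
  obtain P where P: "prime_ideal A P" "I \<subseteq> P" "P \<inter> range (\<lambda>n. a ^ n) = {}"
  proof (rule prime_avoiding[OF A I, of "range (\<lambda>n. a ^ n)"])
    show "range (\<lambda>n. a ^ n) \<subseteq> A" using subring_power[OF A a] by auto
    show "1 \<in> range (\<lambda>n. a ^ n)" by (auto intro: image_eqI[of _ _ 0])
    show "x * y \<in> range (\<lambda>n. a ^ n)" if "x \<in> range (\<lambda>n. a ^ n)" "y \<in> range (\<lambda>n. a ^ n)" for x y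
      using that by (auto simp: power_add[symmetric])
  qed (use no in auto)
  then have "a ^ 1 \<in> P" using pr by auto
  then show False using P by blast
qed

text \<open>Noetherian induction on \<open>J\<close>. An element of \<open>I\<close> outside
  \<open>J\<close> yields two strictly larger ideals, \<open>J + (u)\<close> and the colon ideal
  \<open>(J : u)\<close>, whose product lies in \<open>J\<close>; powers of \<open>I\<close> inside
  both multiply into \<open>J\<close>.\<close>

lemma ideal_pow_subset_of_nil:
  assumes A: "subring A" and N: "noetherian A" and I: "is_ideal A I" and J: "is_ideal A J"
    and nil: "\<And>x. x \<in> I \<Longrightarrow> \<exists>n. x ^ n \<in> J"
  shows "\<exists>s. ideal_pow A I s \<subseteq> J"
  using A N J nil
proof (induction J rule: noetherian_induct)
  case (step J)
  show ?case
  proof (cases "I \<subseteq> J")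
    case True
    then show ?thesis using ideal_pow_1[OF A I] by blast
  next
    case False
    then obtain y where y: "y \<in> I" "y \<notin> J" by auto
    have yA: "y \<in> A" using y idealD[OF A I] by auto
    define k where "k = (LEAST n. y ^ n \<in> J)"
    have k: "y ^ k \<in> J" unfolding k_def using step.prems[OF y(1)] by (rule LeastI_ex)
    show ?thesis
    proof (cases k)
      case 0
      then have "J = A" using k ideal_eq_ring[OF A step.hyps(1)] by simp
      then show ?thesis by (metis ideal_pow.simps(1) order_refl)
    next
      case (Suc l)
      \<comment> \<open>The last power of \<open>y\<close> outside \<open>J\<close>:
        \<open>u\<close> enlarges the first ideal, and \<open>y\<close>, itself outside
        \<open>J\<close>, enlarges the colon ideal.\<close>
      define u where "u = y ^ l"
      have u: "u \<notin> J" "u \<in> A" "y * u \<in> J"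
        using not_less_Least[of l "\<lambda>n. y ^ n \<in> J"] k Suc subring_power[OF A yA]
        by (auto simp: u_def k_def[symmetric])
      let ?J1 = "ideal_add J (principal A u)"
      let ?J2 = "{r \<in> A. r * u \<in> J}"
      note JJ = step.hyps(1)
      have J1: "is_ideal A ?J1" "J \<subset> ?J1"
      proof -
        show "is_ideal A ?J1" by (intro ideal_add_ideal principal_ideal A JJ u)
        have "u \<in> ?J1" "J \<subseteq> ?J1"
          using ideal_add_sup[OF A JJ principal_ideal[OF A u(2)]] principal_self[OF A] by auto
        then show "J \<subset> ?J1" using u by auto
      qed
      have J2: "is_ideal A ?J2" "J \<subset> ?J2"
      proof -
        show "is_ideal A ?J2"
          using subringD[OF A] idealD[OF A JJ] by (auto simp: is_ideal_def distrib_right mult.assoc)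
        have "J \<subseteq> ?J2" using idealD[OF A JJ] u by auto
        moreover have "y \<in> ?J2" using yA u by auto
        ultimately show "J \<subset> ?J2" using y by auto
      qed
      have "\<exists>s. ideal_pow A I s \<subseteq> ?J1"
        by (rule step.IH[OF J1]) (use step.prems J1 in blast)
      then obtain s where s: "ideal_pow A I s \<subseteq> ?J1" by blast
      have "\<exists>s. ideal_pow A I s \<subseteq> ?J2"
        by (rule step.IH[OF J2]) (use step.prems J2 in blast)
      then obtain t where t: "ideal_pow A I t \<subseteq> ?J2" by blast
      have *: "a * b \<in> J" if "a \<in> ideal_pow A I t" "b \<in> ideal_pow A I s" for a b
      proof -
        have "b \<in> ?J1" using s that by auto
        then obtain j r where jr: "b = j + u * r" "j \<in> J" "r \<in> A" by (auto simp: ideal_add_def principal_def)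
        have "a \<in> A" "a * u \<in> J" using t that by auto
        then have "a * j \<in> J" "(a * u) * r \<in> J" using jr idealD[OF A JJ] by auto
        then show ?thesis using jr idealD(3)[OF A JJ] by (simp add: distrib_left mult.assoc)
      qed
      have "ideal_pow A I (t + s') \<subseteq> ideal_mul A (ideal_pow A I t) (ideal_pow A I s')" for s'
      proof (induction s')
        case 0
        have "a \<in> ideal_mul A (ideal_pow A I t) (ideal_pow A I 0)" if "a \<in> ideal_pow A I t" for a
          using ideal_mulI[OF A that, of 1 "ideal_pow A I 0"] subringD[OF A] by simp
        then show ?case by auto
      next
        case (Suc s')
        let ?L = "ideal_mul A (ideal_pow A I t) (ideal_pow A I (Suc s'))"
        note IP = ideal_pow_ideal[OF A I]
        have L: "is_ideal A ?L" by (intro ideal_mul_ideal A IP)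
        have "a * b \<in> ?L" if ab: "a \<in> ideal_pow A I (t + s')" "b \<in> I" for a b
        proof -
          let ?K = "{a \<in> A. a * b \<in> ?L}"
          have bA: "b \<in> A" using ab idealD[OF A I] by auto
          have K: "is_ideal A ?K"
            using subringD[OF A] idealD[OF A L] by (auto simp: is_ideal_def distrib_right mult.assoc)
          have "ideal_mul A (ideal_pow A I t) (ideal_pow A I s') \<subseteq> ?K"
          proof (rule ideal_mul_least[OF A K])
            fix x y assume xy: "x \<in> ideal_pow A I t" "y \<in> ideal_pow A I s'"
            have "x * (y * b) \<in> ?L" using xy ab by (intro ideal_mulI A ideal_pow_SucI)
            moreover have "x * y \<in> A" using xy IP idealD(2)[OF A IP] subringD(5)[OF A] by blast
            ultimately show "x * y \<in> ?K" by (simp add: mult.assoc)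
          qed
          then show ?thesis using Suc ab by auto
        qed
        then show ?case unfolding add_Suc_right ideal_pow_Suc[of A I "t + s'"]
          by (intro ideal_mul_least[OF A L])
      qed
      from this[of s] have "ideal_pow A I (t + s) \<subseteq> J"
        using ideal_mul_least[OF A JJ *, of "ideal_pow A I t" "ideal_pow A I s"] by blast
      then show ?thesis by blast
    qed
  qed
qed

subsection \<open>Local rings\<close>

lemma max_ideal_unit: "a \<in> A \<Longrightarrow> a \<notin> max_ideal A \<Longrightarrow> a \<noteq> 0 \<and> inverse a \<in> A"
  by (auto simp: max_ideal_def)

lemma one_notin_max: "subring A \<Longrightarrow> 1 \<notin> max_ideal A"
  by (auto simp: max_ideal_def subringD)

lemma unit_notin_max: "u \<noteq> 0 \<Longrightarrow> inverse u \<in> A \<Longrightarrow> u \<notin> max_ideal A"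
  by (auto simp: max_ideal_def)

lemma ideal_le_max:
  assumes A: "subring A" and I: "is_ideal A I" "I \<noteq> A"
  shows "I \<subseteq> max_ideal A"
proof
  fix x assume x: "x \<in> I"
  show "x \<in> max_ideal A"
  proof (rule ccontr)
    assume "x \<notin> max_ideal A"
    then have "x \<noteq> 0" "inverse x \<in> A" using max_ideal_unit[of x A] idealD(2)[OF A I(1) x] by auto
    then have "1 \<in> I" using idealD(6)[OF A I(1), of "inverse x" x] x by simp
    then show False using ideal_eq_ring[OF A I(1)] I(2) by simp
  qed
qed

lemma prime_le_max: "subring A \<Longrightarrow> prime_ideal A P \<Longrightarrow> P \<subseteq> max_ideal A"
  by (rule ideal_le_max) (auto simp: prime_ideal_def)

lemma max_ideal_prime:
  assumes "local_ring A" shows "prime_ideal A (max_ideal A)"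
proof (rule primeI)
  have A: "subring A" using assms by (simp add: local_ring_def)
  show "is_ideal A (max_ideal A)" using assms by (simp add: local_ring_def)
  show "1 \<notin> max_ideal A" by (rule one_notin_max[OF A])
  show "1 \<in> A" by (rule subringD[OF A])
  fix a b assume ab: "a \<in> A" "b \<in> A" "a * b \<in> max_ideal A"
  show "a \<in> max_ideal A \<or> b \<in> max_ideal A"
  proof (rule ccontr)
    assume "\<not> ?thesis"
    then have "a \<noteq> 0" "b \<noteq> 0" "inverse a \<in> A" "inverse b \<in> A" using max_ideal_unit ab by auto
    then have "a * b \<notin> max_ideal A" using subringD(5)[OF A] by (auto simp: max_ideal_def inverse_mult_distrib)
    then show False using ab by simp
  qed
qed

lemma local_add_unit:
  assumes "local_ring A" "u \<in> A" "u \<notin> max_ideal A" "a \<in> max_ideal A"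
  shows "u + a \<notin> max_ideal A" "u - a \<notin> max_ideal A"
proof -
  have A: "subring A" "is_ideal A (max_ideal A)" using assms by (auto simp: local_ring_def)
  show "u + a \<notin> max_ideal A" using idealD(4)[OF A, of "u + a" a] assms by auto
  show "u - a \<notin> max_ideal A" using idealD(3)[OF A, of "u - a" a] assms by auto
qed

text \<open>In place of the determinant trick, \<open>J'\<close> is maximal among the ideals
  containing \<open>J\<close> and strictly smaller than \<open>I + J\<close>. If a product
  \<open>y * v\<close> were outside \<open>J'\<close>, adding it would give all of
  \<open>I + J\<close>; then \<open>(1 - y * r) * v\<close> lies in \<open>J'\<close>, and
  \<open>1 - y * r\<close> is a unit.\<close>

lemma nakayama:
  assumes L: "local_ring A" and N: "noetherian A" and I: "is_ideal A I" and J: "is_ideal A J"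
    and sub: "I \<subseteq> ideal_add J (ideal_mul A (max_ideal A) I)"
  shows "I \<subseteq> J"
proof (rule ccontr)
  assume no: "\<not> I \<subseteq> J"
  have A: "subring A" and M: "is_ideal A (max_ideal A)" using L by (auto simp: local_ring_def)
  let ?K = "ideal_add I J"
  have K: "is_ideal A ?K" "I \<subseteq> ?K" "J \<subseteq> ?K"
    using ideal_add_ideal[OF A I J] ideal_add_sup[OF A I J] by auto
  have "J \<subset> ?K" using K no by blast
  then obtain J' where J'0: "is_ideal A J' \<and> J \<subseteq> J' \<and> J' \<subset> ?K"
    and mx0: "\<And>J''. is_ideal A J'' \<and> J \<subseteq> J'' \<and> J'' \<subset> ?K \<Longrightarrow> J' \<subseteq> J'' \<Longrightarrow> J'' = J'"
    using noetherian_max[OF A N, of "\<lambda>J'. is_ideal A J' \<and> J \<subseteq> J' \<and> J' \<subset> ?K" J thesis] J by blast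
  note J' = J'0[THEN conjunct1] J'0[THEN conjunct2, THEN conjunct1] J'0[THEN conjunct2, THEN conjunct2]
  have mx: "\<And>J''. is_ideal A J'' \<Longrightarrow> J \<subseteq> J'' \<Longrightarrow> J'' \<subset> ?K \<Longrightarrow> J' \<subseteq> J'' \<Longrightarrow> J'' = J'"
    using mx0 by blast
  have mK: "y * v \<in> J'" if y: "y \<in> max_ideal A" and v: "v \<in> I" for y v
  proof (rule ccontr)
    assume c: "y * v \<notin> J'"
    have yA: "y \<in> A" "v \<in> A" using y v idealD(2)[OF A M] idealD(2)[OF A I] by auto
    have yv: "y * v \<in> I" using idealD(6)[OF A I] yA v by auto
    let ?L = "ideal_add J' (principal A (y * v))"
    have pI: "is_ideal A (principal A (y * v))" using principal_ideal[OF A] yA subringD[OF A] by auto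
    have L: "is_ideal A ?L" "J' \<subseteq> ?L" "y * v \<in> ?L"
      using ideal_add_ideal[OF A J'(1) pI] ideal_add_sup[OF A J'(1) pI] principal_self[OF A] by auto
    have "?L \<subseteq> ?K"
      using J' K yv principal_least[OF A K(1), of "y * v"] by (intro ideal_add_least[OF A K(1)]) auto
    then have "?L = ?K" using mx[OF L(1)] L J' c by blast
    then have "v \<in> ?L" using v K by auto
    then obtain j r where jr: "j \<in> J'" "r \<in> A" "v = j + y * v * r" by (auto simp: ideal_add_def principal_def)
    have ry: "y * r \<in> max_ideal A" using idealD[OF A M] y jr by auto
    have u: "1 - y * r \<notin> max_ideal A"
      by (rule local_add_unit(2)[OF \<open>local_ring A\<close> subringD(2)[OF A] one_notin_max[OF A] ry])
    have "1 - y * r \<in> A" using subringD[OF A] jr yA by auto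
    then have inv: "1 - y * r \<noteq> 0" "inverse (1 - y * r) \<in> A" using max_ideal_unit[OF _ u] by blast+
    have "(1 - y * r) * v = j" using jr(3) by (simp add: algebra_simps)
    then have "v = inverse (1 - y * r) * j" using inv by (simp add: field_simps)
    then have "v \<in> J'" using inv jr idealD[OF A J'(1)] by auto
    then have "y * v \<in> J'" using yA idealD[OF A J'(1)] by auto
    then show False using c by simp
  qed
  have "ideal_mul A (max_ideal A) I \<subseteq> J'" by (rule ideal_mul_least[OF A J'(1) mK])
  then have "ideal_add J (ideal_mul A (max_ideal A) I) \<subseteq> J'" using ideal_add_least[OF A J'(1,2)] by auto
  then have "?K \<subseteq> J'" using sub J'(2) ideal_add_least[OF A J'(1)] by auto
  then show False using J' by auto
qed

text \<open>For the intersection \<open>I\<close>, Nakayama's lemma needs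
  \<open>I \<subseteq> J0 + m I\<close>. An ideal \<open>J\<close> maximal with
  \<open>J \<inter> I = J0 + m I\<close> contains a power of every element of \<open>m\<close>,
  hence a power of \<open>m\<close>, and together with \<open>J0\<close> all of
  \<open>I\<close>.\<close>

lemma krull_intersection:
  assumes L: "local_ring A" and N: "noetherian A" and J0: "is_ideal A J0"
    and a: "\<And>n. a \<in> ideal_add J0 (ideal_pow A (max_ideal A) n)"
  shows "a \<in> J0"
proof -
  have A: "subring A" and M: "is_ideal A (max_ideal A)" using L by (auto simp: local_ring_def)
  let ?m = "max_ideal A"
  define I where "I = (\<Inter>n. ideal_add J0 (ideal_pow A ?m n))"
  note IP = ideal_pow_ideal[OF A M]
  have S: "is_ideal A (ideal_add J0 (ideal_pow A ?m n))" for n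
    by (intro ideal_add_ideal A J0 IP)
  have I: "is_ideal A I"
    unfolding is_ideal_def I_def
    using idealD[OF A S] by auto
  have J0I: "J0 \<subseteq> I" unfolding I_def using ideal_add_sup[OF A J0 IP] by auto
  let ?B = "ideal_add J0 (ideal_mul A ?m I)"
  have mI: "is_ideal A (ideal_mul A ?m I)" by (intro ideal_mul_ideal A M I)
  have B: "is_ideal A ?B" by (intro ideal_add_ideal A J0 mI)
  have BI: "?B \<subseteq> I"
    by (intro ideal_add_least[OF A] I J0I ideal_mul_least[OF A I]) (use idealD[OF A I] idealD[OF A M] in auto)
  obtain J where J: "is_ideal A J" "?B \<subseteq> J" "J \<inter> I = ?B"
    and mx: "\<And>J'. is_ideal A J' \<Longrightarrow> ?B \<subseteq> J' \<Longrightarrow> J' \<inter> I = ?B \<Longrightarrow> J \<subseteq> J' \<Longrightarrow> J' = J"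
    by (rule noetherian_max[OF A N, of "\<lambda>J. is_ideal A J \<and> ?B \<subseteq> J \<and> J \<inter> I = ?B" ?B])
      (use B BI in auto)
  have nil: "\<exists>n. x ^ n \<in> J" if x: "x \<in> ?m" for x
  proof -
    have xA: "x \<in> A" using x idealD[OF A M] by auto
    let ?C = "\<lambda>k. {r \<in> A. x ^ k * r \<in> J}"
    have C: "is_ideal A (?C k)" for k
      using subringD[OF A] idealD[OF A J(1)] by (auto simp: is_ideal_def distrib_left mult.left_commute)
    have Cs: "?C k \<subseteq> ?C (Suc k)" for k using idealD[OF A J(1)] xA by (auto simp: mult.assoc)
    \<comment> \<open>Once the colon ideals \<open>(J : x ^ k)\<close> are stable, adding
      \<open>x ^ k\<close> to \<open>J\<close> does not change the intersection with
      \<open>I\<close>, so maximality puts \<open>x ^ k\<close> into \<open>J\<close>.\<close>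
    obtain k where k: "?C (Suc k) = ?C k" by (rule noetherian_acc[of A ?C, OF A N C Cs])
    let ?J' = "ideal_add J (principal A (x ^ k))"
    have xk: "x ^ k \<in> A" using subring_power[OF A xA] .
    have J': "is_ideal A ?J'" "J \<subseteq> ?J'" "x ^ k \<in> ?J'"
      using ideal_add_ideal[OF A J(1) principal_ideal[OF A xk]]
        ideal_add_sup[OF A J(1) principal_ideal[OF A xk]] principal_self[OF A] by auto
    have "?J' \<inter> I \<subseteq> ?B"
    proof
      fix y assume y: "y \<in> ?J' \<inter> I"
      then obtain j r where jr: "j \<in> J" "r \<in> A" "y = j + x ^ k * r" by (auto simp: ideal_add_def principal_def)
      have "x * y \<in> ideal_mul A ?m I" using x y by (intro ideal_mulI A) auto
      then have "x * y \<in> J" using J(2) ideal_add_sup[OF A J0 mI] by auto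
      moreover have "x * j \<in> J" using jr xA idealD[OF A J(1)] by auto
      ultimately have "x * y - x * j \<in> J" using idealD[OF A J(1)] by auto
      then have "x ^ Suc k * r \<in> J" using jr by (simp add: algebra_simps)
      then have "x ^ k * r \<in> J" using k jr by auto
      then have "y \<in> J" using jr idealD[OF A J(1)] by auto
      then show "y \<in> ?B" using y J by auto
    qed
    then have "?J' = J" using mx[OF J'(1)] J J' BI by auto
    then show ?thesis using J' by auto
  qed
  obtain s where s: "ideal_pow A ?m s \<subseteq> J" using ideal_pow_subset_of_nil[OF A N M J(1) nil] by blast
  have "J0 \<subseteq> J" using J(2) ideal_add_sup[OF A J0 mI] by auto
  then have "I \<subseteq> J" unfolding I_def using s ideal_add_least[OF A J(1), of J0 "ideal_pow A ?m s"] by auto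
  then have "I \<subseteq> ?B" using J by auto
  then have "I \<subseteq> J0" by (rule nakayama[OF L N I J0])
  then show ?thesis using a unfolding I_def by auto
qed

subsection \<open>Localization\<close>

definition ext_ideal :: "'a::field set \<Rightarrow> 'a set \<Rightarrow> 'a set \<Rightarrow> 'a set" where
  "ext_ideal A P I = {a / b | a b. a \<in> I \<and> b \<in> A \<and> b \<notin> P}"

lemma localize_ext: "localize A P = ext_ideal A P A"
  by (auto simp: localize_def ext_ideal_def)

context
  fixes A P :: "'a::field set"
  assumes A: "subring A" and P: "prime_ideal A P"
begin

lemma mult_compl: "x \<in> A \<Longrightarrow> y \<in> A \<Longrightarrow> x \<notin> P \<Longrightarrow> y \<notin> P \<Longrightarrow> x * y \<in> A \<and> x * y \<notin> P"
  using primeD(3)[OF A P, of x y] subringD(5)[OF A, of x y] by blast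

lemma compl_nonzero: "x \<notin> P \<Longrightarrow> x \<noteq> 0"
  using idealD(1)[OF A primeD(1)[OF A P]] by auto

lemma ext_idealI: "a \<in> I \<Longrightarrow> b \<in> A \<Longrightarrow> b \<notin> P \<Longrightarrow> a / b \<in> ext_ideal A P I"
  by (auto simp: ext_ideal_def)

lemma ext_idealE:
  assumes "x \<in> ext_ideal A P I"
  obtains a b where "a \<in> I" "b \<in> A" "b \<notin> P" "b \<noteq> 0" "x = a / b"
  using assms compl_nonzero by (auto simp: ext_ideal_def)

lemma ext_ideal_add:
  assumes I: "is_ideal A I" and "x \<in> ext_ideal A P I" "y \<in> ext_ideal A P I"
  shows "x + y \<in> ext_ideal A P I"
proof -
  obtain a b c d where *: "a \<in> I" "b \<in> A" "b \<notin> P" "b \<noteq> 0" "x = a / b" "c \<in> I" "d \<in> A" "d \<notin> P" "d \<noteq> 0" "y = c / d"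
    using assms by (elim ext_idealE)
  then have "x + y = (a * d + c * b) / (b * d)" by (simp add: field_simps)
  moreover have "a * d + c * b \<in> I" using * idealD[OF A I] by auto
  ultimately show ?thesis using ext_idealI[of "a * d + c * b" I "b * d"] mult_compl[of b d] * by simp
qed

lemma ext_ideal_mult:
  assumes I: "is_ideal A I" and "x \<in> localize A P" "y \<in> ext_ideal A P I"
  shows "x * y \<in> ext_ideal A P I"
proof -
  obtain a b c d where *: "a \<in> A" "b \<in> A" "b \<notin> P" "b \<noteq> 0" "x = a / b" "c \<in> I" "d \<in> A" "d \<notin> P" "d \<noteq> 0" "y = c / d"
    using assms(2,3) unfolding localize_ext by (elim ext_idealE)
  then have "x * y = (a * c) / (b * d)" by (simp add: field_simps)
  moreover have "a * c \<in> I" using * idealD[OF A I] by auto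
  ultimately show ?thesis using ext_idealI[of "a * c" I "b * d"] mult_compl[of b d] * by simp
qed

lemma one_compl: "1 \<in> A" "1 \<notin> P"
  using subringD[OF A] primeD[OF A P] by auto

lemma ext_ideal_sup: "I \<subseteq> ext_ideal A P I"
  using ext_idealI[OF _ one_compl, of _ I] by auto

lemma localize_sup: "A \<subseteq> localize A P"
  unfolding localize_ext by (rule ext_ideal_sup)

lemma localize_inverse: "b \<in> A \<Longrightarrow> b \<notin> P \<Longrightarrow> inverse b \<in> localize A P"
  using ext_idealI[of 1 A b] one_compl unfolding localize_ext by (simp add: field_simps)

lemma localize_subring: "subring (localize A P)"
proof -
  note I = ideal_self[OF A]
  have m: "- 1 \<in> localize A P" using localize_sup subringD[OF A] by auto
  have "x + y \<in> localize A P" "x * y \<in> localize A P" if "x \<in> localize A P" "y \<in> localize A P" for x y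
    using ext_ideal_add[OF I, of x y] ext_ideal_mult[OF I, of x y] that unfolding localize_ext by auto
  moreover have "x - y \<in> localize A P" if "x \<in> localize A P" "y \<in> localize A P" for x y
    using calculation(1)[OF that(1), of "-1 * y"] calculation(2)[OF m that(2)] by simp
  moreover have "0 \<in> localize A P" "1 \<in> localize A P" using localize_sup subringD[OF A] by auto
  ultimately show ?thesis by (auto simp: subring_def)
qed

lemma ext_ideal_ideal: "is_ideal A I \<Longrightarrow> is_ideal (localize A P) (ext_ideal A P I)"
  unfolding is_ideal_def[of "localize A P"]
proof (intro conjI ballI)
  assume I: "is_ideal A I"
  show "ext_ideal A P I \<subseteq> localize A P" using idealD(2)[OF A I] by (auto simp: localize_def ext_ideal_def)
  show "0 \<in> ext_ideal A P I" using ext_ideal_sup idealD[OF A I] by blast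
qed (auto intro: ext_ideal_add ext_ideal_mult)

lemma contract_ideal: "is_ideal (localize A P) J \<Longrightarrow> is_ideal A (J \<inter> A)"
  using localize_sup subringD[OF A] by (auto simp: is_ideal_def)

lemma ext_contract:
  assumes J: "is_ideal (localize A P) J" shows "ext_ideal A P (J \<inter> A) = J"
proof
  note L = localize_subring
  show "ext_ideal A P (J \<inter> A) \<subseteq> J"
  proof
    fix x assume "x \<in> ext_ideal A P (J \<inter> A)"
    then obtain a b where *: "a \<in> J \<inter> A" "b \<in> A" "b \<notin> P" "b \<noteq> 0" "x = a / b" by (elim ext_idealE)
    then have "inverse b * a \<in> J" using idealD(6)[OF L J] localize_inverse by auto
    moreover have "inverse b * a = x" using * by (simp add: divide_inverse mult.commute)
    ultimately show "x \<in> J" by simp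
  qed
  show "J \<subseteq> ext_ideal A P (J \<inter> A)"
  proof
    fix x assume x: "x \<in> J"
    then have "x \<in> localize A P" using idealD[OF L J] by auto
    then obtain a b where *: "a \<in> A" "b \<in> A" "b \<notin> P" "b \<noteq> 0" "x = a / b" unfolding localize_ext by (elim ext_idealE)
    then have "b * x \<in> J" using idealD(6)[OF L J _ x, of b] localize_sup by blast
    then have "a \<in> J" using * by simp
    then show "x \<in> ext_ideal A P (J \<inter> A)" using * ext_idealI by auto
  qed
qed

lemma ext_prime_contract:
  assumes Q: "prime_ideal A Q" "Q \<subseteq> P" shows "ext_ideal A P Q \<inter> A = Q"
proof
  show "ext_ideal A P Q \<inter> A \<subseteq> Q"
  proof
    fix x assume x: "x \<in> ext_ideal A P Q \<inter> A"
    then obtain a b where *: "a \<in> Q" "b \<in> A" "b \<notin> P" "b \<noteq> 0" "x = a / b" by (auto elim: ext_idealE)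
    then have "x * b \<in> Q" by simp
    then show "x \<in> Q" using primeD(3)[OF A Q(1), of x b] x * Q by auto
  qed
  show "Q \<subseteq> ext_ideal A P Q \<inter> A" using ext_ideal_sup idealD(2)[OF A primeD(1)[OF A Q(1)]] by blast
qed

lemma ext_prime:
  assumes Q: "prime_ideal A Q" "Q \<subseteq> P" shows "prime_ideal (localize A P) (ext_ideal A P Q)"
proof (rule primeI)
  note QI = primeD(1)[OF A Q(1)]
  show "is_ideal (localize A P) (ext_ideal A P Q)" by (rule ext_ideal_ideal[OF QI])
  show "1 \<notin> ext_ideal A P Q" using ext_prime_contract[OF Q] primeD(2)[OF A Q(1)] subringD(2)[OF A] by blast
  show "1 \<in> localize A P" using subringD[OF localize_subring] by auto
  fix x y assume xy: "x \<in> localize A P" "y \<in> localize A P" "x * y \<in> ext_ideal A P Q"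
  then obtain a b c d where *: "a \<in> A" "b \<in> A" "b \<notin> P" "b \<noteq> 0" "x = a / b" "c \<in> A" "d \<in> A" "d \<notin> P" "d \<noteq> 0" "y = c / d"
    unfolding localize_ext by (elim ext_idealE)
  have "(b * d) * (x * y) \<in> ext_ideal A P Q"
    using ext_ideal_mult[OF QI _ xy(3)] localize_sup mult_compl[of b d] * by blast
  then have "a * c \<in> ext_ideal A P Q" using * by (simp add: field_simps)
  then have "a * c \<in> Q" using ext_prime_contract[OF Q] subringD(5)[OF A] * by blast
  then have "a \<in> Q \<or> c \<in> Q" using primeD(3)[OF A Q(1)] * by blast
  then show "x \<in> ext_ideal A P Q \<or> y \<in> ext_ideal A P Q" using * ext_idealI by blast
qed

lemma contract_prime:
  assumes J: "prime_ideal (localize A P) J" shows "prime_ideal A (J \<inter> A)" "J \<inter> A \<subseteq> P"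
proof -
  note L = localize_subring
  note JD = primeD[OF L J]
  show "prime_ideal A (J \<inter> A)"
  proof (rule primeI[OF contract_ideal[OF JD(1)]])
    fix a b assume "a \<in> A" "b \<in> A" "a * b \<in> J \<inter> A"
    then show "a \<in> J \<inter> A \<or> b \<in> J \<inter> A" using JD(3)[of a b] localize_sup by blast
  qed (use JD(2) subringD[OF A] in auto)
  show "J \<inter> A \<subseteq> P"
  proof
    fix x assume x: "x \<in> J \<inter> A"
    show "x \<in> P"
    proof (rule ccontr)
      assume n: "x \<notin> P"
      then have "inverse x * x \<in> J" using idealD(6)[OF L JD(1) localize_inverse, of x x] x by auto
      then show False using JD(2) compl_nonzero[OF n] by simp
    qed
  qed
qed

lemma max_localize: "max_ideal (localize A P) = ext_ideal A P P"
proof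
  note L = localize_subring
  have PP: "prime_ideal (localize A P) (ext_ideal A P P)" by (rule ext_prime[OF P order_refl])
  show "ext_ideal A P P \<subseteq> max_ideal (localize A P)"
    by (rule prime_le_max[OF L PP])
  show "max_ideal (localize A P) \<subseteq> ext_ideal A P P"
  proof
    fix x assume x: "x \<in> max_ideal (localize A P)"
    then have "x \<in> localize A P" by (auto simp: max_ideal_def)
    then obtain a b where *: "a \<in> A" "b \<in> A" "b \<notin> P" "b \<noteq> 0" "x = a / b" unfolding localize_ext by (elim ext_idealE)
    have "a \<in> P"
    proof (rule ccontr)
      assume a: "a \<notin> P"
      then have "b * inverse a \<in> localize A P"
        using subringD(5)[OF L] localize_inverse localize_sup * by blast
      then have "inverse x \<in> localize A P" using * by (simp add: divide_inverse mult.commute)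
      moreover have "x \<noteq> 0" using * compl_nonzero[OF a] by auto
      ultimately show False using x by (auto simp: max_ideal_def)
    qed
    then show "x \<in> ext_ideal A P P" using * ext_idealI by blast
  qed
qed

lemma localize_local: "local_ring (localize A P)"
  unfolding local_ring_def max_localize
  using localize_subring ext_ideal_ideal[OF primeD(1)[OF A P]] by auto

lemma localize_noetherian:
  assumes N: "noetherian A" shows "noetherian (localize A P)"
  unfolding noetherian_def
proof (intro allI impI)
  fix J assume J: "is_ideal (localize A P) J"
  note L = localize_subring
  obtain X where X: "finite X" "X \<subseteq> J \<inter> A" "gen_ideal A X = J \<inter> A"
    using N[unfolded noetherian_def, rule_format, OF contract_ideal[OF J]] by auto
  let ?G = "gen_ideal (localize A P) X"
  have "X \<subseteq> localize A P" using X localize_sup by auto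
  then have G: "is_ideal (localize A P) ?G" by (rule gen_ideal_ideal[OF L])
  have "J \<inter> A \<subseteq> ?G \<inter> A"
    using gen_ideal_least[OF A contract_ideal[OF G], of X] X gen_ideal_superset[OF L, of X] by auto
  then have "ext_ideal A P (J \<inter> A) \<subseteq> ext_ideal A P (?G \<inter> A)" by (auto simp: ext_ideal_def)
  then have "J \<subseteq> ?G" using ext_contract[OF J] ext_contract[OF G] by simp
  moreover have "?G \<subseteq> J" using gen_ideal_least[OF L J] X by auto
  ultimately show "\<exists>X. finite X \<and> X \<subseteq> J \<and> gen_ideal (localize A P) X = J" using X by blast
qed

end

subsection \<open>Krull's principal ideal theorem\<close>

text \<open>This is the Artinian property of \<open>A/K\<close>, obtained without lengths by
  noetherian induction on \<open>K\<close>: modulo an element \<open>u\<close> outside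
  \<open>K\<close> with \<open>m u \<subseteq> K\<close> the chain becomes stationary by induction,
  and after that only the membership of \<open>u\<close> in \<open>J n\<close> can change.\<close>

lemma dcc_above:
  assumes L: "local_ring A" and N: "noetherian A" and K: "is_ideal A K"
    and nil: "\<And>x. x \<in> max_ideal A \<Longrightarrow> \<exists>n. x ^ n \<in> K"
    and J: "\<And>n. is_ideal A (J n)" "\<And>n. K \<subseteq> J n" "\<And>n. J (Suc n) \<subseteq> J n"
  shows "\<exists>n0. \<forall>n\<ge>n0. J n = J n0"
proof -
  have A: "subring A" and M: "is_ideal A (max_ideal A)" using L by (auto simp: local_ring_def)
  note IP = ideal_pow_ideal[OF A M]
  show ?thesis
    using A N K nil J
  proof (induction K arbitrary: J rule: noetherian_induct)
    case (step K)
    have dec: "m \<le> n \<Longrightarrow> J n \<subseteq> J m" for m n using step.prems(4) by (rule lift_Suc_antimono_le)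
    note K = step.hyps
    show ?case
    proof (cases "K = A")
      case True
      then have "J n = A" for n using step.prems(2,3) idealD(2)[OF A step.prems(2)] by blast
      then show ?thesis by auto
    next
      case False
      obtain s where s: "ideal_pow A (max_ideal A) s \<subseteq> K"
        using ideal_pow_subset_of_nil[OF A N M K step.prems(1)] by blast
      define t where "t = (LEAST s. ideal_pow A (max_ideal A) s \<subseteq> K)"
      have t: "ideal_pow A (max_ideal A) t \<subseteq> K" unfolding t_def using s by (rule LeastI)
      then obtain t' where t': "t = Suc t'" using False idealD(2)[OF A K] by (cases t) auto
      then have "\<not> ideal_pow A (max_ideal A) t' \<subseteq> K"
        using not_less_Least[of t' "\<lambda>s. ideal_pow A (max_ideal A) s \<subseteq> K"] by (simp add: t_def[symmetric])
      \<comment> \<open>A socle element of \<open>A/K\<close>, taken from the last power of the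
        maximal ideal not contained in \<open>K\<close>.\<close>
      then obtain u where u: "u \<in> ideal_pow A (max_ideal A) t'" "u \<notin> K" by blast
      have uA: "u \<in> A" using u idealD(2)[OF A IP] by auto
      have mu: "u * y \<in> K" if "y \<in> max_ideal A" for y
        using ideal_pow_SucI[OF A u(1) that] t t' by auto
      let ?p = "principal A u"
      have p: "is_ideal A ?p" by (rule principal_ideal[OF A uA])
      let ?K' = "ideal_add K ?p"
      have K': "is_ideal A ?K'" "K \<subset> ?K'"
        using ideal_add_ideal[OF A K p] ideal_add_sup[OF A K p] principal_self[OF A, of u] u by auto
      let ?J = "\<lambda>n. ideal_add (J n) ?p"
      have "\<exists>n0. \<forall>n\<ge>n0. ?J n = ?J n0"
      proof (rule step.IH[OF K'])
        show "\<exists>n. x ^ n \<in> ?K'" if "x \<in> max_ideal A" for x using step.prems(1)[OF that] K' by blast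
        show "is_ideal A (?J n)" for n by (rule ideal_add_ideal[OF A step.prems(2) p])
        show "?K' \<subseteq> ?J n" "?J (Suc n) \<subseteq> ?J n" for n
          using step.prems(3,4)[of n] by (auto simp: ideal_add_def)
      qed
      then obtain n0 where n0: "\<And>n. n \<ge> n0 \<Longrightarrow> ?J n = ?J n0" by blast
      obtain n1 where n1: "(\<forall>n\<ge>n1. u \<notin> J n) \<or> (\<forall>n. u \<in> J n)"
      proof (cases "\<forall>n. u \<in> J n")
        case False
        then obtain n1 where "u \<notin> J n1" by blast
        then show ?thesis using that[of n1] dec by blast
      qed (use that in blast)
      have "J n = J (max n0 n1)" if n: "n \<ge> max n0 n1" for n
      proof
        let ?N = "max n0 n1"
        show "J n \<subseteq> J ?N" using dec n by blast
        show "J ?N \<subseteq> J n"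
        proof
          fix y assume y: "y \<in> J ?N"
          have "y \<in> ?J ?N" using y ideal_add_sup[OF A step.prems(2) p] by blast
          moreover have "?J ?N = ?J n" using n0[of ?N] n0[of n] n by simp
          ultimately have "y \<in> ?J n" by simp
          then obtain z r where zr: "z \<in> J n" "r \<in> A" "y = z + u * r"
            by (auto simp: ideal_add_def principal_def)
          have "z \<in> J ?N" using zr dec n by blast
          then have "y - z \<in> J ?N" using y idealD[OF A step.prems(2)] by blast
          then have ur: "u * r \<in> J ?N" using zr by simp
          have "u * r \<in> J n"
          proof (cases "r \<in> max_ideal A")
            case True
            then show ?thesis using mu step.prems(3) by blast
          next
            case False
            then have r: "r \<noteq> 0" "inverse r \<in> A" using max_ideal_unit zr by auto
            then have "(u * r) * inverse r \<in> J ?N" using ur idealD(7)[OF A step.prems(2)] by blast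
            then have "u \<in> J ?N" using r by (simp add: mult.assoc)
            then have "u \<in> J n" using n1 by auto
            then show ?thesis using zr idealD(7)[OF A step.prems(2)] by blast
          qed
          then show "y \<in> J n" using zr idealD(3)[OF A step.prems(2)] by blast
        qed
      qed
      then show ?thesis by blast
    qed
  qed
qed

text \<open>The classical proof with symbolic powers: \<open>q n\<close> is the contraction to the localization at
  \<open>P2\<close> of the \<open>n\<close>-th power of \<open>P1\<close> (modulo \<open>P0\<close>), taken in the localization at \<open>P1\<close>.\<close>

lemma principal_ideal_theorem:
  assumes A: "subring A" and N: "noetherian A"
    and P: "prime_ideal A P0" "prime_ideal A P1" "prime_ideal A P2" "P0 \<subset> P1" "P1 \<subset> P2"
    and x: "x \<in> P2"
  shows "\<exists>P'. prime_ideal A P' \<and> P0 \<subset> P' \<and> P' \<subset> P2 \<and> x \<in> P'"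
proof (rule ccontr)
  assume no: "\<not> ?thesis"
  have xA: "x \<in> A" using x idealD(2)[OF A primeD(1)[OF A P(3)]] by auto
  have x1: "x \<notin> P1" using no P by blast
  then have x0: "x \<notin> P0" using P by blast
  define L where "L = localize A P2"
  define B where "B = localize A P1"
  have L: "local_ring L" "noetherian L" "subring L" "max_ideal L = ext_ideal A P2 P2" "A \<subseteq> L"
    unfolding L_def using localize_local[OF A P(3)] localize_noetherian[OF A P(3) N] localize_subring[OF A P(3)]
      max_localize[OF A P(3)] localize_sup[OF A P(3)] by auto
  have B: "local_ring B" "noetherian B" "subring B" "max_ideal B = ext_ideal A P1 P1" "A \<subseteq> B"
    unfolding B_def using localize_local[OF A P(2)] localize_noetherian[OF A P(2) N] localize_subring[OF A P(2)]
      max_localize[OF A P(2)] localize_sup[OF A P(2)] by auto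
  have LB: "L \<subseteq> B" using P(5) by (auto simp: L_def B_def localize_def)
  have MB: "is_ideal B (max_ideal B)" using B(1) by (simp add: local_ring_def)
  define Q0 where "Q0 = ext_ideal A P1 P0"
  have Q0: "is_ideal B Q0" "prime_ideal B Q0" "Q0 \<inter> A = P0"
    unfolding Q0_def B_def using ext_ideal_ideal[OF A P(2)] primeD(1)[OF A P(1)] ext_prime[OF A P(2) P(1)]
      ext_prime_contract[OF A P(2) P(1)] P(4) by auto
  define qB where "qB n = ideal_add Q0 (ideal_pow B (max_ideal B) n)" for n
  define q where "q n = qB n \<inter> L" for n
  have qB: "is_ideal B (qB n)" for n
    unfolding qB_def by (intro ideal_add_ideal B Q0 ideal_pow_ideal MB)
  have qBs: "qB (Suc n) \<subseteq> qB n" for n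
    using ideal_pow_antimono[OF B(3) MB, of n "Suc n"] by (auto simp: qB_def ideal_add_def)
  have q: "is_ideal L (q n)" for n
    using qB[of n] LB subringD[OF L(3)] by (auto simp: is_ideal_def q_def)
  let ?px = "principal L x"
  have px: "is_ideal L ?px" using principal_ideal[OF L(3)] xA L(5) by auto
  define K where "K = ideal_add (Q0 \<inter> L) ?px"
  have Q0L: "is_ideal L (Q0 \<inter> L)"
    using Q0(1) LB subringD[OF L(3)] by (auto simp: is_ideal_def)
  have K: "is_ideal L K" unfolding K_def by (rule ideal_add_ideal[OF L(3) Q0L px])
  \<comment> \<open>By the assumption \<open>no\<close>, a prime of \<open>L\<close> containing
    \<open>P0\<close> and \<open>x\<close> contracts to \<open>P2\<close>, so it is the maximal
    ideal; this is what makes \<open>L/K\<close> Artinian.\<close>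
  have nil: "\<exists>n. y ^ n \<in> K" if y: "y \<in> max_ideal L" for y
  proof (rule power_mem_if_all_primes[OF L(3) K])
    show "y \<in> L" using y by (auto simp: max_ideal_def)
    fix T assume T: "prime_ideal L T" "K \<subseteq> T"
    have T': "prime_ideal A (T \<inter> A)" "T \<inter> A \<subseteq> P2"
      using contract_prime[OF A P(3) T(1)[unfolded L_def]] by auto
    have "P0 \<subseteq> Q0 \<inter> L" using Q0 L(5) by blast
    then have "P0 \<subseteq> T" using T(2) ideal_add_sup[OF L(3) Q0L px] by (auto simp: K_def)
    moreover have "x \<in> T" using T(2) ideal_add_sup[OF L(3) Q0L px] principal_self[OF L(3), of x] by (auto simp: K_def)
    ultimately have "P0 \<subset> T \<inter> A" "x \<in> T \<inter> A" using Q0(3) xA x0 by auto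
    then have "T \<inter> A = P2" using no T' by blast
    moreover have "ext_ideal A P2 (T \<inter> A) = T"
      using ext_contract[OF A P(3)] primeD(1)[OF L(3) T(1)] unfolding L_def by auto
    ultimately show "y \<in> T" using y L(4) by simp
  qed
  have "\<exists>n0. \<forall>n\<ge>n0. ideal_add (q n) ?px = ideal_add (q n0) ?px"
  proof (rule dcc_above[OF L(1,2) K nil])
    show "is_ideal L (ideal_add (q n) ?px)" for n by (rule ideal_add_ideal[OF L(3) q px])
    have "Q0 \<subseteq> qB n" for n unfolding qB_def by (rule ideal_add_sup[OF B(3) Q0(1) ideal_pow_ideal[OF B(3) MB]])
    then show "K \<subseteq> ideal_add (q n) ?px" for n by (fastforce simp: K_def q_def ideal_add_def)
    show "ideal_add (q (Suc n)) ?px \<subseteq> ideal_add (q n) ?px" for n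
      using qBs[of n] by (fastforce simp: q_def ideal_add_def)
  qed
  then obtain n where n: "ideal_add (q (Suc n)) ?px = ideal_add (q n) ?px" by (metis le_Suc_eq order_refl)
  have xBu: "inverse x \<in> B" unfolding B_def by (rule localize_inverse[OF A P(2) xA x1])
  have xnz: "x \<noteq> 0" using x1 idealD(1)[OF A primeD(1)[OF A P(2)]] by auto
  \<comment> \<open>\<open>x\<close> is a unit of \<open>B\<close>, so
    \<open>x * r \<in> q n\<close> forces \<open>r \<in> q n\<close>; this turns the chain that is
    stationary modulo \<open>x\<close> into the hypothesis of Nakayama's lemma.\<close>
  have "q n \<subseteq> ideal_add (q (Suc n)) (ideal_mul L (max_ideal L) (q n))"
  proof
    fix y assume y: "y \<in> q n"
    then have "y \<in> ideal_add (q (Suc n)) ?px" using n ideal_add_sup[OF L(3) q px] by blast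
    then obtain z r where zr: "z \<in> q (Suc n)" "r \<in> L" "y = z + x * r" by (auto simp: ideal_add_def principal_def)
    have "z \<in> qB n" using zr qBs by (auto simp: q_def)
    then have "x * r \<in> qB n" using y zr(3) idealD(4)[OF B(3) qB, of y n z] by (auto simp: q_def)
    then have "inverse x * (x * r) \<in> qB n" using idealD(6)[OF B(3) qB xBu] by blast
    then have "r \<in> q n" using zr xnz by (simp add: q_def mult.assoc[symmetric])
    moreover have "x \<in> max_ideal L" using x L(4) ext_ideal_sup[OF A P(3)] by blast
    ultimately have "x * r \<in> ideal_mul L (max_ideal L) (q n)" by (intro ideal_mulI[OF L(3)])
    then show "y \<in> ideal_add (q (Suc n)) (ideal_mul L (max_ideal L) (q n))" using zr ideal_addI by blast
  qed
  then have qq: "q n \<subseteq> q (Suc n)" by (rule nakayama[OF L(1,2) q q])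
  \<comment> \<open>Back in \<open>B\<close>, the \<open>n\<close>-th power of the maximal ideal
    lies in \<open>Q0\<close> plus the next power. A second use of Nakayama's lemma puts it into
    \<open>Q0\<close>, against \<open>P0 \<subset> P1\<close>.\<close>
  have "qB n \<subseteq> qB (Suc n)"
  proof -
    have "qB n \<inter> A \<subseteq> qB (Suc n) \<inter> A" using qq L(5) by (auto simp: q_def)
    then have "ext_ideal A P1 (qB n \<inter> A) \<subseteq> ext_ideal A P1 (qB (Suc n) \<inter> A)" by (auto simp: ext_ideal_def)
    then show ?thesis using ext_contract[OF A P(2)] qB unfolding B_def by auto
  qed
  moreover have "ideal_pow B (max_ideal B) n \<subseteq> qB n"
    unfolding qB_def by (rule ideal_add_sup[OF B(3) Q0(1) ideal_pow_ideal[OF B(3) MB]])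
  ultimately have "ideal_pow B (max_ideal B) n \<subseteq> qB (Suc n)" by blast
  also have "qB (Suc n) \<subseteq> ideal_add Q0 (ideal_mul B (max_ideal B) (ideal_pow B (max_ideal B) n))"
  proof -
    have "ideal_pow B (max_ideal B) (Suc n) \<subseteq> ideal_mul B (max_ideal B) (ideal_pow B (max_ideal B) n)"
      unfolding ideal_pow_Suc
      by (rule ideal_mul_least[OF B(3) ideal_mul_ideal[OF B(3) MB ideal_pow_ideal[OF B(3) MB]]])
        (use ideal_mulI[OF B(3)] in \<open>metis mult.commute\<close>)
    then show ?thesis by (auto simp: qB_def ideal_add_def)
  qed
  finally have "ideal_pow B (max_ideal B) n \<subseteq> Q0"
    by (rule nakayama[OF B(1,2) ideal_pow_ideal[OF B(3) MB] Q0(1)])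
  moreover obtain y where y: "y \<in> P1" "y \<notin> P0" using P(4) by blast
  have yB: "y \<in> max_ideal B" using y B(4) ext_ideal_sup[OF A P(2)] by blast
  ultimately have "y ^ n \<in> Q0" using ideal_pow_power[OF B(3) yB] by blast
  moreover have "y \<in> B" using yB by (auto simp: max_ideal_def)
  ultimately have "y \<in> Q0" using prime_power[OF B(3) Q0(2)] by blast
  moreover have "y \<in> A" using y idealD(2)[OF A primeD(1)[OF A P(2)]] by auto
  ultimately show False using Q0(3) y by auto
qed

text \<open>The principal ideal theorem is used from the top downwards: the prime just below the top
  is replaced by one containing \<open>x\<close>, then the one below that, and so on. The last
  replacement lies strictly above \<open>p 0\<close>, which is dropped, so the chain gets shorter by
  one.\<close>

lemma chain_through:
  assumes A: "subring A" and N: "noetherian A"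
    and p: "\<And>i. i \<le> Suc c \<Longrightarrow> prime_ideal A (p i)" "\<And>i. i \<le> c \<Longrightarrow> p i \<subset> p (Suc i)"
    and x: "x \<in> p (Suc c)"
  shows "\<exists>p'. (\<forall>i\<le>c. prime_ideal A (p' i)) \<and> (\<forall>i<c. p' i \<subset> p' (Suc i)) \<and> p' c = p (Suc c) \<and> x \<in> p' 0 \<and> p 0 \<subset> p' 0"
  using p x
proof (induction c arbitrary: p)
  case 0
  then show ?case by (intro exI[of _ "\<lambda>_. p 1"]) auto
next
  case (Suc c)
  have "\<exists>T. prime_ideal A T \<and> p c \<subset> T \<and> T \<subset> p (Suc (Suc c)) \<and> x \<in> T"
    by (rule principal_ideal_theorem[OF A N, of "p c" "p (Suc c)"]) (use Suc.prems in auto)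
  then obtain T where T: "prime_ideal A T" "p c \<subset> T" "T \<subset> p (Suc (Suc c))" "x \<in> T" by blast
  let ?p = "\<lambda>i. if i = Suc c then T else p i"
  have "\<exists>p'. (\<forall>i\<le>c. prime_ideal A (p' i)) \<and> (\<forall>i<c. p' i \<subset> p' (Suc i)) \<and> p' c = ?p (Suc c) \<and> x \<in> p' 0 \<and> ?p 0 \<subset> p' 0"
  proof (rule Suc.IH)
    show "prime_ideal A (?p i)" if "i \<le> Suc c" for i using Suc.prems(1)[of i] T that by auto
    show "?p i \<subset> ?p (Suc i)" if "i \<le> c" for i using Suc.prems(2)[of i] T that by (cases "i = c") auto
    show "x \<in> ?p (Suc c)" using T by simp
  qed
  then obtain p' where p': "\<And>i. i\<le>c \<Longrightarrow> prime_ideal A (p' i)" "\<And>i. i<c \<Longrightarrow> p' i \<subset> p' (Suc i)" "p' c = T" "x \<in> p' 0" "p 0 \<subset> p' 0"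
    by auto
  let ?q = "\<lambda>i. if i = Suc c then p (Suc (Suc c)) else p' i"
  have "prime_ideal A (?q i)" if "i \<le> Suc c" for i using p'(1)[of i] Suc.prems(1)[of "Suc (Suc c)"] that by auto
  moreover have "?q i \<subset> ?q (Suc i)" if "i < Suc c" for i
    using p'(2)[of i] p'(3) T(3) that by (cases "i = c") auto
  moreover have "?q (Suc c) = p (Suc (Suc c))" "x \<in> ?q 0" "p 0 \<subset> ?q 0" using p' by auto
  ultimately show ?case by (intro exI[of _ ?q]) blast
qed

subsection \<open>Regular local rings\<close>

lemma krull_dim_ge: "prime_chain A p n \<Longrightarrow> enat n \<le> krull_dim A"
  unfolding krull_dim_def by (rule Sup_upper) auto

lemma enat_Sup_attained:
  assumes "Sup {enat n | n. Q n} = enat d" "\<exists>n. Q n"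
  shows "Q d"
proof -
  let ?X = "{enat n | n. Q n}"
  have "?X \<noteq> {}" using assms(2) by auto
  moreover have "finite ?X"
  proof -
    have "\<And>x. x \<in> ?X \<Longrightarrow> x \<le> enat d" using assms(1) Sup_upper[of _ ?X] by auto
    then have "?X \<subseteq> enat ` {..d}" by fastforce
    then show ?thesis by (rule finite_subset) auto
  qed
  ultimately have "Max ?X \<in> ?X" "Sup ?X = Max ?X" using Max_in[of ?X] Max_Sup[of ?X] by auto
  then show ?thesis using assms(1) by auto
qed

lemma krull_dim_chain:
  assumes "subring A" "krull_dim A = enat d"
  shows "\<exists>p. prime_chain A p d"
proof -
  have "prime_chain A (\<lambda>_. {0}) 0" using prime_zero[OF assms(1)] by (simp add: prime_chain_def)
  then show ?thesis
    using enat_Sup_attained[of "\<lambda>n. \<exists>p. prime_chain A p n" d] assms(2) unfolding krull_dim_def by blast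
qed

text \<open>By induction on \<open>c\<close>: route the chain through a generator \<open>z \<notin> p 0\<close>; then the induction hypothesis
  gives \<open>p 0 \<subseteq> I + z p 0\<close>, and Nakayama's lemma applies.\<close>

lemma ideal_eq_chain_start:
  assumes L: "local_ring A" and N: "noetherian A" and I: "is_ideal A I"
    and Z: "finite Z" "card Z \<le> c" "gen_ideal A (I \<union> Z) = max_ideal A"
    and p: "prime_chain A p c" "I \<subseteq> p 0"
  shows "I = p 0"
proof -
  have A: "subring A" and M: "is_ideal A (max_ideal A)" using L by (auto simp: local_ring_def)
  show ?thesis
    using I Z p
  proof (induction c arbitrary: I Z p)
    case 0
    then have "max_ideal A \<subseteq> I" using gen_ideal_least[OF A 0(1), of I] by auto
    then show ?case using prime_le_max[OF A, of "p 0"] 0 by (auto simp: prime_chain_def)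
  next
    case (Suc c)
    have pr: "\<And>i. i \<le> Suc c \<Longrightarrow> prime_ideal A (p i)" "\<And>i. i \<le> c \<Longrightarrow> p i \<subset> p (Suc i)"
      using Suc.prems(5) by (auto simp: prime_chain_def)
    have pM: "p (Suc c) \<subseteq> max_ideal A" using prime_le_max[OF A pr(1)] by auto
    note P0 = primeD[OF A pr(1)[of 0, simplified]]
    have sub: "I \<union> Z \<subseteq> max_ideal A"
    proof -
      have ZA: "gen_ideal A (I \<union> Z) = max_ideal A" by (rule Suc.prems)
      show ?thesis using gen_ideal_superset[OF A, of "I \<union> Z"] ZA by simp
    qed
    have "\<exists>z\<in>Z. z \<notin> p 0"
    proof (rule ccontr)
      assume "\<not> ?thesis"
      then have "max_ideal A \<subseteq> p 0" using gen_ideal_least[OF A P0(1), of "I \<union> Z"] Suc.prems by auto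
      moreover have "p 0 \<subset> p 1" using pr(2)[of 0] by simp
      moreover have "p 1 \<subseteq> max_ideal A" using prime_le_max[OF A pr(1)[of 1]] by auto
      ultimately show False by blast
    qed
    then obtain z where z: "z \<in> Z" "z \<notin> p 0" by blast
    have zM: "z \<in> max_ideal A" using z sub by auto
    have zA: "z \<in> A" using zM idealD[OF A M] by auto
    \<comment> \<open>Raising the top prime to the maximal ideal puts \<open>z\<close> into it, so
      that the chain can be routed through \<open>z\<close>.\<close>
    let ?p = "\<lambda>i. if i = Suc c then max_ideal A else p i"
    have "\<exists>p'. (\<forall>i\<le>c. prime_ideal A (p' i)) \<and> (\<forall>i<c. p' i \<subset> p' (Suc i)) \<and> p' c = ?p (Suc c) \<and> z \<in> p' 0 \<and> ?p 0 \<subset> p' 0"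
    proof (rule chain_through[OF A N])
      show "prime_ideal A (?p i)" if "i \<le> Suc c" for i using pr(1)[OF that] max_ideal_prime[OF L] by auto
      show "?p i \<subset> ?p (Suc i)" if "i \<le> c" for i using pr(2)[OF that] pM that by auto
      show "z \<in> ?p (Suc c)" using zM by simp
    qed
    then obtain p' where p': "prime_chain A p' c" "z \<in> p' 0" "p 0 \<subset> p' 0"
      by (auto simp: prime_chain_def)
    have pz: "is_ideal A (principal A z)" by (rule principal_ideal[OF A zA])
    let ?I = "ideal_add I (principal A z)"
    have I': "is_ideal A ?I" "I \<subseteq> ?I" "z \<in> ?I"
      using ideal_add_ideal[OF A Suc.prems(1) pz] ideal_add_sup[OF A Suc.prems(1) pz] principal_self[OF A, of z] by auto
    have p'0: "is_ideal A (p' 0)" using p'(1) primeD(1)[OF A] by (auto simp: prime_chain_def)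
    have "?I = p' 0"
    proof (rule Suc.IH[OF I'(1), of "Z - {z}"])
      show "finite (Z - {z})" "card (Z - {z}) \<le> c" using Suc.prems(2,3) z by auto
      have IZ: "?I \<union> (Z - {z}) \<subseteq> max_ideal A"
        using ideal_add_least[OF A M, of I "principal A z"] sub principal_least[OF A M zM] by auto
      show "gen_ideal A (?I \<union> (Z - {z})) = max_ideal A"
      proof
        show "gen_ideal A (?I \<union> (Z - {z})) \<subseteq> max_ideal A" by (rule gen_ideal_least[OF A M IZ])
        have g: "is_ideal A (gen_ideal A (?I \<union> (Z - {z})))"
          using gen_ideal_ideal[OF A] IZ idealD(2)[OF A M] by blast
        have "I \<union> Z \<subseteq> ?I \<union> (Z - {z})" using I' by auto
        then have "I \<union> Z \<subseteq> gen_ideal A (?I \<union> (Z - {z}))" using gen_ideal_superset[OF A] by blast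
        then show "max_ideal A \<subseteq> gen_ideal A (?I \<union> (Z - {z}))"
          using gen_ideal_least[OF A g] Suc.prems(4) by blast
      qed
      show "?I \<subseteq> p' 0"
        using ideal_add_least[OF A p'0, of I "principal A z"] principal_least[OF A p'0 p'(2)] Suc.prems(6) p'(3) by auto
    qed (rule p')
    then have p0I: "p 0 \<subseteq> ?I" using p' by auto
    have "p 0 \<subseteq> ideal_add I (ideal_mul A (max_ideal A) (p 0))"
    proof
      fix y assume y: "y \<in> p 0"
      then obtain i r where ir: "i \<in> I" "r \<in> A" "y = i + z * r" using p0I by (auto simp: ideal_add_def principal_def)
      have "z * r \<in> p 0" using ir y idealD(4)[OF A P0(1), of y i] Suc.prems(6) by auto
      then have "r \<in> p 0" using P0(3)[OF zA ir(2)] z by auto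
      then have "z * r \<in> ideal_mul A (max_ideal A) (p 0)" using zM by (intro ideal_mulI A)
      then show "y \<in> ideal_add I (ideal_mul A (max_ideal A) (p 0))" using ir ideal_addI by blast
    qed
    then have "p 0 \<subseteq> I" by (rule nakayama[OF L N P0(1) Suc.prems(1)])
    then show ?case using Suc.prems by auto
  qed
qed

definition flag :: "'a::field set \<Rightarrow> (nat \<Rightarrow> 'a) \<Rightarrow> nat \<Rightarrow> 'a set" where
  "flag A y i = gen_ideal A (y ` {..<i})"

text \<open>Regularity in the form used by the later inductions: a flag of primes, each arising from
  the previous one by adding a parameter outside it. Thus each parameter is a nonzero prime element
  modulo its predecessors.\<close>

locale reg_params =
  fixes A :: "'a::field set" and y :: "nat \<Rightarrow> 'a" and d :: nat
  assumes local: "local_ring A" and noeth: "noetherian A"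
    and gen: "flag A y d = max_ideal A"
    and flag_prime: "\<And>i. i \<le> d \<Longrightarrow> prime_ideal A (flag A y i)"
    and notin_flag: "\<And>i. i < d \<Longrightarrow> y i \<notin> flag A y i"

text \<open>Inductively, a prime chain of length \<open>d - i\<close> starts at
  \<open>flag A y i\<close>. Routing it through \<open>y i\<close> shortens it by one, and
  \<open>ideal_eq_chain_start\<close> identifies the new start with the next flag ideal, since the
  remaining \<open>d - Suc i\<close> parameters generate the maximal ideal modulo it.\<close>

lemma reg_paramsI:
  assumes L: "local_ring A" and N: "noetherian A" and d: "krull_dim A = enat d"
    and y: "y ` {..<d} \<subseteq> max_ideal A" "gen_ideal A (y ` {..<d}) = max_ideal A"
  shows "reg_params A y d"
proof -
  have A: "subring A" and M: "is_ideal A (max_ideal A)" using L by (auto simp: local_ring_def)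
  have yA: "y i \<in> A" if "i < d" for i using y(1) idealD(2)[OF A M] that by auto
  have F: "is_ideal A (flag A y i)" if "i \<le> d" for i
    unfolding flag_def by (rule gen_ideal_ideal[OF A]) (use yA that in auto)
  have genI: "gen_ideal A (flag A y i \<union> y ` {i..<d}) = max_ideal A" if i: "i \<le> d" for i
  proof
    have "flag A y i \<subseteq> max_ideal A" unfolding flag_def by (rule gen_ideal_least[OF A M]) (use y i in auto)
    then have s: "flag A y i \<union> y ` {i..<d} \<subseteq> max_ideal A" using y i by auto
    then show "gen_ideal A (flag A y i \<union> y ` {i..<d}) \<subseteq> max_ideal A" by (rule gen_ideal_least[OF A M])
    have "is_ideal A (gen_ideal A (flag A y i \<union> y ` {i..<d}))"
      using gen_ideal_ideal[OF A] s idealD(2)[OF A M] by blast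
    moreover have "y ` {..<d} \<subseteq> gen_ideal A (flag A y i \<union> y ` {i..<d})"
    proof -
      have "y ` {..<d} \<subseteq> y ` {..<i} \<union> y ` {i..<d}" by (auto simp: image_iff) (metis atLeastLessThan_iff lessThan_iff not_less)
      then show ?thesis
        using gen_ideal_superset[OF A, of "y ` {..<i}"] gen_ideal_superset[OF A, of "flag A y i \<union> y ` {i..<d}"]
        unfolding flag_def by blast
    qed
    ultimately show "max_ideal A \<subseteq> gen_ideal A (flag A y i \<union> y ` {i..<d})"
      using gen_ideal_least[OF A] y(2) by metis
  qed
  have crd: "card (y ` {i..<d}) \<le> d - i" for i using card_image_le[of "{i..<d}" y] by simp
  have step: "\<exists>p'. prime_chain A p' (d - Suc i) \<and> p' 0 = flag A y (Suc i) \<and> flag A y i \<subset> p' 0"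
    if i: "i < d" and p: "prime_chain A p (d - i)" "p 0 = flag A y i" for i p
  proof -
    obtain c where c: "d - i = Suc c" using i by (metis Suc_diff_Suc)
    have pr: "\<And>i. i \<le> Suc c \<Longrightarrow> prime_ideal A (p i)" "\<And>i. i \<le> c \<Longrightarrow> p i \<subset> p (Suc i)"
      using p(1) c by (auto simp: prime_chain_def)
    have pM: "p (Suc c) \<subseteq> max_ideal A" using prime_le_max[OF A pr(1)] by auto
    let ?p = "\<lambda>i. if i = Suc c then max_ideal A else p i"
    have "\<exists>p'. (\<forall>i\<le>c. prime_ideal A (p' i)) \<and> (\<forall>i<c. p' i \<subset> p' (Suc i)) \<and> p' c = ?p (Suc c) \<and> y i \<in> p' 0 \<and> ?p 0 \<subset> p' 0"
    proof (rule chain_through[OF A N])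
      show "prime_ideal A (?p i)" if "i \<le> Suc c" for i using pr(1)[OF that] max_ideal_prime[OF L] by auto
      show "?p i \<subset> ?p (Suc i)" if "i \<le> c" for i using pr(2)[OF that] pM that by auto
      show "y i \<in> ?p (Suc c)" using y(1) i by auto
    qed
    then obtain p' where p': "prime_chain A p' c" "y i \<in> p' 0" "p 0 \<subset> p' 0"
      by (auto simp: prime_chain_def)
    have p'0: "is_ideal A (p' 0)" using p'(1) primeD(1)[OF A] by (auto simp: prime_chain_def)
    have "y ` {..<i} \<subseteq> flag A y i" using gen_ideal_superset[OF A] by (auto simp: flag_def)
    then have "y ` {..<i} \<subseteq> p' 0" using p'(3) p(2) by blast
    then have "y ` {..<Suc i} \<subseteq> p' 0" using p'(2) by (simp add: lessThan_Suc)
    then have s: "flag A y (Suc i) \<subseteq> p' 0" unfolding flag_def by (rule gen_ideal_least[OF A p'0])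
    have "flag A y (Suc i) = p' 0"
      by (rule ideal_eq_chain_start[OF L N F _ _ genI p'(1) s]) (use i c crd[of "Suc i"] in auto)
    then show ?thesis using p' p(2) c by (intro exI[of _ p']) (metis Suc_diff_Suc i old.nat.inject)
  qed
  have chain: "\<exists>p. prime_chain A p (d - i) \<and> p 0 = flag A y i" if "i \<le> d" for i
    using that
  proof (induction i)
    case 0
    obtain p where p: "prime_chain A p d" using krull_dim_chain[OF A d] by blast
    have "0 \<in> p 0" using p idealD(1)[OF A primeD(1)[OF A]] by (auto simp: prime_chain_def)
    moreover have "flag A y 0 = {0}" by (auto simp: flag_def gen_ideal_def)
    ultimately have "flag A y 0 = p 0"
      by (intro ideal_eq_chain_start[OF L N F _ _ genI p]) (use crd[of 0] in auto)
    then show ?case using p by auto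
  next
    case (Suc i)
    then obtain p where "prime_chain A p (d - i)" "p 0 = flag A y i" by auto
    then show ?case using step[of i p] Suc.prems by auto
  qed
  show ?thesis
  proof
    show "local_ring A" "noetherian A" by fact+
    show "flag A y d = max_ideal A" using y by (simp add: flag_def)
    show "prime_ideal A (flag A y i)" if "i \<le> d" for i
      using chain[OF that] by (auto simp: prime_chain_def)
    show "y i \<notin> flag A y i" if i: "i < d" for i
    proof
      assume yi: "y i \<in> flag A y i"
      obtain p where "prime_chain A p (d - i)" "p 0 = flag A y i" using chain[of i] i by auto
      then have "flag A y i \<subset> flag A y (Suc i)" using step[OF i, of p] by metis
      moreover have "y ` {..<i} \<subseteq> flag A y i" using gen_ideal_superset[OF A] by (simp add: flag_def)
      then have "y ` {..<Suc i} \<subseteq> flag A y i" using yi by (simp add: lessThan_Suc)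
      then have "flag A y (Suc i) \<subseteq> flag A y i"
        unfolding flag_def[of A y "Suc i"] using gen_ideal_least[OF A F] i by auto
      ultimately show False by auto
    qed
  qed
qed


text \<open>Exchange argument: since \<open>x\<close> is outside the square of the maximal ideal,
  some coefficient of \<open>x\<close> with respect to a minimal generating set is a unit, and
  \<open>x\<close> can replace that generator. It gets index 0 because that variable is
  dehomogenized later.\<close>

lemma regular_params_start:
  assumes R: "regular_local_ring A" and x: "x \<in> max_ideal A" "x \<notin> ideal_pow A (max_ideal A) 2"
  obtains y d where "reg_params A y d" "0 < d" "y 0 = x"
proof -
  have L: "local_ring A" and N: "noetherian A" using R by (auto simp: regular_local_ring_def)
  have A: "subring A" and M: "is_ideal A (max_ideal A)" using L by (auto simp: local_ring_def)
  let ?Q = "\<lambda>n. \<exists>X. finite X \<and> card X = n \<and> X \<subseteq> max_ideal A \<and> gen_ideal A X = max_ideal A"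
  define d where "d = (LEAST n. ?Q n)"
  have "\<exists>n. ?Q n" using N[unfolded noetherian_def, rule_format, OF M] by auto
  then have "?Q d" unfolding d_def by (rule LeastI_ex)
  then obtain X where X: "finite X" "card X = d" "X \<subseteq> max_ideal A" "gen_ideal A X = max_ideal A" by blast
  have d: "krull_dim A = enat d" using R by (simp add: regular_local_ring_def d_def)
  have "x \<in> gen_ideal A X" using x X by simp
  then obtain Y c where Y: "finite Y" "Y \<subseteq> X" "c ` Y \<subseteq> A" "x = (\<Sum>z\<in>Y. c z * z)"
    unfolding gen_ideal_def by blast
  have "\<exists>z\<in>Y. c z \<notin> max_ideal A"
  proof (rule ccontr)
    assume "\<not> ?thesis"
    then have "c z * z \<in> ideal_pow A (max_ideal A) (Suc (Suc 0))" if "z \<in> Y" for z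
      using that Y X ideal_pow_SucI[OF A, of "c z" "max_ideal A" "Suc 0" z] ideal_pow_1[OF A M] by auto
    then have "x \<in> ideal_pow A (max_ideal A) (Suc (Suc 0))"
      unfolding Y(4) by (intro ideal_sum[OF A ideal_pow_ideal[OF A M]])
    then show False using x by (simp add: numeral_2_eq_2)
  qed
  then obtain z where z: "z \<in> Y" "c z \<notin> max_ideal A" by blast
  have cz: "c z \<noteq> 0" "inverse (c z) \<in> A" using max_ideal_unit[OF _ z(2)] z Y by auto
  let ?X = "insert x (X - {z})"
  have genX: "gen_ideal A ?X = max_ideal A"
  proof
    have s: "?X \<subseteq> max_ideal A" using x X by auto
    then show "gen_ideal A ?X \<subseteq> max_ideal A" by (rule gen_ideal_least[OF A M])
    have g: "is_ideal A (gen_ideal A ?X)"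
      by (rule gen_ideal_ideal[OF A]) (use s idealD(2)[OF A M] in auto)
    have s': "?X \<subseteq> gen_ideal A ?X" by (rule gen_ideal_superset[OF A])
    have "x = c z * z + (\<Sum>w\<in>Y-{z}. c w * w)" using Y z by (simp add: sum.remove)
    then have "z = inverse (c z) * (x - (\<Sum>w\<in>Y-{z}. c w * w))" using cz by (simp add: field_simps)
    moreover have sm: "(\<Sum>w\<in>Y-{z}. c w * w) \<in> gen_ideal A ?X"
    proof (rule ideal_sum[OF A g])
      fix w assume w: "w \<in> Y - {z}"
      then have "w \<in> gen_ideal A ?X" using s' Y by auto
      then show "c w * w \<in> gen_ideal A ?X" using w Y idealD(6)[OF A g] by auto
    qed
    moreover have "inverse (c z) * (x - (\<Sum>w\<in>Y-{z}. c w * w)) \<in> gen_ideal A ?X"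
      using s' by (intro idealD(6)[OF A g cz(2)] idealD(4)[OF A g] sm) auto
    ultimately have "z \<in> gen_ideal A ?X" by metis
    then have "X \<subseteq> gen_ideal A ?X" using s' by auto
    then show "max_ideal A \<subseteq> gen_ideal A ?X" using gen_ideal_least[OF A g] X by metis
  qed
  have zX: "z \<in> X" using z Y by auto
  then have d0: "0 < d" using X by (auto simp: card_gt_0_iff)
  have "card (X - {z}) = d - 1" using X zX by simp
  then obtain f where f: "bij_betw f {..<d - 1} (X - {z})"
    using ex_bij_betw_nat_finite[of "X - {z}"] X by (auto simp: atLeast0LessThan)
  define y where "y i = (if i = 0 then x else f (i - 1))" for i
  have "y ` {..<d} = ?X"
  proof -
    have "{..<d} = insert 0 (Suc ` {..<d - 1})"
      using d0 by (cases d) (auto simp: lessThan_Suc_eq_insert_0)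
    then have "y ` {..<d} = insert (y 0) ((\<lambda>i. y (Suc i)) ` {..<d - 1})" by (metis image_image image_insert)
    then have "y ` {..<d} = insert x (f ` {..<d - 1})" by (simp add: y_def)
    then show ?thesis using f by (simp add: bij_betw_def)
  qed
  then have "reg_params A y d" using genX x X by (intro reg_paramsI[OF L N d]) auto
  then show ?thesis using that d0 by (simp add: y_def)
qed

subsection \<open>Complete integral closedness\<close>

context reg_params
begin

lemma A: "subring A" and M: "is_ideal A (max_ideal A)"
  using local by (auto simp: local_ring_def)

lemma flag_ideal: "i \<le> d \<Longrightarrow> is_ideal A (flag A y i)"
  using primeD(1)[OF A flag_prime] .

lemma flag_0: "flag A y 0 = {0}"
  by (auto simp: flag_def gen_ideal_def)

lemma y_max: "i < d \<Longrightarrow> y i \<in> max_ideal A"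
  using gen_ideal_superset[OF A, of "y ` {..<d}"] gen by (auto simp: flag_def)

lemma y_in: "i < d \<Longrightarrow> y i \<in> A"
  using y_max by (auto simp: max_ideal_def)

lemma flag_Suc:
  assumes i: "i < d" shows "flag A y (Suc i) = ideal_add (flag A y i) (principal A (y i))"
proof
  have F: "is_ideal A (flag A y i)" "is_ideal A (flag A y (Suc i))" using i flag_ideal by auto
  have p: "is_ideal A (principal A (y i))" by (rule principal_ideal[OF A y_in[OF i]])
  have "y ` {..<i} \<subseteq> flag A y i" using gen_ideal_superset[OF A] by (auto simp: flag_def)
  then have "y ` {..<Suc i} \<subseteq> ideal_add (flag A y i) (principal A (y i))"
    using ideal_add_sup[OF A F(1) p] principal_self[OF A, of "y i"] by (simp add: lessThan_Suc) blast
  then show "flag A y (Suc i) \<subseteq> ideal_add (flag A y i) (principal A (y i))"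
    using gen_ideal_least[OF A ideal_add_ideal[OF A F(1) p]] unfolding flag_def by blast
  have "y ` {..<Suc i} \<subseteq> flag A y (Suc i)" using gen_ideal_superset[OF A] by (auto simp: flag_def)
  then have s: "y ` {..<i} \<subseteq> flag A y (Suc i)" "y i \<in> flag A y (Suc i)" by (auto simp: lessThan_Suc)
  have "flag A y i \<subseteq> flag A y (Suc i)"
    unfolding flag_def[of A y i] by (rule gen_ideal_least[OF A F(2) s(1)])
  then show "ideal_add (flag A y i) (principal A (y i)) \<subseteq> flag A y (Suc i)"
    using ideal_add_least[OF A F(2)] principal_least[OF A F(2) s(2)] by blast
qed

end


text \<open>One step of the flag: \<open>x\<close> is a nonzero prime element of the local domain
  \<open>A/P\<close>, and congruences modulo \<open>P\<close> stand for equalities in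
  \<open>A/P\<close>.\<close>

locale flag_step =
  fixes A P :: "'a::field set" and x :: 'a
  assumes loc: "local_ring A" and noe: "noetherian A" and P: "prime_ideal A P"
    and xm: "x \<in> max_ideal A" and xP: "x \<notin> P" and Px: "prime_ideal A (ideal_add P (principal A x))"
begin

lemma A: "subring A" using loc by (simp add: local_ring_def)
lemma xA: "x \<in> A" using xm by (simp add: max_ideal_def)
lemmas PI = primeD(1)[OF A P]
lemmas PD = idealD[OF A PI]
lemmas AD = subringD[OF A]

lemma Px_iff: "z \<in> ideal_add P (principal A x) \<longleftrightarrow> (\<exists>p\<in>P. \<exists>r\<in>A. z = p + x * r)"
  by (auto simp: ideal_add_def principal_def)

lemma cancel_x:
  assumes "u \<in> A" "v \<in> A" "x ^ n * u - x ^ n * v \<in> P" shows "u - v \<in> P"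
proof -
  have "x ^ n * (u - v) \<in> P" using assms(3) by (simp add: algebra_simps)
  then have "x ^ n \<in> P \<or> u - v \<in> P"
    using primeD(3)[OF A P, of "x ^ n" "u - v"] subring_power[OF A xA] AD assms(1,2) by auto
  then show ?thesis using prime_power[OF A P xA] xP by blast
qed

text \<open>If factors \<open>x\<close> could be split off without end, \<open>b\<close> would lie
  in \<open>P + m^s\<close> for all \<open>s\<close>, hence in \<open>P\<close> by Krull's
  intersection theorem.\<close>

lemma x_factor:
  assumes b: "b \<in> A" "b \<notin> P"
  shows "\<exists>s b'. b' \<in> A \<and> b' \<notin> ideal_add P (principal A x) \<and> b - x ^ s * b' \<in> P"
proof (rule ccontr)
  assume no: "\<not> ?thesis"
  have "\<exists>b'\<in>A. b - x ^ s * b' \<in> P" for s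
  proof (induction s)
    case 0 then show ?case using b PD(1) by (intro bexI[of _ b]) auto
  next
    case (Suc s)
    then obtain b' where b': "b' \<in> A" "b - x ^ s * b' \<in> P" by blast
    then obtain p r where pr: "p \<in> P" "r \<in> A" "b' = p + x * r" using no Px_iff by meson
    have "b - x ^ Suc s * r = (b - x ^ s * b') + x ^ s * p" using pr by (simp add: algebra_simps)
    then have "b - x ^ Suc s * r \<in> P"
      using PD(3)[OF b'(2) PD(6)[OF subring_power[OF A xA] pr(1)], of s] by (simp only:)
    then show ?case using pr by blast
  qed
  then have "b \<in> ideal_add P (ideal_pow A (max_ideal A) s)" for s
  proof -
    obtain b' where b': "b' \<in> A" "b - x ^ s * b' \<in> P" using \<open>\<And>s. \<exists>b'\<in>A. b - x ^ s * b' \<in> P\<close> by blast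
    have "x ^ s * b' \<in> ideal_pow A (max_ideal A) s"
      using idealD(7)[OF A ideal_pow_ideal[OF A] ideal_pow_power[OF A xm] b'(1)] loc by (simp add: local_ring_def)
    then show ?thesis using ideal_addI[OF b'(2), of "x ^ s * b'"] by simp
  qed
  then have "b \<in> P" by (rule krull_intersection[OF loc noe PI])
  then show False using b by simp
qed

text \<open>The prime element \<open>x\<close> of \<open>A/P\<close> does not divide
  \<open>b\<close>, so the factor \<open>x ^ n\<close> of \<open>b * c\<close> moves into
  \<open>c\<close>, one \<open>x\<close> at a time.\<close>

lemma div_x:
  assumes b: "b \<in> A" "b \<notin> ideal_add P (principal A x)" and c: "c \<in> A" and e: "e \<in> A" "b * c - x ^ n * e \<in> P"
  shows "\<exists>c'\<in>A. c - x ^ n * c' \<in> P"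
  using c e
proof (induction n arbitrary: c e)
  case 0 then show ?case using PD(1) by (intro bexI[of _ c]) auto
next
  case (Suc n)
  have "b * c = (b * c - x ^ Suc n * e) + x * (x ^ n * e)" by (simp add: algebra_simps)
  then have "b * c \<in> ideal_add P (principal A x)"
    using Px_iff Suc.prems(2,3) AD(5)[OF subring_power[OF A xA] Suc.prems(2)] by metis
  then have "c \<in> ideal_add P (principal A x)" using primeD(3)[OF A Px, of b c] b Suc.prems by auto
  then obtain p r where pr: "p \<in> P" "r \<in> A" "c = p + x * r" using Px_iff by blast
  have "x ^ 1 * (b * r) - x ^ 1 * (x ^ n * e) = (b * c - x ^ Suc n * e) - b * p" using pr by (simp add: algebra_simps)
  then have "x ^ 1 * (b * r) - x ^ 1 * (x ^ n * e) \<in> P" using PD(4)[OF Suc.prems(3) PD(6)[OF b(1) pr(1)]] by metis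
  then have "b * r - x ^ n * e \<in> P"
    using cancel_x[of "b * r" "x ^ n * e" 1] AD(5) b(1) pr(2) subring_power[OF A xA] Suc.prems(2) by blast
  then obtain c' where c': "c' \<in> A" "r - x ^ n * c' \<in> P" using Suc.IH[of r e] pr Suc.prems by blast
  have "c - x ^ Suc n * c' = p + x * (r - x ^ n * c')" using pr by (simp add: algebra_simps)
  then show ?case using PD(3)[OF pr(1) PD(6)[OF xA c'(2)]] c'(1) by metis
qed

text \<open>In \<open>A/P\<close> this says that \<open>D * (a/b)^k\<close> belongs to the ring for
  every \<open>k\<close>: the fraction \<open>a/b\<close> is almost integral with common denominator
  \<open>D\<close>.\<close>

definition almost :: "'a \<Rightarrow> 'a \<Rightarrow> 'a \<Rightarrow> bool" where
  "almost D a b \<longleftrightarrow> (\<forall>k. \<exists>r\<in>A. D * a ^ k - b ^ k * r \<in> P)"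

text \<open>Subtracting the ring element \<open>c\<close> from the almost integral fraction
  \<open>e/b\<close> keeps the common denominator \<open>D\<close>: every binomial term of
  \<open>D * (e - b * c) ^ k\<close> is divisible by \<open>b ^ k\<close> modulo
  \<open>P\<close>.\<close>

lemma almost_sub:
  assumes D: "D \<in> A" and b: "b \<in> A" and e: "e \<in> A" "almost D e b" and c: "c \<in> A" and p: "p \<in> P"
  shows "almost D (e - b * c - p) b"
  unfolding almost_def
proof
  fix k
  let ?J = "ideal_add P (principal A (b ^ k))"
  have J: "is_ideal A ?J" by (intro ideal_add_ideal A PI principal_ideal subring_power b)
  have Js: "P \<subseteq> ?J" "b ^ k \<in> ?J"
    using ideal_add_sup[OF A PI principal_ideal[OF A subring_power[OF A b]]] principal_self[OF A, of "b ^ k"] by auto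
  note JD = idealD[OF A J]
  have m: "D * e ^ j * (b * c) ^ (k - j) \<in> ?J" if j: "j \<le> k" for j
  proof -
    obtain r where r: "r \<in> A" "D * e ^ j - b ^ j * r \<in> P" using e(2) by (auto simp: almost_def)
    have "D * e ^ j * (b * c) ^ (k - j) = (b * c) ^ (k - j) * (D * e ^ j - b ^ j * r) + (r * c ^ (k - j)) * (b ^ j * b ^ (k - j))"
      by (simp add: algebra_simps power_mult_distrib)
    also have "b ^ j * b ^ (k - j) = b ^ k" using j by (simp add: power_add[symmetric])
    finally have eq: "D * e ^ j * (b * c) ^ (k - j) = (b * c) ^ (k - j) * (D * e ^ j - b ^ j * r) + (r * c ^ (k - j)) * b ^ k" .
    have "(b * c) ^ (k - j) * (D * e ^ j - b ^ j * r) \<in> ?J"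
      using PD(6)[OF _ r(2)] subring_power[OF A] AD(5) b c Js by blast
    moreover have "(r * c ^ (k - j)) * b ^ k \<in> ?J"
      using JD(6)[OF _ Js(2)] subring_power[OF A] AD(5) r c by blast
    ultimately show ?thesis unfolding eq by (rule JD(3))
  qed
  have "D * (e - b * c) ^ k = (\<Sum>j\<le>k. (of_nat (k choose j) * (- 1) ^ (k - j)) * (D * e ^ j * (b * c) ^ (k - j)))"
  proof -
    have "(e - b * c) ^ k = (e + - (b * c)) ^ k" by simp
    also have "\<dots> = (\<Sum>j\<le>k. of_nat (k choose j) * e ^ j * (- (b * c)) ^ (k - j))" by (rule binomial_ring)
    finally show ?thesis
      by (simp add: sum_distrib_left power_minus[of "b * c"] mult_ac)
  qed
  moreover have "(of_nat (k choose j) * (- 1) ^ (k - j)) * (D * e ^ j * (b * c) ^ (k - j)) \<in> ?J" if "j \<le> k" for j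
  proof (rule JD(6)[OF _ m[OF that]])
    have "of_nat n \<in> A" for n by (induction n) (auto simp: AD)
    then show "of_nat (k choose j) * (- 1) ^ (k - j) \<in> A"
      by (intro AD(5) subring_power[OF A] AD(6) AD(2))
  qed
  ultimately have 1: "D * (e - b * c) ^ k \<in> ?J" by (auto intro: ideal_sum[OF A J])
  have 2: "(z - p) ^ k - z ^ k \<in> P" if "z \<in> A" for z
  proof (induction k)
    case (Suc k)
    have "(z - p) ^ Suc k - z ^ Suc k = z * ((z - p) ^ k - z ^ k) - p * (z - p) ^ k" by (simp add: algebra_simps)
    moreover have "(z - p) ^ k \<in> A" using subring_power[OF A] AD(4) that PD(2) p by blast
    ultimately show ?case using PD(4)[OF PD(6)[OF that Suc.IH] PD(7)[OF p]] by metis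
  qed (simp add: PD)
  have "D * (e - b * c - p) ^ k = D * (e - b * c) ^ k + D * ((e - b * c - p) ^ k - (e - b * c) ^ k)"
    by (simp add: algebra_simps)
  moreover have "D * ((e - b * c - p) ^ k - (e - b * c) ^ k) \<in> ?J"
    using PD(6)[OF D 2] AD(4)[OF e(1) AD(5)[OF b c]] Js(1) by blast
  ultimately have "D * (e - b * c - p) ^ k \<in> ?J" using JD(3)[OF 1] by metis
  then obtain u r where "D * (e - b * c - p) ^ k = u + b ^ k * r" "u \<in> P" "r \<in> A"
    by (auto simp: ideal_add_def principal_def)
  then show "\<exists>r\<in>A. D * (e - b * c - p) ^ k - b ^ k * r \<in> P" by (intro bexI[of _ r]) auto
qed

text \<open>As \<open>x\<close> does not divide \<open>b ^ k\<close> modulo \<open>P\<close>, the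
  factor \<open>x ^ k\<close> of \<open>D * (x * e) ^ k\<close> passes to the cofactor of
  \<open>b ^ k\<close> and can be cancelled.\<close>

lemma almost_div:
  assumes D: "D \<in> A" and b: "b \<in> A" "b \<notin> ideal_add P (principal A x)" and e: "e \<in> A" "almost D (x * e) b"
  shows "almost D e b"
  unfolding almost_def
proof
  fix k
  obtain r where r: "r \<in> A" "D * (x * e) ^ k - b ^ k * r \<in> P" using e(2) by (auto simp: almost_def)
  have bk: "b ^ k \<in> A" "b ^ k \<notin> ideal_add P (principal A x)"
    using subring_power[OF A b(1)] prime_power[OF A Px b(1)] b(2) by auto
  have De: "D * e ^ k \<in> A" using AD(5) D subring_power[OF A e(1)] by auto
  have "b ^ k * r - x ^ k * (D * e ^ k) = - (D * (x * e) ^ k - b ^ k * r)" by (simp add: power_mult_distrib)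
  then have "b ^ k * r - x ^ k * (D * e ^ k) \<in> P" using PD(5)[OF r(2)] by metis
  then obtain c' where c': "c' \<in> A" "r - x ^ k * c' \<in> P" using div_x[OF bk r(1) De] by blast
  have "x ^ k * (D * e ^ k) - x ^ k * (b ^ k * c') = (D * (x * e) ^ k - b ^ k * r) + b ^ k * (r - x ^ k * c')"
    by (simp add: algebra_simps power_mult_distrib)
  then have "x ^ k * (D * e ^ k) - x ^ k * (b ^ k * c') \<in> P" using PD(3)[OF r(2) PD(6)[OF bk(1) c'(2)]] by metis
  then have "D * e ^ k - b ^ k * c' \<in> P" by (rule cancel_x[OF De AD(5)[OF bk(1) c'(1)]])
  then show "\<exists>r\<in>A. D * e ^ k - b ^ k * r \<in> P" using c' by blast
qed

text \<open>Successive approximation: solving modulo \<open>P + xA\<close> and dividing the error by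
  \<open>x\<close> gives \<open>a = b c_n + x^n e_n\<close> modulo \<open>P\<close>, where
  \<open>e_n / b\<close> is again almost integral. Krull's intersection theorem for
  \<open>P + bA\<close> turns this into a solution modulo \<open>P\<close>.\<close>

lemma closed_core:
  assumes IH: "\<And>e. e \<in> A \<Longrightarrow> almost D e b \<Longrightarrow> \<exists>c\<in>A. e - b * c \<in> ideal_add P (principal A x)"
    and D: "D \<in> A" and b: "b \<in> A" "b \<notin> ideal_add P (principal A x)"
    and a: "a \<in> A" "almost D a b"
  shows "\<exists>c\<in>A. a - b * c \<in> P"
proof -
  have st: "\<exists>c\<in>A. \<exists>e\<in>A. a - b * c - x ^ n * e \<in> P \<and> almost D e b" for n
  proof (induction n)
    case 0 then show ?case using a PD(1) AD(1) by (intro bexI[of _ 0] bexI[of _ a]) auto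
  next
    case (Suc n)
    then obtain c e where ce: "c \<in> A" "e \<in> A" "a - b * c - x ^ n * e \<in> P" "almost D e b" by blast
    obtain c' where c': "c' \<in> A" "e - b * c' \<in> ideal_add P (principal A x)" using IH ce by blast
    then obtain p e' where e': "p \<in> P" "e' \<in> A" "e - b * c' = p + x * e'" using Px_iff by meson
    have "x * e' = e - b * c' - p" using e' by (simp add: algebra_simps)
    then have "almost D (x * e') b" using almost_sub[OF D b(1) ce(2,4) c'(1) e'(1)] by simp
    then have al: "almost D e' b" by (rule almost_div[OF D b e'(2)])
    have "e = b * c' + (p + x * e')" using e' by (simp add: algebra_simps)
    then have "a - b * (c + x ^ n * c') - x ^ Suc n * e' = (a - b * c - x ^ n * e) + x ^ n * p"
      by (simp add: algebra_simps)
    then have "a - b * (c + x ^ n * c') - x ^ Suc n * e' \<in> P"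
      using PD(3)[OF ce(3) PD(6)[OF subring_power[OF A xA] e'(1)]] by metis
    moreover have "c + x ^ n * c' \<in> A" using AD ce c' subring_power[OF A xA] by auto
    ultimately show ?case using al e' by blast
  qed
  let ?J = "ideal_add P (principal A b)"
  have J: "is_ideal A ?J" by (intro ideal_add_ideal A PI principal_ideal b)
  have M: "is_ideal A (max_ideal A)" using loc by (simp add: local_ring_def)
  have "a \<in> ideal_add ?J (ideal_pow A (max_ideal A) n)" for n
  proof -
    obtain c e where ce: "c \<in> A" "e \<in> A" "a - b * c - x ^ n * e \<in> P" using st by blast
    have 1: "(a - b * c - x ^ n * e) + b * c \<in> ?J" by (rule ideal_addI[OF ce(3)]) (use ce in \<open>auto simp: principal_def\<close>)
    have 2: "x ^ n * e \<in> ideal_pow A (max_ideal A) n"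
      using idealD(7)[OF A ideal_pow_ideal[OF A M] ideal_pow_power[OF A xm] ce(2)] .
    show ?thesis using ideal_addI[OF 1 2] by simp
  qed
  then have "a \<in> ?J" by (rule krull_intersection[OF loc noe J])
  then obtain u r where "a = u + b * r" "u \<in> P" "r \<in> A"
    by (auto simp: ideal_add_def principal_def)
  then show ?thesis by (intro bexI[of _ r]) auto
qed

text \<open>Powers of \<open>x\<close> are split off from \<open>D\<close>, \<open>b\<close> and
  \<open>a\<close>, so that \<open>closed_core\<close> applies to a denominator prime to
  \<open>x\<close>. The point to prove is that \<open>a\<close> contains at least as many factors
  \<open>x\<close> as \<open>b\<close>.\<close>

lemma closed_step:
  assumes IH: "\<And>D b e. D \<in> A \<Longrightarrow> b \<in> A \<Longrightarrow> e \<in> A \<Longrightarrow> D \<notin> ideal_add P (principal A x) \<Longrightarrow>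
      b \<notin> ideal_add P (principal A x) \<Longrightarrow>
      (\<And>k. \<exists>r\<in>A. D * e ^ k - b ^ k * r \<in> ideal_add P (principal A x)) \<Longrightarrow>
      \<exists>c\<in>A. e - b * c \<in> ideal_add P (principal A x)"
    and D: "D \<in> A" "D \<notin> P" and b: "b \<in> A" "b \<notin> P" and a: "a \<in> A" "almost D a b"
  shows "\<exists>c\<in>A. a - b * c \<in> P"
proof (cases "a \<in> P")
  case True then show ?thesis using AD(1) by (intro bexI[of _ 0]) auto
next
  case False
  let ?I = "ideal_add P (principal A x)"
  have PI': "P \<subseteq> ?I" by (rule ideal_add_sup[OF A PI principal_ideal[OF A xA]])
  obtain s b' where b': "b' \<in> A" "b' \<notin> ?I" "b - x ^ s * b' \<in> P" using x_factor[OF b] by blast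
  obtain t D' where D': "D' \<in> A" "D' \<notin> ?I" "D - x ^ t * D' \<in> P" using x_factor[OF D] by blast
  obtain u a' where a': "a' \<in> A" "a' \<notin> ?I" "a - x ^ u * a' \<in> P" using x_factor[OF a(1) False] by blast
  have pw: "z ^ k - w ^ k \<in> P" if "z \<in> A" "w \<in> A" "z - w \<in> P" for z w k
  proof (induction k)
    case (Suc k)
    have "z ^ Suc k - w ^ Suc k = z * (z ^ k - w ^ k) + (z - w) * w ^ k" by (simp add: algebra_simps)
    then show ?case using PD(3)[OF PD(6)[OF that(1) Suc.IH] PD(7)[OF that(3) subring_power[OF A that(2)]]] by metis
  qed (simp add: PD)
  note xp = subring_power[OF A xA]
  have red: "\<exists>r\<in>A. x ^ (t + u * k) * (D' * a' ^ k) - x ^ (s * k) * (b' ^ k * r) \<in> P" for k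
  proof -
    obtain r where r: "r \<in> A" "D * a ^ k - b ^ k * r \<in> P" using a(2) by (auto simp: almost_def)
    have 1: "a ^ k - (x ^ u * a') ^ k \<in> P" by (rule pw[OF a(1) AD(5)[OF xp a'(1)] a'(3)])
    have 2: "b ^ k - (x ^ s * b') ^ k \<in> P" by (rule pw[OF b(1) AD(5)[OF xp b'(1)] b'(3)])
    have e1: "x ^ (t + u * k) = x ^ t * (x ^ u) ^ k" "x ^ (s * k) = (x ^ s) ^ k"
      by (simp_all add: power_add power_mult)
    have "x ^ (t + u * k) * (D' * a' ^ k) - x ^ (s * k) * (b' ^ k * r)
      = (D * a ^ k - b ^ k * r) - (a ^ k * (D - x ^ t * D') + (x ^ t * D') * (a ^ k - (x ^ u * a') ^ k))
        + r * (b ^ k - (x ^ s * b') ^ k)"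
      unfolding e1 by (simp add: algebra_simps power_mult_distrib)
    moreover have "\<dots> \<in> P"
      by (intro PD(3,4,6) r 1 2 D' AD(5) xp subring_power[OF A a(1)])
    ultimately show ?thesis using r(1) by metis
  qed
  have us: "s \<le> u"
  proof (rule ccontr)
    assume "\<not> s \<le> u"
    then obtain v where v: "s = u + Suc v" using less_imp_Suc_add[of u s] by auto
    \<comment> \<open>For an exponent above \<open>t\<close>, the power \<open>s * k\<close> of
      \<open>x\<close> on the right exceeds the power \<open>t + u * k\<close> on the left, so
      \<open>x\<close> would divide \<open>D' * a' ^ k\<close> modulo \<open>P\<close>.\<close>
    let ?k = "Suc t"
    obtain r where r: "r \<in> A" "x ^ (t + u * ?k) * (D' * a' ^ ?k) - x ^ (s * ?k) * (b' ^ ?k * r) \<in> P" using red by blast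
    have ex: "s * ?k = (t + u * ?k) + Suc (v * ?k)" unfolding v by (simp add: algebra_simps)
    have "x ^ (t + u * ?k) * (D' * a' ^ ?k) - x ^ (t + u * ?k) * (x ^ Suc (v * ?k) * (b' ^ ?k * r)) \<in> P"
      using r(2) unfolding ex power_add[of x "t + u * ?k"] by (simp only: mult.assoc)
    moreover have br: "b' ^ ?k * r \<in> A" using AD(5) subring_power[OF A b'(1)] r(1) by blast
    moreover have Da: "D' * a' ^ ?k \<in> A" using AD(5)[OF D'(1) subring_power[OF A a'(1)]] .
    ultimately have "D' * a' ^ ?k - x ^ Suc (v * ?k) * (b' ^ ?k * r) \<in> P"
      using cancel_x[OF Da AD(5)[OF xp br]] by blast
    moreover have "D' * a' ^ ?k = (D' * a' ^ ?k - x ^ Suc (v * ?k) * (b' ^ ?k * r)) + x * (x ^ (v * ?k) * (b' ^ ?k * r))"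
      by (simp add: algebra_simps)
    ultimately have "D' * a' ^ ?k \<in> ?I" using Px_iff AD(5)[OF xp br] by metis
    then have "a' ^ ?k \<in> ?I" using primeD(3)[OF A Px D'(1) subring_power[OF A a'(1)]] D'(2) by blast
    then show False using prime_power[OF A Px a'(1)] a'(2) by blast
  qed
  define w where "w = x ^ (u - s) * a'"
  have w: "w \<in> A" using AD(5)[OF xp a'(1)] by (simp add: w_def)
  have "almost D' w b'"
    unfolding almost_def
  proof
    fix k
    obtain r where r: "r \<in> A" "x ^ (t + u * k) * (D' * a' ^ k) - x ^ (s * k) * (b' ^ k * r) \<in> P" using red by blast
    have "u * k = s * k + (u - s) * k" using us by (simp add: add_mult_distrib[symmetric])
    then have ex: "t + u * k = s * k + (t + (u - s) * k)" by simp
    have "x ^ (s * k) * (x ^ (t + (u - s) * k) * (D' * a' ^ k)) - x ^ (s * k) * (b' ^ k * r) \<in> P"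
      using r(2) unfolding ex power_add[of x "s * k"] by (simp only: mult.assoc)
    moreover have br: "b' ^ k * r \<in> A" using AD(5) subring_power[OF A b'(1)] r(1) by blast
    moreover have Da: "D' * a' ^ k \<in> A" using AD(5)[OF D'(1) subring_power[OF A a'(1)]] .
    ultimately have "x ^ (t + (u - s) * k) * (D' * a' ^ k) - b' ^ k * r \<in> P"
      using cancel_x[OF AD(5)[OF xp Da] br] by blast
    then have *: "x ^ t * (D' * w ^ k) - b' ^ k * r \<in> P"
    proof -
      have "x ^ (t + (u - s) * k) = x ^ t * (x ^ (u - s)) ^ k" by (simp add: power_add power_mult)
      then show ?thesis using \<open>x ^ (t + (u - s) * k) * (D' * a' ^ k) - b' ^ k * r \<in> P\<close>
        by (simp add: w_def power_mult_distrib mult.assoc mult.left_commute)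
    qed
    have bk: "b' ^ k \<in> A" "b' ^ k \<notin> ?I" using subring_power[OF A b'(1)] prime_power[OF A Px b'(1)] b'(2) by auto
    have Dw: "D' * w ^ k \<in> A" using AD(5)[OF D'(1) subring_power[OF A w]] .
    have "b' ^ k * r - x ^ t * (D' * w ^ k) \<in> P" using PD(5)[OF *] by simp
    then obtain c' where c': "c' \<in> A" "r - x ^ t * c' \<in> P" using div_x[OF bk r(1) Dw] by blast
    have "x ^ t * (D' * w ^ k) - x ^ t * (b' ^ k * c') = (x ^ t * (D' * w ^ k) - b' ^ k * r) + b' ^ k * (r - x ^ t * c')"
      by (simp add: algebra_simps)
    then have "x ^ t * (D' * w ^ k) - x ^ t * (b' ^ k * c') \<in> P" using PD(3)[OF * PD(6)[OF bk(1) c'(2)]] by metis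
    then have "D' * w ^ k - b' ^ k * c' \<in> P" by (rule cancel_x[OF Dw AD(5)[OF bk(1) c'(1)]])
    then show "\<exists>r\<in>A. D' * w ^ k - b' ^ k * r \<in> P" using c' by blast
  qed
  note al = this
  have "\<exists>c\<in>A. w - b' * c \<in> P"
  proof (rule closed_core[OF _ D'(1) b'(1,2) w al])
    fix e assume e: "e \<in> A" "almost D' e b'"
    show "\<exists>c\<in>A. e - b' * c \<in> ?I"
      by (rule IH[OF D'(1) b'(1) e(1) D'(2) b'(2)]) (use e(2) PI' in \<open>auto simp: almost_def\<close>)
  qed
  then obtain c where c: "c \<in> A" "w - b' * c \<in> P" by blast
  have "x ^ u = x ^ s * x ^ (u - s)" using us by (simp add: power_add[symmetric])
  then have "a - b * c = (a - x ^ u * a') + x ^ s * (w - b' * c) - c * (b - x ^ s * b')"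
    by (simp add: w_def algebra_simps)
  moreover have "\<dots> \<in> P" by (intro PD(3,4,6) a' c xp b')
  ultimately show ?thesis using c(1) by metis
qed

end

context reg_params
begin

text \<open>Complete integral closedness of the ring modulo the \<open>i\<close>-th prime of the flag, stated without
  quotients; descending induction on \<open>i\<close>.\<close>

lemma flag_closed:
  assumes "i \<le> d" and "D \<in> A" "b \<in> A" "a \<in> A" "D \<notin> flag A y i" "b \<notin> flag A y i"
    and "\<And>k. \<exists>r\<in>A. D * a ^ k - b ^ k * r \<in> flag A y i"
  shows "\<exists>c\<in>A. a - b * c \<in> flag A y i"
  using assms
proof (induction "d - i" arbitrary: i D b a)
  case 0
  then have "b \<notin> max_ideal A" using gen by simp
  then have b: "b \<noteq> 0" "inverse b \<in> A" using max_ideal_unit 0 by auto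
  have "inverse b * a \<in> A" using subringD(5)[OF A b(2)] 0 by auto
  moreover have "a - b * (inverse b * a) = 0" using b by (simp add: mult.assoc[symmetric])
  ultimately show ?case using idealD(1)[OF A flag_ideal] 0 by metis
next
  case (Suc n)
  then have i: "i < d" by simp
  interpret flag_step A "flag A y i" "y i"
    by unfold_locales
      (use local noeth flag_prime[of i] flag_prime[of "Suc i"] i y_max notin_flag flag_Suc[OF i] in auto)
  show ?case
  proof (rule closed_step)
    show "\<exists>c\<in>A. e - b * c \<in> ideal_add (flag A y i) (principal A (y i))"
      if "D \<in> A" "b \<in> A" "e \<in> A" "D \<notin> ideal_add (flag A y i) (principal A (y i))"
        "b \<notin> ideal_add (flag A y i) (principal A (y i))"
        "\<And>k. \<exists>r\<in>A. D * e ^ k - b ^ k * r \<in> ideal_add (flag A y i) (principal A (y i))" for D b e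
      using Suc.hyps(1)[of "Suc i" D b e] that Suc.hyps(2) i unfolding flag_Suc[OF i] by auto
  qed (use Suc.prems in \<open>auto simp: almost_def\<close>)
qed

lemma completely_integrally_closed:
  assumes D: "D \<in> A" "D \<noteq> 0" and q: "q = a / b" "a \<in> A" "b \<in> A" "b \<noteq> 0" and al: "\<And>k. D * q ^ k \<in> A"
  shows "q \<in> A"
proof -
  have "\<exists>c\<in>A. a - b * c \<in> flag A y 0"
  proof (rule flag_closed)
    fix k
    have "D * a ^ k - b ^ k * (D * q ^ k) = 0" using q by (simp add: power_divide)
    then show "\<exists>r\<in>A. D * a ^ k - b ^ k * r \<in> flag A y 0" using al[of k] by (intro bexI[of _ "D * q ^ k"]) (auto simp: flag_0)
  qed (use assms in \<open>auto simp: flag_0\<close>)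
  then obtain c where "c \<in> A" "a = b * c" by (auto simp: flag_0)
  then show ?thesis using q by simp
qed

end

subsection \<open>Polynomials with coefficients in a ring\<close>

type_synonym expo = "nat \<Rightarrow>\<^sub>0 nat"
type_synonym 'a mpol = "expo \<Rightarrow>\<^sub>0 'a"

abbreviation cf :: "('k \<Rightarrow>\<^sub>0 'b::zero) \<Rightarrow> 'k \<Rightarrow> 'b" where "cf \<equiv> Poly_Mapping.lookup"
abbreviation trm :: "'k \<Rightarrow> 'b::zero \<Rightarrow> ('k \<Rightarrow>\<^sub>0 'b)" where "trm \<equiv> Poly_Mapping.single"
abbreviation supp :: "('k \<Rightarrow>\<^sub>0 'b::zero) \<Rightarrow> 'k set" where "supp \<equiv> Poly_Mapping.keys"
abbreviation var :: "nat \<Rightarrow> expo" where "var i \<equiv> trm i (Suc 0)"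

definition mdeg :: "expo \<Rightarrow> nat" where "mdeg \<alpha> = (\<Sum>i\<in>supp \<alpha>. cf \<alpha> i)"

definition mon :: "(nat \<Rightarrow> 'b::comm_monoid_mult) \<Rightarrow> expo \<Rightarrow> 'b" where
  "mon t \<alpha> = (\<Prod>i\<in>supp \<alpha>. t i ^ cf \<alpha> i)"

lemma supp_add_nat: "supp (\<alpha> + \<beta> :: expo) = supp \<alpha> \<union> supp \<beta>"
  by (auto simp: in_keys_iff lookup_add)

lemma mdeg_sup: "finite I \<Longrightarrow> supp \<alpha> \<subseteq> I \<Longrightarrow> mdeg \<alpha> = (\<Sum>i\<in>I. cf \<alpha> i)"
  unfolding mdeg_def by (rule sum.mono_neutral_left) (auto simp: in_keys_iff)

lemma mon_sup: "finite I \<Longrightarrow> supp \<alpha> \<subseteq> I \<Longrightarrow> mon t \<alpha> = (\<Prod>i\<in>I. t i ^ cf \<alpha> i)"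
  unfolding mon_def by (rule prod.mono_neutral_left) (auto simp: in_keys_iff)

lemma mdeg_add: "mdeg (\<alpha> + \<beta>) = mdeg \<alpha> + mdeg \<beta>"
  using mdeg_sup[of "supp \<alpha> \<union> supp \<beta>"] by (simp add: supp_add_nat lookup_add sum.distrib)

lemma mon_add: "mon t (\<alpha> + \<beta>) = mon t \<alpha> * mon t \<beta>"
  using mon_sup[of "supp \<alpha> \<union> supp \<beta>" _ t] by (simp add: supp_add_nat lookup_add power_add prod.distrib)

lemma mdeg_0 [simp]: "mdeg 0 = 0" by (simp add: mdeg_def)
lemma mon_0 [simp]: "mon t 0 = 1" by (simp add: mon_def)
lemma mdeg_var [simp]: "mdeg (var i) = Suc 0" by (simp add: mdeg_def)
lemma mon_var [simp]: "mon t (var i) = t i" by (simp add: mon_def)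

lemma mdeg_eq_0: "mdeg \<alpha> = 0 \<longleftrightarrow> \<alpha> = 0"
proof
  assume "mdeg \<alpha> = 0"
  then have "cf \<alpha> i = 0" for i by (cases "i \<in> supp \<alpha>") (auto simp: mdeg_def in_keys_iff)
  then show "\<alpha> = 0" by (intro poly_mapping_eqI) simp
qed simp

lemma expo_split:
  assumes "cf \<alpha> i \<noteq> 0" shows "\<alpha> = (\<alpha> - var i) + var i"
proof (rule poly_mapping_eqI)
  fix k show "cf \<alpha> k = cf (\<alpha> - var i + var i) k"
    using assms by (cases "k = i") (auto simp: lookup_add lookup_minus lookup_single)
qed

lemma mpol_expand: "F = (\<Sum>\<alpha>\<in>supp F. trm \<alpha> (cf F \<alpha>))"
proof (rule poly_mapping_eqI)
  fix k
  have "cf (\<Sum>\<alpha>\<in>supp F. trm \<alpha> (cf F \<alpha>)) k = (\<Sum>\<alpha>\<in>supp F. if \<alpha> = k then cf F \<alpha> else 0)"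
    by (simp add: lookup_sum lookup_single when_def)
  then show "cf F k = cf (\<Sum>\<alpha>\<in>supp F. trm \<alpha> (cf F \<alpha>)) k" by (simp add: in_keys_iff)
qed

lemma mult_expand:
  fixes F G :: "'b::comm_semiring_1 mpol"
  shows "F * G = (\<Sum>\<alpha>\<in>supp F. \<Sum>\<beta>\<in>supp G. trm (\<alpha> + \<beta>) (cf F \<alpha> * cf G \<beta>))"
  by (subst mpol_expand[of F], subst mpol_expand[of G]) (simp add: sum_product mult_single)

lemma cf_mult:
  fixes F G :: "'b::comm_semiring_1 mpol"
  shows "cf (F * G) \<gamma> = (\<Sum>\<alpha>\<in>supp F. \<Sum>\<beta>\<in>supp G. if \<alpha> + \<beta> = \<gamma> then cf F \<alpha> * cf G \<beta> else 0)"
  by (simp add: mult_expand lookup_sum lookup_single when_def)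

lemma cf_const_mult: "cf (trm 0 c * F) \<alpha> = c * cf (F :: 'b::comm_semiring_1 mpol) \<alpha>"
proof (cases "c = 0")
  case False
  then have "cf (trm 0 c * F) \<alpha> = (\<Sum>\<beta>\<in>supp F. if \<beta> = \<alpha> then c * cf F \<beta> else 0)"
    unfolding cf_mult by simp
  then show ?thesis by (simp add: in_keys_iff)
qed simp


text \<open>The coefficient map is a parameter so that evaluation (the identity) and Taylor
  expansion (the embedding as constants) share one proof that substitution is
  multiplicative.\<close>

definition sbst :: "('b::comm_ring_1 \<Rightarrow> 'c::comm_ring_1) \<Rightarrow> (nat \<Rightarrow> 'c) \<Rightarrow> 'b mpol \<Rightarrow> 'c" where
  "sbst \<phi> t F = (\<Sum>\<alpha>\<in>supp F. \<phi> (cf F \<alpha>) * mon t \<alpha>)"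

locale coeff_hom =
  fixes \<phi> :: "'b::comm_ring_1 \<Rightarrow> 'c::comm_ring_1"
  assumes h0: "\<phi> 0 = 0" and h1: "\<phi> 1 = 1" and hadd: "\<And>a b. \<phi> (a + b) = \<phi> a + \<phi> b"
    and hmult: "\<And>a b. \<phi> (a * b) = \<phi> a * \<phi> b"
begin

lemma sbst_sup: "finite K \<Longrightarrow> supp F \<subseteq> K \<Longrightarrow> sbst \<phi> t F = (\<Sum>\<alpha>\<in>K. \<phi> (cf F \<alpha>) * mon t \<alpha>)"
  unfolding sbst_def by (rule sum.mono_neutral_left) (auto simp: in_keys_iff h0)

lemma sbst_add: "sbst \<phi> t (F + G) = sbst \<phi> t F + sbst \<phi> t G"
  using sbst_sup[of "supp F \<union> supp G"] Poly_Mapping.keys_add[of F G]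
  by (simp add: lookup_add hadd distrib_right sum.distrib)

lemma sbst_0: "sbst \<phi> t 0 = 0"
  by (simp add: sbst_def)

lemma sbst_sum: "sbst \<phi> t (\<Sum>i\<in>I. f i) = (\<Sum>i\<in>I. sbst \<phi> t (f i))"
  by (induction I rule: infinite_finite_induct) (auto simp: sbst_add sbst_0)

lemma sbst_trm: "sbst \<phi> t (trm \<alpha> c) = \<phi> c * mon t \<alpha>"
  by (cases "c = 0") (auto simp: sbst_def h0)

lemma sbst_mult: "sbst \<phi> t (F * G) = sbst \<phi> t F * sbst \<phi> t G"
proof -
  have "sbst \<phi> t (F * G) = (\<Sum>\<alpha>\<in>supp F. \<Sum>\<beta>\<in>supp G. (\<phi> (cf F \<alpha>) * mon t \<alpha>) * (\<phi> (cf G \<beta>) * mon t \<beta>))"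
    by (simp add: mult_expand sbst_sum sbst_trm hmult mon_add mult_ac)
  then show ?thesis by (simp add: sbst_def sum_product)
qed

lemma sbst_minus: "sbst \<phi> t (F - G) = sbst \<phi> t F - sbst \<phi> t G"
  using sbst_add[of t "F - G" G] by simp

end

abbreviation ev :: "(nat \<Rightarrow> 'b::comm_ring_1) \<Rightarrow> 'b mpol \<Rightarrow> 'b" where "ev \<equiv> sbst (\<lambda>c. c)"

interpretation ev: coeff_hom "\<lambda>c. c :: 'b::comm_ring_1"
  by unfold_locales auto

definition form :: "'a::field set \<Rightarrow> nat \<Rightarrow> nat \<Rightarrow> 'a mpol \<Rightarrow> bool" where
  "form I k n F \<longleftrightarrow> (\<forall>\<alpha>. cf F \<alpha> \<in> I) \<and> (\<forall>\<alpha>. cf F \<alpha> \<noteq> 0 \<longrightarrow> mdeg \<alpha> = n \<and> supp \<alpha> \<subseteq> {..<k})"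

lemma form_mono: "form I k n F \<Longrightarrow> I \<subseteq> J \<Longrightarrow> k \<le> l \<Longrightarrow> form J l n F"
  by (fastforce simp: form_def)

lemma form_trm: "c \<in> I \<Longrightarrow> 0 \<in> I \<Longrightarrow> mdeg \<alpha> = n \<Longrightarrow> supp \<alpha> \<subseteq> {..<k} \<Longrightarrow> form I k n (trm \<alpha> c)"
  by (auto simp: form_def lookup_single when_def)

lemma form_add:
  assumes "subring A" "is_ideal A I" "form I k n F" "form I k n G" shows "form I k n (F + G)"
  unfolding form_def
proof (intro conjI allI impI)
  fix \<alpha>
  show "cf (F + G) \<alpha> \<in> I" using assms idealD(3)[OF assms(1,2)] by (auto simp: form_def lookup_add)
  assume "cf (F + G) \<alpha> \<noteq> 0"
  then have "cf F \<alpha> \<noteq> 0 \<or> cf G \<alpha> \<noteq> 0" by (auto simp: lookup_add)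
  then show "mdeg \<alpha> = n" "supp \<alpha> \<subseteq> {..<k}" using assms by (auto simp: form_def)
qed

lemma form_uminus:
  assumes "subring A" "is_ideal A I" "form I k n F" shows "form I k n (- F)"
  using assms idealD(5)[OF assms(1,2)] by (auto simp: form_def)

lemma form_diff:
  assumes "subring A" "is_ideal A I" "form I k n F" "form I k n G" shows "form I k n (F - G)"
  using form_add[OF assms(1,2,3) form_uminus[OF assms(1,2,4)]] by simp

lemma form_zero: "0 \<in> I \<Longrightarrow> form I k n 0"
  by (simp add: form_def)

lemma form_sum:
  assumes "subring A" "is_ideal A I" "\<And>i. i \<in> K \<Longrightarrow> form I k n (f i)" shows "form I k n (\<Sum>i\<in>K. f i)"
  using assms(3)
  by (induction K rule: infinite_finite_induct)
    (auto intro: form_add[OF assms(1,2)] form_zero idealD[OF assms(1,2)])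

lemma form_mult:
  assumes A: "subring A" and K: "is_ideal A K" and F: "form I k n F" and G: "form J k m G"
    and IJ: "\<And>x y. x \<in> I \<Longrightarrow> y \<in> J \<Longrightarrow> x * y \<in> K"
  shows "form K k (n + m) (F * G)"
  unfolding mult_expand
proof (intro form_sum[OF A K])
  fix \<alpha> \<beta> assume "\<alpha> \<in> supp F" "\<beta> \<in> supp G"
  then show "form K k (n + m) (trm (\<alpha> + \<beta>) (cf F \<alpha> * cf G \<beta>))"
    using F G by (intro form_trm IJ idealD(1)[OF A K])
      (auto simp: form_def mdeg_add supp_add_nat in_keys_iff)
qed

lemma ev_scale: "(\<And>\<alpha>. cf F \<alpha> \<noteq> 0 \<Longrightarrow> mdeg \<alpha> = n) \<Longrightarrow> ev (\<lambda>i. x * y i) F = x ^ n * ev y F"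
proof -
  have m: "mon (\<lambda>i. x * y i) \<alpha> = x ^ mdeg \<alpha> * mon y \<alpha>" for \<alpha>
    by (simp add: mon_def mdeg_def power_mult_distrib prod.distrib power_sum)
  assume "\<And>\<alpha>. cf F \<alpha> \<noteq> 0 \<Longrightarrow> mdeg \<alpha> = n"
  then show ?thesis
    unfolding sbst_def sum_distrib_left
    by (intro sum.cong) (auto simp: m in_keys_iff mult_ac)
qed

text \<open>Compare the largest exponents of coefficients outside \<open>P\<close>.\<close>

lemma gauss:
  fixes F G :: "'a::field mpol"
  assumes A: "subring A" and P: "prime_ideal A P"
    and F: "\<And>\<alpha>. cf F \<alpha> \<in> A" "cf F \<alpha>0 \<notin> P" and G: "\<And>\<alpha>. cf G \<alpha> \<in> A" "cf G \<beta>0 \<notin> P"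
  shows "\<exists>\<gamma>. cf (F * G) \<gamma> \<notin> P"
proof -
  note PI = primeD(1)[OF A P]
  let ?U = "{\<alpha>. cf F \<alpha> \<notin> P}" and ?V = "{\<alpha>. cf G \<alpha> \<notin> P}"
  have sub: "?U \<subseteq> supp F" "?V \<subseteq> supp G" using idealD(1)[OF A PI] by (auto simp: in_keys_iff)
  then have fin: "finite ?U" "finite ?V" using finite_subset finite_keys by blast+
  define a b where "a = Max ?U" and "b = Max ?V"
  have ne: "?U \<noteq> {}" "?V \<noteq> {}" using F(2) G(2) by auto
  have a: "a \<in> ?U" "\<And>\<alpha>. \<alpha> \<in> ?U \<Longrightarrow> \<alpha> \<le> a" using Max_in[OF fin(1) ne(1)] Max_ge[OF fin(1)] by (auto simp: a_def)
  have b: "b \<in> ?V" "\<And>\<alpha>. \<alpha> \<in> ?V \<Longrightarrow> \<alpha> \<le> b" using Max_in[OF fin(2) ne(2)] Max_ge[OF fin(2)] by (auto simp: b_def)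
  let ?t = "\<lambda>p. if fst p + snd p = a + b then cf F (fst p) * cf G (snd p) else 0"
  have "cf (F * G) (a + b) = (\<Sum>p\<in>supp F \<times> supp G. ?t p)"
    unfolding cf_mult by (simp add: sum.cartesian_product split_def)
  also have "\<dots> = ?t (a, b) + (\<Sum>p\<in>supp F \<times> supp G - {(a, b)}. ?t p)"
    using a(1) b(1) sub by (subst sum.remove[of _ "(a, b)"]) auto
  finally have eq: "cf (F * G) (a + b) = cf F a * cf G b + (\<Sum>p\<in>supp F \<times> supp G - {(a, b)}. ?t p)" by simp
  have "?t p \<in> P" if p: "p \<in> supp F \<times> supp G - {(a, b)}" for p
  proof (cases "fst p + snd p = a + b")
    case True
    have "fst p \<notin> ?U \<or> snd p \<notin> ?V"
    proof (rule ccontr)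
      assume "\<not> ?thesis"
      then have le: "fst p \<le> a" "snd p \<le> b" using a b by auto
      moreover have "fst p \<noteq> a \<or> snd p \<noteq> b" using p by auto
      ultimately have "fst p < a \<and> snd p \<le> b \<or> fst p \<le> a \<and> snd p < b" by auto
      then have "fst p + snd p < a + b" by (metis add_less_le_mono add_le_less_mono)
      then show False using True by simp
    qed
    then show ?thesis using True F(1) G(1) idealD(6,7)[OF A PI] by auto
  next
    case False
    then show ?thesis using idealD(1)[OF A PI] by simp
  qed
  then have "(\<Sum>p\<in>supp F \<times> supp G - {(a, b)}. ?t p) \<in> P" by (rule ideal_sum[OF A PI])
  moreover have "cf F a * cf G b \<notin> P" using primeD(3)[OF A P, of "cf F a" "cf G b"] F(1) G(1) a b by auto
  moreover have "u \<notin> P" if "u = v + w" "w \<in> P" "v \<notin> P" for u v w :: 'a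
    using idealD(4)[OF A PI, of u w] that by auto
  ultimately have "cf (F * G) (a + b) \<notin> P" using eq by blast
  then show ?thesis by blast
qed

subsection \<open>Analytic independence of a regular system of parameters\<close>

context reg_params
begin

text \<open>The \<open>n\<close>-th power of the ideal of the first \<open>k\<close> parameters,
  presented by forms; \<open>mpow\<close> confirms this for \<open>k = d\<close>.\<close>

definition FI :: "nat \<Rightarrow> nat \<Rightarrow> 'a set" where "FI k n = {ev y F | F. form A k n F}"

lemma AA: "is_ideal A A" by (rule ideal_self[OF A])

lemma FI_I: "form A k n F \<Longrightarrow> ev y F \<in> FI k n" by (auto simp: FI_def)

lemma mon_in: "supp \<alpha> \<subseteq> {..<d} \<Longrightarrow> mon y \<alpha> \<in> A"
  unfolding mon_def by (rule subring_prod[OF A]) (use subring_power[OF A y_in] in auto)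

lemma ev_in: "k \<le> d \<Longrightarrow> form A k n F \<Longrightarrow> ev y F \<in> A"
  unfolding sbst_def
proof (rule subring_sum[OF A], rule subringD(5)[OF A])
  fix \<alpha> assume *: "k \<le> d" "form A k n F" "\<alpha> \<in> supp F"
  then have "supp \<alpha> \<subseteq> {..<k}" "{..<k} \<subseteq> {..<d}" by (auto simp: form_def in_keys_iff)
  then have "supp \<alpha> \<subseteq> {..<d}" by (rule subset_trans)
  then show "mon y \<alpha> \<in> A" by (rule mon_in)
  show "cf F \<alpha> \<in> A" using * by (simp add: form_def)
qed

lemma FI_mult: "a \<in> FI k n \<Longrightarrow> b \<in> FI k m \<Longrightarrow> a * b \<in> FI k (n + m)"
  using form_mult[OF A AA, of A k n _ A m] subringD(5)[OF A] by (fastforce simp: FI_def ev.sbst_mult[symmetric])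

lemma FI_0: "k \<le> d \<Longrightarrow> FI k 0 = A"
proof
  assume k: "k \<le> d"
  show "FI k 0 \<subseteq> A" using ev_in[OF k] by (auto simp: FI_def)
  show "A \<subseteq> FI k 0"
  proof
    fix a assume "a \<in> A"
    then have "form A k 0 (trm 0 a)" using subringD[OF A] by (intro form_trm) auto
    from FI_I[OF this] show "a \<in> FI k 0" by (simp add: ev.sbst_trm)
  qed
qed

lemma FI_ideal: "k \<le> d \<Longrightarrow> is_ideal A (FI k n)"
  unfolding is_ideal_def
proof (intro conjI ballI)
  assume k: "k \<le> d"
  show "FI k n \<subseteq> A" using ev_in[OF k] by (auto simp: FI_def)
  show "0 \<in> FI k n" using FI_I[OF form_zero[of A]] subringD[OF A] by (metis ev.sbst_0)
  show "x + z \<in> FI k n" if xz: "x \<in> FI k n" "z \<in> FI k n" for x z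
  proof -
    obtain F where "x = ev y F" "form A k n F" using xz unfolding FI_def by blast
    moreover obtain G where "z = ev y G" "form A k n G" using xz unfolding FI_def by blast
    ultimately show ?thesis using FI_I[OF form_add[OF A AA]] by (metis ev.sbst_add)
  qed
  show "a * x \<in> FI k n" if "a \<in> A" "x \<in> FI k n" for a x
    using FI_mult[of a k 0 x n] FI_0[OF k] that by simp
qed

lemma FI_1: "k \<le> d \<Longrightarrow> FI k (Suc 0) = flag A y k"
proof
  assume k: "k \<le> d"
  have yF: "y i \<in> flag A y k" if "i < k" for i
    using gen_ideal_superset[OF A, of "y ` {..<k}"] that by (auto simp: flag_def)
  show "FI k (Suc 0) \<subseteq> flag A y k"
  proof
    fix z assume "z \<in> FI k (Suc 0)"
    then obtain F where F: "z = ev y F" "form A k (Suc 0) F" by (auto simp: FI_def)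
    show "z \<in> flag A y k" unfolding F sbst_def
    proof (rule ideal_sum[OF A flag_ideal[OF k]])
      fix \<alpha> assume "\<alpha> \<in> supp F"
      then have \<alpha>: "mdeg \<alpha> = Suc 0" "supp \<alpha> \<subseteq> {..<k}" "cf F \<alpha> \<in> A" using F by (auto simp: form_def in_keys_iff)
      then have "\<alpha> \<noteq> 0" by auto
      then obtain i where i: "i \<in> supp \<alpha>" by (metis all_not_in_conv keys_eq_empty)
      then have s: "\<alpha> = (\<alpha> - var i) + var i" by (intro expo_split) (simp add: in_keys_iff)
      then have "mdeg (\<alpha> - var i) = 0" using \<alpha>(1) mdeg_add[of "\<alpha> - var i" "var i"] by simp
      then have "\<alpha> = var i" using s by (simp add: mdeg_eq_0)
      then show "cf F \<alpha> * mon y \<alpha> \<in> flag A y k"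
        using idealD(6)[OF A flag_ideal[OF k] \<alpha>(3) yF[of i]] i \<alpha>(2) by auto
    qed
  qed
  show "flag A y k \<subseteq> FI k (Suc 0)" unfolding flag_def
  proof (rule gen_ideal_least[OF A FI_ideal[OF k]])
    show "y ` {..<k} \<subseteq> FI k (Suc 0)"
    proof
      fix z assume "z \<in> y ` {..<k}"
      then obtain i where i: "z = y i" "i < k" by auto
      then have "form A k (Suc 0) (trm (var i) 1)" using subringD[OF A] by (intro form_trm) auto
      from FI_I[OF this] show "z \<in> FI k (Suc 0)" using i by (simp add: ev.sbst_trm)
    qed
  qed
qed

lemma ev_flag_coeffs:
  assumes k: "k \<le> d" and F: "form (flag A y k) k n F" shows "ev y F \<in> FI k (Suc n)"
  unfolding sbst_def
proof (rule ideal_sum[OF A FI_ideal[OF k]])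
  fix \<alpha> assume "\<alpha> \<in> supp F"
  then have \<alpha>: "mdeg \<alpha> = n" "supp \<alpha> \<subseteq> {..<k}" "cf F \<alpha> \<in> flag A y k" using F by (auto simp: form_def in_keys_iff)
  have "form A k n (trm \<alpha> 1)" using \<alpha> subringD[OF A] by (intro form_trm) auto
  from FI_I[OF this] have "mon y \<alpha> \<in> FI k n" by (simp add: ev.sbst_trm)
  then show "cf F \<alpha> * mon y \<alpha> \<in> FI k (Suc n)" using FI_mult[of "cf F \<alpha>" k "Suc 0" _ n] FI_1[OF k] \<alpha> by simp
qed

text \<open>Each monomial of degree \<open>Suc n\<close> gives up one variable, whose value joins
  the coefficient and puts it into the flag ideal. This is the converse of
  \<open>ev_flag_coeffs\<close>.\<close>

lemma FI_Suc_repr: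
  assumes k: "k \<le> d" and z: "z \<in> FI k (Suc n)" obtains F where "form (flag A y k) k n F" "z = ev y F"
proof -
  obtain G where G: "z = ev y G" "form A k (Suc n) G" using z by (auto simp: FI_def)
  have "\<exists>i. i < k \<and> cf \<alpha> i \<noteq> 0" if "\<alpha> \<in> supp G" for \<alpha>
  proof -
    have \<alpha>: "mdeg \<alpha> = Suc n" "supp \<alpha> \<subseteq> {..<k}" using G that by (auto simp: form_def in_keys_iff)
    then have "\<alpha> \<noteq> 0" by auto
    then obtain i where "i \<in> supp \<alpha>" by (metis all_not_in_conv keys_eq_empty)
    then have "i < k \<and> cf \<alpha> i \<noteq> 0" using \<alpha>(2) in_keys_iff[of i \<alpha>] by auto
    then show ?thesis by blast
  qed
  then obtain g where g: "\<And>\<alpha>. \<alpha> \<in> supp G \<Longrightarrow> g \<alpha> < k \<and> cf \<alpha> (g \<alpha>) \<noteq> 0" by metis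
  let ?F = "\<Sum>\<alpha>\<in>supp G. trm (\<alpha> - var (g \<alpha>)) (cf G \<alpha> * y (g \<alpha>))"
  have 1: "form (flag A y k) k n ?F"
  proof (rule form_sum[OF A flag_ideal[OF k]], rule form_trm)
    fix \<alpha> assume a: "\<alpha> \<in> supp G"
    then have \<alpha>: "mdeg \<alpha> = Suc n" "supp \<alpha> \<subseteq> {..<k}" "cf G \<alpha> \<in> A" using G by (auto simp: form_def in_keys_iff)
    have s: "\<alpha> = (\<alpha> - var (g \<alpha>)) + var (g \<alpha>)" using g[OF a] by (intro expo_split) simp
    show "mdeg (\<alpha> - var (g \<alpha>)) = n" using \<alpha>(1) mdeg_add[of "\<alpha> - var (g \<alpha>)" "var (g \<alpha>)"] s by simp
    show "supp (\<alpha> - var (g \<alpha>)) \<subseteq> {..<k}" using \<alpha>(2) supp_add_nat[of "\<alpha> - var (g \<alpha>)" "var (g \<alpha>)"] s by auto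
    have "y (g \<alpha>) \<in> flag A y k" using g[OF a] gen_ideal_superset[OF A, of "y ` {..<k}"] by (auto simp: flag_def)
    then show "cf G \<alpha> * y (g \<alpha>) \<in> flag A y k" using idealD(6)[OF A flag_ideal[OF k] \<alpha>(3)] by auto
    show "0 \<in> flag A y k" by (rule idealD(1)[OF A flag_ideal[OF k]])
  qed
  have "ev y ?F = (\<Sum>\<alpha>\<in>supp G. cf G \<alpha> * mon y \<alpha>)"
    unfolding ev.sbst_sum ev.sbst_trm
  proof (rule sum.cong[OF refl])
    fix \<alpha> assume a: "\<alpha> \<in> supp G"
    have s: "\<alpha> = (\<alpha> - var (g \<alpha>)) + var (g \<alpha>)" using g[OF a] by (intro expo_split) simp
    have "mon y \<alpha> = mon y (\<alpha> - var (g \<alpha>)) * y (g \<alpha>)"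
      using mon_add[of y "\<alpha> - var (g \<alpha>)" "var (g \<alpha>)"] s by simp
    then show "cf G \<alpha> * y (g \<alpha>) * mon y (\<alpha> - var (g \<alpha>)) = cf G \<alpha> * mon y \<alpha>" by (simp add: mult_ac)
  qed
  then have "z = ev y ?F" using G by (simp add: sbst_def)
  then show ?thesis using that 1 by blast
qed

lemma FI_antimono: "k \<le> d \<Longrightarrow> FI k (Suc n) \<subseteq> FI k n"
proof
  fix z assume k: "k \<le> d" and "z \<in> FI k (Suc n)"
  then obtain F where F: "form (flag A y k) k n F" "z = ev y F" by (elim FI_Suc_repr)
  then have "form A k n F" using form_mono[OF F(1), of A k] idealD(2)[OF A flag_ideal[OF k]] by auto
  then show "z \<in> FI k n" using F FI_I by simp
qed

text \<open>Quasi-regularity of the first \<open>k\<close> parameters: the associated graded ring of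
  the ideal they generate is a polynomial ring.\<close>

definition indep :: "nat \<Rightarrow> bool" where
  "indep k \<longleftrightarrow> (\<forall>n F. form A k n F \<longrightarrow> ev y F = 0 \<longrightarrow> form (flag A y k) k n F)"

lemma form_const_mult: "c \<in> A \<Longrightarrow> form A k n F \<Longrightarrow> form A k n (trm 0 c * F)"
proof -
  assume "c \<in> A" "form A k n F"
  moreover have "form A k 0 (trm 0 c)" using \<open>c \<in> A\<close> subringD[OF A] by (intro form_trm) auto
  ultimately show ?thesis using form_mult[OF A AA, of A k 0 "trm 0 c" A n F] subringD(5)[OF A] by simp
qed

text \<open>Induction on \<open>s\<close>. Presenting \<open>a\<close> and \<open>y k * a\<close> by
  forms of degree \<open>s\<close> gives a relation, whose coefficients lie in the flag ideal by
  \<open>indep k\<close>. This ideal is prime and excludes \<open>y k\<close>, so it contains the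
  coefficients of the form for \<open>a\<close>, which raises the degree by one.\<close>

lemma nzd_FI:
  assumes k: "k < d" and I: "indep k" and a: "a \<in> A" "y k * a \<in> FI k s"
  shows "a \<in> FI k s"
  using a(2)
proof (induction s)
  case 0 then show ?case using FI_0[of k] k a by simp
next
  case (Suc s)
  have kd: "k \<le> d" using k by simp
  have "a \<in> FI k s" using Suc FI_antimono[OF kd] by auto
  then obtain F where F: "a = ev y F" "form A k s F" by (auto simp: FI_def)
  obtain H where H: "form (flag A y k) k s H" "y k * a = ev y H" by (rule FI_Suc_repr[OF kd Suc.prems])
  have HA: "form A k s H" using form_mono[OF H(1), of A k] idealD(2)[OF A flag_ideal[OF kd]] by auto
  let ?G = "trm 0 (y k) * F - H"
  have "form A k s ?G" by (intro form_diff[OF A AA] form_const_mult y_in k F HA)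
  moreover have "ev y ?G = 0" using H F by (simp add: ev.sbst_minus ev.sbst_mult ev.sbst_trm)
  ultimately have G: "form (flag A y k) k s ?G" using I by (auto simp: indep_def)
  have "cf F \<alpha> \<in> flag A y k" for \<alpha>
  proof -
    have "y k * cf F \<alpha> = cf ?G \<alpha> + cf H \<alpha>" by (simp add: lookup_minus cf_const_mult)
    moreover have "cf ?G \<alpha> \<in> flag A y k" "cf H \<alpha> \<in> flag A y k" using G H by (auto simp only: form_def)
    ultimately have "y k * cf F \<alpha> \<in> flag A y k" using idealD(3)[OF A flag_ideal[OF kd]] by metis
    moreover have "cf F \<alpha> \<in> A" using F by (auto simp: form_def)
    ultimately show ?thesis using primeD(3)[OF A flag_prime[OF kd] y_in[OF k]] notin_flag[OF k] by blast
  qed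
  then have "form (flag A y k) k s F" using F(2) by (simp add: form_def)
  then show ?case using ev_flag_coeffs[OF kd] F by simp
qed

lemma split_var:
  assumes "form A (Suc k) (Suc n) F"
  obtains G H where "form A k (Suc n) G" "form A (Suc k) n H" "F = G + trm (var k) 1 * H"
proof -
  let ?S = "{\<alpha> \<in> supp F. cf \<alpha> k = 0}" and ?T = "{\<alpha> \<in> supp F. cf \<alpha> k \<noteq> 0}"
  let ?G = "\<Sum>\<alpha>\<in>?S. trm \<alpha> (cf F \<alpha>)" and ?H = "\<Sum>\<alpha>\<in>?T. trm (\<alpha> - var k) (cf F \<alpha>)"
  have zA: "0 \<in> A" by (rule subringD[OF A])
  have al: "mdeg \<alpha> = Suc n" "supp \<alpha> \<subseteq> {..<Suc k}" "cf F \<alpha> \<in> A" if "\<alpha> \<in> supp F" for \<alpha>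
    using assms that by (auto simp: form_def in_keys_iff)
  have 1: "form A k (Suc n) ?G"
  proof (rule form_sum[OF A AA], rule form_trm)
    fix \<alpha> assume a: "\<alpha> \<in> ?S"
    then show "cf F \<alpha> \<in> A" "mdeg \<alpha> = Suc n" using al by auto
    have "k \<notin> supp \<alpha>" using a by (simp add: in_keys_iff)
    then show "supp \<alpha> \<subseteq> {..<k}" using al(2)[of \<alpha>] a by (auto simp: less_Suc_eq)
  qed (rule zA)
  have 2: "form A (Suc k) n ?H"
  proof (rule form_sum[OF A AA], rule form_trm)
    fix \<alpha> assume a: "\<alpha> \<in> ?T"
    then have s: "\<alpha> = (\<alpha> - var k) + var k" by (intro expo_split) simp
    show "cf F \<alpha> \<in> A" using al a by auto
    show "mdeg (\<alpha> - var k) = n" using al(1)[of \<alpha>] a mdeg_add[of "\<alpha> - var k" "var k"] s by simp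
    show "supp (\<alpha> - var k) \<subseteq> {..<Suc k}" using al(2)[of \<alpha>] a supp_add_nat[of "\<alpha> - var k" "var k"] s by auto
  qed (rule zA)
  have "trm (var k) 1 * ?H = (\<Sum>\<alpha>\<in>?T. trm \<alpha> (cf F \<alpha>))"
    unfolding sum_distrib_left mult_single
  proof (rule sum.cong[OF refl])
    fix \<alpha> assume "\<alpha> \<in> ?T"
    then have "\<alpha> = (\<alpha> - var k) + var k" by (intro expo_split) simp
    then have "var k + (\<alpha> - var k) = \<alpha>" by (metis add.commute)
    then show "trm (var k + (\<alpha> - var k)) (1 * cf F \<alpha>) = trm \<alpha> (cf F \<alpha>)" by simp
  qed
  moreover have "F = ?G + (\<Sum>\<alpha>\<in>?T. trm \<alpha> (cf F \<alpha>))"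
  proof -
    have "supp F = ?S \<union> ?T" by auto
    then have "(\<Sum>\<alpha>\<in>supp F. trm \<alpha> (cf F \<alpha>)) = ?G + (\<Sum>\<alpha>\<in>?T. trm \<alpha> (cf F \<alpha>))"
      by (subst sum.union_disjoint[symmetric]) (auto intro: sum.cong)
    then show ?thesis using mpol_expand[of F] by simp
  qed
  ultimately show ?thesis using that[OF 1 2] by simp
qed

text \<open>Split \<open>F = G + U_k H\<close>. The relation puts \<open>y k * ev y H\<close>, hence
  \<open>ev y H\<close>, into the power \<open>Suc n\<close> of the smaller flag ideal. Writing this
  value as a form \<open>h\<close> in the first \<open>k\<close> variables gives a relation between
  these parameters alone, which controls \<open>G\<close>; writing it as a form \<open>h'\<close> of
  degree \<open>n\<close> controls \<open>H\<close> by induction.\<close>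

lemma indep_Suc:
  assumes k: "k < d" and I: "indep k" shows "indep (Suc k)"
proof -
  have kd: "k \<le> d" "Suc k \<le> d" using k by auto
  have fl: "flag A y k \<subseteq> flag A y (Suc k)" "y k \<in> flag A y (Suc k)"
    using flag_Suc[OF k] ideal_add_sup[OF A flag_ideal[OF kd(1)] principal_ideal[OF A y_in[OF k]]]
      principal_self[OF A, of "y k"] by auto
  have "form (flag A y (Suc k)) (Suc k) n F" if "form A (Suc k) n F" "ev y F = 0" for n F
    using that
  proof (induction n arbitrary: F)
    case 0
    have "\<And>\<alpha>. cf F \<alpha> \<noteq> 0 \<Longrightarrow> \<alpha> = 0" using 0(1) mdeg_eq_0 by (auto simp: form_def)
    then have "F = trm 0 (cf F 0)" by (intro poly_mapping_eqI) (auto simp: lookup_single when_def)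
    moreover from this have "cf F 0 = 0" using 0(2) by (metis ev.sbst_trm mon_0 mult.right_neutral)
    ultimately have "F = 0" by simp
    then show ?case using form_zero idealD(1)[OF A flag_ideal[OF kd(2)]] by simp
  next
    case (Suc n)
    obtain G H where GH: "form A k (Suc n) G" "form A (Suc k) n H" "F = G + trm (var k) 1 * H"
      by (rule split_var[OF Suc.prems(1)])
    have HA: "ev y H \<in> A" by (rule ev_in[OF kd(2) GH(2)])
    have e: "ev y G + y k * ev y H = 0" using Suc.prems(2) GH by (simp add: ev.sbst_add ev.sbst_mult ev.sbst_trm)
    then have "y k * ev y H = - ev y G" by (metis add.inverse_unique)
    then have "y k * ev y H = ev y (- G)" using ev.sbst_minus[of y 0 G] by (simp add: ev.sbst_0)
    then have "y k * ev y H \<in> FI k (Suc n)" using FI_I[OF form_uminus[OF A AA GH(1)]] by simp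
    then have HF: "ev y H \<in> FI k (Suc n)" by (rule nzd_FI[OF k I HA])
    then obtain h where h: "ev y H = ev y h" "form A k (Suc n) h" by (auto simp: FI_def)
    have "form A k (Suc n) (G + trm 0 (y k) * h)"
      by (intro form_add[OF A AA] GH form_const_mult y_in k h)
    moreover have "ev y (G + trm 0 (y k) * h) = 0" using e h by (simp add: ev.sbst_add ev.sbst_mult ev.sbst_trm)
    ultimately have Gh: "form (flag A y k) k (Suc n) (G + trm 0 (y k) * h)" using I by (auto simp: indep_def)
    have G': "cf G \<alpha> \<in> flag A y (Suc k)" for \<alpha>
    proof -
      have "cf G \<alpha> = cf (G + trm 0 (y k) * h) \<alpha> - y k * cf h \<alpha>" by (simp add: lookup_add cf_const_mult)
      moreover have "cf (G + trm 0 (y k) * h) \<alpha> \<in> flag A y (Suc k)" using Gh fl by (auto simp only: form_def)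
      moreover have "y k * cf h \<alpha> \<in> flag A y (Suc k)"
        using idealD(7)[OF A flag_ideal[OF kd(2)] fl(2)] h(2) by (auto simp: form_def)
      ultimately show ?thesis using idealD(4)[OF A flag_ideal[OF kd(2)]] by metis
    qed
    then have G'': "form (flag A y (Suc k)) (Suc k) (Suc n) G"
      using GH(1) by (fastforce simp: form_def)
    obtain h' where h': "form (flag A y k) k n h'" "ev y H = ev y h'" by (rule FI_Suc_repr[OF kd(1) HF])
    have h'2: "form (flag A y (Suc k)) (Suc k) n h'" "form A (Suc k) n h'"
      using form_mono[OF h'(1) fl(1), of "Suc k"] form_mono[OF h'(1), of A "Suc k"] idealD(2)[OF A flag_ideal[OF kd(1)]] by auto
    have "form (flag A y (Suc k)) (Suc k) n (H - h')"
      by (rule Suc.IH) (use form_diff[OF A AA GH(2) h'2(2)] h' in \<open>auto simp: ev.sbst_minus\<close>)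
    then have "form (flag A y (Suc k)) (Suc k) n H"
      using form_add[OF A flag_ideal[OF kd(2)], of "Suc k" n "H - h'" h'] h'2 by simp
    moreover have "form A (Suc k) (Suc 0) (trm (var k) 1)" using subringD[OF A] by (intro form_trm) auto
    ultimately have "form (flag A y (Suc k)) (Suc k) (Suc 0 + n) (trm (var k) 1 * H)"
      using form_mult[OF A flag_ideal[OF kd(2)]] idealD(6)[OF A flag_ideal[OF kd(2)]] by blast
    then show ?case using form_add[OF A flag_ideal[OF kd(2)] G''] GH(3) by simp
  qed
  then show ?thesis by (simp add: indep_def)
qed

lemma indep_all: "k \<le> d \<Longrightarrow> indep k"
proof (induction k)
  case 0
  have "form (flag A y 0) 0 n F" if F: "form A 0 n F" "ev y F = 0" for n F
  proof -
    have "\<And>\<alpha>. cf F \<alpha> \<noteq> 0 \<Longrightarrow> \<alpha> = 0" using F(1) by (auto simp: form_def)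
    then have "F = trm 0 (cf F 0)" by (intro poly_mapping_eqI) (auto simp: lookup_single when_def)
    moreover from this have "cf F 0 = 0" using F(2) by (metis ev.sbst_trm mon_0 mult.right_neutral)
    ultimately have "F = 0" by simp
    then show ?thesis by (simp add: form_zero flag_0)
  qed
  then show ?case by (simp add: indep_def)
qed (auto intro: indep_Suc)

abbreviation "mm \<equiv> max_ideal A"

lemma mpow: "ideal_pow A mm n = FI d n"
proof (induction n)
  case 0 then show ?case by (simp add: FI_0)
next
  case (Suc n)
  have F1: "FI d (Suc 0) = mm" using FI_1 gen by simp
  show ?case
  proof
    show "ideal_pow A mm (Suc n) \<subseteq> FI d (Suc n)" unfolding ideal_pow_Suc
      by (rule ideal_mul_least[OF A FI_ideal]) (use FI_mult[of _ d n _ "Suc 0"] Suc F1 in auto)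
    show "FI d (Suc n) \<subseteq> ideal_pow A mm (Suc n)"
    proof
      fix z assume "z \<in> FI d (Suc n)"
      then obtain F where F: "form mm d n F" "z = ev y F" using FI_Suc_repr[of d z n] gen by auto
      show "z \<in> ideal_pow A mm (Suc n)" unfolding F(2) sbst_def
      proof (rule ideal_sum[OF A ideal_pow_ideal[OF A M]])
        fix \<alpha> assume "\<alpha> \<in> supp F"
        then have \<alpha>: "mdeg \<alpha> = n" "supp \<alpha> \<subseteq> {..<d}" "cf F \<alpha> \<in> mm" using F by (auto simp: form_def in_keys_iff)
        have "form A d n (trm \<alpha> 1)" using \<alpha> subringD[OF A] by (intro form_trm) auto
        from FI_I[OF this] have "mon y \<alpha> \<in> ideal_pow A mm n" using Suc by (simp add: ev.sbst_trm)
        then show "cf F \<alpha> * mon y \<alpha> \<in> ideal_pow A mm (Suc n)"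
          using ideal_pow_SucI[OF A _ \<alpha>(3)] by (metis mult.commute)
      qed
    qed
  qed
qed

text \<open>Coefficient version of the statement that the graded ring of the maximal ideal is a
  polynomial ring over the residue field.\<close>

lemma initial_form:
  assumes F: "form A d n F" "ev y F \<in> ideal_pow A mm (Suc n)" shows "form mm d n F"
proof -
  obtain H where H: "form mm d n H" "ev y F = ev y H"
    using FI_Suc_repr[of d "ev y F" n] F(2) gen mpow by auto
  have HA: "form A d n H" using form_mono[OF H(1), of A d] idealD(2)[OF A M] by auto
  have "form (flag A y d) d n (F - H)"
    using indep_all[of d] form_diff[OF A AA F(1) HA] H by (auto simp: indep_def ev.sbst_minus)
  then show ?thesis using form_add[OF A M, of d n "F - H" H] H gen by simp
qed

lemma pow_repr: "z \<in> ideal_pow A mm n \<Longrightarrow> \<exists>F. form A d n F \<and> z = ev y F"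
  by (auto simp: mpow FI_def)

text \<open>Forms presenting \<open>a\<close> and \<open>b\<close> each have a unit coefficient; by
  \<open>gauss\<close> modulo the maximal ideal so does their product. This makes the order
  additive.\<close>

lemma pow_mult_notin:
  assumes a: "a \<in> ideal_pow A mm n" "a \<notin> ideal_pow A mm (Suc n)"
    and b: "b \<in> ideal_pow A mm k" "b \<notin> ideal_pow A mm (Suc k)"
  shows "a * b \<notin> ideal_pow A mm (Suc (n + k))"
proof
  assume ab: "a * b \<in> ideal_pow A mm (Suc (n + k))"
  obtain F where F: "form A d n F" "a = ev y F" using pow_repr a by blast
  obtain G where G: "form A d k G" "b = ev y G" using pow_repr b by blast
  have FG: "form A d (n + k) (F * G)" using form_mult[OF A AA F(1) G(1)] subringD(5)[OF A] by blast
  have "form mm d (n + k) (F * G)" using initial_form[OF FG] ab F G by (simp add: ev.sbst_mult)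
  then have no: "\<And>\<gamma>. cf (F * G) \<gamma> \<in> mm" by (simp add: form_def)
  have "\<not> form mm d n F" using ev_flag_coeffs[of d n F] gen F a mpow by auto
  then obtain \<alpha> where "cf F \<alpha> \<notin> mm" using F(1) by (auto simp: form_def)
  moreover have "\<not> form mm d k G" using ev_flag_coeffs[of d k G] gen G b mpow by auto
  then obtain \<beta> where "cf G \<beta> \<notin> mm" using G(1) by (auto simp: form_def)
  ultimately show False using gauss[OF A max_ideal_prime[OF local], of F \<alpha> G \<beta>] F(1) G(1) no by (auto simp: form_def)
qed

end

subsection \<open>The order function\<close>

lemma pow_bound:
  assumes L: "local_ring A" and N: "noetherian A" and a: "a \<noteq> 0"
  shows "\<exists>n. a \<notin> ideal_pow A (max_ideal A) n"
proof (rule ccontr)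
  assume no: "\<not> ?thesis"
  have A: "subring A" using L by (simp add: local_ring_def)
  have "a \<in> {0}"
    by (rule krull_intersection[OF L N ideal_zero[OF A]]) (use no in \<open>auto simp: ideal_add_def\<close>)
  then show False using a by simp
qed

text \<open>The \<open>GREATEST\<close> in the definition of \<open>ord\<close> is attained because
  Krull's intersection theorem bounds the exponents.\<close>

lemma ord_iff:
  assumes L: "local_ring A" and N: "noetherian A" and a: "a \<in> A" "a \<noteq> 0"
  shows "n \<le> ord A a \<longleftrightarrow> a \<in> ideal_pow A (max_ideal A) n"
proof -
  have A: "subring A" and M: "is_ideal A (max_ideal A)" using L by (auto simp: local_ring_def)
  obtain b where b: "a \<notin> ideal_pow A (max_ideal A) b" using pow_bound[OF L N a(2)] by blast
  have bd: "k \<le> b" if "a \<in> ideal_pow A (max_ideal A) k" for k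
    using ideal_pow_antimono[OF A M, of b k] b that by (metis nat_le_linear subsetD)
  have o: "a \<in> ideal_pow A (max_ideal A) (ord A a)"
    unfolding ord_def by (rule GreatestI_nat[where k = 0 and b = b]) (use a bd in auto)
  show ?thesis
  proof
    assume "n \<le> ord A a" then show "a \<in> ideal_pow A (max_ideal A) n"
      using ideal_pow_antimono[OF A M] o by blast
  next
    assume "a \<in> ideal_pow A (max_ideal A) n" then show "n \<le> ord A a"
      unfolding ord_def by (rule Greatest_le_nat[where b = b]) (use bd in auto)
  qed
qed

subsection \<open>Local quadratic transforms\<close>

lemma var_neq_0: "var i \<noteq> 0"
  using mdeg_var[of i] by force

lemma cf_mult_0: "cf (F * G) 0 = cf F 0 * cf (G :: 'b::comm_semiring_1 mpol) 0"
proof -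
  have z: "\<alpha> + \<beta> = 0 \<longleftrightarrow> \<alpha> = 0 \<and> \<beta> = 0" for \<alpha> \<beta> :: expo
    using mdeg_add[of \<alpha> \<beta>] mdeg_eq_0 by (metis add_is_0 add_0)
  have "cf (F * G) 0 = (\<Sum>\<alpha>\<in>supp F. \<Sum>\<beta>\<in>supp G. if \<alpha> = 0 then (if \<beta> = 0 then cf F \<alpha> * cf G \<beta> else 0) else 0)"
    unfolding cf_mult z by (intro sum.cong) auto
  also have "\<dots> = (\<Sum>\<alpha>\<in>supp F. if \<alpha> = 0 then cf F \<alpha> * cf G 0 else 0)"
    by (intro sum.cong) (auto simp: in_keys_iff)
  also have "\<dots> = cf F 0 * cf G 0" by (simp add: in_keys_iff)
  finally show ?thesis .
qed

lemma cf_power_0: "cf (F ^ n) 0 = cf (F :: 'b::comm_semiring_1 mpol) 0 ^ n"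
  by (induction n) (auto simp: cf_mult_0 lookup_one)

lemma cf_prod_0: "cf (\<Prod>i\<in>I. f i) 0 = (\<Prod>i\<in>I. cf (f i :: 'b::comm_semiring_1 mpol) 0)"
  by (induction I rule: infinite_finite_induct) (auto simp: cf_mult_0 lookup_one)

lemma cf_mult_ideal:
  fixes F G :: "'a::field mpol"
  assumes B: "subring B" and J: "is_ideal B J"
    and m: "\<And>\<alpha> \<beta>. \<alpha> + \<beta> = \<gamma> \<Longrightarrow> cf F \<alpha> * cf G \<beta> \<in> J"
  shows "cf (F * G) \<gamma> \<in> J"
  unfolding cf_mult using m idealD(1)[OF B J] by (auto intro!: ideal_sum[OF B J])

lemma cf_mult_ring:
  fixes F G :: "'a::field mpol"
  assumes B: "subring B" and F: "\<And>\<alpha>. cf F \<alpha> \<in> B" and G: "\<And>\<alpha>. cf G \<alpha> \<in> B"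
  shows "cf (F * G) \<gamma> \<in> B"
  using cf_mult_ideal[OF B ideal_self[OF B]] F G subringD(5)[OF B] by blast

lemma cf_one_ring: "subring B \<Longrightarrow> cf (1 :: 'a::field mpol) \<gamma> \<in> B"
  by (simp add: lookup_one when_def subringD)

lemma cf_mon_ring:
  fixes \<tau> :: "nat \<Rightarrow> 'a::field mpol"
  assumes B: "subring B" and \<tau>: "\<And>i \<gamma>. i \<in> supp \<alpha> \<Longrightarrow> cf (\<tau> i) \<gamma> \<in> B"
  shows "cf (mon \<tau> \<alpha>) \<gamma> \<in> B"
proof -
  have pw: "cf (F ^ n) \<gamma> \<in> B" if "\<And>\<gamma>. cf F \<gamma> \<in> B" for F :: "'a mpol" and n \<gamma>
    by (induction n arbitrary: \<gamma>) (use that in \<open>auto intro!: cf_mult_ring[OF B] simp: cf_one_ring[OF B]\<close>)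
  have "cf (\<Prod>i\<in>I. \<tau> i ^ cf \<alpha> i) \<gamma> \<in> B" if "I \<subseteq> supp \<alpha>" for I \<gamma>
    using that
  proof (induction I arbitrary: \<gamma> rule: infinite_finite_induct)
    case (insert i I)
    then show ?case using pw \<tau> by (auto intro!: cf_mult_ring[OF B])
  qed (use cf_one_ring[OF B] in auto)
  then show ?thesis by (simp add: mon_def)
qed

text \<open>The monomial \<open>\<alpha>\<close> plus terms of smaller total degree, as it arises
  from expanding a monomial in the \<open>t i + U_i\<close>. The notion is multiplicative, so no
  binomial coefficients have to be computed.\<close>

definition top_form :: "nat \<Rightarrow> expo \<Rightarrow> 'b::comm_ring_1 mpol \<Rightarrow> bool" where
  "top_form n \<alpha> F \<longleftrightarrow> mdeg \<alpha> = n \<and> (\<forall>\<gamma>. n \<le> mdeg \<gamma> \<longrightarrow> cf F \<gamma> = (if \<gamma> = \<alpha> then 1 else 0))"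

lemma top_form_mult:
  assumes F: "top_form n \<alpha> F" and G: "top_form k \<beta> G" shows "top_form (n + k) (\<alpha> + \<beta>) (F * G)"
  unfolding top_form_def
proof (intro conjI allI impI)
  show "mdeg (\<alpha> + \<beta>) = n + k" using F G by (simp add: top_form_def mdeg_add)
  fix \<gamma> assume \<gamma>: "n + k \<le> mdeg \<gamma>"
  have sup: "\<alpha> \<in> supp F \<or> (1::'a) = 0" "\<beta> \<in> supp G \<or> (1::'a) = 0"
    using F G by (auto simp: top_form_def in_keys_iff)
  have "(\<Sum>b\<in>supp G. if a + b = \<gamma> then cf F a * cf G b else 0)
      = (if a = \<alpha> then (\<Sum>b\<in>supp G. if b = \<beta> then (if \<gamma> = \<alpha> + \<beta> then 1 else 0) else 0) else 0)" if a: "a \<in> supp F" for a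
  proof -
    have t: "(if a + b = \<gamma> then cf F a * cf G b else 0) = (if a = \<alpha> \<and> b = \<beta> then (if \<gamma> = \<alpha> + \<beta> then 1 else 0) else 0)"
      if b: "b \<in> supp G" for b
    proof (cases "a + b = \<gamma>")
      case True
      have "mdeg a \<le> n" using F a by (auto simp: top_form_def in_keys_iff) (metis nat_le_linear)
      moreover have "mdeg b \<le> k" using G b by (auto simp: top_form_def in_keys_iff) (metis nat_le_linear)
      moreover have "n + k \<le> mdeg a + mdeg b" using \<gamma> True mdeg_add by metis
      ultimately have "mdeg a = n" "mdeg b = k" by auto
      then have "cf F a = (if a = \<alpha> then 1 else 0)" "cf G b = (if b = \<beta> then 1 else 0)"
        using F G by (auto simp: top_form_def)
      then show ?thesis using True by auto
    qed auto
    show ?thesis using t by (cases "a = \<alpha>") (auto intro!: sum.cong sum.neutral)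
  qed
  then have "cf (F * G) \<gamma> = (\<Sum>a\<in>supp F. if a = \<alpha> then (\<Sum>b\<in>supp G. if b = \<beta> then (if \<gamma> = \<alpha> + \<beta> then 1 else 0) else 0) else 0)"
    unfolding cf_mult by (intro sum.cong) auto
  also have "\<dots> = (if \<gamma> = \<alpha> + \<beta> then 1 else 0)" using sup by auto
  finally show "cf (F * G) \<gamma> = (if \<gamma> = \<alpha> + \<beta> then 1 else 0)" .
qed

lemma top_form_one: "top_form 0 0 1"
  by (auto simp: top_form_def lookup_one when_def)

lemma top_form_mon:
  assumes \<tau>: "\<And>i. top_form 1 (var i) (\<tau> i)" shows "top_form (mdeg \<alpha>) \<alpha> (mon \<tau> \<alpha>)"
proof -
  have pw: "top_form n (trm i n) (\<tau> i ^ n)" for i n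
  proof (induction n)
    case (Suc n)
    have "trm i (Suc n) = var i + trm i n" by (simp add: single_add[symmetric])
    then show ?case using top_form_mult[OF \<tau>[of i] Suc] by simp
  qed (simp add: top_form_one)
  have "top_form (\<Sum>i\<in>I. cf \<alpha> i) (\<Sum>i\<in>I. trm i (cf \<alpha> i)) (\<Prod>i\<in>I. \<tau> i ^ cf \<alpha> i)" if "finite I" for I
    using that
  proof (induction I)
    case (insert i I)
    then show ?case using top_form_mult[OF pw insert.IH] by simp
  qed (simp add: top_form_one)
  moreover have "(\<Sum>i\<in>supp \<alpha>. trm i (cf \<alpha> i)) = \<alpha>"
    by (rule poly_mapping_eqI) (simp add: lookup_sum lookup_single when_def in_keys_iff)
  ultimately show ?thesis unfolding mdeg_def mon_def by (metis finite_keys)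
qed

interpretation const: coeff_hom "trm 0 :: 'b::comm_ring_1 \<Rightarrow> 'b mpol"
  by unfold_locales (auto simp: single_add mult_single)

lemma ring_adjoin_subring: "subring (ring_adjoin A I x)"
  unfolding ring_adjoin_def by (fastforce simp: subring_def)

text \<open>Since \<open>x\<close> is the parameter of index 0, the ratios
  \<open>t i = y i / x\<close> satisfy \<open>t 0 = 1\<close>, and the values of forms at
  \<open>t\<close> make up the ring \<open>B\<close>.\<close>

locale lqt_step = reg_params +
  fixes x :: 'a and Q :: "'a set"
  assumes d0: "0 < d" and y0: "y 0 = x" and x2: "x \<notin> ideal_pow A (max_ideal A) 2"
    and Q: "prime_ideal (ring_adjoin A (max_ideal A) x) Q" and mQ: "max_ideal A \<subseteq> Q"
begin

abbreviation "B \<equiv> ring_adjoin A mm x"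
abbreviation "A' \<equiv> localize B Q"

lemma xm: "x \<in> mm" using y_max[OF d0] y0 by simp
lemma x0: "x \<noteq> 0" using x2 idealD(1)[OF A ideal_pow_ideal[OF A M]] by auto
lemma Bsub: "subring B" by (rule ring_adjoin_subring)
lemmas BD = subringD[OF Bsub]
lemmas QI = primeD(1)[OF Bsub Q]
lemmas QD = idealD[OF Bsub QI]
lemmas Qprime = primeD(3)[OF Bsub Q]
lemmas IP = ideal_pow_ideal[OF A M]

lemma AB: "A \<subseteq> B" by (auto simp: ring_adjoin_def)

lemma pow_div_in_B: "a \<in> ideal_pow A mm n \<Longrightarrow> a / x ^ n \<in> B"
proof (induction n arbitrary: a)
  case 0 then show ?case using AB by auto
next
  case (Suc n)
  let ?K = "{a \<in> A. a / x ^ Suc n \<in> B}"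
  have K: "is_ideal A ?K"
    unfolding is_ideal_def
  proof (intro conjI ballI)
    fix r a assume "r \<in> A" "a \<in> ?K"
    then show "r * a \<in> ?K" using BD(5)[of r "a / x ^ Suc n"] AB subringD(5)[OF A] by auto
  qed (use BD(1,3) subringD[OF A] in \<open>auto simp: add_divide_distrib\<close>)
  have mB: "b / x \<in> B" if "b \<in> mm" for b using that by (auto simp: ring_adjoin_def)
  have "ideal_mul A (ideal_pow A mm n) mm \<subseteq> ?K"
  proof (rule ideal_mul_least[OF A K])
    fix a b assume ab: "a \<in> ideal_pow A mm n" "b \<in> mm"
    have "(a / x ^ n) * (b / x) \<in> B" by (rule BD(5)[OF Suc.IH[OF ab(1)] mB[OF ab(2)]])
    moreover have "a * b \<in> A" using subringD(5)[OF A idealD(2)[OF A IP ab(1)] idealD(2)[OF A M ab(2)]] .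
    ultimately show "a * b \<in> ?K" by (simp add: mult.commute)
  qed
  then show ?case using Suc.prems by (auto simp: ideal_pow_Suc)
qed

lemma x_pow: "x ^ n \<in> ideal_pow A mm n" using ideal_pow_power[OF A xm] .

text \<open>The fractions \<open>a / x ^ k\<close> with \<open>a\<close> in the \<open>k\<close>-th
  power of the maximal ideal already form a ring.\<close>

lemma B_repr: "b \<in> B \<Longrightarrow> \<exists>k. \<exists>a\<in>ideal_pow A mm k. b = a / x ^ k"
proof -
  let ?C = "{b. \<exists>k. \<exists>a\<in>ideal_pow A mm k. b = a / x ^ k}"
  have shift: "a * x ^ l \<in> ideal_pow A mm (k + l)" if "a \<in> ideal_pow A mm k" for a k l
    by (rule ideal_pow_mult[OF A M that x_pow])
  have "subring ?C"
    unfolding subring_def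
  proof (intro conjI ballI)
    show "0 \<in> ?C" using idealD(1)[OF A IP] by force
    show "1 \<in> ?C" using subringD[OF A] by (auto intro!: exI[of _ 0] bexI[of _ 1])
    fix b c assume "b \<in> ?C" "c \<in> ?C"
    then obtain k a l a' where *: "a \<in> ideal_pow A mm k" "b = a / x ^ k" "a' \<in> ideal_pow A mm l" "c = a' / x ^ l" by auto
    have s: "a * x ^ l \<in> ideal_pow A mm (k + l)" "a' * x ^ k \<in> ideal_pow A mm (k + l)"
      using shift[OF *(1), of l] shift[OF *(3), of k] by (auto simp: add.commute)
    have "b + c = (a * x ^ l + a' * x ^ k) / x ^ (k + l)" "b - c = (a * x ^ l - a' * x ^ k) / x ^ (k + l)"
      using * x0 by (auto simp: field_simps power_add)
    then show "b + c \<in> ?C" "b - c \<in> ?C" using idealD(3,4)[OF A IP s] by blast+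
    have "b * c = (a * a') / x ^ (k + l)" using * by (simp add: power_add)
    then show "b * c \<in> ?C" using ideal_pow_mult[OF A M *(1,3)] by blast
  qed
  moreover have "A \<subseteq> ?C"
  proof
    fix a assume "a \<in> A"
    then have "a \<in> ideal_pow A mm 0 \<and> a = a / x ^ 0" by simp
    then show "a \<in> ?C" by blast
  qed
  moreover have "\<forall>a\<in>mm. a / x \<in> ?C"
  proof
    fix a assume "a \<in> mm"
    then have "a \<in> ideal_pow A mm (Suc 0) \<and> a / x = a / x ^ Suc 0" using ideal_pow_1[OF A M] by simp
    then show "a / x \<in> ?C" by blast
  qed
  ultimately have "B \<subseteq> ?C" unfolding ring_adjoin_def by blast
  then show "b \<in> B \<Longrightarrow> ?thesis" by blast
qed

lemma xB_Q: "b \<in> B \<Longrightarrow> x * b \<in> Q" using QD(7) xm mQ by auto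

definition t where "t i = y i / x"

lemma y_t: "y = (\<lambda>i. x * t i)" using x0 by (auto simp: t_def)
lemma t0: "t 0 = 1" using x0 y0 by (simp add: t_def)

lemma t_B: "i < d \<Longrightarrow> t i \<in> B"
  using pow_div_in_B[of "y i" 1] y_max ideal_pow_1[OF A M] by (simp add: t_def)

lemma ev_y_t: "form A d n F \<Longrightarrow> ev y F = x ^ n * ev t F"
  by (subst y_t, rule ev_scale) (auto simp: form_def)

lemma B_form: "b \<in> B \<Longrightarrow> \<exists>n F. form A d n F \<and> b = ev t F"
proof -
  assume "b \<in> B"
  then obtain k a where a: "a \<in> ideal_pow A mm k" "b = a / x ^ k" using B_repr by blast
  obtain F where "form A d k F" "a = ev y F" using pow_repr[OF a(1)] by blast
  then show ?thesis using a(2) ev_y_t x0 by fastforce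
qed

text \<open>Multiplication by \<open>x ^ n\<close> turns a homogeneous relation between the
  \<open>t i\<close> into one between the parameters. As the maximal ideal lies in \<open>Q\<close>,
  the Taylor coefficients modulo \<open>Q\<close> of a form of given degree thus depend only on its
  value at \<open>t\<close>.\<close>

lemma ev_t_zero:
  assumes F: "form A d n F" "ev t F = 0" shows "form mm d n F"
proof (rule initial_form[OF F(1)])
  show "ev y F \<in> ideal_pow A mm (Suc n)" using ev_y_t[OF F(1)] F(2) idealD(1)[OF A IP] by simp
qed

text \<open>\<open>tay F\<close> is the Taylor expansion \<open>F(t + U)\<close>, a polynomial in \<open>U\<close> whose coefficients are the
  Hasse derivatives of \<open>F\<close> at \<open>t\<close>. Membership in the \<open>n\<close>-th power of \<open>Q\<close> forces those of degree
  below \<open>n\<close> into \<open>Q\<close>, whereas those of top degree are coefficients of \<open>F\<close>.\<close>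

definition tay :: "'a mpol \<Rightarrow> 'a mpol" where
  "tay F = sbst (trm 0) (\<lambda>i. trm 0 (t i) + trm (var i) 1) F"

lemma tay_mult: "tay (F * G) = tay F * tay G" by (simp add: tay_def const.sbst_mult)
lemma tay_add: "tay (F + G) = tay F + tay G" by (simp add: tay_def const.sbst_add)
lemma tay_minus: "tay (F - G) = tay F - tay G" by (simp add: tay_def const.sbst_minus)

lemma cf_tay: "cf (tay F) \<gamma> = (\<Sum>\<alpha>\<in>supp F. cf F \<alpha> * cf (mon (\<lambda>i. trm 0 (t i) + trm (var i) 1) \<alpha>) \<gamma>)"
  by (simp add: tay_def sbst_def lookup_sum cf_const_mult)

lemma tay_0: "cf (tay F) 0 = ev t F"
proof -
  have "cf (mon (\<lambda>i. trm 0 (t i) + trm (var i) 1) \<alpha>) 0 = mon t \<alpha>" for \<alpha>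
  proof -
    have "cf (trm (var i) (1::'a)) 0 = 0" for i by (simp add: lookup_single when_def var_neq_0)
    then show ?thesis by (simp add: mon_def cf_prod_0 cf_power_0 lookup_add)
  qed
  then show ?thesis by (simp add: cf_tay sbst_def)
qed

lemma tay_ideal:
  assumes J: "is_ideal B J" and F: "form I d n F" "I \<subseteq> J" shows "cf (tay F) \<gamma> \<in> J"
  unfolding cf_tay
proof (rule ideal_sum[OF Bsub J], rule idealD(7)[OF Bsub J])
  fix \<alpha> assume \<alpha>: "\<alpha> \<in> supp F"
  show "cf F \<alpha> \<in> J" using F by (auto simp: form_def)
  have sd: "supp \<alpha> \<subseteq> {..<d}" using F \<alpha> by (auto simp: form_def in_keys_iff)
  show "cf (mon (\<lambda>i. trm 0 (t i) + trm (var i) 1) \<alpha>) \<gamma> \<in> B"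
    using sd t_B BD(1,2) by (intro cf_mon_ring[OF Bsub]) (auto simp: lookup_add lookup_single when_def intro!: BD(3))
qed

lemma tay_B: "form A d n F \<Longrightarrow> cf (tay F) \<gamma> \<in> B"
  using tay_ideal[OF ideal_self[OF Bsub]] AB by blast

lemma tay_top:
  assumes F: "form A d n F" and \<gamma>: "mdeg \<gamma> = n" shows "cf (tay F) \<gamma> = cf F \<gamma>"
proof -
  have "top_form 1 (var i) (trm 0 (t i) + trm (var i) 1)" for i
    by (auto simp: top_form_def lookup_add lookup_single when_def var_neq_0)
  then have "top_form (mdeg \<alpha>) \<alpha> (mon (\<lambda>i. trm 0 (t i) + trm (var i) 1) \<alpha>)" for \<alpha>
    by (rule top_form_mon)
  then have "cf (mon (\<lambda>i. trm 0 (t i) + trm (var i) 1) \<alpha>) \<gamma> = (if \<gamma> = \<alpha> then 1 else 0)" if "\<alpha> \<in> supp F" for \<alpha>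
    using that F \<gamma> by (auto simp: top_form_def form_def in_keys_iff)
  then have "cf (tay F) \<gamma> = (\<Sum>\<alpha>\<in>supp F. if \<gamma> = \<alpha> then cf F \<alpha> else 0)"
    unfolding cf_tay by (intro sum.cong) auto
  then show ?thesis by (simp add: in_keys_iff)
qed

definition vanish :: "nat \<Rightarrow> 'a mpol \<Rightarrow> bool" where
  "vanish n F \<longleftrightarrow> (\<forall>\<gamma>. mdeg \<gamma> < n \<longrightarrow> cf (tay F) \<gamma> \<in> Q)"

lemma vanish_mult:
  assumes "form A d k F" "form A d l G" "vanish n F" "vanish m G" "m \<le> 1"
  shows "vanish (n + m) (F * G)"
  unfolding vanish_def tay_mult
proof (intro allI impI cf_mult_ideal[OF Bsub QI])
  fix \<gamma> \<alpha> \<beta> assume \<gamma>: "mdeg \<gamma> < n + m" and s: "\<alpha> + \<beta> = \<gamma>"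
  note FB = tay_B[OF assms(1)] and GB = tay_B[OF assms(2)]
  show "cf (tay F) \<alpha> * cf (tay G) \<beta> \<in> Q"
  proof (cases "mdeg \<alpha> < n")
    case True
    then show ?thesis using assms(3) QD(7) GB by (auto simp: vanish_def)
  next
    case False
    then have "mdeg \<beta> < m" using \<gamma> s mdeg_add[of \<alpha> \<beta>] by auto
    then show ?thesis using assms(4) QD(6) FB by (auto simp: vanish_def)
  qed
qed

lemma vanish_add: "vanish n F \<Longrightarrow> vanish n G \<Longrightarrow> vanish n (F + G)"
  by (auto simp: vanish_def tay_add lookup_add QD)

lemma vanish_0 [simp]: "vanish 0 F" by (simp add: vanish_def)
lemma vanish_1: "ev t F \<in> Q \<Longrightarrow> vanish 1 F" by (auto simp: vanish_def mdeg_eq_0 tay_0)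

text \<open>Only some representation of the fraction has to vanish to order \<open>n\<close>. The
  powers of the maximal ideal of \<open>A'\<close> are contained in these ideals
  (\<open>pow_LQ\<close>), and this inclusion is what bounds orders from above.\<close>

definition LQ :: "nat \<Rightarrow> 'a set" where
  "LQ n = {ev t F / ev t G | F G. \<exists>k. form A d k F \<and> form A d k G \<and> vanish n F \<and> ev t G \<notin> Q}"

lemma LQ_I: "form A d k F \<Longrightarrow> form A d k G \<Longrightarrow> vanish n F \<Longrightarrow> ev t G \<notin> Q \<Longrightarrow> ev t F / ev t G \<in> LQ n"
  unfolding LQ_def by blast

lemma LQ_E:
  assumes "z \<in> LQ n"
  obtains k F G where "form A d k F" "form A d k G" "vanish n F" "ev t G \<notin> Q" "z = ev t F / ev t G"
  using assms unfolding LQ_def by blast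

lemma form_prod: "form A d k F \<Longrightarrow> form A d l G \<Longrightarrow> form A d (k + l) (F * G)"
  using form_mult[OF A AA] subringD(5)[OF A] by blast

lemma ev_t_B: "form A d k F \<Longrightarrow> ev t F \<in> B"
  using tay_B[of k F 0] tay_0 by simp

lemma ev_t_mult_notin: "form A d k F \<Longrightarrow> form A d l G \<Longrightarrow> ev t F \<notin> Q \<Longrightarrow> ev t G \<notin> Q \<Longrightarrow> ev t (F * G) \<notin> Q"
  using Qprime[of "ev t F" "ev t G"] ev_t_B by (auto simp: ev.sbst_mult)

lemma notinQ_nonzero: "z \<notin> Q \<Longrightarrow> z \<noteq> 0" using QD(1) by auto

lemma LQ_mult: "z \<in> LQ n \<Longrightarrow> w \<in> LQ m \<Longrightarrow> m \<le> 1 \<Longrightarrow> z * w \<in> LQ (n + m)"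
proof -
  assume z: "z \<in> LQ n" and w: "w \<in> LQ m" and m: "m \<le> 1"
  obtain k F G where 1: "form A d k F" "form A d k G" "vanish n F" "ev t G \<notin> Q" "z = ev t F / ev t G"
    using z by (rule LQ_E)
  obtain l F' G' where 2: "form A d l F'" "form A d l G'" "vanish m F'" "ev t G' \<notin> Q" "w = ev t F' / ev t G'"
    using w by (rule LQ_E)
  have "ev t (F * F') / ev t (G * G') \<in> LQ (n + m)"
    by (rule LQ_I[OF form_prod[OF 1(1) 2(1)] form_prod[OF 1(2) 2(2)] vanish_mult[OF 1(1) 2(1) 1(3) 2(3) m]
          ev_t_mult_notin[OF 1(2) 2(2) 1(4) 2(4)]])
  then show ?thesis using 1 2 by (simp add: ev.sbst_mult)
qed

lemma LQ_add: "z \<in> LQ n \<Longrightarrow> w \<in> LQ n \<Longrightarrow> z + w \<in> LQ n"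
proof -
  assume z: "z \<in> LQ n" and w: "w \<in> LQ n"
  obtain k F G where 1: "form A d k F" "form A d k G" "vanish n F" "ev t G \<notin> Q" "z = ev t F / ev t G"
    using z by (rule LQ_E)
  obtain l F' G' where 2: "form A d l F'" "form A d l G'" "vanish n F'" "ev t G' \<notin> Q" "w = ev t F' / ev t G'"
    using w by (rule LQ_E)
  have v: "vanish n (F * G')" "vanish n (F' * G)"
    using vanish_mult[OF 1(1) 2(2) 1(3), of 0] vanish_mult[OF 2(1) 1(2) 2(3), of 0] by auto
  have "form A d (k + l) (F * G' + F' * G)"
    using form_add[OF A AA form_prod[OF 1(1) 2(2)]] form_prod[OF 2(1) 1(2)] by (simp add: add.commute)
  then have "ev t (F * G' + F' * G) / ev t (G * G') \<in> LQ n"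
    by (rule LQ_I[OF _ form_prod[OF 1(2) 2(2)] vanish_add[OF v] ev_t_mult_notin[OF 1(2) 2(2) 1(4) 2(4)]])
  moreover have "z + w = ev t (F * G' + F' * G) / ev t (G * G')"
    using notinQ_nonzero[OF 1(4)] notinQ_nonzero[OF 2(4)]
    unfolding 1(5) 2(5) ev.sbst_mult ev.sbst_add by (simp add: field_simps)
  ultimately show ?thesis by simp
qed

text \<open>The form \<open>U_0^k\<close>. Because \<open>t 0 = 1\<close>, multiplying by it raises
  the degree without changing the value, which brings forms to a common degree.\<close>

definition xp :: "nat \<Rightarrow> 'a mpol" where "xp k = trm (trm 0 k) 1"

lemma xp: "form A d k (xp k)" "ev t (xp k) = 1"
proof -
  have "mdeg (trm 0 k) = k" by (cases "k = 0") (auto simp: mdeg_def)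
  then show "form A d k (xp k)" unfolding xp_def
    using subringD[OF A] d0 by (intro form_trm) auto
  have "mon t (trm 0 k) = 1" using t0 by (cases "k = 0") (auto simp: mon_def)
  then show "ev t (xp k) = 1" by (simp add: xp_def ev.sbst_trm)
qed

lemma LQ_of_B: "a \<in> B \<Longrightarrow> b \<in> B \<Longrightarrow> b \<notin> Q \<Longrightarrow> a / b \<in> LQ 0 \<and> (a \<in> Q \<longrightarrow> a / b \<in> LQ 1)"
proof -
  assume ab: "a \<in> B" "b \<in> B" "b \<notin> Q"
  obtain k F where F: "form A d k F" "a = ev t F" using B_form[OF ab(1)] by blast
  obtain l G where G: "form A d l G" "b = ev t G" using B_form[OF ab(2)] by blast
  have 1: "form A d (k + l) (F * xp l)" "form A d (k + l) (xp k * G)"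
    using form_prod[OF F(1) xp(1)] form_prod[OF xp(1) G(1)] by auto
  have 2: "ev t (F * xp l) = a" "ev t (xp k * G) = b" using F G xp by (auto simp: ev.sbst_mult)
  show ?thesis
    using LQ_I[OF 1, of 0] LQ_I[OF 1, of 1] vanish_1[of "F * xp l"] 2 ab by auto
qed

lemma A'_eq: "A' = LQ 0"
proof
  show "A' \<subseteq> LQ 0" using LQ_of_B by (auto simp: localize_def)
  show "LQ 0 \<subseteq> A'" using ev_t_B by (fastforce elim: LQ_E simp: localize_def)
qed

lemma LQ_sub: "LQ n \<subseteq> LQ 0"
  by (auto simp: LQ_def)

lemma LQ_ideal: "is_ideal A' (LQ n)"
  unfolding is_ideal_def
proof (intro conjI ballI)
  show "LQ n \<subseteq> A'" using LQ_sub A'_eq by simp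
  have "ev t (0 * xp 0) / ev t (xp 0) \<in> LQ n"
  proof (rule LQ_I)
    show "form A d 0 (0 * xp 0)" using form_zero subringD[OF A] by simp
    show "form A d 0 (xp 0)" by (rule xp)
    have "tay 0 = 0" using tay_minus[of 0 0] by simp
    then show "vanish n (0 * xp 0)" using QD(1) by (simp add: vanish_def)
    show "ev t (xp 0) \<notin> Q" using xp(2) primeD(2)[OF Bsub Q] by simp
  qed
  then show "0 \<in> LQ n" by (simp add: ev.sbst_0)
  show "a * z \<in> LQ n" if "a \<in> A'" "z \<in> LQ n" for a z
    using LQ_mult[of z n a 0] that A'_eq by (simp add: mult.commute)
qed (rule LQ_add)

lemma pow_LQ: "ideal_pow A' (max_ideal A') n \<subseteq> LQ n"
proof (induction n)
  case 0 then show ?case by (simp add: A'_eq)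
next
  case (Suc n)
  have "max_ideal A' \<subseteq> LQ 1"
    unfolding max_localize[OF Bsub Q] ext_ideal_def using LQ_of_B QD(2) by auto
  then show ?case unfolding ideal_pow_Suc
    using Suc LQ_mult[of _ n _ 1] by (intro ideal_mul_least[OF localize_subring[OF Bsub Q] LQ_ideal]) auto
qed

text \<open>If \<open>f / x ^ r = F(t)\<close> had order above \<open>r\<close>, all Taylor
  coefficients of \<open>F\<close> of degree at most \<open>r\<close> would lie in \<open>Q\<close>.
  Those of degree \<open>r\<close> are coefficients of \<open>F\<close>, and one of them is a unit
  of \<open>A\<close> because \<open>f\<close> is outside \<open>m^(r+1)\<close>.\<close>

lemma order_transform:
  assumes f: "f \<in> ideal_pow A mm r" "f \<notin> ideal_pow A mm (Suc r)"
  shows "f / x ^ r \<notin> ideal_pow A' (max_ideal A') (Suc r)"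
proof
  assume "f / x ^ r \<in> ideal_pow A' (max_ideal A') (Suc r)"
  then have "f / x ^ r \<in> LQ (Suc r)" using pow_LQ by auto
  then obtain k H G where HG: "form A d k H" "form A d k G" "vanish (Suc r) H" "ev t G \<notin> Q" "f / x ^ r = ev t H / ev t G"
    by (elim LQ_E)
  obtain F where F: "form A d r F" "f = ev y F" using pow_repr[OF f(1)] by blast
  have fF: "f / x ^ r = ev t F" using F ev_y_t[OF F(1)] x0 by simp
  have FG: "form A d (k + r) (F * G)" "form A d (k + r) (H * xp r)"
    using form_prod[OF F(1) HG(2)] form_prod[OF HG(1) xp(1)[of r]] by (auto simp: add.commute)
  have "ev t (F * G - H * xp r) = 0"
    using HG(5) fF notinQ_nonzero[OF HG(4)] xp(2) by (simp add: ev.sbst_minus ev.sbst_mult field_simps)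
  \<comment> \<open>\<open>F * G\<close> and \<open>H * xp r\<close> have the same degree and the
    same value at \<open>t\<close>, so they differ by a form with coefficients in the maximal ideal,
    which does not affect Taylor coefficients modulo \<open>Q\<close>.\<close>
  then have mform: "form mm d (k + r) (F * G - H * xp r)" by (rule ev_t_zero[OF form_diff[OF A AA FG]])
  have "vanish (Suc r) (H * xp r)" using vanish_mult[OF HG(1) xp(1) HG(3), of 0] by simp
  moreover have "cf (tay (F * G - H * xp r)) \<gamma> \<in> Q" for \<gamma> by (rule tay_ideal[OF QI mform mQ])
  ultimately have van: "vanish (Suc r) (F * G)"
    unfolding vanish_def tay_minus lookup_minus using QD(3) by (metis diff_add_cancel)
  \<comment> \<open>Cancellation of \<open>G\<close>: its constant Taylor coefficient is
    \<open>ev t G\<close>, which is outside \<open>Q\<close>, so the coefficients of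
    \<open>F\<close> fall into \<open>Q\<close> by induction on the degree.\<close>
  have "mdeg \<gamma> < Suc r \<Longrightarrow> cf (tay F) \<gamma> \<in> Q" for \<gamma>
  proof (induction "mdeg \<gamma>" arbitrary: \<gamma> rule: less_induct)
    case less
    have FB: "cf (tay F) \<alpha> \<in> B" "cf (tay G) \<alpha> \<in> B" for \<alpha> using tay_B F(1) HG(2) by auto
    let ?T = "\<lambda>p. if fst p + snd p = \<gamma> then cf (tay F) (fst p) * cf (tay G) (snd p) else 0"
    let ?D = "supp (tay F) \<times> supp (tay G)"
    show ?case
    proof (cases "(\<gamma>, 0) \<in> ?D")
      case False
      moreover have "cf (tay G) 0 \<noteq> 0" using HG(4) tay_0 notinQ_nonzero by auto
      ultimately have "cf (tay F) \<gamma> = 0" by (simp add: in_keys_iff)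
      then show ?thesis using QD(1) by simp
    next
      case True
      have "cf (tay (F * G)) \<gamma> = (\<Sum>p\<in>?D. ?T p)"
        unfolding tay_mult cf_mult by (simp add: sum.cartesian_product split_def)
      also have "\<dots> = cf (tay F) \<gamma> * cf (tay G) 0 + (\<Sum>p\<in>?D - {(\<gamma>, 0)}. ?T p)"
        using True by (subst sum.remove[of _ "(\<gamma>, 0)"]) auto
      finally have eq: "cf (tay F) \<gamma> * cf (tay G) 0 = cf (tay (F * G)) \<gamma> - (\<Sum>p\<in>?D - {(\<gamma>, 0)}. ?T p)" by simp
      have "?T p \<in> Q" if p: "p \<in> ?D - {(\<gamma>, 0)}" for p
      proof (cases "fst p + snd p = \<gamma>")
        case True
        then have "snd p \<noteq> 0" using p by (auto simp: prod_eq_iff)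
        then have "mdeg (snd p) \<noteq> 0" by (simp add: mdeg_eq_0)
        then have "mdeg (fst p) < mdeg \<gamma>" using True mdeg_add[of "fst p" "snd p"] by simp
        then have "cf (tay F) (fst p) \<in> Q" using less by auto
        then show ?thesis using True QD(7)[OF _ FB(2)] by auto
      next
        case False then show ?thesis using QD(1) by simp
      qed
      then have "(\<Sum>p\<in>?D - {(\<gamma>, 0)}. ?T p) \<in> Q" by (rule ideal_sum[OF Bsub QI])
      moreover have "cf (tay (F * G)) \<gamma> \<in> Q" using van less.prems by (simp add: vanish_def)
      ultimately have "cf (tay F) \<gamma> * cf (tay G) 0 \<in> Q" unfolding eq by (intro QD(4))
      then show ?thesis using Qprime[OF FB(1) FB(2), of \<gamma> 0] HG(4) by (auto simp: tay_0)
    qed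
  qed
  moreover have "\<not> form mm d r F" using ev_flag_coeffs[of d r F] gen F f(2) mpow by auto
  then obtain \<alpha> where \<alpha>: "cf F \<alpha> \<notin> mm" using F(1) by (auto simp: form_def)
  then have "cf F \<alpha> \<noteq> 0" using idealD(1)[OF A M] by auto
  then have "mdeg \<alpha> = r" using F(1) by (auto simp: form_def)
  ultimately have aQ: "cf F \<alpha> \<in> Q" using tay_top[OF F(1), of \<alpha>] by (metis lessI)
  have aA: "cf F \<alpha> \<in> A" using F(1) by (simp add: form_def)
  then have "inverse (cf F \<alpha>) \<in> B" "cf F \<alpha> \<noteq> 0" using max_ideal_unit[OF _ \<alpha>] AB by auto
  then have "1 \<in> Q" using QD(6)[OF _ aQ] by fastforce
  then show False using primeD(2)[OF Bsub Q] by simp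
qed

lemma AA': "A \<subseteq> A'" using AB localize_sup[OF Bsub Q] by auto

lemma mm_sub: "mm \<subseteq> max_ideal A'"
  unfolding max_localize[OF Bsub Q] using mQ ext_ideal_sup[OF Bsub Q] by blast

lemma pow_div_in: "a \<in> ideal_pow A mm n \<Longrightarrow> a / x ^ n \<in> A'"
  using pow_div_in_B localize_sup[OF Bsub Q] by auto

text \<open>Powers of \<open>x\<close> bring numerator and denominator to a common exponent
  \<open>k\<close>, as large as desired; the bound \<open>K\<close> allows a prescribed power of
  \<open>x\<close> to be split off later. The order of \<open>b\<close> is exactly \<open>k\<close>
  because \<open>b / x ^ k\<close> lies outside \<open>Q\<close>.\<close>

lemma fraction_repr:
  assumes z: "z \<in> A'"
  obtains k a b where "K \<le> k" "a \<in> ideal_pow A mm k" "b \<in> ideal_pow A mm k" "b \<notin> ideal_pow A mm (Suc k)"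
    "b \<noteq> 0" "z = a / b" "b / x ^ k \<notin> max_ideal A'"
proof -
  obtain \<beta> \<gamma> where bg: "\<beta> \<in> B" "\<gamma> \<in> B" "\<gamma> \<notin> Q" "z = \<beta> / \<gamma>" using z by (auto simp: localize_def)
  obtain k a where a: "a \<in> ideal_pow A mm k" "\<beta> = a / x ^ k" using B_repr[OF bg(1)] by blast
  obtain l b where b: "b \<in> ideal_pow A mm l" "\<gamma> = b / x ^ l" using B_repr[OF bg(2)] by blast
  let ?n = "k + l + K"
  have s: "a * x ^ (l + K) \<in> ideal_pow A mm ?n" "b * x ^ (k + K) \<in> ideal_pow A mm ?n"
    using ideal_pow_mult[OF A M a(1) x_pow, of "l + K"] ideal_pow_mult[OF A M b(1) x_pow, of "k + K"] by (auto simp: ac_simps)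
  have g: "b * x ^ (k + K) / x ^ ?n = \<gamma>" using b(2) x0 by (simp add: field_simps power_add)
  have gm: "\<gamma> \<notin> max_ideal A'"
    using localize_inverse[OF Bsub Q bg(2,3)] notinQ_nonzero[OF bg(3)] by (auto simp: max_ideal_def)
  have "b * x ^ (k + K) \<notin> ideal_pow A mm (Suc ?n)"
  proof
    assume "b * x ^ (k + K) \<in> ideal_pow A mm (Suc ?n)"
    then have "x * (b * x ^ (k + K) / x ^ Suc ?n) \<in> Q" using xB_Q[OF pow_div_in_B] by blast
    then show False using g bg(3) x0 by simp
  qed
  moreover have "z = (a * x ^ (l + K)) / (b * x ^ (k + K))" using bg(4) a b x0 by (simp add: field_simps power_add)
  moreover have "b * x ^ (k + K) \<noteq> 0" using b(2) x0 notinQ_nonzero[OF bg(3)] by auto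
  ultimately show ?thesis using that[of ?n, OF _ s] g gm by auto
qed

end

subsection \<open>Height one primes of a completely integrally closed noetherian ring\<close>

text \<open>The localization is a discrete valuation ring. For a nonzero \<open>g \<in> P\<close>
  take \<open>u\<close> outside \<open>gL\<close> with \<open>m u \<subseteq> gL\<close>. If
  \<open>m (u/g) \<subseteq> m\<close>, then a multiple of \<open>u/g\<close> by some
  \<open>s\<close> outside \<open>P\<close> is almost integral over \<open>A\<close>, forcing
  \<open>u/g\<close> into \<open>L\<close>. Hence some \<open>\<pi> * (u / g)\<close> is a unit, and
  then \<open>\<pi>\<close> generates \<open>m\<close>.\<close>

lemma localize_height_one_valuation:
  assumes A: "subring A" and N: "noetherian A" and P: "prime_ideal A P"
    and h1: "\<And>q. prime_ideal A q \<Longrightarrow> q \<subset> P \<Longrightarrow> q = {0}" and P0: "P \<noteq> {0}"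
    and cic: "\<And>D a b. D \<in> A \<Longrightarrow> D \<noteq> 0 \<Longrightarrow> a \<in> A \<Longrightarrow> b \<in> A \<Longrightarrow> b \<noteq> 0 \<Longrightarrow>
        (\<And>k. D * (a / b) ^ k \<in> A) \<Longrightarrow> a / b \<in> A"
    and ab: "a \<in> A" "b \<in> A" "a \<noteq> 0" "b \<noteq> 0"
  shows "a / b \<in> localize A P \<or> b / a \<in> localize A P"
proof -
  let ?L = "localize A P"
  let ?m = "max_ideal ?L"
  note L = localize_subring[OF A P]
  note Lloc = localize_local[OF A P]
  note LN = localize_noetherian[OF A P N]
  note PI = primeD(1)[OF A P]
  have m: "?m = ext_ideal A P P" by (rule max_localize[OF A P])
  have M: "is_ideal ?L ?m" using Lloc by (simp add: local_ring_def)
  obtain g where g: "g \<in> P" "g \<noteq> 0" using P0 idealD(1)[OF A PI] by blast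
  have gA: "g \<in> A" using g idealD(2)[OF A PI] by auto
  have AL: "A \<subseteq> ?L" by (rule localize_sup[OF A P])
  let ?K = "principal ?L g"
  have K: "is_ideal ?L ?K" using principal_ideal[OF L] gA AL by auto
  have nil: "\<exists>n. z ^ n \<in> ?K" if z: "z \<in> ?m" for z
  proof (rule power_mem_if_all_primes[OF L K])
    show "z \<in> ?L" using z by (auto simp: max_ideal_def)
    fix T assume T: "prime_ideal ?L T" "?K \<subseteq> T"
    have T': "prime_ideal A (T \<inter> A)" "T \<inter> A \<subseteq> P" using contract_prime[OF A P T(1)] by auto
    have "g \<in> T \<inter> A" using T(2) principal_self[OF L, of g] gA by auto
    then have "T \<inter> A = P" using h1[OF T'(1)] T'(2) g by blast
    then show "z \<in> T" using ext_contract[OF A P primeD(1)[OF L T(1)]] z m by simp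
  qed
  obtain s where s: "ideal_pow ?L ?m s \<subseteq> ?K" using ideal_pow_subset_of_nil[OF L LN M K nil] by blast
  define r where "r = (LEAST s. ideal_pow ?L ?m s \<subseteq> ?K)"
  have r: "ideal_pow ?L ?m r \<subseteq> ?K" unfolding r_def using s by (rule LeastI)
  have gm: "g \<in> ?m" unfolding m using g ext_ideal_sup[OF A P] by blast
  have Km: "?K \<subseteq> ?m" by (rule principal_least[OF L M gm])
  obtain r' where r': "r = Suc r'"
  proof (cases r)
    case 0
    then have "1 \<in> ?m" using r Km subringD[OF L] by auto
    then show ?thesis using one_notin_max[OF L] by simp
  qed (use that in auto)
  then have "\<not> ideal_pow ?L ?m r' \<subseteq> ?K"
    using not_less_Least[of r' "\<lambda>s. ideal_pow ?L ?m s \<subseteq> ?K"] by (simp add: r_def[symmetric])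
  then obtain u where u: "u \<in> ideal_pow ?L ?m r'" "u \<notin> ?K" by blast
  have uL: "u \<in> ?L" using u idealD(2)[OF L ideal_pow_ideal[OF L M]] by auto
  have mu: "z * (u / g) \<in> ?L" if z: "z \<in> ?m" for z
  proof -
    have "u * z \<in> ?K" using ideal_pow_SucI[OF L u(1) z] r r' by auto
    then obtain w where "w \<in> ?L" "u * z = g * w" by (auto simp: principal_def)
    then show ?thesis using g by (simp add: field_simps)
  qed
  have qL: "u / g \<notin> ?L"
  proof
    assume "u / g \<in> ?L"
    then have "g * (u / g) \<in> ?K" unfolding principal_def by blast
    then show False using u g by simp
  qed
  have "\<exists>\<pi>\<in>?m. \<pi> * (u / g) \<notin> ?m"
  proof (rule ccontr)
    assume no: "\<not> ?thesis"
    obtain X where X: "finite X" "X \<subseteq> P" "gen_ideal A X = P" using N[unfolded noetherian_def, rule_format, OF PI] by auto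
    have Pm: "P \<subseteq> ?m" unfolding m using ext_ideal_sup[OF A P] by blast
    \<comment> \<open>Complete integral closedness is given for \<open>A\<close> and not for its
      localization, so a common denominator \<open>s\<close> for the finitely many generators of
      \<open>P\<close> brings the inclusion down to \<open>A\<close>: \<open>s * (u / g)\<close>
      maps \<open>P\<close> into \<open>P\<close>.\<close>
    have "\<exists>s\<in>A. s \<notin> P \<and> (\<forall>z\<in>X. s * (z * (u / g)) \<in> P)"
      using X(1,2)
    proof (induction X)
      case empty then show ?case using one_compl[OF A P] by blast
    next
      case (insert z X)
      then obtain s where s: "s \<in> A" "s \<notin> P" "\<forall>z\<in>X. s * (z * (u / g)) \<in> P" by auto
      have "z * (u / g) \<in> ext_ideal A P P" using no insert.prems Pm m by auto
      then obtain c e where ce: "c \<in> P" "e \<in> A" "e \<notin> P" "e \<noteq> 0" "z * (u / g) = c / e" by (rule ext_idealE[OF A P])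
      have "s * e * (z * (u / g)) = s * c" using ce by simp
      then have "s * e * (z * (u / g)) \<in> P" using idealD(6)[OF A PI s(1) ce(1)] by metis
      moreover have "s * e * (w * (u / g)) \<in> P" if "w \<in> X" for w
      proof -
        have "s * e * (w * (u / g)) = e * (s * (w * (u / g)))" by simp
        then show ?thesis using idealD(6)[OF A PI ce(2)] s(3) that by metis
      qed
      ultimately show ?case using mult_compl[OF A P s(1) ce(2) s(2) ce(3)] by blast
    qed
    then obtain s where s: "s \<in> A" "s \<notin> P" "\<And>z. z \<in> X \<Longrightarrow> s * (z * (u / g)) \<in> P" by auto
    have "is_ideal A {z \<in> A. z * (s * (u / g)) \<in> P}"
      unfolding is_ideal_def
    proof (intro conjI ballI)
      fix a z assume "a \<in> A" "z \<in> {z \<in> A. z * (s * (u / g)) \<in> P}"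
      then show "a * z \<in> {z \<in> A. z * (s * (u / g)) \<in> P}"
        using idealD(6)[OF A PI, of a "z * (s * (u / g))"] subringD(5)[OF A, of a z]
        by (simp only: mult.assoc mem_Collect_eq)
    qed (use subringD[OF A] idealD[OF A PI] in \<open>auto simp: add_divide_distrib distrib_right\<close>)
    moreover have "X \<subseteq> {z \<in> A. z * (s * (u / g)) \<in> P}"
      using s(3) X(2) idealD(2)[OF A PI] by (auto simp: mult.left_commute)
    ultimately have st: "z * (s * (u / g)) \<in> P" if "z \<in> P" for z
      using gen_ideal_least[OF A] X(3) that by blast
    have gk: "g * (s * (u / g)) ^ k \<in> P" for k
    proof (induction k)
      case (Suc k)
      have "g * (s * (u / g)) ^ Suc k = (g * (s * (u / g)) ^ k) * (s * (u / g))" by (simp add: mult_ac)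
      then show ?case using st[OF Suc] by metis
    qed (use g in simp)
    obtain c e where ce: "c \<in> A" "e \<in> A" "e \<notin> P" "e \<noteq> 0" "u = c / e" using uL unfolding localize_ext by (rule ext_idealE[OF A P])
    have eq: "s * (u / g) = (s * c) / (e * g)" using ce by simp
    have "(s * c) / (e * g) \<in> A"
      by (rule cic[OF gA g(2)]) (use gk idealD(2)[OF A PI] s ce gA g subringD(5)[OF A] eq in auto)
    then have "s * (u / g) \<in> ?L" using eq AL by auto
    then have "inverse s * (s * (u / g)) \<in> ?L" by (rule subringD(5)[OF L localize_inverse[OF A P s(1,2)]])
    moreover have "s \<noteq> 0" using compl_nonzero[OF A P s(2)] .
    then have "inverse s * (s * (u / g)) = u / g" by simp
    ultimately show False using qL by metis
  qed
  then obtain \<pi> where \<pi>: "\<pi> \<in> ?m" "\<pi> * (u / g) \<notin> ?m" by blast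
  define c where "c = \<pi> * (u / g)"
  have c: "c \<in> ?L" "c \<noteq> 0" "inverse c \<in> ?L" using mu[OF \<pi>(1)] max_ideal_unit[OF mu[OF \<pi>(1)] \<pi>(2)] by (auto simp: c_def)
  have \<pi>0: "\<pi> \<noteq> 0" using c by (auto simp: c_def)
  have div: "z / \<pi> \<in> ?L" if z: "z \<in> ?m" for z
  proof -
    have "z / \<pi> = (z * (u / g)) * inverse c" using \<pi>0 c(2) by (auto simp: c_def field_simps)
    then show ?thesis using subringD(5)[OF L mu[OF z] c(3)] by simp
  qed
  have pw: "z / \<pi> ^ n \<in> ?L" if "z \<in> ideal_pow ?L ?m n" for z n
    using that
  proof (induction n arbitrary: z)
    case (Suc n)
    let ?J = "{z \<in> ?L. z / \<pi> ^ Suc n \<in> ?L}"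
    have J: "is_ideal ?L ?J"
      unfolding is_ideal_def
    proof (intro conjI ballI)
      fix r z assume "r \<in> ?L" "z \<in> ?J"
      then show "r * z \<in> ?J" using subringD(5)[OF L, of r "z / \<pi> ^ Suc n"] subringD(5)[OF L] by auto
    qed (use subringD[OF L] in \<open>auto simp: add_divide_distrib\<close>)
    have "ideal_pow ?L ?m (Suc n) \<subseteq> ?J" unfolding ideal_pow_Suc
    proof (rule ideal_mul_least[OF L J])
      fix a b assume ab: "a \<in> ideal_pow ?L ?m n" "b \<in> ?m"
      have "(a / \<pi> ^ n) * (b / \<pi>) \<in> ?L" using subringD(5)[OF L Suc.IH[OF ab(1)] div[OF ab(2)]] .
      moreover have "a * b \<in> ?L" using subringD(5)[OF L idealD(2)[OF L ideal_pow_ideal[OF L M] ab(1)] idealD(2)[OF L M ab(2)]] .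
      ultimately show "a * b \<in> ?J" by (simp add: mult.commute)
    qed
    then show ?case using Suc.prems by auto
  qed simp
  have unit: "\<exists>n w. z = \<pi> ^ n * w \<and> w \<in> ?L \<and> w \<noteq> 0 \<and> inverse w \<in> ?L" if z: "z \<in> ?L" "z \<noteq> 0" for z
  proof -
    let ?n = "ord ?L z"
    have 1: "z \<in> ideal_pow ?L ?m ?n" "z \<notin> ideal_pow ?L ?m (Suc ?n)"
      using ord_iff[OF Lloc LN z, of ?n] ord_iff[OF Lloc LN z, of "Suc ?n"] by auto
    let ?w = "z / \<pi> ^ ?n"
    have w: "?w \<in> ?L" by (rule pw[OF 1(1)])
    have "?w \<notin> ?m"
    proof
      assume "?w \<in> ?m"
      then have "\<pi> ^ ?n * ?w \<in> ideal_pow ?L ?m (Suc ?n)" by (rule ideal_pow_SucI[OF L ideal_pow_power[OF L \<pi>(1)]])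
      then show False using 1(2) \<pi>0 by simp
    qed
    then show ?thesis using max_ideal_unit[OF w] w \<pi>0 by (intro exI[of _ ?n] exI[of _ ?w]) auto
  qed
  obtain i v where a: "a = \<pi> ^ i * v" "v \<in> ?L" "v \<noteq> 0" "inverse v \<in> ?L" using unit[of a] ab AL by blast
  obtain j w where b: "b = \<pi> ^ j * w" "w \<in> ?L" "w \<noteq> 0" "inverse w \<in> ?L" using unit[of b] ab AL by blast
  have \<pi>L: "\<pi> \<in> ?L" using \<pi> by (auto simp: max_ideal_def)
  show ?thesis
  proof (cases "j \<le> i")
    case True
    then have "a / b = \<pi> ^ (i - j) * (v * inverse w)" using a b \<pi>0 by (simp add: field_simps power_add[symmetric])
    then show ?thesis using subringD(5)[OF L subring_power[OF L \<pi>L]] subringD(5)[OF L a(2) b(4)] by auto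
  next
    case False
    then have "b / a = \<pi> ^ (j - i) * (w * inverse v)" using a b \<pi>0 by (simp add: field_simps power_add[symmetric])
    then show ?thesis using subringD(5)[OF L subring_power[OF L \<pi>L]] subringD(5)[OF L b(2) a(4)] by auto
  qed
qed

subsection \<open>Height and dimension\<close>

lemma chain_step_down:
  assumes A: "subring A" and p: "prime_chain A p n" and "i < n"
  shows "p i \<noteq> p n" "0 \<in> p i"
proof -
  have "\<And>j. i + Suc j \<le> n \<Longrightarrow> p i \<subset> p (i + Suc j)"
  proof -
    fix j show "i + Suc j \<le> n \<Longrightarrow> p i \<subset> p (i + Suc j)"
    proof (induction j)
      case 0 then show ?case using p by (auto simp: prime_chain_def)
    next
      case (Suc j)
      then have "p i \<subset> p (i + Suc j)" "p (i + Suc j) \<subset> p (Suc (i + Suc j))" using p by (auto simp: prime_chain_def)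
      then show ?case by auto
    qed
  qed
  from this[of "n - Suc i"] show "p i \<noteq> p n" using assms(3) by auto
  show "0 \<in> p i" using p assms(3) idealD(1)[OF A primeD(1)[OF A]] by (auto simp: prime_chain_def)
qed

lemma chain_inj:
  assumes A: "subring A" and p: "prime_chain A p n" shows "inj_on p {..n}"
proof (rule inj_onI)
  have *: "p i \<noteq> p j" if "i < j" "j \<le> n" for i j
    using chain_step_down(1)[OF A, of p j i] p that by (auto simp: prime_chain_def)
  fix i j assume "i \<in> {..n}" "j \<in> {..n}" "p i = p j"
  then show "i = j" using *[of i j] *[of j i] by (cases i j rule: linorder_cases) auto
qed

lemma chain2: "prime_ideal A a \<Longrightarrow> prime_ideal A b \<Longrightarrow> a \<subset> b \<Longrightarrow> prime_chain A (\<lambda>i. if i = 0 then a else b) 1"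
  by (auto simp: prime_chain_def)

lemma chain3: "prime_ideal A a \<Longrightarrow> prime_ideal A b \<Longrightarrow> prime_ideal A c \<Longrightarrow> a \<subset> b \<Longrightarrow> b \<subset> c \<Longrightarrow>
    prime_chain A (\<lambda>i. if i = 0 then a else if i = 1 then b else c) 2"
  by (auto simp: prime_chain_def less_Suc_eq numeral_2_eq_2)

lemma chain4: "prime_ideal A a \<Longrightarrow> prime_ideal A b \<Longrightarrow> prime_ideal A c \<Longrightarrow> prime_ideal A e \<Longrightarrow>
    a \<subset> b \<Longrightarrow> b \<subset> c \<Longrightarrow> c \<subset> e \<Longrightarrow>
    prime_chain A (\<lambda>i. if i = 0 then a else if i = 1 then b else if i = 2 then c else e) 3"
  by (auto simp: prime_chain_def less_Suc_eq numeral_3_eq_3 numeral_2_eq_2)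

lemma height_one_iff:
  assumes A: "subring A" and P: "prime_ideal A P"
  shows "height A P = 1 \<longleftrightarrow> P \<noteq> {0} \<and> (\<forall>q. prime_ideal A q \<longrightarrow> q \<subset> P \<longrightarrow> q = {0})"
proof
  have Z: "prime_ideal A {0}" by (rule prime_zero[OF A])
  have up: "prime_chain A p n \<Longrightarrow> p n = P \<Longrightarrow> enat n \<le> height A P" for p n
    unfolding height_def by (rule Sup_upper) auto
  have z: "0 \<in> q" if "prime_ideal A q" for q using idealD(1)[OF A primeD(1)[OF A that]] .
  {
    assume h: "height A P = 1"
    have "P \<noteq> {0}"
    proof
      assume P0: "P = {0}"
      have "n = 0" if "prime_chain A p n" "p n = P" for p n
      proof (rule ccontr)
        assume n: "n \<noteq> 0"
        then obtain k where k: "n = Suc k" using not0_implies_Suc by blast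
        then have "p (n - 1) \<subset> P" using that by (auto simp: prime_chain_def)
        moreover have "0 \<in> p (n - 1)" using chain_step_down(2)[OF A that(1), of "n - 1"] n by simp
        ultimately show False using P0 by auto
      qed
      then have "height A P \<le> 0" unfolding height_def by (intro Sup_least) (auto simp: zero_enat_def)
      then show False using h by simp
    qed
    moreover have "q = {0}" if q: "prime_ideal A q" "q \<subset> P" for q
    proof (rule ccontr)
      assume "q \<noteq> {0}"
      then have "{0} \<subset> q" using z[OF q(1)] by auto
      from up[OF chain3[OF Z q(1) P this q(2)]] have "enat 2 \<le> 1" using h by simp
      then show False by (simp add: one_enat_def)
    qed
    ultimately show "P \<noteq> {0} \<and> (\<forall>q. prime_ideal A q \<longrightarrow> q \<subset> P \<longrightarrow> q = {0})" by blast
  }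
  assume r: "P \<noteq> {0} \<and> (\<forall>q. prime_ideal A q \<longrightarrow> q \<subset> P \<longrightarrow> q = {0})"
  then have "{0} \<subset> P" using z[OF P] by auto
  from up[OF chain2[OF Z P this]] have 1: "1 \<le> height A P" by (simp add: one_enat_def)
  have "n \<le> 1" if p: "prime_chain A p n" "p n = P" for p n
  proof (rule ccontr)
    assume "\<not> n \<le> 1"
    then obtain k where k: "n = Suc (Suc k)" by (metis Suc_diff_Suc diff_Suc_1 less_imp_Suc_add not_le One_nat_def plus_1_eq_Suc)
    have "p (Suc k) \<subset> P" "prime_ideal A (p (Suc k))" "p k \<subset> p (Suc k)"
      using p k by (auto simp: prime_chain_def)
    then have "p k \<subset> {0}" using r by auto
    moreover have "0 \<in> p k" using chain_step_down(2)[OF A p(1), of k] k by simp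
    ultimately show False by auto
  qed
  then have "height A P \<le> 1" unfolding height_def by (intro Sup_least) (auto simp: one_enat_def)
  then show "height A P = 1" using 1 by simp
qed

lemma krull_dim_le_card:
  assumes A: "subring A" and F: "finite F" and all: "\<And>p. prime_ideal A p \<Longrightarrow> p \<in> F" and c: "card F \<le> Suc n"
  shows "krull_dim A \<le> enat n"
  unfolding krull_dim_def
proof (rule Sup_least)
  fix z assume "z \<in> {enat n |n. \<exists>p. prime_chain A p n}"
  then obtain k p where p: "z = enat k" "prime_chain A p k" by auto
  have "p ` {..k} \<subseteq> F" using p(2) all by (auto simp: prime_chain_def)
  then have "card (p ` {..k}) \<le> card F" by (rule card_mono[OF F])
  then have "Suc k \<le> card F" using card_image[OF chain_inj[OF A p(2)]] by simp
  then show "z \<le> enat n" using c p by simp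
qed

subsection \<open>Sequences of local quadratic transforms\<close>

locale quad_seq =
  fixes R :: "nat \<Rightarrow> 'a::field set" and x :: "nat \<Rightarrow> 'a" and Q :: "nat \<Rightarrow> 'a set"
  assumes quot: "has_quotient_field (R 0)"
    and reg: "\<And>i. regular_local_ring (R i)"
    and x_m: "\<And>i. x i \<in> max_ideal (R i)" and x_m2: "\<And>i. x i \<notin> ideal_pow (R i) (max_ideal (R i)) 2"
    and Q_prime: "\<And>i. prime_ideal (ring_adjoin (R i) (max_ideal (R i)) (x i)) (Q i)"
    and m_Q: "\<And>i. max_ideal (R i) \<subseteq> Q i"
    and R_Suc: "\<And>i. R (Suc i) = localize (ring_adjoin (R i) (max_ideal (R i)) (x i)) (Q i)"
begin

abbreviation m where "m i \<equiv> max_ideal (R i)"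
abbreviation od where "od i \<equiv> ord (R i)"
abbreviation mp where "mp i \<equiv> ideal_pow (R i) (m i)"

lemma loc: "local_ring (R i)" and noe: "noetherian (R i)"
  using reg[of i] by (auto simp: regular_local_ring_def)

lemma sub: "subring (R i)" and mI: "is_ideal (R i) (m i)"
  using loc[of i] by (auto simp: local_ring_def)

lemmas RD = subringD[OF sub]
lemmas mD = idealD[OF sub mI]
lemmas mpI = ideal_pow_ideal[OF sub mI]

lemma step_ex: "\<exists>y d. lqt_step (R i) y d (x i) (Q i)"
proof -
  obtain y d where "reg_params (R i) y d" "0 < d" "y 0 = x i"
    by (rule regular_params_start[OF reg x_m x_m2])
  then show ?thesis
    using x_m2 Q_prime m_Q by (auto simp: lqt_step_def lqt_step_axioms_def)
qed

lemma R_step: "R i \<subseteq> R (Suc i)" and m_step: "m i \<subseteq> m (Suc i)" and x_nz: "x i \<noteq> 0"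
proof -
  obtain y d where "lqt_step (R i) y d (x i) (Q i)" using step_ex by blast
  then interpret lqt_step "R i" y d "x i" "Q i" .
  show "R i \<subseteq> R (Suc i)" "m i \<subseteq> m (Suc i)" "x i \<noteq> 0"
    using AA' mm_sub x0 R_Suc by auto
qed

lemma R_mono: "i \<le> j \<Longrightarrow> R i \<subseteq> R j" using R_step by (rule lift_Suc_mono_le)
lemma m_mono: "i \<le> j \<Longrightarrow> m i \<subseteq> m j" using m_step by (rule lift_Suc_mono_le)
lemma m_R: "m i \<subseteq> R i" by (auto simp: max_ideal_def)
lemma x_R: "x i \<in> R i" using x_m m_R by auto

lemma o_iff: "a \<in> R i \<Longrightarrow> a \<noteq> 0 \<Longrightarrow> n \<le> od i a \<longleftrightarrow> a \<in> mp i n"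
  by (rule ord_iff[OF loc noe])

lemma o_eqI: "a \<in> R i \<Longrightarrow> a \<in> mp i n \<Longrightarrow> a \<notin> mp i (Suc n) \<Longrightarrow> od i a = n"
  using o_iff[of a i n] o_iff[of a i "Suc n"] idealD(1)[OF sub mpI, of i "Suc n"] by (cases "a = 0") auto

lemma o_mult: 
  assumes "a \<in> R i" "b \<in> R i" "a \<noteq> 0" "b \<noteq> 0" shows "od i (a * b) = od i a + od i b"
proof -
  obtain y d where "lqt_step (R i) y d (x i) (Q i)" using step_ex by blast
  then interpret lqt_step "R i" y d "x i" "Q i" .
  have a: "a \<in> mp i (od i a)" "a \<notin> mp i (Suc (od i a))" "b \<in> mp i (od i b)" "b \<notin> mp i (Suc (od i b))"
    using o_iff[OF assms(1,3)] o_iff[OF assms(2,4)] by (auto simp: o_iff[symmetric] assms)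
  show ?thesis
    by (rule o_eqI) (use RD assms ideal_pow_mult[OF sub mI a(1,3)] pow_mult_notin[OF a] in auto)
qed

lemma o_x: "od i (x i) = 1"
  using ideal_pow_1[OF sub mI] x_m x_m2 x_R by (intro o_eqI) (auto simp: numeral_2_eq_2)

lemma o_0_iff: "a \<in> R i \<Longrightarrow> a \<noteq> 0 \<Longrightarrow> od i a = 0 \<longleftrightarrow> a \<notin> m i"
  using o_iff[of a i "Suc 0"] ideal_pow_1[OF sub mI] by auto

lemma o_pos: "a \<in> m i \<Longrightarrow> a \<noteq> 0 \<Longrightarrow> 1 \<le> od i a"
  using o_0_iff[of a i] m_R by fastforce

lemma o_one: "od i 1 = 0"
  using o_0_iff[of 1 i] RD one_notin_max[OF sub] by auto

lemma o_power: "a \<in> R i \<Longrightarrow> a \<noteq> 0 \<Longrightarrow> od i (a ^ n) = n * od i a"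
  by (induction n) (auto simp: o_one o_mult subring_power[OF sub])

lemma o_prod: "(\<And>j. j \<in> J \<Longrightarrow> f j \<in> R i \<and> f j \<noteq> 0) \<Longrightarrow> od i (prod f J) = (\<Sum>j\<in>J. od i (f j))"
proof (induction J rule: infinite_finite_induct)
  case (insert j J)
  have "prod f J \<in> R i" by (rule subring_prod[OF sub]) (use insert in auto)
  moreover have "prod f J \<noteq> 0" using insert by auto
  ultimately show ?case using insert by (simp add: o_mult)
qed (auto simp: o_one)

lemma o_add: "a \<in> R i \<Longrightarrow> b \<in> R i \<Longrightarrow> a \<noteq> 0 \<Longrightarrow> b \<noteq> 0 \<Longrightarrow> a + b \<noteq> 0 \<Longrightarrow> n \<le> od i a \<Longrightarrow> n \<le> od i b \<Longrightarrow> n \<le> od i (a + b)"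
  using idealD(3)[OF sub mpI] RD by (simp add: o_iff)

lemma div_pow: "a \<in> R i \<Longrightarrow> a \<noteq> 0 \<Longrightarrow> n \<le> od i a \<Longrightarrow> a / x i ^ n \<in> R (Suc i)"
proof -
  obtain y d where "lqt_step (R i) y d (x i) (Q i)" using step_ex by blast
  then interpret lqt_step "R i" y d "x i" "Q i" .
  assume "a \<in> R i" "a \<noteq> 0" "n \<le> od i a"
  then show ?thesis using pow_div_in R_Suc o_iff by auto
qed

lemma div_x: "a \<in> m i \<Longrightarrow> a / x i \<in> R (Suc i)"
  using div_pow[of a i 1] o_pos[of a i] m_R RD(1) by (cases "a = 0") auto

lemma o_transform: 
  assumes "a \<in> R i" "a \<noteq> 0" shows "od (Suc i) (a / x i ^ od i a) \<le> od i a"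
proof -
  obtain y d where "lqt_step (R i) y d (x i) (Q i)" using step_ex by blast
  then interpret lqt_step "R i" y d "x i" "Q i" .
  have "a \<in> mp i (od i a)" "a \<notin> mp i (Suc (od i a))" using assms by (auto simp: o_iff[symmetric])
  then have "a / x i ^ od i a \<notin> mp (Suc i) (Suc (od i a))" using order_transform R_Suc by auto
  then show ?thesis using o_iff[OF div_pow[OF assms order_refl], of "Suc (od i a)"] assms x_nz by auto
qed

lemma frac:
  assumes "z \<in> R (Suc i)"
  obtains k a b where "K \<le> k" "a \<in> mp i k" "b \<in> mp i k" "b \<noteq> 0" "od i b = k" "a \<in> R i" "b \<in> R i" "z = a / b"
    "b / x i ^ k \<in> R (Suc i)" "b / x i ^ k \<notin> m (Suc i)"
proof -
  obtain y d where "lqt_step (R i) y d (x i) (Q i)" using step_ex by blast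
  then interpret lqt_step "R i" y d "x i" "Q i" .
  have "z \<in> A'" using assms R_Suc by simp
  then obtain k a b where *: "K \<le> k" "a \<in> mp i k" "b \<in> mp i k" "b \<notin> mp i (Suc k)" "b \<noteq> 0" "z = a / b" "b / x i ^ k \<notin> max_ideal A'"
    by (rule fraction_repr)
  have ab: "a \<in> R i" "b \<in> R i" using *(2,3) idealD(2)[OF sub mpI] by auto
  have "od i b = k" by (rule o_eqI[OF ab(2) *(3,4)])
  then show ?thesis using that[OF *(1,2,3,5) _ ab *(6)] *(7) R_Suc pow_div_in[OF *(3)] by auto
qed

lemma cic: "D \<in> R i \<Longrightarrow> D \<noteq> 0 \<Longrightarrow> a \<in> R i \<Longrightarrow> b \<in> R i \<Longrightarrow> b \<noteq> 0 \<Longrightarrow> (\<And>k. D * (a / b) ^ k \<in> R i) \<Longrightarrow> a / b \<in> R i"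
proof -
  obtain y d where "lqt_step (R i) y d (x i) (Q i)" using step_ex by blast
  then interpret lqt_step "R i" y d "x i" "Q i" .
  assume "D \<in> R i" "D \<noteq> 0" "a \<in> R i" "b \<in> R i" "b \<noteq> 0" "\<And>k. D * (a / b) ^ k \<in> R i"
  then show ?thesis using completely_integrally_closed[of D "a / b" a b] by blast
qed

definition S :: "'a set" where "S = (\<Union>i. R i)"
definition N :: "'a set" where "N = (\<Union>i. m i)"

lemma R_S: "R i \<subseteq> S" by (auto simp: S_def)

lemma S_common: "a \<in> S \<Longrightarrow> \<exists>i. \<forall>j\<ge>i. a \<in> R j"
proof -
  assume "a \<in> S"
  then obtain i where "a \<in> R i" by (auto simp: S_def)
  then have "\<forall>j\<ge>i. a \<in> R j" using R_mono[of i] by blast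
  then show ?thesis by blast
qed

lemma S_common2: "a \<in> S \<Longrightarrow> b \<in> S \<Longrightarrow> \<exists>i\<ge>k. a \<in> R i \<and> b \<in> R i"
proof -
  assume "a \<in> S" "b \<in> S"
  then obtain i j where "\<forall>l\<ge>i. a \<in> R l" "\<forall>l\<ge>j. b \<in> R l" using S_common by meson
  then show ?thesis by (intro exI[of _ "max k (max i j)"]) auto
qed

lemma S_sub: "subring S"
  unfolding subring_def
proof (intro conjI ballI)
  fix a b assume "a \<in> S" "b \<in> S"
  then obtain i where "a \<in> R i" "b \<in> R i" using S_common2 by meson
  then have "a + b \<in> R i" "a - b \<in> R i" "a * b \<in> R i" by (auto intro: RD)
  then show "a + b \<in> S" "a - b \<in> S" "a * b \<in> S" using R_S by auto
next
  have "0 \<in> R 0" "1 \<in> R 0" by (auto intro: RD)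
  then show "0 \<in> S" "1 \<in> S" using R_S by auto
qed

lemmas SD = subringD[OF S_sub]

lemma N_S: "N \<subseteq> S" using m_R by (auto simp: N_def S_def)

lemma N_eq: "max_ideal S = N"
proof
  show "max_ideal S \<subseteq> N"
  proof
    fix a assume a: "a \<in> max_ideal S"
    then obtain i where i: "a \<in> R i" by (auto simp: max_ideal_def S_def)
    then have "a \<in> m i" using a R_S[of i] by (auto simp: max_ideal_def)
    then show "a \<in> N" by (auto simp: N_def)
  qed
  show "N \<subseteq> max_ideal S"
  proof
    fix a assume "a \<in> N"
    then obtain i where i: "a \<in> m i" by (auto simp: N_def)
    have "inverse a \<notin> S" if "a \<noteq> 0"
    proof
      assume "inverse a \<in> S"
      then obtain j where j: "inverse a \<in> R j" by (auto simp: S_def)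
      have "a \<in> m (max i j)" using i m_mono[of i "max i j"] by auto
      moreover have "inverse a \<in> R (max i j)" using j R_mono[of j "max i j"] by auto
      ultimately show False using that by (auto simp: max_ideal_def)
    qed
    then show "a \<in> max_ideal S" using i m_R[of i] R_S[of i] by (auto simp: max_ideal_def)
  qed
qed

lemma S_local: "local_ring S"
  unfolding local_ring_def
proof
  show "is_ideal S (max_ideal S)" unfolding N_eq is_ideal_def
  proof (intro conjI ballI)
    show "N \<subseteq> S" by (rule N_S)
    show "0 \<in> N" using mD(1) by (auto simp: N_def)
    fix a b assume "a \<in> N" "b \<in> N"
    then obtain i j where "a \<in> m i" "b \<in> m j" by (auto simp: N_def)
    then have "a \<in> m (max i j)" "b \<in> m (max i j)" using m_mono[of _ "max i j"] by (meson max.cobounded1 max.cobounded2 subsetD)+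
    then show "a + b \<in> N" using mD(3) by (auto simp: N_def)
  next
    fix a b assume "a \<in> S" "b \<in> N"
    then obtain i j where "a \<in> R i" "b \<in> m j" by (auto simp: N_def S_def)
    then have "a \<in> R (max i j)" "b \<in> m (max i j)" using m_mono[of j "max i j"] R_mono[of i "max i j"] by auto
    then show "a * b \<in> N" using mD(6) by (auto simp: N_def)
  qed
qed (rule S_sub)

lemma NI: "is_ideal S N" using S_local by (simp add: local_ring_def N_eq)
lemmas ND = idealD[OF S_sub NI]
lemma N_prime: "prime_ideal S N" using max_ideal_prime[OF S_local] by (simp add: N_eq)
lemma prime_N: "prime_ideal S p \<Longrightarrow> p \<subseteq> N" using prime_le_max[OF S_sub] N_eq by simp

lemma unit_S: "u \<in> S \<Longrightarrow> u \<notin> N \<Longrightarrow> u \<noteq> 0 \<and> inverse u \<in> S" using max_ideal_unit[of u S] N_eq by simp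
lemma unit_N: "u \<noteq> 0 \<Longrightarrow> inverse u \<in> S \<Longrightarrow> u \<notin> N" using unit_notin_max[of u S] N_eq by simp

lemma R_unit: "u \<in> R i \<Longrightarrow> u \<notin> m i \<Longrightarrow> u \<notin> N"
  using max_ideal_unit[of u "R i"] R_S[of i] unit_N by auto

lemma m_eq: "R i \<inter> N = m i"
  using R_unit m_R by (auto simp: N_def)

lemma x_N: "x i \<in> N" and x_S: "x i \<in> S"
  using x_m x_R R_S by (auto simp: N_def)

lemma N_nonzero: "N \<noteq> {0}" using x_N x_nz by blast

text \<open>Each \<open>f \<in> m i\<close> is divisible in \<open>S\<close> by every
  \<open>x j\<close> with \<open>j \<ge> i\<close>, so arbitrarily late \<open>x j\<close> in
  \<open>p\<close> force \<open>f \<in> p\<close>.\<close>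

lemma prime_top:
  assumes p: "prime_ideal S p" and inf: "\<And>l. \<exists>j\<ge>l. x j \<in> p" shows "p = N"
proof
  show "p \<subseteq> N" by (rule prime_N[OF p])
  show "N \<subseteq> p"
  proof
    fix f assume "f \<in> N"
    then obtain i where i: "f \<in> m i" by (auto simp: N_def)
    obtain j where j: "j \<ge> i" "x j \<in> p" using inf by blast
    have "f / x j \<in> S" using div_x[of f j] i m_mono[OF j(1)] R_S by blast
    then have "(f / x j) * x j \<in> p" using idealD(6)[OF S_sub primeD(1)[OF S_sub p] _ j(2)] by blast
    then show "f \<in> p" using x_nz by simp
  qed
qed

lemma quotient: "\<exists>a b. a \<in> R i \<and> b \<in> R i \<and> b \<noteq> 0 \<and> q = a / b"
  using quot R_mono[of 0 i] unfolding has_quotient_field_def by blast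

abbreviation "fo i \<equiv> ord_field (R i)"

text \<open>Additivity of the order makes the value independent of the fraction picked by
  \<open>SOME\<close>.\<close>

lemma fo_eq:
  assumes "a \<in> R i" "b \<in> R i" "a \<noteq> 0" "b \<noteq> 0"
  shows "fo i (a / b) = int (od i a) - int (od i b)"
proof -
  let ?P = "\<lambda>(c, d). c \<in> R i \<and> d \<in> R i \<and> c \<noteq> 0 \<and> d \<noteq> 0 \<and> a / b = c / d"
  have "?P (SOME p. ?P p)" by (rule someI[of ?P "(a, b)"]) (use assms in auto)
  then obtain c d where cd: "(SOME p. ?P p) = (c, d)" "c \<in> R i" "d \<in> R i" "c \<noteq> 0" "d \<noteq> 0" "a / b = c / d"
    by (cases "SOME p. ?P p") auto
  have "a * d = c * b" using cd assms by (simp add: field_simps)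
  then have "od i a + od i d = od i c + od i b" using o_mult assms cd by metis
  then show ?thesis unfolding ord_field_def cd(1) by simp
qed

lemma fo_R: "a \<in> R i \<Longrightarrow> a \<noteq> 0 \<Longrightarrow> fo i a = int (od i a)"
  using fo_eq[of a i 1] RD o_one by simp

lemma fo_mult: "p \<noteq> 0 \<Longrightarrow> q \<noteq> 0 \<Longrightarrow> fo i (p * q) = fo i p + fo i q"
proof -
  assume pq: "p \<noteq> 0" "q \<noteq> 0"
  obtain a b where a: "a \<in> R i" "b \<in> R i" "b \<noteq> 0" "p = a / b" using quotient by blast
  obtain c d where c: "c \<in> R i" "d \<in> R i" "d \<noteq> 0" "q = c / d" using quotient by blast
  have nz: "a \<noteq> 0" "c \<noteq> 0" using a c pq by auto
  have "fo i (p * q) = fo i ((a * c) / (b * d))" using a c by simp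
  also have "\<dots> = int (od i (a * c)) - int (od i (b * d))" using a c nz RD by (intro fo_eq) auto
  also have "\<dots> = fo i p + fo i q" using a c nz by (simp add: o_mult fo_eq)
  finally show ?thesis .
qed

lemma fo_inverse: "p \<noteq> 0 \<Longrightarrow> fo i (inverse p) = - fo i p"
  using fo_mult[of p "inverse p" i] fo_R[of 1 i] RD o_one by simp

lemma fo_divide: "p \<noteq> 0 \<Longrightarrow> q \<noteq> 0 \<Longrightarrow> fo i (p / q) = fo i p - fo i q"
  using fo_mult[of p "inverse q" i] fo_inverse by (simp add: divide_inverse)

lemma fo_power: "p \<noteq> 0 \<Longrightarrow> fo i (p ^ n) = int n * fo i p"
  by (induction n) (use fo_R[of 1 i] RD o_one in \<open>auto simp: fo_mult algebra_simps\<close>)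

subsection \<open>Order transforms and simple transforms\<close>

definition pr :: "nat \<Rightarrow> nat \<Rightarrow> 'a" where "pr l n = (\<Prod>j\<in>{l..<n}. x j)"

lemma pr_self [simp]: "pr l l = 1" by (simp add: pr_def)
lemma pr_Suc: "l \<le> n \<Longrightarrow> pr l (Suc n) = pr l n * x n" by (simp add: pr_def)
lemma pr_nz: "pr l n \<noteq> 0" by (simp add: pr_def x_nz)
lemma x_R': "j \<le> n \<Longrightarrow> x j \<in> R n" using R_mono x_R by blast
lemma pr_R: "pr l n \<in> R n" unfolding pr_def by (rule subring_prod[OF sub]) (simp add: x_R')
lemma pr_S: "pr l n \<in> S" using pr_R R_S by blast

lemma o_pr: "od n (pr l n) = (\<Sum>j\<in>{l..<n}. od n (x j))"
  unfolding pr_def by (rule o_prod) (simp add: x_R' x_nz)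

text \<open>One factor \<open>x n\<close> is removed per step, in contrast to \<open>ot\<close>
  below, which removes the full power given by the order.\<close>

definition stays :: "'a \<Rightarrow> nat \<Rightarrow> bool" where
  "stays f l \<longleftrightarrow> (\<forall>n\<ge>l. f / pr l n \<in> m n)"

text \<open>A nonunit of \<open>R n\<close> is divisible by \<open>x n\<close> in
  \<open>R (Suc n)\<close>, so the division continues either forever or until the quotient is a
  unit.\<close>

lemma stays_or_dies:
  assumes f: "f \<in> R l" "f \<noteq> 0"
  shows "stays f l \<or> (\<exists>n\<ge>l. \<exists>u\<in>R n. u \<notin> N \<and> f = u * pr l n)"
proof (rule ccontr)
  assume no: "\<not> ?thesis"
  have "f / pr l n \<in> R n \<and> f / pr l n \<in> m n" if "l \<le> n" for n
    using that
  proof (induction n rule: dec_induct)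
    case base
    have "f \<in> m l" using no f R_unit by (metis order_refl pr_self mult.right_neutral)
    then show ?case using f by simp
  next
    case (step n)
    have "f / pr l (Suc n) = (f / pr l n) / x n" using pr_Suc[OF step(1)] by simp
    then have 1: "f / pr l (Suc n) \<in> R (Suc n)" using div_x[of "f / pr l n" n] step by metis
    have "f = (f / pr l (Suc n)) * pr l (Suc n)" using pr_nz by simp
    then have "f / pr l (Suc n) \<in> N" using no 1 step by (metis le_SucI)
    then show ?case using 1 m_eq[of "Suc n"] by blast
  qed
  then show False using no by (auto simp: stays_def)
qed

fun ot :: "'a \<Rightarrow> nat \<Rightarrow> nat \<Rightarrow> 'a" where
  "ot f l 0 = f"
| "ot f l (Suc k) = ot f l k / x (l + k) ^ od (l + k) (ot f l k)"

lemma ot_R: "f \<in> R l \<Longrightarrow> f \<noteq> 0 \<Longrightarrow> ot f l k \<in> R (l + k) \<and> ot f l k \<noteq> 0"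
  by (induction k) (use div_pow x_nz in auto)

lemma ot_o_Suc: "f \<in> R l \<Longrightarrow> f \<noteq> 0 \<Longrightarrow> od (l + Suc k) (ot f l (Suc k)) \<le> od (l + k) (ot f l k)"
  using o_transform ot_R by simp

lemma ot_o_antimono: "f \<in> R l \<Longrightarrow> f \<noteq> 0 \<Longrightarrow> k \<le> n \<Longrightarrow> od (l + n) (ot f l n) \<le> od (l + k) (ot f l k)"
  using lift_Suc_antimono_le[of "\<lambda>k. od (l + k) (ot f l k)" k n] ot_o_Suc by simp

lemma ot_prod: "f \<in> R l \<Longrightarrow> f \<noteq> 0 \<Longrightarrow> f = ot f l k * (\<Prod>j<k. x (l + j) ^ od (l + j) (ot f l j))"
proof (induction k)
  case (Suc k)
  have "ot f l (Suc k) * x (l + k) ^ od (l + k) (ot f l k) = ot f l k"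
    using x_nz[of "l + k"] by (simp only: ot.simps) simp
  then have "f = (ot f l (Suc k) * x (l + k) ^ od (l + k) (ot f l k)) * (\<Prod>j<k. x (l + j) ^ od (l + j) (ot f l j))"
    using Suc by simp
  then show ?case by (simp only: prod.lessThan_Suc mult.assoc mult.commute mult.left_commute)
qed simp

lemma ot_mult:
  assumes "f \<in> R l" "f \<noteq> 0" "g \<in> R l" "g \<noteq> 0" shows "ot (f * g) l k = ot f l k * ot g l k"
proof (induction k)
  case (Suc k)
  then show ?case using ot_R[OF assms(1,2), of k] ot_R[OF assms(3,4), of k] by (simp add: o_mult power_add)
qed simp

lemma ot_shift: "ot f l (k + n) = ot (ot f l k) (l + k) n"
  by (induction n) (auto simp: add.assoc)

text \<open>If every \<open>x j\<close> can be divided out of \<open>f\<close> once, then the orders of \<open>f\<close> grow fast enough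
  to dominate those of any other element: the exponents of the order transform are bounded.\<close>

lemma order_domination:
  assumes e: "e \<in> R l" "e \<noteq> 0" and f: "stays f l" "f \<noteq> 0"
  shows "l \<le> n \<Longrightarrow> od n e \<le> od l e * od n f"
proof -
  assume ln: "l \<le> n"
  then obtain k where k: "n = l + k" using le_Suc_ex by blast
  let ?r = "od l e"
  let ?E = "\<lambda>j. od (l + j) (ot e l j)"
  have xR: "x (l + j) \<in> R n" if "j < k" for j using x_R[of "l + j"] R_mono[of "l + j" n] k that by auto
  have p: "(\<Prod>j<k. x (l + j) ^ ?E j) \<in> R n" "(\<Prod>j<k. x (l + j) ^ ?E j) \<noteq> 0"
    using x_nz by (auto intro!: subring_prod[OF sub] subring_power[OF sub] xR)
  have "od n e = od n (ot e l k) + od n (\<Prod>j<k. x (l + j) ^ ?E j)"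
    using o_mult[of "ot e l k" n] ot_prod[OF e, of k] ot_R[OF e, of k] p k by metis
  also have "od n (\<Prod>j<k. x (l + j) ^ ?E j) = (\<Sum>j<k. ?E j * od n (x (l + j)))"
    using xR x_nz by (subst o_prod) (auto simp: o_power intro!: subring_power[OF sub])
  also have "\<dots> \<le> (\<Sum>j<k. ?r * od n (x (l + j)))"
    using ot_o_antimono[OF e, of 0] by (intro sum_mono mult_right_mono) auto
  also have "\<dots> = ?r * od n (pr l n)"
  proof -
    have "(\<Sum>j\<in>{l..<l + k}. g j) = (\<Sum>j<k. g (l + j))" for g :: "nat \<Rightarrow> nat"
      using sum.shift_bounds_nat_ivl[of g 0 l k] by (simp add: add.commute atLeast0LessThan)
    then show ?thesis unfolding o_pr k sum_distrib_left[symmetric] by simp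
  qed
  also have "od n (ot e l k) \<le> ?r" using ot_o_antimono[OF e, of 0 k] k by simp
  finally have 1: "od n e \<le> ?r * (1 + od n (pr l n))" by (simp add: algebra_simps)
  have fn: "f / pr l n \<in> m n" "f / pr l n \<noteq> 0" using f ln pr_nz by (auto simp: stays_def)
  have "od n f = od n (f / pr l n) + od n (pr l n)"
    using o_mult[of "f / pr l n" n "pr l n"] fn m_R pr_R pr_nz by auto
  then have "1 + od n (pr l n) \<le> od n f" using o_pos[OF fn] by simp
  then show "od n e \<le> ?r * od n f" using 1 by (meson le_trans mult_le_mono2)
qed

lemma stays_m: "stays f l \<Longrightarrow> f \<in> m l"
  unfolding stays_def by (metis div_by_1 order_refl pr_self)

text \<open>With \<open>M = Suc (od l e)\<close> the bound of \<open>order_domination\<close>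
  becomes strict. Negative orders at all late stages exclude the quotient from \<open>S\<close> and
  from the boundary valuation ring, which is how \<open>stays f l\<close> is refuted.\<close>

lemma fo_negative:
  assumes e: "e \<in> R l" "e \<noteq> 0" and f: "stays f l" "f \<noteq> 0"
  obtains M where "\<And>n. l \<le> n \<Longrightarrow> fo n (e / f ^ M) < 0"
proof
  fix n assume n: "l \<le> n"
  have fR: "f \<in> m n" using stays_m[OF f(1)] m_mono[OF n] by auto
  have eR: "e \<in> R n" using e R_mono[OF n] by auto
  have "od n e < Suc (od l e) * od n f" using order_domination[OF e f n] o_pos[OF fR f(2)] by simp
  then have "int (od n e) < int (Suc (od l e)) * int (od n f)" by (metis of_nat_less_iff of_nat_mult)
  moreover have "fo n (e / f ^ Suc (od l e)) = int (od n e) - int (Suc (od l e)) * int (od n f)"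
    using fo_divide[of e "f ^ Suc (od l e)" n] fo_power[OF f(2), of n "Suc (od l e)"] fo_R[OF eR e(2)]
      fo_R[of f n] f e fR m_R by auto
  ultimately show "fo n (e / f ^ Suc (od l e)) < 0" by linarith
qed

lemma prime_dies:
  assumes p: "prime_ideal S p" and u: "u \<in> S" "u \<notin> N" and f: "u * pr l n \<in> p"
  shows "\<exists>j\<ge>l. x j \<in> p"
proof -
  have "u \<notin> p" using u prime_N[OF p] by auto
  then have "pr l n \<in> p" using primeD(3)[OF S_sub p u(1) pr_S] f by auto
  then show ?thesis using prime_prod[OF S_sub p, of "{l..<n}" x] x_S by (auto simp: pr_def)
qed

end

section \<open>Height one primes of the union and signs of orders at late stages\<close>

context quad_seq
begin

abbreviation "height_one_primes \<equiv> {P. prime_ideal S P \<and> height S P = 1}"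

lemma zero_prime: "prime_ideal S {0}" by (rule prime_zero[OF S_sub])

lemma zero_N: "{0} \<subset> N" using ND(1) N_nonzero by auto

lemma prime_zero_in: "prime_ideal S p \<Longrightarrow> 0 \<in> p"
  using idealD(1)[OF S_sub primeD(1)[OF S_sub]] .

lemma prime_S: "prime_ideal S p \<Longrightarrow> p \<subseteq> S"
  using idealD(2)[OF S_sub primeD(1)[OF S_sub]] by blast

lemma height_one_neq:
  assumes "P \<in> height_one_primes" "P \<noteq> N" shows "{0} \<subset> P" "P \<subset> N"
  using assms height_one_iff[OF S_sub, of P] prime_zero_in prime_N by blast+

lemma dim1_finite:
  assumes "krull_dim S = 1" shows "finite height_one_primes"
proof -
  have "P = N" if P: "P \<in> height_one_primes" for P
  proof (rule ccontr)
    assume "P \<noteq> N"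
    from krull_dim_ge[OF chain3[OF zero_prime _ N_prime height_one_neq[OF P this]]] P
    have "enat 2 \<le> 1" using assms by simp
    then show False by (simp add: one_enat_def)
  qed
  then have "height_one_primes \<subseteq> {N}" by blast
  then show ?thesis by (rule finite_subset) simp
qed

lemma unit_set_mult: "u \<in> S \<Longrightarrow> u \<notin> N \<Longrightarrow> v \<in> S \<Longrightarrow> v \<notin> N \<Longrightarrow> u * v \<in> S \<and> u * v \<notin> N"
  using SD(5) primeD(3)[OF S_sub N_prime] by blast

lemma eventually_S: "q \<in> S \<Longrightarrow> q \<noteq> 0 \<Longrightarrow> \<forall>\<^sub>F i in sequentially. fo i q \<ge> 0"
proof -
  assume q: "q \<in> S" "q \<noteq> 0"
  then obtain i where "\<forall>j\<ge>i. q \<in> R j" using S_common by blast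
  then show ?thesis unfolding eventually_sequentially using fo_R q by (metis of_nat_0_le_iff)
qed

lemma eventually_N: "q \<in> N \<Longrightarrow> q \<noteq> 0 \<Longrightarrow> \<forall>\<^sub>F i in sequentially. fo i q \<ge> 1"
proof -
  assume q: "q \<in> N" "q \<noteq> 0"
  then obtain i where i: "q \<in> m i" by (auto simp: N_def)
  have "fo j q \<ge> 1" if "j \<ge> i" for j
  proof -
    have qm: "q \<in> m j" using m_mono[OF that] i by auto
    then have "fo j q = int (od j q)" using fo_R[of q j] q m_R[of j] by auto
    then show ?thesis using o_pos[OF qm q(2)] by simp
  qed
  then show ?thesis unfolding eventually_sequentially by blast
qed

lemma not_eventually_inverse_N:
  assumes q: "q \<in> N" "q \<noteq> 0" shows "\<not> (\<forall>\<^sub>F i in sequentially. fo i (inverse q) \<ge> 0)"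
proof
  assume "\<forall>\<^sub>F i in sequentially. fo i (inverse q) \<ge> 0"
  then have "\<forall>\<^sub>F i in sequentially. fo i (inverse q) \<ge> 0 \<and> fo i q \<ge> 1" using eventually_N[OF q] by (rule eventually_conj)
  then obtain i where "fo i (inverse q) \<ge> 0 \<and> fo i q \<ge> 1" unfolding eventually_sequentially by blast
  then show False using fo_inverse[OF q(2), of i] by linarith
qed

lemma S_quotient: "\<exists>a b. a \<in> S \<and> b \<in> S \<and> b \<noteq> 0 \<and> q = a / b"
  using quotient[of 0 q] R_S by blast

end

section \<open>Dimension two with a lexicographic value group: finitely many height one
  primes\<close>

locale quad_seq_value = quad_seq +
  fixes v :: "'a \<Rightarrow> int \<times> rat" and G :: "rat set"
  assumes G0: "0 \<in> G"
    and v_mult: "\<And>a b. a \<noteq> 0 \<Longrightarrow> b \<noteq> 0 \<Longrightarrow> v (a * b) = (fst (v a) + fst (v b), snd (v a) + snd (v b))"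
    and v_surj: "v ` (UNIV - {0}) = {z. snd z \<in> G}"
    and v_V: "\<And>q. q \<noteq> 0 \<Longrightarrow> lex_nonneg (v q) \<longleftrightarrow> (\<forall>\<^sub>F i in sequentially. fo i q \<ge> 0)"
begin

text \<open>By the lexicographic order, \<open>w q \<ge> 1\<close> alone puts \<open>q\<close> into
  the boundary valuation ring, whatever the rational component.\<close>

definition w where "w q = fst (v q)"

lemma w_mult: "a \<noteq> 0 \<Longrightarrow> b \<noteq> 0 \<Longrightarrow> w (a * b) = w a + w b"
  by (simp add: w_def v_mult)

lemma v_one: "v 1 = (0, 0)"
  using v_mult[of 1 1] by (simp add: prod_eq_iff)

lemma v_inverse: "a \<noteq> 0 \<Longrightarrow> v (inverse a) = (- fst (v a), - snd (v a))"
  using v_mult[of a "inverse a"] v_one by (simp add: prod_eq_iff)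

lemma w_inverse: "a \<noteq> 0 \<Longrightarrow> w (inverse a) = - w a"
  by (simp add: w_def v_inverse)

lemma w_divide: "a \<noteq> 0 \<Longrightarrow> b \<noteq> 0 \<Longrightarrow> w (a / b) = w a - w b"
  using w_mult[of a "inverse b"] w_inverse by (simp add: divide_inverse)

lemma w_power: "a \<noteq> 0 \<Longrightarrow> w (a ^ n) = int n * w a"
  using v_one by (induction n) (auto simp: w_mult algebra_simps, simp add: w_def)

lemma w_S: "q \<in> S \<Longrightarrow> q \<noteq> 0 \<Longrightarrow> 0 \<le> w q"
  using eventually_S[of q] v_V[of q] by (auto simp: lex_nonneg_def w_def)

lemma w_pos_V: "q \<noteq> 0 \<Longrightarrow> 1 \<le> w q \<Longrightarrow> \<forall>\<^sub>F i in sequentially. fo i q \<ge> 0"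
  using v_V[of q] by (auto simp: lex_nonneg_def w_def)

text \<open>Here \<open>w \<ge> 1\<close> on all nonzero elements of \<open>N\<close>. An
  \<open>x n\<close> with least \<open>w\<close> divides every element of \<open>N\<close>, so every
  nonzero element of \<open>S\<close> is a unit times a power of \<open>x n\<close>, and
  \<open>N\<close> is the only possible height one prime.\<close>

lemma finite_case_pos:
  assumes pos: "\<And>i. 1 \<le> w (x i)" shows "finite height_one_primes"
proof -
  have wN: "1 \<le> w f" if f: "f \<in> N" "f \<noteq> 0" for f
  proof -
    obtain k where k: "f \<in> m k" using f by (auto simp: N_def)
    then have "f / x k \<in> S" using div_x R_S by blast
    then have "0 \<le> w (f / x k)" using f x_nz by (intro w_S) auto
    then show ?thesis using w_divide[OF f(2) x_nz] pos[of k] by simp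
  qed
  obtain n where n: "\<And>j. nat (w (x n)) \<le> nat (w (x j))"
    using ex_has_least_nat[of "\<lambda>_. True" _ "\<lambda>i. nat (w (x i))"] by auto
  have div: "f / x n \<in> S" if f: "f \<in> N" for f
  proof -
    obtain k where k: "f \<in> m k" using f by (auto simp: N_def)
    define j where "j = max k n"
    have fj: "f / x j \<in> S" using div_x[of f j] k m_mono[of k j] R_S by (auto simp: j_def)
    have xj: "x n / x j \<in> S" using div_x[of "x n" j] x_m[of n] m_mono[of n j] R_S by (auto simp: j_def)
    \<comment> \<open>Minimality of \<open>w (x n)\<close> makes \<open>x n / x j\<close> a unit of
      \<open>S\<close>, so divisibility by the late \<open>x j\<close> becomes divisibility by the
      fixed \<open>x n\<close>.\<close>
    have "w (x n / x j) < 1" using w_divide[OF x_nz x_nz, of n j] n[of j] pos[of j] by auto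
    then have "x n / x j \<notin> N" using wN[of "x n / x j"] x_nz by auto
    then have "inverse (x n / x j) \<in> S" using unit_S[OF xj] by auto
    then have "(f / x j) * inverse (x n / x j) \<in> S" using SD(5)[OF fj] by blast
    then show ?thesis using x_nz[of j] by (simp add: field_simps)
  qed
  have fac: "\<exists>k u. u \<in> S \<and> u \<notin> N \<and> f = u * x n ^ k" if "f \<in> S" "f \<noteq> 0" for f
    using that
  proof (induction "nat (w f)" arbitrary: f rule: less_induct)
    case less
    show ?case
    proof (cases "f \<in> N")
      case True
      have "nat (w (f / x n)) < nat (w f)" using w_divide[OF less.prems(2) x_nz, of n] pos[of n] wN[OF True less.prems(2)] by auto
      then obtain k u where "u \<in> S" "u \<notin> N" "f / x n = u * x n ^ k"
        using less.hyps[of "f / x n"] div[OF True] less.prems x_nz by auto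
      then show ?thesis using x_nz[of n] by (intro exI[of _ "Suc k"] exI[of _ u]) (auto simp: field_simps)
    next
      case False
      then show ?thesis using less.prems by (intro exI[of _ 0] exI[of _ f]) auto
    qed
  qed
  have "p = N" if p: "p \<in> height_one_primes" for p
  proof -
    have pp: "prime_ideal S p" using p by simp
    obtain f where f: "f \<in> p" "f \<noteq> 0" using p height_one_iff[OF S_sub pp] prime_zero_in[OF pp] by auto
    obtain k u where u: "u \<in> S" "u \<notin> N" "f = u * x n ^ k" using fac[of f] f prime_S[OF pp] by auto
    have "u \<notin> p" using u prime_N[OF pp] by auto
    then have "x n ^ k \<in> p" using primeD(3)[OF S_sub pp u(1), of "x n ^ k"] f u subring_power[OF S_sub x_S] by auto
    then have xp: "x n \<in> p" using prime_power[OF S_sub pp x_S] by auto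
    have "f \<in> p" if "f \<in> N" for f
      using idealD(6)[OF S_sub primeD(1)[OF S_sub pp] div[OF that] xp] x_nz by simp
    then show ?thesis using prime_N[OF pp] by blast
  qed
  then have "height_one_primes \<subseteq> {N}" by blast
  then show ?thesis by (rule finite_subset) simp
qed

text \<open>The set \<open>P\<close> where \<open>w\<close> is positive is a prime different from
  \<open>N\<close>, since it excludes \<open>x n0\<close>, and every prime other than
  \<open>N\<close> lies in it. A height one prime other than \<open>N\<close> and \<open>P\<close>
  would then give a chain of length three.\<close>

lemma finite_case_zero:
  assumes n0: "w (x n0) = 0" and dim2: "krull_dim S = 2" shows "finite height_one_primes"
proof -
  obtain q where q: "q \<noteq> 0" "v q = (1, 0)"
  proof -
    have "(1, 0) \<in> v ` (UNIV - {0})" unfolding v_surj using G0 by simp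
    then show ?thesis using that by (metis DiffE imageE singletonI)
  qed
  obtain e c where ec: "e \<in> S" "c \<in> S" "c \<noteq> 0" "q = e / c" using S_quotient by blast
  have e0: "e \<noteq> 0" using ec q by auto
  have we: "1 \<le> w e" using w_divide[OF e0 ec(3)] w_S[OF ec(2,3)] q(2) ec(4) by (simp add: w_def)
  define P where "P = {f \<in> S. f = 0 \<or> 1 \<le> w f}"
  have PI: "is_ideal S P"
    unfolding is_ideal_def
  proof (intro conjI ballI)
    show "P \<subseteq> S" "0 \<in> P" using SD(1) by (auto simp: P_def)
    show "a * f \<in> P" if "a \<in> S" "f \<in> P" for a f
      using that w_mult[of a f] w_S[of a] SD(5) by (cases "a = 0"; cases "f = 0") (auto simp: P_def)
    fix f g assume fg: "f \<in> P" "g \<in> P"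
    show "f + g \<in> P"
    proof (rule ccontr)
      assume no: "f + g \<notin> P"
      have fgS: "f \<in> S" "g \<in> S" "f + g \<in> S" using fg SD(3) by (auto simp: P_def)
      have nz: "f \<noteq> 0" "g \<noteq> 0" using no fg by auto
      have h: "f + g \<noteq> 0" "w (f + g) = 0" using no fgS w_S[of "f + g"] by (auto simp: P_def)
      \<comment> \<open>The factor \<open>x n0\<close> in the denominator costs nothing in
        \<open>w\<close> but has order at least one at late stages; this supplies the
        \<open>+ 1\<close>. A sum cannot have smaller order than both its terms, so this leads to a
        contradiction for \<open>f + g\<close>.\<close>
      have ge: "\<forall>\<^sub>F i in sequentially. fo i (f + g) + 1 \<le> fo i z" if z: "z \<noteq> 0" "1 \<le> w z" for z
      proof -
        have hx: "(f + g) * x n0 \<noteq> 0" using h x_nz by simp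
        have "1 \<le> w (z / ((f + g) * x n0))" using w_divide[OF z(1) hx] w_mult[OF h(1) x_nz] z h n0 by simp
        then have "\<forall>\<^sub>F i in sequentially. 0 \<le> fo i (z / ((f + g) * x n0))" using z hx by (intro w_pos_V) auto
        then show ?thesis using eventually_N[OF x_N x_nz, of n0]
        proof eventually_elim
          case (elim i)
          then show ?case using fo_divide[OF z(1) hx, of i] fo_mult[OF h(1) x_nz, of i n0] by simp
        qed
      qed
      obtain i1 where i1: "\<forall>j\<ge>i1. f \<in> R j" using S_common fgS by blast
      obtain i2 where i2: "\<forall>j\<ge>i2. g \<in> R j" using S_common fgS by blast
      have "\<forall>\<^sub>F i in sequentially. fo i (f + g) + 1 \<le> fo i f \<and> fo i (f + g) + 1 \<le> fo i g"
        using ge[of f] ge[of g] nz fg by (intro eventually_conj) (auto simp: P_def)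
      then obtain i3 where i3: "\<forall>i\<ge>i3. fo i (f + g) + 1 \<le> fo i f \<and> fo i (f + g) + 1 \<le> fo i g"
        unfolding eventually_sequentially by blast
      define i where "i = max i1 (max i2 i3)"
      have i: "f \<in> R i" "g \<in> R i" "fo i (f + g) + 1 \<le> fo i f" "fo i (f + g) + 1 \<le> fo i g"
        using i1 i2 i3 by (auto simp: i_def)
      then have "Suc (od i (f + g)) \<le> od i f" "Suc (od i (f + g)) \<le> od i g" using fo_R nz h RD(3) by auto
      then have "Suc (od i (f + g)) \<le> od i (f + g)" using o_add i nz h by blast
      then show False by simp
    qed
  qed
  have w1: "w 1 = 0" using v_one by (simp add: w_def)
  have P: "prime_ideal S P"
  proof (rule primeI[OF PI])
    show "1 \<notin> P" "1 \<in> S" using w1 SD(2) by (auto simp: P_def)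
    show "a \<in> P \<or> b \<in> P" if "a \<in> S" "b \<in> S" "a * b \<in> P" for a b
    proof (cases "a = 0 \<or> b = 0")
      case True then show ?thesis using SD(1) by (auto simp: P_def)
    next
      case False
      then show ?thesis using that w_mult[of a b] w_S[of a] w_S[of b] by (auto simp: P_def)
    qed
  qed
  have xP: "x n0 \<notin> P" using n0 x_nz by (simp add: P_def)
  have below: "p \<subseteq> P" if p: "prime_ideal S p" "p \<noteq> N" for p
  proof (rule subsetI, rule ccontr)
    fix f assume f: "f \<in> p" "f \<notin> P"
    have fS: "f \<in> S" "f \<noteq> 0" using f prime_S[OF p(1)] SD(1) by (auto simp: P_def)
    have wf: "w f = 0" using f fS w_S[OF fS] by (simp add: P_def)
    \<comment> \<open>If \<open>f\<close> stayed, some \<open>e / f ^ M\<close> would have negative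
      order at late stages, although its \<open>w\<close> is that of \<open>e\<close>, hence
      positive. So \<open>f\<close> is a unit times a product of late \<open>x j\<close>, one of
      which lies in \<open>p\<close>.\<close>
    have "\<exists>j\<ge>l. x j \<in> p" for l
    proof -
      obtain l' where l': "l' \<ge> l" "e \<in> R l'" "f \<in> R l'" using S_common2[OF ec(1) fS(1)] by blast
      have "\<not> stays f l'"
      proof
        assume "stays f l'"
        then obtain M where M: "\<And>n. l' \<le> n \<Longrightarrow> fo n (e / f ^ M) < 0"
          using fo_negative[OF l'(2) e0 _ fS(2)] by blast
        have "1 \<le> w (e / f ^ M)" using w_divide[OF e0, of "f ^ M"] w_power[OF fS(2)] we wf fS by simp
        then have "\<forall>\<^sub>F i in sequentially. 0 \<le> fo i (e / f ^ M)" using e0 fS by (intro w_pos_V) auto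
        then obtain i where "\<forall>j\<ge>i. 0 \<le> fo j (e / f ^ M)" unfolding eventually_sequentially by blast
        then have "0 \<le> fo (max i l') (e / f ^ M)" by simp
        then show False using M[of "max i l'"] by simp
      qed
      then obtain n u where "u \<in> R n" "u \<notin> N" "f = u * pr l' n" using stays_or_dies[OF l'(3) fS(2)] by blast
      then have "\<exists>j\<ge>l'. x j \<in> p" using prime_dies[OF p(1), of u l' n] f R_S by blast
      then show ?thesis using l'(1) le_trans by blast
    qed
    then show False using prime_top[OF p(1)] p(2) by blast
  qed
  have "p = N \<or> p = P" if p: "p \<in> height_one_primes" for p
  proof (rule ccontr)
    assume no: "\<not> ?thesis"
    then have "p \<subset> P" using below p by blast
    moreover have "P \<subset> N" using prime_N[OF P] x_N xP by blast
    ultimately have "enat 3 \<le> krull_dim S"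
      using krull_dim_ge[OF chain4[OF zero_prime _ P N_prime height_one_neq(1)[OF p]]] p no by blast
    then show False unfolding dim2 by (simp add: numeral_eq_enat)
  qed
  then have "height_one_primes \<subseteq> {N, P}" by blast
  then show ?thesis by (rule finite_subset) simp
qed

lemma finite_height_one: "krull_dim S = 2 \<Longrightarrow> finite height_one_primes"
proof (cases "\<forall>i. 1 \<le> w (x i)")
  case False
  then obtain i where "\<not> 1 \<le> w (x i)" by blast
  then have "w (x i) = 0" using w_S[OF x_S x_nz, of i] by simp
  then show "krull_dim S = 2 \<Longrightarrow> ?thesis" by (rule finite_case_zero)
qed (use finite_case_pos in blast)

end

context quad_seq
begin

lemma dim2_finite:
  assumes "krull_dim S = 2" "rat_subgroup G" "value_group_is_Z_lex (boundary_valuation_ring R) G"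
  shows "finite height_one_primes"
proof -
  obtain v :: "'a \<Rightarrow> int \<times> rat" where v:
    "\<forall>x y. x \<noteq> 0 \<longrightarrow> y \<noteq> 0 \<longrightarrow> v (x * y) = (fst (v x) + fst (v y), snd (v x) + snd (v y))"
    "v ` (UNIV - {0}) = {z. snd z \<in> G}"
    "\<forall>x. x \<noteq> 0 \<longrightarrow> (x \<in> boundary_valuation_ring R) = lex_nonneg (v x)"
    using assms(3) unfolding value_group_is_Z_lex_def by blast
  interpret quad_seq_value R x Q v G
    by unfold_locales (use assms(2) v in \<open>auto simp: rat_subgroup_def boundary_valuation_ring_def\<close>)
  show ?thesis by (rule finite_height_one[OF assms(1)])
qed

subsection \<open>Localizations of the union at non-maximal primes\<close>

lemma not_top_x: "prime_ideal S p \<Longrightarrow> p \<noteq> N \<Longrightarrow> \<exists>l. \<forall>j\<ge>l. x j \<notin> p"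
  using prime_top by blast

lemma contract_S: "prime_ideal S p \<Longrightarrow> prime_ideal (R j) (p \<inter> R j)"
proof (rule primeI)
  assume p: "prime_ideal S p"
  note pI = idealD[OF S_sub primeD(1)[OF S_sub p]]
  show "is_ideal (R j) (p \<inter> R j)" unfolding is_ideal_def
  proof (intro conjI ballI)
    show "0 \<in> p \<inter> R j" using pI(1) RD(1) by blast
    show "a + b \<in> p \<inter> R j" if "a \<in> p \<inter> R j" "b \<in> p \<inter> R j" for a b using that pI(3) RD(3) by blast
    show "a * b \<in> p \<inter> R j" if "a \<in> R j" "b \<in> p \<inter> R j" for a b using that pI(6) RD(5) R_S by blast
  qed simp
  show "1 \<notin> p \<inter> R j" using primeD(2)[OF S_sub p] by blast
  show "1 \<in> R j" by (rule RD)
  show "a \<in> p \<inter> R j \<or> b \<in> p \<inter> R j" if "a \<in> R j" "b \<in> R j" "a * b \<in> p \<inter> R j" for a b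
    using that primeD(3)[OF S_sub p, of a b] R_S[of j] by blast
qed

text \<open>A denominator used in passing from \<open>R n\<close> to \<open>R (Suc n)\<close> is a
  unit of \<open>R (Suc n)\<close> times a power of \<open>x n\<close>. For \<open>n \<ge> j\<close>
  it is therefore outside \<open>p\<close>, and denominators can be collected step by step.\<close>

lemma denominator:
  assumes p: "prime_ideal S p" and l: "\<And>i. j \<le> i \<Longrightarrow> x i \<notin> p" and f: "f \<in> S"
  shows "\<exists>s\<in>R j. s \<notin> p \<and> s * f \<in> R j"
proof -
  have pm: "a * b \<notin> p" if "a \<in> S" "b \<in> S" "a \<notin> p" "b \<notin> p" for a b
    using primeD(3)[OF S_sub p] that by blast
  have "\<forall>f\<in>R (j + k). \<exists>s\<in>R j. s \<notin> p \<and> s * f \<in> R j" for k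
  proof (induction k)
    case 0 then show ?case using RD(2) primeD(2)[OF S_sub p] by force
  next
    case (Suc k)
    show ?case
    proof
      fix f assume "f \<in> R (j + Suc k)"
      then have "f \<in> R (Suc (j + k))" by simp
      then obtain n a b where ab: "a \<in> R (j + k)" "b \<in> R (j + k)" "b \<noteq> 0" "f = a / b"
          "b / x (j + k) ^ n \<in> R (Suc (j + k))" "b / x (j + k) ^ n \<notin> m (Suc (j + k))"
        by (rule frac)
      have "b / x (j + k) ^ n \<notin> N" using R_unit ab by blast
      then have "b / x (j + k) ^ n \<notin> p" using prime_N[OF p] by blast
      moreover have "x (j + k) ^ n \<notin> p" using prime_power[OF S_sub p x_S, of "j + k" n] l[of "j + k"] by auto
      ultimately have "b / x (j + k) ^ n * x (j + k) ^ n \<notin> p"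
        using pm ab(5) R_S subring_power[OF S_sub x_S] by blast
      then have bp: "b \<notin> p" using x_nz by simp
      obtain s where s: "s \<in> R j" "s \<notin> p" "s * a \<in> R j" using Suc ab by blast
      obtain t where t: "t \<in> R j" "t \<notin> p" "t * b \<in> R j" using Suc ab by blast
      have S: "s \<in> S" "t \<in> S" "b \<in> S" using s t ab R_S by blast+
      have "s * (t * b) \<notin> p" using pm S s t bp SD(5) by blast
      moreover have "s * (t * b) \<in> R j" using RD(5) s t by blast
      moreover have "s * (t * b) * f = t * (s * a)" using ab by simp
      moreover have "t * (s * a) \<in> R j" using RD(5) s t by blast
      ultimately show "\<exists>s\<in>R j. s \<notin> p \<and> s * f \<in> R j" by metis
    qed
  qed
  moreover obtain n where "f \<in> R n" using f by (auto simp: S_def)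
  then have "f \<in> R (j + n)" using R_mono[of n "j + n"] by auto
  ultimately show ?thesis by blast
qed

lemma S_localize:
  assumes p: "prime_ideal S p" and l: "\<And>i. j \<le> i \<Longrightarrow> x i \<notin> p"
  shows "S \<subseteq> localize (R j) (p \<inter> R j)"
proof
  fix f assume "f \<in> S"
  then obtain s where s: "s \<in> R j" "s \<notin> p" "s * f \<in> R j" using denominator[OF p l] by blast
  have "s \<noteq> 0" using s prime_zero_in[OF p] by auto
  then have "f = (s * f) / s" by simp
  then show "f \<in> localize (R j) (p \<inter> R j)" using s unfolding localize_def by blast
qed

text \<open>At a late stage \<open>S\<close> is contained in the localization of \<open>R j\<close>
  at \<open>p \<inter> R j\<close>, a noetherian local ring, where Krull's intersection theorem
  applies.\<close>

lemma not_infinitely_divisible: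
  assumes p: "prime_ideal S p" "p \<noteq> N" and y: "y \<in> p" "y \<noteq> 0" and a: "a \<in> S" "a \<noteq> 0"
  shows "\<exists>k. a / y ^ k \<notin> S"
proof (rule ccontr)
  assume no: "\<not> ?thesis"
  obtain l where l: "\<And>j. j \<ge> l \<Longrightarrow> x j \<notin> p" using not_top_x[OF p] by blast
  have "y \<in> S" using y prime_S[OF p(1)] by auto
  then obtain j where j: "j \<ge> l" "a \<in> R j" "y \<in> R j" using S_common2[OF a(1)] by blast
  have P: "prime_ideal (R j) (p \<inter> R j)" by (rule contract_S[OF p(1)])
  let ?L = "localize (R j) (p \<inter> R j)"
  have SL: "S \<subseteq> ?L" by (rule S_localize[OF p(1)]) (use l j in auto)
  note L = localize_subring[OF sub P]
  have LM: "is_ideal ?L (max_ideal ?L)" using localize_local[OF sub P] by (simp add: local_ring_def)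
  have ym: "y \<in> max_ideal ?L" unfolding max_localize[OF sub P] using ext_ideal_sup[OF sub P] y j by blast
  obtain n where n: "a \<notin> ideal_pow ?L (max_ideal ?L) n"
    using pow_bound[OF localize_local[OF sub P] localize_noetherian[OF sub P noe] a(2)] by blast
  have "y ^ n * (a / y ^ n) \<in> ideal_pow ?L (max_ideal ?L) n"
    using idealD(7)[OF L ideal_pow_ideal[OF L LM] ideal_pow_power[OF L ym]] no SL by blast
  then show False using n y by simp
qed

end

subsection \<open>The union as a valuation ring\<close>

locale quad_seq_val = quad_seq +
  assumes val: "valuation_ring S"
begin

lemma val_dvd: "a \<noteq> 0 \<Longrightarrow> b \<noteq> 0 \<Longrightarrow> a / b \<in> S \<or> b / a \<in> S"
  using val unfolding valuation_ring_def by (metis divide_eq_0_iff inverse_divide)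

lemma dvd_of_notin:
  assumes p: "prime_ideal S p" and y: "y \<in> S" "y \<notin> p" and a: "a \<in> p" shows "a / y \<in> S"
proof (cases "a = 0")
  case False
  have "y / a \<notin> S"
  proof
    assume "y / a \<in> S"
    then have "(y / a) * a \<in> p" using idealD(6)[OF S_sub primeD(1)[OF S_sub p] _ a] by blast
    then show False using y False by simp
  qed
  moreover have "y \<noteq> 0" using y prime_zero_in[OF p] by auto
  ultimately show ?thesis using val_dvd[OF False] by blast
qed (use SD(1) in simp)

lemma div_in_prime:
  assumes p: "prime_ideal S p" and y: "y \<in> S" "y \<notin> p" and a: "a \<in> p" shows "a / y \<in> p"
proof -
  have "y \<noteq> 0" using y prime_zero_in[OF p] by auto
  then have "(a / y) * y \<in> p" using a by simp
  then show ?thesis using primeD(3)[OF S_sub p dvd_of_notin[OF p y a] y(1)] y(2) by blast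
qed

lemma primes_comparable:
  assumes p: "prime_ideal S p" and q: "prime_ideal S q" shows "p \<subseteq> q \<or> q \<subseteq> p"
proof (rule ccontr)
  assume "\<not> ?thesis"
  then obtain a b where ab: "a \<in> p" "a \<notin> q" "b \<in> q" "b \<notin> p" by blast
  have b: "b \<in> S" "b \<noteq> 0" using ab prime_S[OF q] prime_zero_in[OF p] by auto
  have "b / a \<in> q" using div_in_prime[OF q _ ab(2,3)] ab prime_S[OF p] by blast
  then have "(b / a) * a \<in> p" using idealD(6)[OF S_sub primeD(1)[OF S_sub p] _ ab(1)] prime_S[OF q] by blast
  then show False using ab prime_zero_in[OF q] by (metis nonzero_mult_div_cancel_left times_divide_eq_left mult.commute)
qed

text \<open>In a valuation ring a nonzero \<open>a \<in> q\<close> is divisible by all powers of any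
  \<open>y \<in> p\<close> outside \<open>q\<close>, against
  \<open>not_infinitely_divisible\<close>.\<close>

lemma below_nonmax:
  assumes p: "prime_ideal S p" "p \<noteq> N" and q: "prime_ideal S q" "q \<subset> p" shows "q = {0}"
proof (rule ccontr)
  assume "q \<noteq> {0}"
  then obtain a where a: "a \<in> q" "a \<noteq> 0" using prime_zero_in[OF q(1)] by blast
  obtain y where y: "y \<in> p" "y \<notin> q" using q by blast
  have yS: "y \<in> S" using y prime_S[OF p(1)] by auto
  have "a / y ^ k \<in> q" for k
  proof (induction k)
    case (Suc k)
    have "a / y ^ Suc k = (a / y ^ k) / y" by simp
    then show ?case using div_in_prime[OF q(1) yS y(2) Suc] by metis
  qed (use a in simp)
  moreover have "y \<noteq> 0" using y prime_zero_in[OF q(1)] by auto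
  ultimately show False using not_infinitely_divisible[OF p y(1), of a] a prime_S[OF q(1)] by blast
qed

text \<open>An element outside \<open>S\<close> is the inverse of an element of \<open>N\<close>,
  whose orders are positive at all late stages.\<close>

lemma boundary_eq: "boundary_valuation_ring R = S"
proof
  show "S \<subseteq> boundary_valuation_ring R"
    using eventually_S by (auto simp: boundary_valuation_ring_def)
  show "boundary_valuation_ring R \<subseteq> S"
  proof
    fix q assume q: "q \<in> boundary_valuation_ring R"
    show "q \<in> S"
    proof (rule ccontr)
      assume n: "q \<notin> S"
      then have q0: "q \<noteq> 0" using SD(1) by auto
      then have i: "inverse q \<in> S" using val n unfolding valuation_ring_def by blast
      then have "inverse q \<in> N" using n unit_S[OF i] by auto
      then have "\<not> (\<forall>\<^sub>F i in sequentially. fo i (inverse (inverse q)) \<ge> 0)"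
        using q0 by (intro not_eventually_inverse_N) auto
      then show False using q q0 by (simp add: boundary_valuation_ring_def)
    qed
  qed
qed

lemma dim_one:
  assumes "\<And>p. prime_ideal S p \<Longrightarrow> p = {0} \<or> p = N" shows "krull_dim S = 1"
proof -
  have "krull_dim S \<le> enat 1"
    by (rule krull_dim_le_card[OF S_sub, of "{{0}, N}"]) (use assms in \<open>auto simp: card_insert_if\<close>)
  moreover have "enat 1 \<le> krull_dim S" by (rule krull_dim_ge[OF chain2[OF zero_prime N_prime zero_N]])
  ultimately show ?thesis by (simp add: one_enat_def)
qed

end

section \<open>The value group of a valuation ring \<open>S\<close> that has a prime strictly
  between zero and \<open>N\<close>\<close>

locale quad_seq_val2 = quad_seq_val +
  fixes P assumes P: "prime_ideal S P" and PN: "P \<noteq> N" and P0: "P \<noteq> {0}"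
begin

lemma primes: "prime_ideal S p \<Longrightarrow> p = {0} \<or> p = P \<or> p = N"
proof -
  assume p: "prime_ideal S p"
  show ?thesis
  proof (cases "p = N \<or> p = P")
    case False
    then have "p \<subset> P \<or> P \<subset> p" using primes_comparable[OF p P] by blast
    then show ?thesis using below_nonmax[OF P PN p] below_nonmax[OF p _ P] False P0 by blast
  qed auto
qed

lemma dim_two: "krull_dim S = 2"
proof -
  have "krull_dim S \<le> enat 2"
  proof (rule krull_dim_le_card[OF S_sub, of "{{0}, P, N}"])
    show "card {{0}, P, N} \<le> Suc 2" by (simp add: card_insert_if)
  qed (use primes in auto)
  moreover have "{0} \<subset> P" "P \<subset> N" using P0 PN prime_zero_in[OF P] prime_N[OF P] by auto
  then have "enat 2 \<le> krull_dim S" by (intro krull_dim_ge[OF chain3[OF zero_prime P N_prime]])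
  ultimately show ?thesis by (simp add: numeral_eq_enat)
qed

lemma PS: "P \<subseteq> S" by (rule prime_S[OF P])
lemmas PD = idealD[OF S_sub primeD(1)[OF S_sub P]]
lemmas Pp = primeD(3)[OF S_sub P]

text \<open>\<open>P \<inter> R j\<close> is finitely generated, and among finitely many elements of
  a valuation ring one divides all the others. The stage \<open>j\<close> is late enough that
  \<open>P\<close> contains no further \<open>x i\<close>; \<open>denominator\<close> then extends
  the divisibility to all of \<open>P\<close>, up to factors outside \<open>P\<close>.\<close>

lemma uniformizer_ex: "\<exists>\<pi> j. \<pi> \<in> P \<and> \<pi> \<noteq> 0 \<and> \<pi> \<in> R j \<and> (\<forall>i\<ge>j. x i \<notin> P) \<and> (\<forall>z\<in>P \<inter> R j. z / \<pi> \<in> S)"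
proof -
  obtain a where a: "a \<in> P" "a \<noteq> 0" using P0 PD(1) by blast
  obtain l where l: "\<forall>j\<ge>l. x j \<notin> P" using not_top_x[OF P PN] by blast
  obtain j where j: "j \<ge> l" "a \<in> R j" using S_common2[of a a] a PS by blast
  have PI: "is_ideal (R j) (P \<inter> R j)" by (rule primeD(1)[OF sub contract_S[OF P]])
  obtain X where X: "finite X" "X \<subseteq> P \<inter> R j" "gen_ideal (R j) X = P \<inter> R j"
    using noe[of j, unfolded noetherian_def, rule_format, OF PI] by auto
  have "\<exists>\<pi>\<in>P \<inter> R j. \<pi> \<noteq> 0 \<and> (\<forall>z\<in>X. z / \<pi> \<in> S)"
    using X(1,2)
  proof (induction X)
    case empty then show ?case using a j by auto
  next
    case (insert z X)
    then obtain \<pi> where \<pi>: "\<pi> \<in> P \<inter> R j" "\<pi> \<noteq> 0" "\<forall>z\<in>X. z / \<pi> \<in> S" by auto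
    show ?case
    proof (cases "z / \<pi> \<in> S")
      case True then show ?thesis using \<pi> by auto
    next
      case False
      then have z0: "z \<noteq> 0" using SD(1) by auto
      then have z: "z \<noteq> 0" "\<pi> / z \<in> S" using val_dvd[OF z0 \<pi>(2)] False by auto
      have "y / z \<in> S" if "y \<in> X" for y
      proof -
        have "y / z = (y / \<pi>) * (\<pi> / z)" using \<pi> by simp
        then show ?thesis using SD(5) \<pi>(3) z that by metis
      qed
      then show ?thesis using z insert.prems SD(2) by (intro bexI[of _ z]) auto
    qed
  qed
  then obtain \<pi> where \<pi>: "\<pi> \<in> P \<inter> R j" "\<pi> \<noteq> 0" "\<forall>z\<in>X. z / \<pi> \<in> S" by blast
  have "is_ideal (R j) {z \<in> R j. z / \<pi> \<in> S}"
    unfolding is_ideal_def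
  proof (intro conjI ballI)
    show "r * z \<in> {z \<in> R j. z / \<pi> \<in> S}" if "r \<in> R j" "z \<in> {z \<in> R j. z / \<pi> \<in> S}" for r z
      using that SD(5)[of r "z / \<pi>"] R_S[of j] RD(5) by auto
  qed (use RD SD in \<open>auto simp: add_divide_distrib\<close>)
  then have "gen_ideal (R j) X \<subseteq> {z \<in> R j. z / \<pi> \<in> S}"
    using gen_ideal_least[OF sub] X(2) \<pi>(3) by blast
  then show ?thesis using \<pi> l j X(3) by (intro exI[of _ \<pi>] exI[of _ j]) auto
qed

text \<open>The uniformizer and its stage are chosen as one pair, since the divisibility by the
  former holds relative to the latter.\<close>

definition pi_j where "pi_j = (SOME p. fst p \<in> P \<and> fst p \<noteq> 0 \<and> fst p \<in> R (snd p) \<and> (\<forall>i\<ge>snd p. x i \<notin> P) \<and> (\<forall>z\<in>P \<inter> R (snd p). z / fst p \<in> S))"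
definition \<pi> where "\<pi> = fst pi_j"
definition j0 where "j0 = snd pi_j"

lemma pi_props: "\<pi> \<in> P" "\<pi> \<noteq> 0" "\<pi> \<in> R j0" "\<And>i. i \<ge> j0 \<Longrightarrow> x i \<notin> P" "\<And>z. z \<in> P \<Longrightarrow> z \<in> R j0 \<Longrightarrow> z / \<pi> \<in> S"
proof -
  let ?Q = "\<lambda>p. fst p \<in> P \<and> fst p \<noteq> 0 \<and> fst p \<in> R (snd p) \<and> (\<forall>i\<ge>snd p. x i \<notin> P) \<and> (\<forall>z\<in>P \<inter> R (snd p). z / fst p \<in> S)"
  obtain p j where "p \<in> P \<and> p \<noteq> 0 \<and> p \<in> R j \<and> (\<forall>i\<ge>j. x i \<notin> P) \<and> (\<forall>z\<in>P \<inter> R j. z / p \<in> S)"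
    using uniformizer_ex by blast
  then have "?Q (p, j)" by simp
  then have "?Q pi_j" unfolding pi_j_def by (rule someI)
  then show "\<pi> \<in> P" "\<pi> \<noteq> 0" "\<pi> \<in> R j0" "\<And>i. i \<ge> j0 \<Longrightarrow> x i \<notin> P" "\<And>z. z \<in> P \<Longrightarrow> z \<in> R j0 \<Longrightarrow> z / \<pi> \<in> S"
    unfolding \<pi>_def j0_def by auto
qed

lemma P_uniformizer: "z \<in> P \<Longrightarrow> \<exists>s\<in>S. s \<notin> P \<and> s * z / \<pi> \<in> S"
proof -
  assume z: "z \<in> P"
  obtain s where s: "s \<in> R j0" "s \<notin> P" "s * z \<in> R j0" using denominator[OF P, of j0 z] pi_props z PS by blast
  have "s * z \<in> P" using PD(6) s z R_S by blast
  then show ?thesis using pi_props(5) s R_S by blast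
qed

definition un where "un z \<longleftrightarrow> z \<in> S \<and> z \<notin> N"

lemma un_nz: "un z \<Longrightarrow> z \<noteq> 0" using ND(1) by (auto simp: un_def)
lemma un_mult: "un a \<Longrightarrow> un b \<Longrightarrow> un (a * b)" using unit_set_mult by (simp add: un_def)
lemma un_one: "un 1" using SD(2) primeD(2)[OF S_sub N_prime] by (simp add: un_def)
lemma un_inverse: "un a \<Longrightarrow> un (inverse a)"
  using unit_S[of a] unit_N[of "inverse a"] by (auto simp: un_def)
lemma un_power: "un a \<Longrightarrow> un (a ^ n)" by (induction n) (auto simp: un_one un_mult)
text \<open>In a valuation ring every power of \<open>f\<close> divides
  \<open>\<pi> \<in> P\<close>, so \<open>\<pi> / f ^ M\<close> lies in \<open>S\<close> for all
  \<open>M\<close>; by \<open>fo_negative\<close> this excludes \<open>stays f l\<close>.\<close>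

lemma dies:
  assumes f: "f \<in> R l" "f \<notin> P" and l: "j0 \<le> l"
  shows "\<exists>n\<ge>l. \<exists>u. un u \<and> f = u * pr l n"
proof -
  have f0: "f \<noteq> 0" using f PD(1) by auto
  have \<pi>l: "\<pi> \<in> R l" using pi_props R_mono[OF l] by auto
  have fS: "f \<in> S" using f R_S by auto
  have "\<not> stays f l"
  proof
    assume "stays f l"
    then obtain M where M: "\<And>n. l \<le> n \<Longrightarrow> fo n (\<pi> / f ^ M) < 0"
      using fo_negative[OF \<pi>l pi_props(2) _ f0] by blast
    have "f ^ M \<notin> P" using prime_power[OF S_sub P fS] f by auto
    then have "\<pi> / f ^ M \<in> S" using dvd_of_notin[OF P subring_power[OF S_sub fS] _ pi_props(1)] by blast
    then have "\<forall>\<^sub>F i in sequentially. fo i (\<pi> / f ^ M) \<ge> 0" using f0 pi_props by (intro eventually_S) auto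
    then obtain i where "\<forall>j\<ge>i. fo j (\<pi> / f ^ M) \<ge> 0" unfolding eventually_sequentially by blast
    then have "fo (max i l) (\<pi> / f ^ M) \<ge> 0" by simp
    then show False using M[of "max i l"] by simp
  qed
  then show ?thesis using stays_or_dies[OF f(1) f0] R_S by (fastforce simp: un_def)
qed

text \<open>\<open>E n N\<close> is what remains in \<open>R N\<close> of the exceptional parameter \<open>x n\<close> after dividing by the
  later \<open>x j\<close> as long as possible.  If at least two of these were nonunits at every stage, then their
  product would be divisible by all \<open>x j\<close>, contradicting \<open>dies\<close>.\<close>

fun ee :: "nat \<Rightarrow> nat \<Rightarrow> 'a" where
  "ee n 0 = x n"
| "ee n (Suc k) = (if ee n k \<in> N then ee n k / x (Suc n + k) else ee n k)"

definition E where "E n L = ee n (L - Suc n)"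

lemma ee_R: "ee n k \<in> R (Suc n + k) \<and> ee n k \<noteq> 0"
proof (induction k)
  case 0 then show ?case using x_R'[of n "Suc n"] x_nz by simp
next
  case (Suc k)
  show ?case
  proof (cases "ee n k \<in> N")
    case True
    then have "ee n k \<in> m (Suc n + k)" using m_eq Suc by blast
    then show ?thesis using div_x Suc x_nz True by simp
  next
    case False
    then show ?thesis using Suc R_step by auto
  qed
qed

lemma ee_prod: "\<exists>J. finite J \<and> J \<subseteq> {Suc n..<Suc n + k} \<and> x n = ee n k * prod x J"
proof (induction k)
  case 0 then show ?case by (intro exI[of _ "{}"]) simp
next
  case (Suc k)
  then obtain J where J: "finite J" "J \<subseteq> {Suc n..<Suc n + k}" "x n = ee n k * prod x J" by blast
  show ?case
  proof (cases "ee n k \<in> N")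
    case True
    have "Suc n + k \<notin> J" using J(2) by auto
    then have "x n = ee n (Suc k) * prod x (insert (Suc n + k) J)" using J True x_nz[of "Suc n + k"] by simp
    then show ?thesis using J by (intro exI[of _ "insert (Suc n + k) J"]) auto
  next
    case False
    then show ?thesis using J by (intro exI[of _ J]) auto
  qed
qed

lemma E_R: "n < L \<Longrightarrow> E n L \<in> R L \<and> E n L \<noteq> 0"
  using ee_R[of n "L - Suc n"] by (simp add: E_def)

lemma E_prod: "n < L \<Longrightarrow> \<exists>J. finite J \<and> J \<subseteq> {Suc n..<L} \<and> x n = E n L * prod x J"
  using ee_prod[of n "L - Suc n"] by (simp add: E_def)

lemma E_Suc: "n < L \<Longrightarrow> E n (Suc L) = (if E n L \<in> N then E n L / x L else E n L)"
proof -
  assume "n < L"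
  then obtain k where "L = Suc (n + k)" using less_iff_Suc_add by auto
  then show ?thesis by (simp add: E_def)
qed

lemma E_self: "E n (Suc n) = x n" by (simp add: E_def)

lemma E_notP: "j0 \<le> n \<Longrightarrow> n < L \<Longrightarrow> E n L \<notin> P"
proof
  assume n: "j0 \<le> n" "n < L" and e: "E n L \<in> P"
  obtain J where "x n = E n L * prod x J" using E_prod[OF n(2)] by blast
  moreover have "prod x J \<in> S" by (rule subring_prod[OF S_sub]) (rule x_S)
  ultimately have "x n \<in> P" using PD(7)[OF e] by simp
  then show False using pi_props(4) n by blast
qed

definition Z where "Z L = (\<Prod>n\<in>{j0..<L}. E n L)"
definition cc where "cc L = card {n \<in> {j0..<L}. E n L \<in> N}"

text \<open>From \<open>L\<close> to \<open>Suc L\<close> each of the \<open>cc L\<close> nonunit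
  factors loses one \<open>x L\<close>, while \<open>x L\<close> itself enters as a new factor. With
  \<open>cc L \<ge> 2\<close> the product loses at least one \<open>x L\<close> on balance.\<close>

lemma Z_step: "j0 \<le> L \<Longrightarrow> Z (Suc L) * x L ^ cc L = Z L * x L"
proof -
  assume L: "j0 \<le> L"
  have "Z (Suc L) = (\<Prod>n\<in>{j0..<L}. E n (Suc L)) * x L"
    using L by (simp add: Z_def E_self)
  moreover have "(\<Prod>n\<in>{j0..<L}. E n (Suc L)) * x L ^ cc L = Z L"
  proof -
    have "x L ^ cc L = (\<Prod>n\<in>{j0..<L}. if E n L \<in> N then x L else 1)"
      by (simp add: cc_def prod.If_cases Int_def)
    then have "(\<Prod>n\<in>{j0..<L}. E n (Suc L)) * x L ^ cc L = (\<Prod>n\<in>{j0..<L}. E n (Suc L) * (if E n L \<in> N then x L else 1))"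
      by (simp add: prod.distrib)
    also have "\<dots> = Z L" unfolding Z_def
      by (rule prod.cong) (auto simp: E_Suc x_nz)
    finally show ?thesis .
  qed
  ultimately show ?thesis by (simp add: mult_ac)
qed

lemma Z_S: "Z L \<in> S \<and> Z L \<in> R L \<and> Z L \<notin> P"
proof -
  have "Z L \<in> R L" unfolding Z_def by (rule subring_prod[OF sub]) (use E_R in auto)
  moreover have "Z L \<notin> P"
  proof
    assume "Z L \<in> P"
    then have "\<exists>n\<in>{j0..<L}. E n L \<in> P" unfolding Z_def
      by (intro prime_prod[OF S_sub P]) (use E_R R_S in auto)
    then show False using E_notP by auto
  qed
  ultimately show ?thesis using R_S by blast
qed

lemma single_ex: "\<exists>L\<ge>L1. j0 < L \<and> cc L = 1"
proof (rule ccontr)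
  assume no: "\<not> ?thesis"
  define L2 where "L2 = max L1 (Suc j0)"
  have c2: "2 \<le> cc L" if L: "L2 \<le> L" for L
  proof -
    have "L - 1 \<in> {n \<in> {j0..<L}. E n L \<in> N}" using L E_self[of "L - 1"] x_N by (auto simp: L2_def)
    then have "cc L \<noteq> 0" unfolding cc_def by auto
    moreover have "cc L \<noteq> 1" using no L by (auto simp: L2_def)
    ultimately show ?thesis by linarith
  qed
  have dv: "\<exists>s\<in>S. Z L2 = s * pr L2 L" if "L2 \<le> L" for L
  proof -
    have "\<exists>s\<in>S. Z L2 = s * Z L * pr L2 L" using that
    proof (induction L rule: dec_induct)
      case base then show ?case using SD(2) by (intro bexI[of _ 1]) auto
    next
      case (step L)
      then obtain s where s: "s \<in> S" "Z L2 = s * Z L * pr L2 L" by blast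
      have L: "j0 \<le> L" using step by (auto simp: L2_def)
      obtain r where r: "cc L = Suc (Suc r)" using c2[OF step(1)] by (metis add_2_eq_Suc le_Suc_ex)
      have "Z L * x L = Z (Suc L) * x L ^ Suc (Suc r)" using Z_step[OF L, symmetric] unfolding r .
      also have "\<dots> = Z (Suc L) * x L ^ r * x L * x L" by (simp only: power_Suc2 mult.assoc)
      finally have "Z L = Z (Suc L) * x L ^ r * x L" using x_nz[of L] by simp
      then have "Z L2 = (s * x L ^ r) * Z (Suc L) * pr L2 (Suc L)" using s pr_Suc[OF step(1)] by (simp add: mult_ac)
      then show ?case using SD(5)[OF s(1) subring_power[OF S_sub x_S]] by blast
    qed
    then show ?thesis using SD(5) Z_S by blast
  qed
  \<comment> \<open>By \<open>dies\<close>, \<open>Z L2\<close> is a unit times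
    \<open>pr L2 n\<close> for some \<open>n\<close>; being divisible by
    \<open>pr L2 (Suc n)\<close> as well, it would make \<open>x n\<close> a unit.\<close>
  have "j0 \<le> L2" by (simp add: L2_def)
  then obtain n u where n: "L2 \<le> n" "un u" "Z L2 = u * pr L2 n"
    using dies[of "Z L2" L2] Z_S[of L2] by blast
  obtain s where s: "s \<in> S" "Z L2 = s * pr L2 (Suc n)" using dv[of "Suc n"] n by auto
  have "u * pr L2 n = s * (pr L2 n * x n)" using n(3) s(2) pr_Suc[OF n(1)] by metis
  also have "\<dots> = (s * x n) * pr L2 n" by (simp only: mult_ac)
  finally have "u * pr L2 n = (s * x n) * pr L2 n" .
  then have "u = s * x n" using pr_nz by simp
  then show False using ND(6)[OF s(1) x_N] n(2) by (simp add: un_def)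
qed

definition pw where "pw b z \<longleftrightarrow> (\<exists>u c. un u \<and> z = u * b ^ c)"

lemma pw_mult: "pw b y \<Longrightarrow> pw b z \<Longrightarrow> pw b (y * z)"
proof -
  assume "pw b y" "pw b z"
  then obtain u c u' c' where "un u" "y = u * b ^ c" "un u'" "z = u' * b ^ c'" by (auto simp: pw_def)
  then show ?thesis unfolding pw_def
    by (intro exI[of _ "u * u'"] exI[of _ "c + c'"]) (auto simp: un_mult power_add)
qed

lemma pw_un: "un u \<Longrightarrow> pw b u" unfolding pw_def by (intro exI[of _ u] exI[of _ 0]) auto

lemma pw_prod: "(\<And>i. i \<in> I \<Longrightarrow> pw b (f i)) \<Longrightarrow> pw b (prod f I)"
  by (induction I rule: infinite_finite_induct) (auto intro: pw_mult pw_un un_one)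

text \<open>The single nonunit at stage \<open>L\<close> is \<open>E (L - 1) L = x (L - 1)\<close>.
  All other \<open>E n L\<close> are units, so \<open>x n\<close> is a unit times a product of later
  \<open>x i\<close>, and descending induction on \<open>n\<close> applies.\<close>

lemma pw_x:
  assumes c: "cc L = 1" "j0 < L" and n: "j0 \<le> n" "n < L" shows "pw (x (L - 1)) (x n)"
  using n
proof (induction "L - n" arbitrary: n rule: less_induct)
  case less
  show ?case
  proof (cases "n = L - 1")
    case True
    then show ?thesis unfolding pw_def using un_one by (intro exI[of _ 1] exI[of _ 1]) auto
  next
    case False
    have L1: "L - 1 \<in> {n \<in> {j0..<L}. E n L \<in> N}" using c E_self[of "L - 1"] x_N by auto
    have "E n L \<notin> N"
    proof
      assume "E n L \<in> N"
      then have "n \<in> {n \<in> {j0..<L}. E n L \<in> N}" using less.prems by auto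
      then show False using c(1) L1 False unfolding cc_def by (metis card_1_singletonE singletonD)
    qed
    then have u: "un (E n L)" using E_R[OF less.prems(2)] R_S by (auto simp: un_def)
    obtain J where J: "J \<subseteq> {Suc n..<L}" "x n = E n L * prod x J" using E_prod[OF less.prems(2)] by blast
    have "pw (x (L - 1)) (prod x J)"
    proof (rule pw_prod)
      fix i assume "i \<in> J"
      then have i: "n < i" "i < L" using J(1) by auto
      show "pw (x (L - 1)) (x i)" by (rule less.hyps) (use i less.prems in auto)
    qed
    then show ?thesis using J pw_mult[OF pw_un[OF u]] by metis
  qed
qed

text \<open>At a stage with the single survivor \<open>x (L - 1)\<close>, both \<open>f\<close> and
  \<open>x j0\<close> are units times powers of it; eliminating it gives the relation. The exponent
  \<open>b\<close> is positive because \<open>x j0\<close> is a nonunit.\<close>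

lemma commensurable:
  assumes f: "f \<in> S" "f \<notin> P" shows "\<exists>b>0. \<exists>a u. un u \<and> f ^ b = u * x j0 ^ a"
proof -
  obtain l where l: "j0 \<le> l" "f \<in> R l" using S_common2[OF f(1) f(1)] by blast
  obtain n u where n: "l \<le> n" "un u" "f = u * pr l n" using dies[OF l(2) f(2) l(1)] by blast
  obtain L where L: "L \<ge> n" "j0 < L" "cc L = 1" using single_ex by blast
  let ?b = "x (L - 1)"
  have "pw ?b (pr l n)" unfolding pr_def by (rule pw_prod, rule pw_x[OF L(3,2)]) (use L l in auto)
  then have "pw ?b f" using n pw_mult pw_un by metis
  then obtain v c where v: "un v" "f = v * ?b ^ c" by (auto simp: pw_def)
  obtain v' c' where v': "un v'" "x j0 = v' * ?b ^ c'" using pw_x[OF L(3,2), of j0] L by (auto simp: pw_def)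
  have "c' > 0"
  proof (rule ccontr)
    assume "\<not> ?thesis"
    then have "x j0 = v'" using v' by simp
    then show False using v'(1) x_N[of j0] by (simp add: un_def)
  qed
  have nz: "v' \<noteq> 0" using un_nz v' by simp
  have "f ^ c' = (v ^ c' * inverse (v' ^ c)) * x j0 ^ c"
    unfolding v(2) v'(2) using nz by (simp add: power_mult_distrib power_mult[symmetric] mult.commute)
  then show ?thesis using \<open>c' > 0\<close> v v' by (meson un_inverse un_mult un_power)
qed

text \<open>\<open>rv u r\<close>: the unit \<open>u\<close> of the localization at \<open>P\<close> has value \<open>r\<close>, when \<open>x j0\<close> has value \<open>1\<close>.\<close>

definition U where "U = {s / t | s t. s \<in> S \<and> s \<notin> P \<and> t \<in> S \<and> t \<notin> P}"

definition rv where "rv u r \<longleftrightarrow> u \<in> U \<and> (\<exists>a b u1. b > 0 \<and> un u1 \<and> r = rat_of_int a / rat_of_nat b \<and> u ^ b = u1 * x j0 powi a)"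

lemma notP_nz: "s \<notin> P \<Longrightarrow> s \<noteq> 0" using PD(1) by auto

lemma notP_mult: "s \<in> S \<Longrightarrow> s \<notin> P \<Longrightarrow> t \<in> S \<Longrightarrow> t \<notin> P \<Longrightarrow> s * t \<in> S \<and> s * t \<notin> P"
  using Pp SD(5) by blast

lemma U_I: "s \<in> S \<Longrightarrow> s \<notin> P \<Longrightarrow> t \<in> S \<Longrightarrow> t \<notin> P \<Longrightarrow> s / t \<in> U"
  by (auto simp: U_def)

lemma U_E: "u \<in> U \<Longrightarrow> (\<And>s t. s \<in> S \<Longrightarrow> s \<notin> P \<Longrightarrow> t \<in> S \<Longrightarrow> t \<notin> P \<Longrightarrow> s \<noteq> 0 \<Longrightarrow> t \<noteq> 0 \<Longrightarrow> u = s / t \<Longrightarrow> thesis) \<Longrightarrow> thesis"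
  using notP_nz by (auto simp: U_def)

lemma U_nz: "u \<in> U \<Longrightarrow> u \<noteq> 0" by (elim U_E) auto

lemma U_mult: "u \<in> U \<Longrightarrow> v \<in> U \<Longrightarrow> u * v \<in> U"
proof (elim U_E)
  fix s t s' t' assume *: "s \<in> S" "s \<notin> P" "t \<in> S" "t \<notin> P" "u = s / t" "s' \<in> S" "s' \<notin> P" "t' \<in> S" "t' \<notin> P" "v = s' / t'"
  then have "(s * s') / (t * t') \<in> U" using notP_mult by (intro U_I) auto
  then show ?thesis using * by simp
qed

lemma U_inverse: "u \<in> U \<Longrightarrow> inverse u \<in> U"
proof (elim U_E)
  fix s t assume *: "s \<in> S" "s \<notin> P" "t \<in> S" "t \<notin> P" "u = s / t"
  then have "t / s \<in> U" by (intro U_I) auto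
  then show ?thesis using * by simp
qed

lemma rv_ex: "u \<in> U \<Longrightarrow> \<exists>r. rv u r"
proof -
  assume uU: "u \<in> U"
  then obtain s t where st: "s \<in> S" "s \<notin> P" "t \<in> S" "t \<notin> P" "s \<noteq> 0" "t \<noteq> 0" "u = s / t" by (rule U_E)
  obtain b a v where 1: "b > 0" "un v" "s ^ b = v * x j0 ^ a" using commensurable[OF st(1,2)] by blast
  obtain b' a' v' where 2: "b' > 0" "un v'" "t ^ b' = v' * x j0 ^ a'" using commensurable[OF st(3,4)] by blast
  have nz: "v' \<noteq> 0" "x j0 \<noteq> 0" using un_nz 2 x_nz by auto
  have "u ^ (b * b') = (s ^ b) ^ b' / (t ^ b') ^ b"
    using st by (simp add: power_divide power_mult[symmetric] mult.commute)
  also have "\<dots> = (v ^ b' * inverse (v' ^ b)) * (x j0 ^ (a * b') / x j0 ^ (a' * b))"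
    unfolding 1 2 by (simp add: power_mult_distrib power_mult divide_inverse mult_ac)
  also have "x j0 ^ (a * b') / x j0 ^ (a' * b) = x j0 powi (int (a * b') - int (a' * b))"
    using nz by (simp add: power_int_diff del: of_nat_mult)
  finally have "u ^ (b * b') = (v ^ b' * inverse (v' ^ b)) * x j0 powi (int (a * b') - int (a' * b))" .
  moreover have "un (v ^ b' * inverse (v' ^ b))" using 1 2 by (intro un_mult un_inverse un_power)
  moreover have "b * b' > 0" using 1 2 by simp
  ultimately show ?thesis unfolding rv_def using uU by blast
qed

lemma x_powi_un: "un (x j0 powi k) \<Longrightarrow> k = 0"
proof (rule ccontr)
  assume u: "un (x j0 powi k)" and k: "k \<noteq> 0"
  have no: "\<not> un (x j0 ^ Suc n)" for n
    using ND(7)[OF x_N subring_power[OF S_sub x_S], of j0 j0 n] by (simp add: un_def)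
  show False
  proof (cases "k > 0")
    case True
    then obtain n where "k = int (Suc n)" by (metis gr0_implies_Suc of_nat_0_less_iff zero_less_imp_eq_int)
    then show ?thesis using u no[of n] by (simp only: power_int_of_nat)
  next
    case False
    then obtain n where n: "- k = int (Suc n)" using k by (metis gr0_implies_Suc neg_0_less_iff_less of_nat_0_less_iff zero_less_imp_eq_int linorder_neqE)
    have "un (x j0 powi (- k))" using un_inverse[OF u] by (simp add: power_int_minus)
    then show ?thesis unfolding n using no[of n] by (simp only: power_int_of_nat)
  qed
qed

lemma rv_unique: "rv u r \<Longrightarrow> rv u r' \<Longrightarrow> r = r'"
proof -
  assume "rv u r" "rv u r'"
  then obtain a b v a' b' v' where 1: "b > 0" "un v" "r = rat_of_int a / rat_of_nat b" "u ^ b = v * x j0 powi a"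
    and 2: "b' > 0" "un v'" "r' = rat_of_int a' / rat_of_nat b'" "u ^ b' = v' * x j0 powi a'"
    unfolding rv_def by blast
  have nz: "v \<noteq> 0" "v' \<noteq> 0" "x j0 \<noteq> 0" using un_nz 1 2 x_nz by auto
  have "(u ^ b) ^ b' = (u ^ b') ^ b" by (simp add: power_mult[symmetric] mult.commute)
  then have "v ^ b' * x j0 powi (a * int b') = v' ^ b * x j0 powi (a' * int b)"
    unfolding 1 2 by (simp add: power_mult_distrib power_int_mult)
  then have "x j0 powi (a * int b' - a' * int b) = v' ^ b * inverse (v ^ b')"
    using nz by (simp add: power_int_diff field_simps)
  then have "un (x j0 powi (a * int b' - a' * int b))" using 1 2 by (simp add: un_mult un_inverse un_power)
  then have "a * int b' = a' * int b" using x_powi_un by fastforce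
  then have "rat_of_int a * rat_of_nat b' = rat_of_int a' * rat_of_nat b" by (metis of_int_mult of_int_of_nat_eq)
  then show ?thesis unfolding 1 2 using 1(1) 2(1) by (simp add: field_simps)
qed

lemma rv_mult: "rv u r \<Longrightarrow> rv u' r' \<Longrightarrow> rv (u * u') (r + r')"
proof -
  assume u: "rv u r" "rv u' r'"
  then obtain a b v a' b' v' where 1: "b > 0" "un v" "r = rat_of_int a / rat_of_nat b" "u ^ b = v * x j0 powi a"
    and 2: "b' > 0" "un v'" "r' = rat_of_int a' / rat_of_nat b'" "u' ^ b' = v' * x j0 powi a'"
    unfolding rv_def by blast
  have "(u * u') ^ (b * b') = (u ^ b) ^ b' * (u' ^ b') ^ b"
    by (simp add: power_mult_distrib power_mult[symmetric] mult.commute)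
  also have "\<dots> = (v ^ b' * v' ^ b) * x j0 powi (a * int b' + a' * int b)"
    unfolding 1 2 using x_nz by (simp add: power_mult_distrib power_int_mult power_int_add mult_ac)
  finally have e: "(u * u') ^ (b * b') = (v ^ b' * v' ^ b) * x j0 powi (a * int b' + a' * int b)" .
  have "r + r' = rat_of_int (a * int b' + a' * int b) / rat_of_nat (b * b')"
    unfolding 1 2 using 1(1) 2(1) by (simp add: field_simps)
  moreover have "un (v ^ b' * v' ^ b)" using 1 2 by (intro un_mult un_power)
  moreover have "b * b' > 0" using 1 2 by simp
  moreover have "u * u' \<in> U" using u U_mult by (simp add: rv_def)
  ultimately show ?thesis unfolding rv_def using e by blast
qed

lemma rv_one: "rv 1 0"
proof -
  have "(1::'a) \<in> U" using U_I[of 1 1] SD(2) primeD(2)[OF S_sub P] by simp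
  then show ?thesis unfolding rv_def
    by (intro conjI exI[of _ 0] exI[of _ 1] exI[of _ "1::'a"]) (auto simp: un_one)
qed

lemma rv_inverse: "rv u r \<Longrightarrow> rv (inverse u) (- r)"
proof -
  assume u: "rv u r"
  then have uU: "u \<in> U" by (simp add: rv_def)
  obtain r' where r': "rv (inverse u) r'" using rv_ex[OF U_inverse[OF uU]] by blast
  have "rv 1 (r + r')" using rv_mult[OF u r'] U_nz[OF uU] by simp
  then have "r + r' = 0" using rv_unique rv_one by blast
  then have "r' = - r" by (simp add: eq_neg_iff_add_eq_0 add.commute)
  then show ?thesis using r' by simp
qed

text \<open>Some power of \<open>u\<close> is a unit times \<open>x j0 powi a\<close>, and an
  element of which a positive power lies in a valuation ring lies there itself; so the sign of
  \<open>a\<close> decides.\<close>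

lemma rv_S: "rv u r \<Longrightarrow> u \<in> S \<longleftrightarrow> 0 \<le> r"
proof -
  assume u: "rv u r"
  then obtain a b v where 1: "b > 0" "un v" "r = rat_of_int a / rat_of_nat b" "u ^ b = v * x j0 powi a"
    unfolding rv_def by blast
  have u0: "u \<noteq> 0" using u U_nz by (simp add: rv_def)
  show ?thesis
  proof
    assume r: "0 \<le> r"
    then have "0 \<le> a" using 1 by (simp add: zero_le_divide_iff)
    then obtain n where "a = int n" using nonneg_int_cases by blast
    then have ub: "u ^ b \<in> S" using 1 SD(5) subring_power[OF S_sub x_S] by (simp add: un_def)
    show "u \<in> S"
    proof (rule ccontr)
      assume n: "u \<notin> S"
      then have i: "inverse u \<in> S" using val u0 unfolding valuation_ring_def by blast
      then have iN: "inverse u \<in> N" using unit_S[OF i] n by auto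
      obtain b' where "b = Suc b'" using 1(1) gr0_implies_Suc by blast
      then have "inverse u ^ b \<in> N" using ND(7)[OF iN subring_power[OF S_sub i]] by simp
      then have "u ^ b * inverse u ^ b \<in> N" using ND(6)[OF ub] by blast
      then have "1 \<in> N" using u0 by (simp add: power_inverse)
      then show False using un_one by (simp add: un_def)
    qed
  next
    assume uS: "u \<in> S"
    show "0 \<le> r"
    proof (rule ccontr)
      assume "\<not> 0 \<le> r"
      then have "a < 0" using 1 by (simp add: zero_le_divide_iff not_le divide_less_0_iff) 
      then obtain n where n: "- a = int (Suc n)" by (metis gr0_implies_Suc neg_0_less_iff_less of_nat_0_less_iff zero_less_imp_eq_int)
      then have a: "a = - int (Suc n)" by simp
      have "x j0 ^ Suc n \<noteq> 0" using x_nz by simp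
      then have "u ^ b * x j0 ^ Suc n = v"
        unfolding 1(4) a power_int_minus power_int_of_nat by (simp add: mult.assoc del: power_Suc)
      moreover have "u ^ b * x j0 ^ Suc n \<in> N"
        using ND(6)[OF subring_power[OF S_sub uS] ND(7)[OF x_N subring_power[OF S_sub x_S]], of b j0 j0 n] by simp
      ultimately show False using 1(2) by (simp add: un_def)
    qed
  qed
qed

lemma pi_U: "u \<in> U \<Longrightarrow> \<pi> * u \<in> P"
proof (elim U_E)
  fix s t assume *: "s \<in> S" "s \<notin> P" "t \<in> S" "t \<notin> P" "u = s / t"
  have "\<pi> * s \<in> P" using PD(7) pi_props(1) * by blast
  then have "(\<pi> * s) / t \<in> P" using div_in_prime[OF P] * by blast
  then show ?thesis using * by simp
qed

text \<open>\<open>k\<close> is the first exponent with \<open>f / \<pi> ^ k \<notin> S\<close>.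
  Leaving \<open>S\<close> need not mean leaving the localization at \<open>P\<close>, where this
  quotient may be a unit of negative rational value; hence the two cases, according to whether
  \<open>f / \<pi> ^ (k - 1)\<close> lies in \<open>P\<close>.\<close>

lemma factor_S:
  assumes f: "f \<in> S" "f \<noteq> 0" shows "\<exists>k u. u \<in> U \<and> f = \<pi> ^ k * u"
proof -
  define k where "k = (LEAST k. f / \<pi> ^ k \<notin> S)"
  have ex: "\<exists>k. f / \<pi> ^ k \<notin> S" by (rule not_infinitely_divisible[OF P PN pi_props(1,2) f])
  have k: "f / \<pi> ^ k \<notin> S" unfolding k_def using ex by (rule LeastI_ex)
  then obtain l where l: "k = Suc l" using f by (cases k) auto
  have h: "f / \<pi> ^ l \<in> S" using not_less_Least[of l "\<lambda>k. f / \<pi> ^ k \<notin> S"] l by (auto simp: k_def[symmetric])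
  let ?h = "f / \<pi> ^ l"
  have one: "1 \<in> S" "1 \<notin> P" using SD(2) primeD(2)[OF S_sub P] by auto
  show ?thesis
  proof (cases "?h \<in> P")
    case False
    then have "?h \<in> U" using U_I[OF h _ one] by simp
    then show ?thesis using pi_props(2) by (intro exI[of _ l] exI[of _ ?h]) auto
  next
    case True
    then obtain s where s: "s \<in> S" "s \<notin> P" "s * ?h / \<pi> \<in> S" using P_uniformizer by blast
    let ?t = "s * ?h / \<pi>"
    have s0: "s \<noteq> 0" using notP_nz s by auto
    have eq: "f / \<pi> ^ k = ?t / s" using l s0 by simp
    have "?t \<notin> P"
    proof
      assume "?t \<in> P"
      then have "?t / s \<in> S" using dvd_of_notin[OF P s(1,2)] by blast
      then show False using eq k by simp
    qed
    then have "?t / s \<in> U" using U_I s by blast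
    then show ?thesis using eq pi_props(2) by (intro exI[of _ k] exI[of _ "f / \<pi> ^ k"]) auto
  qed
qed

text \<open>A relation at first, so that its multiplicativity and the description of
  \<open>S\<close> can be proved before uniqueness, which follows from them.\<close>

definition vr where "vr f z \<longleftrightarrow> (\<exists>u. f = \<pi> powi (fst z) * u \<and> rv u (snd z))"

lemma vr_ex: "f \<noteq> 0 \<Longrightarrow> \<exists>z. vr f z"
proof -
  assume f: "f \<noteq> 0"
  obtain a b where ab: "a \<in> S" "b \<in> S" "b \<noteq> 0" "f = a / b" using S_quotient by blast
  then have a0: "a \<noteq> 0" using f by auto
  obtain k u where 1: "u \<in> U" "a = \<pi> ^ k * u" using factor_S[OF ab(1) a0] by blast
  obtain l v where 2: "v \<in> U" "b = \<pi> ^ l * v" using factor_S[OF ab(2,3)] by blast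
  obtain r where r: "rv (u * inverse v) r" using rv_ex U_mult[OF 1(1) U_inverse[OF 2(1)]] by blast
  have "f = \<pi> powi (int k - int l) * (u * inverse v)"
    unfolding ab(4) 1(2) 2(2) using pi_props(2) by (simp add: power_int_diff divide_inverse mult_ac)
  then show ?thesis using r unfolding vr_def by (intro exI[of _ "(int k - int l, r)"]) auto
qed

lemma vr_mult: "vr f z \<Longrightarrow> vr g z' \<Longrightarrow> vr (f * g) (fst z + fst z', snd z + snd z')"
proof -
  assume "vr f z" "vr g z'"
  then obtain u u' where "f = \<pi> powi (fst z) * u" "rv u (snd z)" "g = \<pi> powi (fst z') * u'" "rv u' (snd z')"
    by (auto simp: vr_def)
  then show ?thesis unfolding vr_def
    using rv_mult[of u "snd z" u' "snd z'"] pi_props(2)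
    by (intro exI[of _ "u * u'"]) (auto simp: power_int_add mult.assoc mult.left_commute)
qed

lemma vr_S: "vr f z \<Longrightarrow> f \<in> S \<longleftrightarrow> lex_nonneg z"
proof -
  assume "vr f z"
  then obtain u where u: "f = \<pi> powi (fst z) * u" "rv u (snd z)" by (auto simp: vr_def)
  have uU: "u \<in> U" using u by (simp add: rv_def)
  have pos: "\<pi> ^ Suc n * w \<in> P" if "w \<in> U" for n w
  proof -
    have "\<pi> ^ n * (\<pi> * w) \<in> P" using PD(6)[OF subring_power[OF S_sub] pi_U[OF that]] pi_props(1) PS by blast
    then show ?thesis by (simp add: mult_ac)
  qed
  consider "fst z > 0" | "fst z = 0" | "fst z < 0" by linarith
  then show ?thesis
  proof cases
    case 1
    then obtain n where "fst z = int (Suc n)" by (metis gr0_implies_Suc of_nat_0_less_iff zero_less_imp_eq_int)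
    then have "f \<in> P" using u pos[OF uU] by (simp only: power_int_of_nat)
    then show ?thesis using 1 PS by (auto simp: lex_nonneg_def)
  next
    case 2
    then show ?thesis using u rv_S[OF u(2)] by (auto simp: lex_nonneg_def)
  next
    case 3
    then obtain n where n: "- fst z = int (Suc n)" by (metis gr0_implies_Suc neg_0_less_iff_less of_nat_0_less_iff zero_less_imp_eq_int)
    then have a: "fst z = - int (Suc n)" by simp
    have f0: "f \<noteq> 0" using u U_nz[OF uU] pi_props(2) by simp
    have "inverse f = \<pi> ^ Suc n * inverse u" unfolding u(1) a power_int_minus power_int_of_nat by simp
    then have "inverse f \<in> N" using pos[OF U_inverse[OF uU], of n] prime_N[OF P] by auto
    moreover have "inverse f \<notin> N" if "f \<in> S" using unit_N[of "inverse f"] f0 that by simp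
    ultimately show ?thesis using 3 by (auto simp: lex_nonneg_def)
  qed
qed

lemma vr_inverse: "f \<noteq> 0 \<Longrightarrow> vr f z \<Longrightarrow> vr (inverse f) (- fst z, - snd z)"
proof -
  assume f: "f \<noteq> 0" "vr f z"
  then obtain u where "f = \<pi> powi (fst z) * u" "rv u (snd z)" by (auto simp: vr_def)
  then show ?thesis unfolding vr_def
    using rv_inverse by (intro exI[of _ "inverse u"]) (auto simp: power_int_minus)
qed

lemma vr_unique: "f \<noteq> 0 \<Longrightarrow> vr f z \<Longrightarrow> vr f z' \<Longrightarrow> z = z'"
proof -
  assume f: "f \<noteq> 0" and z: "vr f z" "vr f z'"
  have "vr 1 (fst z - fst z', snd z - snd z')" using vr_mult[OF z(1) vr_inverse[OF f z(2)]] f by simp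
  moreover have "vr 1 (fst z' - fst z, snd z' - snd z)" using vr_mult[OF z(2) vr_inverse[OF f z(1)]] f by simp
  ultimately have "lex_nonneg (fst z - fst z', snd z - snd z')" "lex_nonneg (fst z' - fst z, snd z' - snd z)"
    using vr_S SD(2) by blast+
  then show ?thesis by (auto simp: lex_nonneg_def prod_eq_iff)
qed

lemma value_group: "\<exists>G. rat_subgroup G \<and> value_group_is_Z_lex S G"
proof -
  define G where "G = {r. \<exists>u. rv u r}"
  have "rat_subgroup G"
    unfolding rat_subgroup_def G_def using rv_one rv_mult rv_inverse by blast
  moreover obtain v where v: "\<And>f. f \<noteq> 0 \<Longrightarrow> vr f (v f)" using vr_ex by metis
  have "value_group_is_Z_lex S G"
    unfolding value_group_is_Z_lex_def
  proof (intro exI[of _ v] conjI allI impI)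
    fix f g :: 'a assume fg: "f \<noteq> 0" "g \<noteq> 0"
    then show "v (f * g) = (fst (v f) + fst (v g), snd (v f) + snd (v g))"
      using vr_unique[OF _ v vr_mult[OF v v]] by simp
  next
    show "v ` (UNIV - {0}) = {z. snd z \<in> G}"
    proof
      show "v ` (UNIV - {0}) \<subseteq> {z. snd z \<in> G}" using v by (fastforce simp: vr_def G_def)
      show "{z. snd z \<in> G} \<subseteq> v ` (UNIV - {0})"
      proof
        fix z :: "int \<times> rat" assume "z \<in> {z. snd z \<in> G}"
        then obtain u where u: "rv u (snd z)" by (auto simp: G_def)
        let ?f = "\<pi> powi (fst z) * u"
        have f0: "?f \<noteq> 0" using u U_nz pi_props(2) by (auto simp: rv_def)
        have "vr ?f z" using u by (auto simp: vr_def)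
        then have "z = v ?f" using vr_unique[OF f0 _ v[OF f0]] by blast
        then show "z \<in> v ` (UNIV - {0})" using f0 by blast
      qed
    qed
  next
    fix f :: 'a assume "f \<noteq> 0"
    then show "(f \<in> S) = lex_nonneg (v f)" using vr_S[OF v] by blast
  qed
  ultimately show ?thesis by blast
qed

end

context quad_seq
begin

lemma valuation_ring_dim:
  assumes val: "valuation_ring S"
  shows "krull_dim S = 1 \<or> (krull_dim S = 2 \<and> (\<exists>G. rat_subgroup G \<and>
           value_group_is_Z_lex (boundary_valuation_ring R) G))"
proof -
  interpret quad_seq_val by unfold_locales (rule val)
  show ?thesis
  proof (cases "\<exists>P. prime_ideal S P \<and> P \<noteq> N \<and> P \<noteq> {0}")
    case True
    then obtain P where "prime_ideal S P" "P \<noteq> N" "P \<noteq> {0}" by blast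
    then interpret quad_seq_val2 R x Q P by unfold_locales
    show ?thesis using dim_two value_group boundary_eq by simp
  next
    case False
    then show ?thesis using dim_one by blast
  qed
qed

lemma valuation_ring_finite:
  assumes val: "valuation_ring S" shows "finite height_one_primes"
proof -
  interpret quad_seq_val by unfold_locales (rule val)
  have "p = q" if "p \<in> height_one_primes" "q \<in> height_one_primes" for p q
  proof -
    have pq: "prime_ideal S p" "prime_ideal S q" using that by auto
    then show ?thesis
      using primes_comparable[OF pq] height_one_iff[OF S_sub pq(1)] height_one_iff[OF S_sub pq(2)] that by blast
  qed
  note eq = this
  show ?thesis
  proof (cases "height_one_primes = {}")
    case False
    then obtain p where "p \<in> height_one_primes" by blast
    then have "height_one_primes \<subseteq> {p}" using eq by blast
    then show ?thesis by (rule finite_subset) simp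
  next
    case True
    show ?thesis unfolding True by simp
  qed
qed

end

subsection \<open>Prime ideals of the union and of the members of the sequence\<close>

context quad_seq
begin

text \<open>\<open>S\<close> and \<open>R j\<close> have the same localization at \<open>p\<close>,
  and \<open>q'\<close> is the contraction to \<open>S\<close> of the extension of \<open>q\<close>
  to it.\<close>

lemma lift_prime:
  assumes p: "prime_ideal S p" and l: "\<And>i. j \<le> i \<Longrightarrow> x i \<notin> p"
    and q: "prime_ideal (R j) q" "q \<subseteq> p"
  shows "\<exists>q'. prime_ideal S q' \<and> q' \<subseteq> p \<and> q' \<inter> R j = q"
proof -
  define q' where "q' = {f \<in> S. \<exists>s\<in>R j. s \<notin> p \<and> s * f \<in> q}"
  note qD = idealD[OF sub primeD(1)[OF sub q(1)]]
  note pD = idealD[OF S_sub primeD(1)[OF S_sub p]]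
  have nm: "a * b \<in> R j \<and> a * b \<notin> p" if "a \<in> R j" "b \<in> R j" "a \<notin> p" "b \<notin> p" for a b
    using primeD(3)[OF S_sub p, of a b] that RD(5) R_S by blast
  have one: "1 \<in> R j" "1 \<notin> p" using RD(2) primeD(2)[OF S_sub p] by auto
  have I: "is_ideal S q'"
    unfolding is_ideal_def
  proof (intro conjI ballI)
    show "q' \<subseteq> S" by (auto simp: q'_def)
    show "0 \<in> q'" using one qD(1) SD(1) by (auto simp: q'_def)
    fix f g assume "f \<in> q'" "g \<in> q'"
    then obtain s t where *: "f \<in> S" "g \<in> S" "s \<in> R j" "s \<notin> p" "s * f \<in> q" "t \<in> R j" "t \<notin> p" "t * g \<in> q" by (auto simp: q'_def)
    have "t * (s * f) + s * (t * g) \<in> q" using * qD(3,6) by blast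
    then have "s * t * (f + g) \<in> q" by (simp add: algebra_simps)
    then show "f + g \<in> q'" using * nm[of s t] SD(3) unfolding q'_def by blast
  next
    fix a f assume a: "a \<in> S" and "f \<in> q'"
    then obtain s where *: "f \<in> S" "s \<in> R j" "s \<notin> p" "s * f \<in> q" by (auto simp: q'_def)
    obtain t where t: "t \<in> R j" "t \<notin> p" "t * a \<in> R j" using denominator[OF p l a] by blast
    have "(t * a) * (s * f) \<in> q" using t * qD(6) by blast
    then have "s * t * (a * f) \<in> q" by (simp add: mult_ac)
    then show "a * f \<in> q'" using * t nm[of s t] SD(5) a unfolding q'_def by blast
  qed
  have "prime_ideal S q'"
  proof (rule primeI[OF I])
    show "1 \<notin> q'" using q(2) by (auto simp: q'_def)
    show "1 \<in> S" by (rule SD(2))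
    fix a b assume ab: "a \<in> S" "b \<in> S" "a * b \<in> q'"
    then obtain s where s: "s \<in> R j" "s \<notin> p" "s * (a * b) \<in> q" by (auto simp: q'_def)
    obtain t where t: "t \<in> R j" "t \<notin> p" "t * a \<in> R j" using denominator[OF p l ab(1)] by blast
    obtain t' where t': "t' \<in> R j" "t' \<notin> p" "t' * b \<in> R j" using denominator[OF p l ab(2)] by blast
    have "(t * t') * (s * (a * b)) \<in> q" using s t t' qD(6) RD(5) by blast
    then have "s * ((t * a) * (t' * b)) \<in> q" by (simp add: mult_ac)
    then have "(t * a) * (t' * b) \<in> q" using primeD(3)[OF sub q(1) s(1) RD(5)[OF t(3) t'(3)]] s(2) q(2) by blast
    then have "t * a \<in> q \<or> t' * b \<in> q" using primeD(3)[OF sub q(1) t(3) t'(3)] by blast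
    then show "a \<in> q' \<or> b \<in> q'" using t t' ab unfolding q'_def by blast
  qed
  moreover have "q' \<subseteq> p"
  proof
    fix f assume "f \<in> q'"
    then obtain s where *: "f \<in> S" "s \<in> R j" "s \<notin> p" "s * f \<in> q" by (auto simp: q'_def)
    then show "f \<in> p" using primeD(3)[OF S_sub p, of s f] q(2) R_S by blast
  qed
  moreover have "q' \<inter> R j = q"
  proof
    show "q' \<inter> R j \<subseteq> q"
    proof
      fix f assume "f \<in> q' \<inter> R j"
      then obtain s where *: "f \<in> R j" "s \<in> R j" "s \<notin> p" "s * f \<in> q" by (auto simp: q'_def)
      then show "f \<in> q" using primeD(3)[OF sub q(1), of s f] q(2) by blast
    qed
    show "q \<subseteq> q' \<inter> R j"
    proof
      fix f assume f: "f \<in> q"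
      then have "f \<in> R j" "1 * f \<in> q" using qD(2) by auto
      then show "f \<in> q' \<inter> R j" using one R_S unfolding q'_def by blast
    qed
  qed
  ultimately show ?thesis by blast
qed

lemma contract_nonzero:
  assumes p: "prime_ideal S p" and l: "\<And>i. j \<le> i \<Longrightarrow> x i \<notin> p" and q: "prime_ideal S q" "q \<subseteq> p"
  shows "q \<inter> R j = {0} \<Longrightarrow> q = {0}"
proof -
  assume z: "q \<inter> R j = {0}"
  have "f = 0" if f: "f \<in> q" for f
  proof -
    obtain s where s: "s \<in> R j" "s \<notin> p" "s * f \<in> R j" using denominator[OF p l] f prime_S[OF q(1)] by blast
    have "s * f \<in> q" using idealD(6)[OF S_sub primeD(1)[OF S_sub q(1)], of s f] s f R_S by blast
    then have "s * f = 0" using s z by blast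
    then show "f = 0" using s prime_zero_in[OF p] by auto
  qed
  then show ?thesis using prime_zero_in[OF q(1)] by blast
qed

lemma contract_strict:
  assumes p: "prime_ideal S p" and l: "\<And>i. j \<le> i \<Longrightarrow> x i \<notin> p"
    and q: "prime_ideal S q" "q' \<subseteq> p" "prime_ideal S q'" "q \<subset> q'"
  shows "q \<inter> R j \<subset> q' \<inter> R j"
proof -
  have "q \<inter> R j \<noteq> q' \<inter> R j"
  proof
    assume eq: "q \<inter> R j = q' \<inter> R j"
    have "f \<in> q" if f: "f \<in> q'" for f
    proof -
      obtain s where s: "s \<in> R j" "s \<notin> p" "s * f \<in> R j" using denominator[OF p l] f prime_S[OF q(3)] by blast
      have sS: "s \<in> S" using s R_S by blast
      have "s * f \<in> q'" using idealD(6)[OF S_sub primeD(1)[OF S_sub q(3)] sS f] .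
      then have "s * f \<in> q" using eq s by blast
      moreover have "s \<notin> q" using s q by blast
      ultimately show "f \<in> q" using primeD(3)[OF S_sub q(1) sS, of f] f prime_S[OF q(3)] by blast
    qed
    then show False using q by blast
  qed
  then show ?thesis using q by blast
qed

text \<open>A longest chain from zero to \<open>p \<inter> R j\<close> is routed through
  \<open>c\<close>, which costs one step. A nonzero prime strictly below the first member of the new
  chain could be put in front of it together with zero, giving a longer chain. So that member has
  height one, and it is lifted to \<open>S\<close>.\<close>

lemma height_one_below:
  assumes p: "prime_ideal S p" "p \<noteq> N" and c: "c \<in> p" "c \<noteq> 0"
  shows "\<exists>q\<in>height_one_primes. q \<noteq> N \<and> c \<in> q"
proof -
  obtain l where l: "\<And>i. l \<le> i \<Longrightarrow> x i \<notin> p" using not_top_x[OF p] by blast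
  have cS: "c \<in> S" using c prime_S[OF p(1)] by auto
  obtain j where j: "j \<ge> l" "c \<in> R j" using S_common2[OF cS cS] by blast
  have lj: "\<And>i. j \<le> i \<Longrightarrow> x i \<notin> p" using l j by auto
  have P: "prime_ideal (R j) (p \<inter> R j)" by (rule contract_S[OF p(1)])
  let ?C = "\<lambda>n. \<exists>r. prime_chain (R j) r n \<and> r 0 = {0} \<and> r n = p \<inter> R j"
  obtain d where d: "krull_dim (R j) = enat d" using reg[of j] by (auto simp: regular_local_ring_def)
  have bd: "n \<le> d" if "?C n" for n using that krull_dim_ge[of "R j" _ n] d by fastforce
  have Z: "prime_ideal (R j) {0}" by (rule prime_zero[OF sub])
  have "{0} \<subset> p \<inter> R j" using c j idealD(1)[OF sub primeD(1)[OF sub P]] by blast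
  then have C1: "?C 1" using chain2[OF Z P] by (intro exI[of _ "\<lambda>i. if i = 0 then {0} else p \<inter> R j"]) auto
  define n where "n = (GREATEST n. ?C n)"
  have Cn: "?C n" unfolding n_def by (rule GreatestI_nat[where k = 1 and b = d]) (use C1 bd in auto)
  have mx: "k \<le> n" if "?C k" for k unfolding n_def by (rule Greatest_le_nat[where b = d]) (use that bd in auto)
  obtain k where k: "n = Suc k" using mx[OF C1] by (cases n) auto
  obtain r where r: "prime_chain (R j) r n" "r 0 = {0}" "r n = p \<inter> R j" using Cn by blast
  have "\<exists>p'. (\<forall>i\<le>k. prime_ideal (R j) (p' i)) \<and> (\<forall>i<k. p' i \<subset> p' (Suc i)) \<and> p' k = r (Suc k) \<and> c \<in> p' 0 \<and> r 0 \<subset> p' 0"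
    by (rule chain_through[OF sub noe]) (use r k c j in \<open>auto simp: prime_chain_def\<close>)
  then obtain p' where p': "\<And>i. i\<le>k \<Longrightarrow> prime_ideal (R j) (p' i)" "\<And>i. i<k \<Longrightarrow> p' i \<subset> p' (Suc i)"
    "p' k = p \<inter> R j" "c \<in> p' 0" using r k by auto
  have up: "p' 0 \<subseteq> p' i" if "i \<le> k" for i using that
  proof (induction i)
    case (Suc i)
    then have "p' i \<subset> p' (Suc i)" "p' 0 \<subseteq> p' i" using p'(2)[of i] by auto
    then show ?case by blast
  qed auto
  have q0: "prime_ideal (R j) (p' 0)" "p' 0 \<subseteq> p" using p'(1)[of 0] up[of k] p'(3) by auto
  have min: "q = {0}" if q: "prime_ideal (R j) q" "q \<subset> p' 0" for q
  proof (rule ccontr)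
    assume "q \<noteq> {0}"
    then have "{0} \<subset> q" using idealD(1)[OF sub primeD(1)[OF sub q(1)]] by blast
    let ?r = "\<lambda>i. if i = 0 then {0} else if i = 1 then q else p' (i - 2)"
    have "prime_chain (R j) ?r (Suc (Suc k))"
      unfolding prime_chain_def
    proof (intro conjI allI impI)
      show "prime_ideal (R j) (?r i)" if "i \<le> Suc (Suc k)" for i using Z q p'(1)[of "i - 2"] that by auto
      show "?r i \<subset> ?r (Suc i)" if i: "i < Suc (Suc k)" for i
      proof -
        consider "i = 0" | "i = 1" | i' where "i = Suc (Suc i')" by (metis One_nat_def not0_implies_Suc)
        then show ?thesis
        proof cases
          case 3
          then show ?thesis using p'(2)[of i'] i by simp
        qed (use \<open>{0} \<subset> q\<close> q(2) in auto)
      qed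
    qed
    then have "?C (Suc (Suc k))" using p'(3) by (intro exI[of _ ?r]) auto
    then have "Suc (Suc k) \<le> n" by (rule mx)
    then show False using k by simp
  qed
  obtain q' where q': "prime_ideal S q'" "q' \<subseteq> p" "q' \<inter> R j = p' 0" using lift_prime[OF p(1) lj q0] by blast
  have "height S q' = 1"
    unfolding height_one_iff[OF S_sub q'(1)]
  proof (intro conjI allI impI)
    show "q' \<noteq> {0}" using q'(3) p'(4) c(2) by blast
    fix q assume q: "prime_ideal S q" "q \<subset> q'"
    have "q \<inter> R j \<subset> q' \<inter> R j" by (rule contract_strict[OF p(1) lj q(1) q'(2,1) q(2)])
    then have "q \<inter> R j \<subset> p' 0" using q'(3) by simp
    then have "q \<inter> R j = {0}" by (intro min contract_S q)
    then show "q = {0}" using contract_nonzero[OF p(1) lj q(1)] q(2) q'(2) by blast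
  qed
  moreover have "q' \<noteq> N" using q'(2) p prime_N[OF p(1)] by blast
  moreover have "c \<in> q'" using q'(3) p'(4) by blast
  ultimately show ?thesis using q' by blast
qed

subsection \<open>Exceptional divisors that survive\<close>

definition live where "live i \<longleftrightarrow> (\<forall>k. ot (x i) (Suc i) k \<in> N)"

lemma x_R_Suc: "x i \<in> R (Suc i)" using x_R' by simp

text \<open>As long as the order transform of \<open>x i\<close> remains a nonunit, it generates the center of the
  \<open>i\<close>-th order valuation, and the following \<open>x n\<close> lie outside this center.\<close>

lemma live_center:
  assumes live: "live i"
  shows "(\<forall>f\<in>R (Suc i + k). f \<noteq> 0 \<longrightarrow> 0 \<le> fo i f \<and> (1 \<le> fo i f \<longrightarrow> f / ot (x i) (Suc i) k \<in> R (Suc i + k)))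
     \<and> fo i (ot (x i) (Suc i) k) = 1 \<and> fo i (x (Suc i + k)) = 0"
proof -
  let ?e = "ot (x i) (Suc i)"
  have eR: "?e k \<in> R (Suc i + k)" "?e k \<noteq> 0" "?e k \<in> m (Suc i + k)" for k
  proof -
    show 1: "?e k \<in> R (Suc i + k)" "?e k \<noteq> 0" using ot_R[OF x_R_Suc x_nz] by auto
    show "?e k \<in> m (Suc i + k)" using live 1 m_eq unfolding live_def by blast
  qed
  have xe: "fo i (x (Suc i + k)) = 0"
    if A: "\<forall>f\<in>R (Suc i + k). f \<noteq> 0 \<longrightarrow> 0 \<le> fo i f \<and> (1 \<le> fo i f \<longrightarrow> f / ?e k \<in> R (Suc i + k))" for k
  proof (rule ccontr)
    let ?n = "Suc i + k"
    assume "fo i (x ?n) \<noteq> 0"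
    then have u: "x ?n / ?e k \<in> R ?n" using A x_R[of ?n] x_nz[of ?n] by force
    let ?u = "x ?n / ?e k"
    have u0: "?u \<noteq> 0" using x_nz eR by simp
    \<comment> \<open>\<open>x ?n\<close> has order one and \<open>?e k\<close> is a nonunit, so
      \<open>?e k\<close> has order one and its next transform is the inverse of
      \<open>?u \<in> S\<close>, hence a unit, against \<open>live i\<close>.\<close>
    have "od ?n (x ?n) = od ?n (?u * ?e k)" using eR(2) by simp
    then have "1 = od ?n ?u + od ?n (?e k)" using o_x o_mult[OF u eR(1) u0 eR(2)] by simp
    moreover have "1 \<le> od ?n (?e k)" by (rule o_pos[OF eR(3,2)])
    ultimately have o1: "od ?n (?e k) = 1" by simp
    have "?e (Suc k) = ?e k / x ?n" using o1 by simp
    then have "inverse (?e (Suc k)) = ?u" by simp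
    then have "inverse (?e (Suc k)) \<in> S" using u R_S by fastforce
    then show False using unit_N[OF eR(2)[of "Suc k"]] live unfolding live_def by blast
  qed
  have "(\<forall>f\<in>R (Suc i + k). f \<noteq> 0 \<longrightarrow> 0 \<le> fo i f \<and> (1 \<le> fo i f \<longrightarrow> f / ?e k \<in> R (Suc i + k)))
     \<and> fo i (?e k) = 1"
  proof (induction k)
    case 0
    have "0 \<le> fo i f \<and> (1 \<le> fo i f \<longrightarrow> f / x i \<in> R (Suc i))" if f: "f \<in> R (Suc i)" "f \<noteq> 0" for f
    proof -
      obtain k a b where *: "a \<in> mp i k" "b \<noteq> 0" "od i b = k" "a \<in> R i" "b \<in> R i" "f = a / b"
        "b / x i ^ k \<in> R (Suc i)" "b / x i ^ k \<notin> m (Suc i)" using frac[OF f(1), of 0] by metis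
      have a0: "a \<noteq> 0" using * f by auto
      have ka: "k \<le> od i a" using o_iff[OF *(4) a0] *(1) by simp
      have fe: "fo i f = int (od i a) - int k" using fo_eq[OF *(4,5) a0 *(2)] * by simp
      have "f / x i \<in> R (Suc i)" if "1 \<le> fo i f"
      proof -
        have "Suc k \<le> od i a" using that fe by simp
        then have 1: "a / x i ^ Suc k \<in> R (Suc i)" by (rule div_pow[OF *(4) a0])
        have 2: "inverse (b / x i ^ k) \<in> R (Suc i)" using max_ideal_unit[OF *(7,8)] by blast
        have "f / x i = (a / x i ^ Suc k) * inverse (b / x i ^ k)" using * x_nz by (simp add: field_simps)
        then show ?thesis using RD(5)[OF 1 2] by simp
      qed
      then show ?thesis using ka fe by simp
    qed
    moreover have "fo i (x i) = 1" using fo_R[OF x_R x_nz] o_x by simp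
    ultimately show ?case by simp
  next
    case (Suc k)
    let ?n = "Suc i + k"
    let ?r = "od ?n (?e k)"
    have IH: "\<And>f. f \<in> R ?n \<Longrightarrow> f \<noteq> 0 \<Longrightarrow> 0 \<le> fo i f" "\<And>f. f \<in> R ?n \<Longrightarrow> f \<noteq> 0 \<Longrightarrow> 1 \<le> fo i f \<Longrightarrow> f / ?e k \<in> R ?n" "fo i (?e k) = 1"
      using Suc by auto
    have x0: "fo i (x ?n) = 0" using xe Suc by blast
    have e': "?e (Suc k) = ?e k / x ?n ^ ?r" by simp
    have quo: "\<exists>c\<in>R ?n. c \<noteq> 0 \<and> f = ?e k * c \<and> c / x ?n ^ (k' - ?r) \<in> R (Suc ?n)"
      if f: "f \<in> R ?n" "f \<noteq> 0" "1 \<le> fo i f" "k' \<le> od ?n f" for f k'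
    proof -
      have c: "f / ?e k \<in> R ?n" "f / ?e k \<noteq> 0" "f = ?e k * (f / ?e k)" using IH(2) f eR(2) by auto
      have "od ?n f = ?r + od ?n (f / ?e k)" using o_mult[OF eR(1) c(1) eR(2) c(2)] c(3) by metis
      then have "k' - ?r \<le> od ?n (f / ?e k)" using f(4) by simp
      then have "(f / ?e k) / x ?n ^ (k' - ?r) \<in> R (Suc ?n)" by (rule div_pow[OF c(1,2)])
      then show ?thesis using c by blast
    qed
    have "0 \<le> fo i f \<and> (1 \<le> fo i f \<longrightarrow> f / ?e (Suc k) \<in> R (Suc i + Suc k))" if f: "f \<in> R (Suc i + Suc k)" "f \<noteq> 0" for f
    proof -
      have f': "f \<in> R (Suc ?n)" using f by simp
      obtain k' a b where *: "?r \<le> k'" "a \<in> mp ?n k'" "b \<noteq> 0" "od ?n b = k'" "a \<in> R ?n" "b \<in> R ?n" "f = a / b"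
        "b / x ?n ^ k' \<in> R (Suc ?n)" "b / x ?n ^ k' \<notin> m (Suc ?n)" using frac[OF f', of ?r] by metis
      have a0: "a \<noteq> 0" using * f by auto
      have ka: "k' \<le> od ?n a" using o_iff[OF *(5) a0] *(2) by simp
      have sp: "x ?n ^ k' = x ?n ^ ?r * x ?n ^ (k' - ?r)" using *(1) by (simp add: power_add[symmetric])
      \<comment> \<open>Otherwise \<open>?e k\<close> divides \<open>b\<close>, and after the
        transform the nonunit \<open>?e (Suc k)\<close> would divide the unit
        \<open>b / x ?n ^ k'\<close>.\<close>
      have b0: "fo i b = 0"
      proof (rule ccontr)
        assume "fo i b \<noteq> 0"
        then have "1 \<le> fo i b" using IH(1)[OF *(6,3)] by simp
        then obtain c where c: "b = ?e k * c" "c / x ?n ^ (k' - ?r) \<in> R (Suc ?n)" using quo[OF *(6,3)] *(4) by blast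
        have "b / x ?n ^ k' = ?e (Suc k) * (c / x ?n ^ (k' - ?r))" unfolding c(1) sp e' by simp
        moreover have "?e (Suc k) \<in> m (Suc ?n)" using eR(3)[of "Suc k"] by simp
        ultimately show False using mD(7) c(2) *(9) by metis
      qed
      have fa: "fo i f = fo i a" using fo_divide[OF a0 *(3)] *(7) b0 by simp
      have "f / ?e (Suc k) \<in> R (Suc ?n)" if "1 \<le> fo i f"
      proof -
        have "1 \<le> fo i a" using that fa by simp
        then obtain c where c: "a = ?e k * c" "c / x ?n ^ (k' - ?r) \<in> R (Suc ?n)"
          using quo[OF *(5) a0 _ ka] by blast
        have 2: "inverse (b / x ?n ^ k') \<in> R (Suc ?n)" using max_ideal_unit[OF *(8,9)] by blast
        have "f / ?e (Suc k) = (c / x ?n ^ (k' - ?r)) * inverse (b / x ?n ^ k')"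
          unfolding *(7) c(1) sp e' using x_nz[of ?n] eR(2)[of k] *(3) by (simp add: field_simps)
        then show ?thesis using RD(5)[OF c(2) 2] by simp
      qed
      then show ?thesis using fa IH(1)[OF *(5) a0] by simp
    qed
    moreover have "fo i (?e (Suc k)) = 1"
      unfolding e' using fo_divide[OF eR(2), of "x ?n ^ ?r" i k] fo_power[OF x_nz, of i ?n ?r] x_nz IH(3) x0 by simp
    ultimately show ?case by blast
  qed
  then show ?thesis using xe by blast
qed

definition center where "center i = {f \<in> S. f = 0 \<or> 1 \<le> fo i f}"

text \<open>At every stage the center is generated by the current transform of \<open>x i\<close>. A
  nonzero element of a prime \<open>q\<close> below the center is a power of this generator times an
  element outside the center, so \<open>q\<close> contains the generator at all late stages and
  equals the center. The last claim separates the centers of different indices.\<close>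

lemma live_height_one:
  assumes live: "live i"
  shows "center i \<in> height_one_primes" "x i \<in> center i" "\<And>j. i < j \<Longrightarrow> x j \<notin> center i"
proof -
  let ?e = "ot (x i) (Suc i)"
  note lc = live_center[OF live]
  have stage: "\<exists>k. f \<in> R (Suc i + k) \<and> g \<in> R (Suc i + k)" if "f \<in> S" "g \<in> S" for f g
    using S_common2[OF that, of "Suc i"] le_Suc_ex by blast
  have pos: "0 \<le> fo i f" if f: "f \<in> S" "f \<noteq> 0" for f
    using stage[OF f(1) f(1)] lc f(2) by blast
  have e: "?e k \<in> R (Suc i + k)" "?e k \<noteq> 0" for k using ot_R[OF x_R_Suc x_nz] by auto
  have one: "fo i 1 = 0" using fo_R[of 1 i] RD o_one by simp
  have I: "is_ideal S (center i)"
    unfolding is_ideal_def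
  proof (intro conjI ballI)
    show "center i \<subseteq> S" "0 \<in> center i" using SD(1) by (auto simp: center_def)
    show "a * f \<in> center i" if "a \<in> S" "f \<in> center i" for a f
      using that fo_mult[of a f i] pos[of a] SD(5) by (cases "a = 0"; cases "f = 0") (auto simp: center_def)
    fix f g assume fg: "f \<in> center i" "g \<in> center i"
    then have S: "f \<in> S" "g \<in> S" by (auto simp: center_def)
    obtain k where k: "f \<in> R (Suc i + k)" "g \<in> R (Suc i + k)" using stage[OF S] by blast
    have "h / ?e k \<in> R (Suc i + k)" if "h \<in> center i" "h \<in> R (Suc i + k)" for h
      using that lc[of k] RD(1) by (cases "h = 0") (auto simp: center_def)
    then have "(f + g) / ?e k \<in> R (Suc i + k)" using fg k RD(3) by (simp add: add_divide_distrib)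
    then have q: "(f + g) / ?e k \<in> S" using R_S by blast
    show "f + g \<in> center i"
    proof (cases "f + g = 0")
      case False
      have "f + g = ((f + g) / ?e k) * ?e k" using e by simp
      then have "fo i (f + g) = fo i ((f + g) / ?e k) + fo i (?e k)" using fo_mult e False by (metis divide_eq_0_iff)
      then have "1 \<le> fo i (f + g)" using pos[OF q] lc[of k] e(2) False by simp
      then show ?thesis using SD(3) S by (simp add: center_def)
    qed (use SD(1) in \<open>simp add: center_def\<close>)
  qed
  have P: "prime_ideal S (center i)"
  proof (rule primeI[OF I])
    show "1 \<notin> center i" "1 \<in> S" using one SD(2) by (auto simp: center_def)
    show "a \<in> center i \<or> b \<in> center i" if "a \<in> S" "b \<in> S" "a * b \<in> center i" for a b
    proof (cases "a = 0 \<or> b = 0")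
      case True then show ?thesis using SD(1) by (auto simp: center_def)
    next
      case False
      then show ?thesis using that fo_mult[of a b i] pos[of a] pos[of b] by (auto simp: center_def)
    qed
  qed
  show xi: "x i \<in> center i" using fo_R[OF x_R x_nz] o_x x_S by (simp add: center_def)
  show "x j \<notin> center i" if "i < j" for j
  proof -
    obtain k where "j = Suc i + k" using \<open>i < j\<close> less_imp_Suc_add[of i j] by auto
    then show ?thesis using lc[of k] x_nz by (simp add: center_def)
  qed
  have "height S (center i) = 1"
    unfolding height_one_iff[OF S_sub P]
  proof (intro conjI allI impI)
    show "center i \<noteq> {0}" using xi x_nz by blast
    fix q assume q: "prime_ideal S q" "q \<subset> center i"
    show "q = {0}"
    proof (rule ccontr)
      assume "q \<noteq> {0}"
      then obtain f where f: "f \<in> q" "f \<noteq> 0" using prime_zero_in[OF q(1)] by blast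
      have "g \<in> q" if g: "g \<in> center i" for g
      proof -
        have fS: "f \<in> S" and gS: "g \<in> S" using f g q by (auto simp: center_def)
        obtain k where k: "f \<in> R (Suc i + k)" "g \<in> R (Suc i + k)" using stage[OF fS gS] by blast
        have "\<exists>r. \<exists>h\<in>R (Suc i + k). h \<noteq> 0 \<and> f = ?e k ^ r * h \<and> fo i h = 0" using k(1) f(2)
        proof (induction "nat (fo i f)" arbitrary: f rule: less_induct)
          case less
          have p: "0 \<le> fo i f" using pos less.prems R_S by blast
          show ?case
          proof (cases "fo i f = 0")
            case True
            then show ?thesis using less.prems by (intro exI[of _ 0] bexI[of _ f]) auto
          next
            case False
            then have c: "f / ?e k \<in> R (Suc i + k)" using lc[of k] less.prems p by auto
            have c0: "f / ?e k \<noteq> 0" using less.prems e by simp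
            have "fo i (f / ?e k) = fo i f - 1" using fo_divide[OF less.prems(2) e(2)] lc[of k] by simp
            then have "nat (fo i (f / ?e k)) < nat (fo i f)" using p False by simp
            from less.hyps[OF this c c0] obtain r h where "h \<in> R (Suc i + k)" "h \<noteq> 0" "f / ?e k = ?e k ^ r * h" "fo i h = 0" by blast
            then show ?thesis using e(2)[of k] by (intro exI[of _ "Suc r"] bexI[of _ h]) (auto simp: field_simps)
          qed
        qed
        then obtain r h where h: "h \<in> R (Suc i + k)" "h \<noteq> 0" "f = ?e k ^ r * h" "fo i h = 0" by blast
        have eS: "?e k \<in> S" and hS: "h \<in> S" using e(1)[of k] h R_S by blast+
        have "h \<notin> q" using h q by (auto simp: center_def)
        then have "?e k ^ r \<in> q" using primeD(3)[OF S_sub q(1) subring_power[OF S_sub eS] hS] f h by blast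
        then have eq: "?e k \<in> q" using prime_power[OF S_sub q(1) eS] by blast
        have "g / ?e k \<in> R (Suc i + k)" using g k lc[of k] RD(1) by (cases "g = 0") (auto simp: center_def)
        then have "(g / ?e k) * ?e k \<in> q" using idealD(6)[OF S_sub primeD(1)[OF S_sub q(1)] _ eq] R_S by blast
        then show ?thesis using e by simp
      qed
      then show False using q by blast
    qed
  qed
  then show "center i \<in> height_one_primes" using P by blast
qed

subsection \<open>Elements whose order transform becomes a unit\<close>

definition dead where "dead f l \<longleftrightarrow> (\<exists>k. ot f l k \<notin> N)"

lemma ot_S: "f \<in> R l \<Longrightarrow> f \<noteq> 0 \<Longrightarrow> ot f l k \<in> S"
  using ot_R R_S by blast

lemma ot_stable:
  assumes f: "f \<in> R l" "f \<noteq> 0" and k: "ot f l k \<notin> N"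
  shows "ot f l (k + n) \<notin> N"
proof (induction n)
  case (Suc n)
  have "ot f l (k + n) \<in> R (l + (k + n))" "ot f l (k + n) \<noteq> 0" using ot_R[OF f] by auto
  moreover have "ot f l (k + n) \<notin> m (l + (k + n))" using Suc by (auto simp: N_def)
  ultimately have "od (l + (k + n)) (ot f l (k + n)) = 0" using o_0_iff by blast
  then show ?case using Suc by simp
qed (use k in simp)

lemma dead_mult:
  assumes f: "f \<in> R l" "f \<noteq> 0" "dead f l" and g: "g \<in> R l" "g \<noteq> 0" "dead g l"
  shows "dead (f * g) l"
proof -
  obtain k k' where k: "ot f l k \<notin> N" "ot g l k' \<notin> N" using f g by (auto simp: dead_def)
  have "ot f l (k + k') \<notin> N" "ot g l (k + k') \<notin> N"
    using ot_stable[OF f(1,2) k(1), of k'] ot_stable[OF g(1,2) k(2), of k] by (auto simp: add.commute)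
  then have "ot (f * g) l (k + k') \<notin> N"
    using ot_mult[OF f(1,2) g(1,2)] unit_set_mult ot_S[OF f(1,2)] ot_S[OF g(1,2)] by metis
  then show ?thesis by (auto simp: dead_def)
qed

lemma dead_one: "dead 1 l"
  unfolding dead_def using primeD(2)[OF S_sub N_prime] by (intro exI[of _ 0]) simp

lemma dead_factor:
  assumes f: "f \<in> R l" "f \<noteq> 0" and g: "g \<in> R l" "g \<noteq> 0" and fg: "dead (f * g) l"
  shows "dead f l"
proof -
  obtain k where k: "ot (f * g) l k \<notin> N" using fg by (auto simp: dead_def)
  then have "ot f l k \<notin> N" using ot_mult[OF f g] ND(7) ot_S[OF g] by metis
  then show ?thesis by (auto simp: dead_def)
qed

lemma dead_power: "f \<in> R l \<Longrightarrow> f \<noteq> 0 \<Longrightarrow> dead f l \<Longrightarrow> dead (f ^ n) l"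
  by (induction n) (auto simp: dead_one intro!: dead_mult subring_power[OF sub])

lemma dead_prod: "(\<And>i. i \<in> I \<Longrightarrow> f i \<in> R l \<and> f i \<noteq> 0 \<and> dead (f i) l) \<Longrightarrow> dead (prod f I) l"
proof (induction I rule: infinite_finite_induct)
  case (insert i I)
  have "prod f I \<in> R l" by (rule subring_prod[OF sub]) (use insert in auto)
  moreover have "prod f I \<noteq> 0" using insert by auto
  ultimately show ?case using insert by (auto intro!: dead_mult)
qed (auto simp: dead_one)

text \<open>\<open>x i\<close> is its own transform at stage \<open>l\<close> times powers of
  \<open>x j\<close> with \<open>i < j < l\<close>. The transform dies because \<open>i\<close> is
  not live, the other factors by induction on \<open>l - i\<close>.\<close>

lemma x_dead:
  assumes nl: "\<And>i. i0 \<le> i \<Longrightarrow> \<not> live i" and i: "i0 \<le> i" "i < l" shows "dead (x i) l"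
  using i
proof (induction "l - i" arbitrary: i rule: less_induct)
  case less
  obtain k where k: "l = Suc i + k" using less.prems(2) less_imp_Suc_add by auto
  let ?E = "ot (x i) (Suc i) k"
  have E: "?E \<in> R l" "?E \<noteq> 0" using ot_R[OF x_R_Suc x_nz] k by auto
  have "dead ?E l"
  proof -
    obtain n where n: "ot (x i) (Suc i) n \<notin> N" using nl less.prems by (auto simp: live_def)
    have "ot (x i) (Suc i) (n + k) \<notin> N" by (rule ot_stable[OF x_R_Suc x_nz n])
    then show ?thesis unfolding dead_def k using ot_shift[of "x i" "Suc i" k n] by (metis add.commute)
  qed
  moreover have pr: "dead (\<Prod>j<k. x (Suc i + j) ^ od (Suc i + j) (ot (x i) (Suc i) j)) l"
  proof (rule dead_prod)
    fix j assume "j \<in> {..<k}"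
    then have j: "Suc i + j < l" using k by simp
    have xr: "x (Suc i + j) \<in> R l" using x_R' j by simp
    have "dead (x (Suc i + j)) l" by (rule less.hyps) (use j less.prems in auto)
    then show "x (Suc i + j) ^ od (Suc i + j) (ot (x i) (Suc i) j) \<in> R l \<and>
        x (Suc i + j) ^ od (Suc i + j) (ot (x i) (Suc i) j) \<noteq> 0 \<and>
        dead (x (Suc i + j) ^ od (Suc i + j) (ot (x i) (Suc i) j)) l"
      using dead_power[OF xr x_nz] subring_power[OF sub xr] x_nz by auto
  qed
  moreover have "(\<Prod>j<k. x (Suc i + j) ^ od (Suc i + j) (ot (x i) (Suc i) j)) \<in> R l"
    by (rule subring_prod[OF sub], rule subring_power[OF sub], rule x_R') (use k in auto)
  moreover have "(\<Prod>j<k. x (Suc i + j) ^ od (Suc i + j) (ot (x i) (Suc i) j)) \<noteq> 0" using x_nz by simp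
  ultimately have "dead (?E * (\<Prod>j<k. x (Suc i + j) ^ od (Suc i + j) (ot (x i) (Suc i) j))) l"
    using dead_mult[OF E] by blast
  then show ?case using ot_prod[OF x_R_Suc x_nz, of i k] by simp
qed


text \<open>The order of the successive transforms is at most \<open>s\<close> by
  \<open>o_transform\<close> and at least \<open>s\<close> by assumption; it stays
  \<open>s \<ge> 1\<close>, so no transform becomes a unit.\<close>

lemma dead_order:
  assumes c: "c \<in> R n" "c \<noteq> 0" "dead c n" "od n c = s" "1 \<le> s"
    and st: "\<And>k. c / pr n (n + k) ^ s \<in> mp (n + k) s"
  shows False
proof -
  have "ot c n k = c / pr n (n + k) ^ s \<and> od (n + k) (ot c n k) = s" for k
  proof (induction k)
    case (Suc k)
    have "ot c n (Suc k) = (c / pr n (n + k) ^ s) / x (n + k) ^ s" unfolding ot.simps using Suc by metis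
    also have "\<dots> = c / pr n (n + Suc k) ^ s" using pr_Suc[of n "n + k"] by (simp add: power_mult_distrib)
    finally have 1: "ot c n (Suc k) = c / pr n (n + Suc k) ^ s" .
    have 2: "od (n + Suc k) (ot c n (Suc k)) \<le> s" using ot_o_Suc[OF c(1,2), of k] Suc by metis
    have "s \<le> od (n + Suc k) (ot c n (Suc k))"
      using o_iff ot_R[OF c(1,2), of "Suc k"] st[of "Suc k"] 1 by metis
    then show ?case using 1 2 by simp
  qed (use c in simp)
  note all = this
  have inN: "ot c n k \<in> N" for k
  proof -
    have "od (n + k) (ot c n k) \<noteq> 0" using all[of k] c(5) by linarith
    then have "ot c n k \<in> m (n + k)" using o_0_iff[of "ot c n k" "n + k"] ot_R[OF c(1,2), of k] by simp
    then show ?thesis by (auto simp: N_def)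
  qed
  show False using c(3) inN by (auto simp: dead_def)
qed

text \<open>Both elements are divided by the same power at each stage, which keeps their quotient
  unchanged; hence the minimum of the orders instead of two separate transforms.\<close>

fun dv :: "'a \<Rightarrow> 'a \<Rightarrow> nat \<Rightarrow> nat \<Rightarrow> 'a" where
  "dv a b l 0 = 1"
| "dv a b l (Suc k) = dv a b l k * x (l + k) ^ min (od (l + k) (a / dv a b l k)) (od (l + k) (b / dv a b l k))"

text \<open>The minimum of the two orders cannot increase, hence becomes constant.\<close>

lemma pair_process:
  assumes a: "a \<in> R l" "a \<noteq> 0" and b: "b \<in> R l" "b \<noteq> 0"
  shows "\<exists>n\<ge>l. \<exists>\<rho> r z. z = (\<Prod>j\<in>{l..<n}. x j ^ \<rho> j) \<and> (\<forall>k. a / z / pr n (n + k) ^ r \<in> R (n + k) \<and>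
     b / z / pr n (n + k) ^ r \<in> R (n + k) \<and>
     min (od (n + k) (a / z / pr n (n + k) ^ r)) (od (n + k) (b / z / pr n (n + k) ^ r)) = r)"
proof -
  let ?d = "dv a b l"
  define mn where "mn k = min (od (l + k) (a / ?d k)) (od (l + k) (b / ?d k))" for k
  have d_Suc: "?d (Suc k) = ?d k * x (l + k) ^ mn k" for k by (simp add: mn_def)
  have d0: "?d k \<noteq> 0" for k by (induction k) (use x_nz in auto)
  have R: "a / ?d k \<in> R (l + k) \<and> b / ?d k \<in> R (l + k)" for k
  proof (induction k)
    case (Suc k)
    have "(a / ?d k) / x (l + k) ^ mn k \<in> R (Suc (l + k))" "(b / ?d k) / x (l + k) ^ mn k \<in> R (Suc (l + k))"
      using div_pow[of "a / ?d k" "l + k" "mn k"] div_pow[of "b / ?d k" "l + k" "mn k"] Suc a b d0 by (auto simp: mn_def)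
    then show ?case by (simp add: d_Suc del: dv.simps)
  qed (use a b in simp)
  have anti: "mn (Suc k) \<le> mn k" for k
  proof (cases "mn k = od (l + k) (a / ?d k)")
    case True
    have "od (Suc (l + k)) ((a / ?d k) / x (l + k) ^ mn k) \<le> mn k"
      using o_transform[of "a / ?d k" "l + k"] R[of k] a d0 True by auto
    then show ?thesis unfolding mn_def[of "Suc k"] by (simp add: d_Suc del: dv.simps)
  next
    case False
    then have "mn k = od (l + k) (b / ?d k)" by (simp add: mn_def min_def split: if_splits)
    then have "od (Suc (l + k)) ((b / ?d k) / x (l + k) ^ mn k) \<le> mn k"
      using o_transform[of "b / ?d k" "l + k"] R[of k] b d0 by auto
    then show ?thesis unfolding mn_def[of "Suc k"] by (simp add: d_Suc del: dv.simps)
  qed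
  obtain k0 where k0: "\<And>k. mn k0 \<le> mn k" using ex_has_least_nat[of "\<lambda>_. True" _ mn] by auto
  define n where "n = l + k0"
  define r where "r = mn k0"
  have cst: "mn (k0 + k) = r" for k
    using lift_Suc_antimono_le[of mn k0 "k0 + k", OF anti] k0[of "k0 + k"] by (simp add: r_def)
  have dd: "?d (k0 + k) = ?d k0 * pr n (n + k) ^ r" for k
  proof (induction k)
    case (Suc k)
    have "?d (k0 + Suc k) = ?d (k0 + k) * x (l + (k0 + k)) ^ r" using d_Suc[of "k0 + k"] cst by simp
    moreover have "pr n (n + Suc k) = pr n (n + k) * x (l + (k0 + k))" using pr_Suc[of n "n + k"] by (simp add: n_def add.assoc)
    ultimately show ?case using Suc by (simp only: power_mult_distrib mult.assoc)
  qed simp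
  have z: "?d k = (\<Prod>j\<in>{l..<l + k}. x j ^ mn (j - l))" for k
    by (induction k) (auto simp: d_Suc simp del: dv.simps(2))
  show ?thesis
  proof (rule exI[of _ n], rule conjI)
    show "l \<le> n" by (simp add: n_def)
    show "\<exists>\<rho> r z. z = (\<Prod>j\<in>{l..<n}. x j ^ \<rho> j) \<and> (\<forall>k. a / z / pr n (n + k) ^ r \<in> R (n + k) \<and>
      b / z / pr n (n + k) ^ r \<in> R (n + k) \<and>
      min (od (n + k) (a / z / pr n (n + k) ^ r)) (od (n + k) (b / z / pr n (n + k) ^ r)) = r)"
    proof (rule exI[of _ "\<lambda>j. mn (j - l)"], rule exI[of _ r], rule exI[of _ "?d k0"], intro conjI allI)
      show "?d k0 = (\<Prod>j\<in>{l..<n}. x j ^ mn (j - l))" using z by (simp add: n_def)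
      fix k
      have e: "a / ?d k0 / pr n (n + k) ^ r = a / ?d (k0 + k)" "b / ?d k0 / pr n (n + k) ^ r = b / ?d (k0 + k)" "n + k = l + (k0 + k)"
        using dd[of k] by (auto simp: n_def)
      show "a / ?d k0 / pr n (n + k) ^ r \<in> R (n + k)" "b / ?d k0 / pr n (n + k) ^ r \<in> R (n + k)"
        unfolding e(1,2) unfolding e(3) using R[of "k0 + k"] by auto
      show "min (od (n + k) (a / ?d k0 / pr n (n + k) ^ r)) (od (n + k) (b / ?d k0 / pr n (n + k) ^ r)) = r"
        unfolding e(1,2) unfolding e(3) using cst[of k] by (simp add: mn_def)
    qed
  qed
qed

end

section \<open>Finitely many height one primes: comparability of elements under divisibility\<close>

locale quad_seq_fin = quad_seq +
  assumes fin: "finite {P. prime_ideal S P \<and> height S P = 1}"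
begin

definition H where "H = height_one_primes - {N}"

lemma H_fin: "finite H" using fin by (simp add: H_def)

lemma H_prime: "P \<in> H \<Longrightarrow> prime_ideal S P" by (simp add: H_def)

lemma H_incomparable: "P \<in> H \<Longrightarrow> P' \<in> H \<Longrightarrow> P \<subseteq> P' \<Longrightarrow> P = P'"
  using height_one_iff[OF S_sub, of P] height_one_iff[OF S_sub, of P'] by (auto simp: H_def)

lemma not_live_ex: "\<exists>i0. \<forall>i\<ge>i0. \<not> live i"
proof -
  have "inj_on center {i. live i}"
  proof (rule inj_onI)
    have *: "center i \<noteq> center j" if "live i" "live j" "i < j" for i j
      using live_height_one[OF that(1)] live_height_one[OF that(2)] that(3) by blast
    fix i j assume "i \<in> {i. live i}" "j \<in> {i. live i}" "center i = center j"
    then show "i = j" using *[of i j] *[of j i] by (cases i j rule: linorder_cases) auto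
  qed
  moreover have "center ` {i. live i} \<subseteq> height_one_primes" using live_height_one(1) by blast
  then have "finite (center ` {i. live i})" using fin by (rule finite_subset)
  ultimately have "finite {i. live i}" using finite_imageD by blast
  then obtain b where "\<forall>i\<in>{i. live i}. i < b" using finite_nat_set_iff_bounded by blast
  then show ?thesis by (intro exI[of _ b]) force
qed

definition i0 where "i0 = (SOME i0. \<forall>i\<ge>i0. \<not> live i)"

lemma not_live: "i0 \<le> i \<Longrightarrow> \<not> live i"
  using someI_ex[OF not_live_ex] unfolding i0_def by blast

text \<open>For \<open>i \<ge> i0\<close> the element \<open>x i\<close> is a unit times a product
  of powers of later \<open>x j\<close>, so a prime containing it contains a later one; repetition
  gives arbitrarily late ones, and \<open>prime_top\<close> applies.\<close>

lemma x_only_N: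
  assumes p: "prime_ideal S p" and x: "x i \<in> p" "i0 \<le> i" shows "p = N"
proof -
  have step: "\<exists>j>i. x j \<in> p" if i: "x i \<in> p" "i0 \<le> i" for i
  proof -
    obtain k where k: "ot (x i) (Suc i) k \<notin> N" using not_live[OF i(2)] by (auto simp: live_def)
    let ?u = "ot (x i) (Suc i) k"
    let ?g = "\<lambda>j. x (Suc i + j) ^ od (Suc i + j) (ot (x i) (Suc i) j)"
    have u: "?u \<in> S" "?u \<notin> p" using ot_S[OF x_R_Suc x_nz] k prime_N[OF p] by auto
    have "?u * prod ?g {..<k} \<in> p" using ot_prod[OF x_R_Suc x_nz, of i k] i by simp
    then have "prod ?g {..<k} \<in> p"
      using primeD(3)[OF S_sub p u(1)] u(2) subring_prod[OF S_sub, of "{..<k}" ?g] subring_power[OF S_sub x_S] by blast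
    then obtain j where "?g j \<in> p" using prime_prod[OF S_sub p, of "{..<k}" ?g] subring_power[OF S_sub x_S] by blast
    then have "x (Suc i + j) \<in> p" using prime_power[OF S_sub p x_S] by blast
    then show ?thesis by (intro exI[of _ "Suc i + j"]) auto
  qed
  have "\<exists>j\<ge>l. x j \<in> p \<and> i0 \<le> j" for l
  proof (induction l)
    case 0 then show ?case using x by auto
  next
    case (Suc l)
    then obtain j where "j \<ge> l" "x j \<in> p" "i0 \<le> j" by blast
    moreover obtain j' where "j' > j" "x j' \<in> p" using step calculation by blast
    ultimately show ?case by (intro exI[of _ j']) auto
  qed
  then show ?thesis using prime_top[OF p] by blast
qed

definition free where "free c \<longleftrightarrow> c \<in> S \<and> c \<noteq> 0 \<and> (\<forall>P\<in>H. c \<notin> P)"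

lemma free_factor: "free (a * b) \<Longrightarrow> a \<in> S \<Longrightarrow> b \<in> S \<Longrightarrow> free a"
  unfolding free_def using idealD(7)[OF S_sub primeD(1)[OF S_sub H_prime]] by auto

text \<open>By \<open>height_one_below\<close> no prime other than \<open>N\<close> contains
  \<open>c\<close>, so \<open>c\<close> divides a power of \<open>x i0\<close>. That power is dead,
  and factors of dead elements are dead.\<close>

lemma free_dead:
  assumes c: "free c" "c \<in> R l" "i0 < l" shows "dead c l"
proof -
  have c0: "c \<in> S" "c \<noteq> 0" using c by (auto simp: free_def)
  let ?I = "principal S c"
  have I: "is_ideal S ?I" by (rule principal_ideal[OF S_sub c0(1)])
  have "\<exists>n. x i0 ^ n \<in> ?I"
  proof (rule power_mem_if_all_primes[OF S_sub I x_S])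
    fix p assume p: "prime_ideal S p" "?I \<subseteq> p"
    then have "c \<in> p" using principal_self[OF S_sub] by blast
    then have "p = N" using height_one_below[OF p(1) _ _ c0(2)] c(1) unfolding free_def H_def by blast
    then show "x i0 \<in> p" using x_N by simp
  qed
  then obtain n y where y: "y \<in> S" "x i0 ^ n = c * y" by (auto simp: principal_def)
  have y0: "y \<noteq> 0" using y x_nz[of i0] by (metis mult_zero_right power_not_zero)
  \<comment> \<open>The cofactor \<open>y\<close> may appear only at a later stage
    \<open>l'\<close>; the argument runs there and is brought back to \<open>l\<close> by
    \<open>ot_shift\<close>.\<close>
  obtain l' where l': "l' \<ge> l" "y \<in> R l'" using S_common2[OF y(1) y(1)] by blast
  then obtain k where k: "l' = l + k" using le_Suc_ex by blast
  let ?c = "ot c l k"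
  let ?g = "\<lambda>j. x (l + j) ^ od (l + j) (ot c l j)"
  have C: "?c \<in> R l'" "?c \<noteq> 0" using ot_R[OF c(2) c0(2)] k by auto
  have pR: "prod ?g {..<k} \<in> R l'" by (rule subring_prod[OF sub], rule subring_power[OF sub], rule x_R') (use k in auto)
  have p0: "prod ?g {..<k} \<noteq> 0" using x_nz by simp
  have "c = ?c * prod ?g {..<k}" by (rule ot_prod[OF c(2) c0(2)])
  then have "c * y = ?c * prod ?g {..<k} * y" by (rule arg_cong)
  then have "x i0 ^ n = ?c * (prod ?g {..<k} * y)" using y(2) by (simp only: mult.assoc)
  moreover have "dead (x i0 ^ n) l'"
    by (rule dead_power[OF x_R' x_nz x_dead[OF not_live]]) (use c(3) l' in auto)
  ultimately have "dead (?c * (prod ?g {..<k} * y)) l'" by simp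
  then have "dead ?c l'"
    by (rule dead_factor[OF C, rotated 2]) (use RD(5)[OF pR l'(2)] p0 y0 in auto)
  then show ?thesis unfolding dead_def k using ot_shift[of c l k] by metis
qed

text \<open>After removal of a common divisor \<open>z\<close> the minimum of the two orders is a
  constant \<open>r\<close>. If \<open>r \<ge> 1\<close>, the element attaining it keeps order
  \<open>r\<close> forever, against \<open>dead_order\<close>. So \<open>r = 0\<close>, and one of
  the two quotients is a unit.\<close>

lemma free_pair:
  assumes a: "free a" and b: "free b" shows "a / b \<in> S \<or> b / a \<in> S"
proof -
  have S: "a \<in> S" "b \<in> S" "a \<noteq> 0" "b \<noteq> 0" using a b by (auto simp: free_def)
  obtain l where l: "l \<ge> Suc i0" "a \<in> R l" "b \<in> R l" using S_common2[OF S(1,2)] by blast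
  obtain n \<rho> r z where n: "n \<ge> l" and z: "z = (\<Prod>j\<in>{l..<n}. x j ^ \<rho> j)"
    and st: "\<And>k. a / z / pr n (n + k) ^ r \<in> R (n + k)" "\<And>k. b / z / pr n (n + k) ^ r \<in> R (n + k)"
      "\<And>k. min (od (n + k) (a / z / pr n (n + k) ^ r)) (od (n + k) (b / z / pr n (n + k) ^ r)) = r"
    using pair_process[OF l(2) S(3) l(3) S(4)] by blast
  have zS: "z \<in> S" "z \<noteq> 0" unfolding z using x_nz by (auto intro!: subring_prod[OF S_sub] subring_power[OF S_sub] x_S)
  let ?a = "a / z" and ?b = "b / z"
  have R: "?a \<in> R n" "?b \<in> R n" using st(1,2)[of 0] by auto
  have eq: "?a * z = a" "?b * z = b" using zS by auto
  have fr: "free ?a" "free ?b"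
    using free_factor[of ?a z] free_factor[of ?b z] eq a b zS R R_S by auto
  have dd: "dead ?a n" "dead ?b n" using free_dead fr R n l by auto
  have nz: "?a \<noteq> 0" "?b \<noteq> 0" using zS S by auto
  have mm: "min (od n ?a) (od n ?b) = r" using st(3)[of 0] by simp
  have mem: "?a / pr n (n + k) ^ r \<in> mp (n + k) r" "?b / pr n (n + k) ^ r \<in> mp (n + k) r" for k
    using st(1,2,3)[of k] o_iff[of "?a / pr n (n + k) ^ r" "n + k" r] o_iff[of "?b / pr n (n + k) ^ r" "n + k" r] nz pr_nz by auto
  have "\<not> 1 \<le> r"
  proof
    assume r: "1 \<le> r"
    consider "od n ?a = r" | "od n ?b = r" using mm by (auto simp: min_def split: if_splits)
    then show False
    proof cases
      case 1 then show ?thesis using dead_order[OF R(1) nz(1) dd(1) _ r mem(1)] by blast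
    next
      case 2 then show ?thesis using dead_order[OF R(2) nz(2) dd(2) _ r mem(2)] by blast
    qed
  qed
  then have "od n ?a = 0 \<or> od n ?b = 0" using mm by (auto simp: min_def split: if_splits)
  then show ?thesis
  proof
    assume "od n ?a = 0"
    then have "?a \<notin> m n" using o_0_iff R nz by blast
    then have "inverse ?a \<in> R n" using max_ideal_unit[OF R(1)] by blast
    then have "?b * inverse ?a \<in> S" using RD(5)[OF R(2)] R_S by blast
    then show ?thesis using zS by (simp add: field_simps)
  next
    assume "od n ?b = 0"
    then have "?b \<notin> m n" using o_0_iff R nz by blast
    then have "inverse ?b \<in> R n" using max_ideal_unit[OF R(2)] by blast
    then have "?a * inverse ?b \<in> S" using RD(5)[OF R(1)] R_S by blast
    then show ?thesis using zS by (simp add: field_simps)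
  qed
qed

text \<open>If there were two such primes, choose \<open>u\<close> in one of them and \<open>w\<close> in all the others so that
  \<open>u + w\<close> and \<open>u\<^sup>2 + u w + w\<^sup>2\<close> lie in none: the orders of these two elements cannot both drop.\<close>

lemma H_unique:
  assumes P1: "P1 \<in> H" and P2: "P2 \<in> H" shows "P1 = P2"
proof (rule ccontr)
  assume ne: "P1 \<noteq> P2"
  \<comment> \<open>For each prime of \<open>H\<close>, an element outside it that lies in all the
    others: a product of elements witnessing that the primes are incomparable.\<close>
  have "\<exists>e. e \<in> S \<and> e \<notin> P \<and> (\<forall>P'\<in>H - {P}. e \<in> P')" if P: "P \<in> H" for P
  proof -
    have "\<exists>g. g \<in> P' \<and> g \<notin> P" if "P' \<in> H - {P}" for P' using H_incomparable[OF _ P, of P'] that by blast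
    then obtain g where g: "\<And>P'. P' \<in> H - {P} \<Longrightarrow> g P' \<in> P' \<and> g P' \<notin> P" by metis
    have gS: "\<And>P'. P' \<in> H - {P} \<Longrightarrow> g P' \<in> S" using g H_prime prime_S by blast
    let ?e = "prod g (H - {P})"
    have "?e \<in> S" by (rule subring_prod[OF S_sub gS])
    moreover have "?e \<notin> P" using prime_prod[OF S_sub H_prime[OF P], of "H - {P}" g] g gS by blast
    moreover have "?e \<in> P'" if P': "P' \<in> H - {P}" for P'
    proof -
      have "?e = g P' * prod g (H - {P} - {P'})" using H_fin P' by (subst prod.remove[of _ P']) auto
      moreover have "prod g (H - {P} - {P'}) \<in> S" by (rule subring_prod[OF S_sub]) (use gS in auto)
      ultimately show ?thesis using idealD(7)[OF S_sub primeD(1)[OF S_sub H_prime], of P' "g P'"] g P' by auto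
    qed
    ultimately show ?thesis by blast
  qed
  then obtain e where e: "\<And>P. P \<in> H \<Longrightarrow> e P \<in> S" "\<And>P. P \<in> H \<Longrightarrow> e P \<notin> P"
    "\<And>P P'. P \<in> H \<Longrightarrow> P' \<in> H - {P} \<Longrightarrow> e P \<in> P'" by metis
  \<comment> \<open>Among the primes of \<open>H\<close>, \<open>u\<close> lies exactly in
    \<open>P1\<close> and \<open>w\<close> exactly in the others, so \<open>u + w\<close> lies in
    none.\<close>
  define u where "u = (\<Sum>P\<in>H - {P1}. e P)"
  define w where "w = e P1"
  note HI = primeD(1)[OF S_sub H_prime]
  have u1: "u \<in> P1" unfolding u_def by (rule ideal_sum[OF S_sub HI[OF P1]]) (use e(3) P1 in auto)
  have uP: "u \<notin> P" if P: "P \<in> H - {P1}" for P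
  proof
    assume u: "u \<in> P"
    have "u = e P + (\<Sum>P'\<in>H - {P1} - {P}. e P')" unfolding u_def using H_fin P by (subst sum.remove[of _ P]) auto
    moreover have "(\<Sum>P'\<in>H - {P1} - {P}. e P') \<in> P"
      by (rule ideal_sum[OF S_sub HI]) (use e(3) P in auto)
    ultimately have "e P \<in> P" using idealD(4)[OF S_sub HI[of P], of u "\<Sum>P'\<in>H - {P1} - {P}. e P'"] u P by auto
    then show False using e(2) P by auto
  qed
  have w1: "w \<notin> P1" and wP: "\<And>P. P \<in> H - {P1} \<Longrightarrow> w \<in> P" using e P1 by (auto simp: w_def)
  have S: "u \<in> S" "w \<in> S" using u1 prime_S[OF H_prime[OF P1]] e(1)[OF P1] by (auto simp: w_def)
  have nz: "u \<noteq> 0" "w \<noteq> 0" using uP[of P2] w1 P2 ne idealD(1)[OF S_sub HI] P1 by auto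
  have c: "free (u + w)"
  proof -
    have "u + w \<notin> P" if P: "P \<in> H" for P
    proof (cases "P = P1")
      case True
      then show ?thesis using idealD(4)[OF S_sub HI[OF P1], of "u + w" u] u1 w1 by auto
    next
      case False
      then show ?thesis using idealD(4)[OF S_sub HI[OF P], of "u + w" w] uP[of P] wP[of P] P by auto
    qed
    then show ?thesis using S SD(3) P1 idealD(1)[OF S_sub HI[OF P1]] unfolding free_def by metis
  qed
  \<comment> \<open>This form is congruent to \<open>w * w\<close> modulo \<open>u\<close> and to
    \<open>u * u\<close> modulo \<open>w\<close>, so its value is free as well; it also equals
    \<open>(u + w)^2 - u * w\<close>.\<close>
  let ?q = "\<lambda>u w :: 'a. u * u + u * w + w * w"
  have \<delta>: "free (?q u w)"
  proof -
    have "?q u w \<notin> P" if P: "P \<in> H" for P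
    proof
      note PD = idealD[OF S_sub HI[OF P]]
      assume q: "?q u w \<in> P"
      show False
      proof (cases "P = P1")
        case True
        then have "u * (u + w) \<in> P" using PD(7) u1 S SD(3) by blast
        then have "?q u w - u * (u + w) \<in> P" using PD(4) q by blast
        then have "w * w \<in> P" by (simp add: algebra_simps)
        then show False using primeD(3)[OF S_sub H_prime[OF P], of w w] S w1 True by blast
      next
        case False
        then have "w * (u + w) \<in> P" using PD(7) wP[of P] P S SD(3) by blast
        then have "?q u w - w * (u + w) \<in> P" using PD(4) q by blast
        then have "u * u \<in> P" by (simp add: algebra_simps)
        then show False using primeD(3)[OF S_sub H_prime[OF P], of u u] S uP[of P] P False by blast
      qed
    qed
    then show ?thesis using S SD(3,5) P1 idealD(1)[OF S_sub HI[OF P1]] unfolding free_def by metis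
  qed
  obtain l where l: "l \<ge> Suc i0" "u \<in> R l" "w \<in> R l" using S_common2[OF S] by blast
  obtain n \<rho> r z where n: "n \<ge> l" and z: "z = (\<Prod>j\<in>{l..<n}. x j ^ \<rho> j)"
    and st: "\<And>k. u / z / pr n (n + k) ^ r \<in> R (n + k)" "\<And>k. w / z / pr n (n + k) ^ r \<in> R (n + k)"
      "\<And>k. min (od (n + k) (u / z / pr n (n + k) ^ r)) (od (n + k) (w / z / pr n (n + k) ^ r)) = r"
    using pair_process[OF l(2) nz(1) l(3) nz(2)] by blast
  have zS: "z \<in> S" "z \<noteq> 0" unfolding z using x_nz by (auto intro!: subring_prod[OF S_sub] subring_power[OF S_sub] x_S)
  have zP: "z \<notin> P" if P: "P \<in> H" for P
  proof
    assume "z \<in> P"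
    then obtain j where j: "j \<in> {l..<n}" "x j ^ \<rho> j \<in> P"
      using prime_prod[OF S_sub H_prime[OF P], of "{l..<n}" "\<lambda>j. x j ^ \<rho> j"] subring_power[OF S_sub x_S] z by blast
    then have "x j \<in> P" using prime_power[OF S_sub H_prime[OF P] x_S] by blast
    then have "P = N" using x_only_N[OF H_prime[OF P]] j l by auto
    then show False using P by (simp add: H_def)
  qed
  let ?u = "u / z" and ?w = "w / z"
  have R: "?u \<in> R n" "?w \<in> R n" using st(1,2)[of 0] by auto
  have US: "?u \<in> S" "?w \<in> S" using R R_S by blast+
  have eq: "?u * z = u" "?w * z = w" using zS by auto
  have unz: "?u \<noteq> 0" "?w \<noteq> 0" using nz zS by auto
  have "?u \<in> P1" using primeD(3)[OF S_sub H_prime[OF P1] US(1) zS(1)] eq(1) u1 zP[OF P1] by auto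
  then have uN: "?u \<in> m n" using prime_N[OF H_prime[OF P1]] m_eq R by blast
  have "?w \<in> P2" using primeD(3)[OF S_sub H_prime[OF P2] US(2) zS(1)] eq(2) wP[of P2] P2 ne zP[OF P2] by auto
  then have wN: "?w \<in> m n" using prime_N[OF H_prime[OF P2]] m_eq R by blast
  have mm: "min (od n ?u) (od n ?w) = r" using st(3)[of 0] by simp
  then have r: "1 \<le> r" using o_pos[OF uN unz(1)] o_pos[OF wN unz(2)] by simp
  have mem: "?u / pr n (n + k) ^ r \<in> mp (n + k) r" "?w / pr n (n + k) ^ r \<in> mp (n + k) r" for k
    using st(1,2,3)[of k] o_iff[of "?u / pr n (n + k) ^ r" "n + k" r] o_iff[of "?w / pr n (n + k) ^ r" "n + k" r] unz pr_nz by auto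
  have mem0: "?u \<in> mp n r" "?w \<in> mp n r" using mem[of 0] by auto
  let ?c = "?u + ?w"
  have cR: "?c \<in> R n" using RD(3) R by blast
  have "?c * z = u + w" using eq by (simp add: distrib_right)
  then have cf: "free ?c" using free_factor[of ?c z] c zS cR R_S by auto
  then have c0: "?c \<noteq> 0" by (simp add: free_def)
  have cd: "dead ?c n" using free_dead[OF cf cR] n l by simp
  have cm: "?c / pr n (n + k) ^ r \<in> mp (n + k) r" for k
    using idealD(3)[OF sub mpI mem] by (simp add: add_divide_distrib)
  \<comment> \<open>A dead element cannot keep the positive order \<open>r\<close> at all stages, so
    the initial forms of \<open>?u\<close> and \<open>?w\<close> cancel in the sum.\<close>
  have "od n ?c \<noteq> r" using dead_order[OF cR c0 cd _ r cm] by blast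
  moreover have "r \<le> od n ?c" using o_iff[OF cR c0] cm[of 0] by simp
  ultimately have "Suc r \<le> od n ?c" by simp
  then have c1: "?c \<in> mp n (Suc r)" using o_iff[OF cR c0] by simp
  have ou: "od n ?u = r"
  proof (rule ccontr)
    assume "od n ?u \<noteq> r"
    then have "Suc r \<le> od n ?u" "od n ?w = r" using mm by (auto simp: min_def split: if_splits)
    then have "?u \<in> mp n (Suc r)" using o_iff[OF R(1) unz(1)] by simp
    then have "?c - ?u \<in> mp n (Suc r)" by (rule idealD(4)[OF sub mpI c1])
    then have "Suc r \<le> od n ?w" using o_iff[OF R(2) unz(2), of "Suc r"] by simp
    then show False using \<open>od n ?w = r\<close> by simp
  qed
  have ow: "od n ?w = r"
  proof (rule ccontr)
    assume "od n ?w \<noteq> r"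
    then have "Suc r \<le> od n ?w" using mm by (auto simp: min_def split: if_splits)
    then have "?w \<in> mp n (Suc r)" using o_iff[OF R(2) unz(2)] by simp
    then have "?c - ?w \<in> mp n (Suc r)" by (rule idealD(4)[OF sub mpI c1])
    then have "Suc r \<le> od n ?u" using o_iff[OF R(1) unz(1), of "Suc r"] by simp
    then show False using ou by simp
  qed
  let ?D = "?q ?u ?w"
  have DR: "?D \<in> R n" by (intro RD(3,5) R)
  have "?D * (z * z) = ?q u w"
    using zS(2) by (simp add: field_simps)
  then have Df: "free ?D" using free_factor[of ?D "z * z"] \<delta> SD(5) zS DR R_S by auto
  then have D0: "?D \<noteq> 0" by (simp add: free_def)
  have Dd: "dead ?D n" using free_dead[OF Df DR] n l by simp
  have Dm: "?D / pr n (n + k) ^ (r + r) \<in> mp (n + k) (r + r)" for k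
  proof -
    let ?U = "?u / pr n (n + k) ^ r" and ?W = "?w / pr n (n + k) ^ r"
    have "?q ?U ?W \<in> mp (n + k) (r + r)"
      using ideal_pow_mult[OF sub mI mem(1)[of k] mem(1)[of k]] ideal_pow_mult[OF sub mI mem(1)[of k] mem(2)[of k]]
        ideal_pow_mult[OF sub mI mem(2)[of k] mem(2)[of k]] idealD(3)[OF sub mpI] by blast
    moreover have "?q ?U ?W = ?D / pr n (n + k) ^ (r + r)"
    proof -
      have "?q (a / y) (b / y) = ?q a b / (y * y)" for a b y :: 'a by (simp add: add_divide_distrib)
      then show ?thesis by (simp only: power_add)
    qed
    ultimately show ?thesis by simp
  qed
  \<comment> \<open>\<open>?D\<close> is \<open>?c * ?c - ?u * ?w\<close>, where the first term has
    order at least \<open>2 r + 2\<close> and the second exactly \<open>2 r\<close>. So the order of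
    \<open>?D\<close> never drops, which is impossible for a dead element.\<close>
  have "od n ?D = r + r"
  proof (rule o_eqI[OF DR])
    show "?D \<in> mp n (r + r)" using Dm[of 0] by simp
    show "?D \<notin> mp n (Suc (r + r))"
    proof
      assume D: "?D \<in> mp n (Suc (r + r))"
      have "?c * ?c \<in> mp n (Suc r + Suc r)" by (rule ideal_pow_mult[OF sub mI c1 c1])
      then have "?c * ?c \<in> mp n (Suc (r + r))" using ideal_pow_antimono[OF sub mI, of "Suc (r + r)" "Suc r + Suc r"] by auto
      then have "?c * ?c - ?D \<in> mp n (Suc (r + r))" using idealD(4)[OF sub mpI] D by blast
      moreover have "?c * ?c - ?D = ?u * ?w" by (simp add: algebra_simps)
      ultimately have "?u * ?w \<in> mp n (Suc (r + r))" by metis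
      then have "Suc (r + r) \<le> od n (?u * ?w)" using o_iff RD(5) R unz by (metis mult_eq_0_iff)
      then show False using o_mult[OF R unz] ou ow by simp
    qed
  qed
  then show False using dead_order[OF DR D0 Dd _ _ Dm] r by simp
qed

text \<open>If \<open>t \<in> P\<close>, the numerator is not free, but \<open>t + s\<close> is.
  Comparing \<open>t + s\<close> with \<open>s\<close> settles the matter, since
  \<open>t / s\<close> and \<open>(t + s) / s\<close> differ by one.\<close>

lemma almost_local:
  assumes q: "q = t / s" "t \<in> S" "s \<in> S" "t \<noteq> 0" and P: "H \<subseteq> {P}" "s \<notin> P" "s \<noteq> 0"
  shows "q \<in> S \<or> inverse q \<in> S"
proof -
  have fs: "free s" using q P by (auto simp: free_def)
  show ?thesis
  proof (cases "free t")
    case True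
    then show ?thesis using free_pair[OF True fs] q by auto
  next
    case False
    then have PH: "P \<in> H" and tP: "t \<in> P" using q P by (auto simp: free_def)
    note PD = idealD[OF S_sub primeD(1)[OF S_sub H_prime[OF PH]]]
    have "t + s \<notin> P" using PD(4)[of "t + s" t] tP P(2) by auto
    then have ts: "free (t + s)" using P q SD(3) PD(1) unfolding free_def by auto
    have ts0: "t + s \<noteq> 0" using ts by (simp add: free_def)
    from free_pair[OF ts fs] show ?thesis
    proof
      assume "(t + s) / s \<in> S"
      then have "(t + s) / s - 1 \<in> S" using SD(2,4) by blast
      moreover have "(t + s) / s - 1 = q" using q P(3) by (simp add: add_divide_distrib)
      ultimately show ?thesis by simp
    next
      assume sg: "s / (t + s) \<in> S"
      show ?thesis
      proof (cases "s / (t + s) \<in> N")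
        case False
        then have "inverse (s / (t + s)) \<in> S" using unit_S[OF sg] by blast
        then have "inverse (s / (t + s)) - 1 \<in> S" using SD(2,4) by blast
        moreover have "inverse (s / (t + s)) - 1 = q" using q P(3) by (simp add: add_divide_distrib)
        ultimately show ?thesis by simp
      next
        \<comment> \<open>Now \<open>1 - s / (t + s) = t / (t + s)\<close> is a unit, and
          \<open>s / t\<close> is its inverse minus one.\<close>
        case True
        have "1 - s / (t + s) \<notin> N" using local_add_unit(2)[OF S_local SD(2), of "s / (t + s)"] one_notin_max[OF S_sub] True N_eq by simp
        then have "inverse (1 - s / (t + s)) \<in> S" using unit_S SD(2,4) sg by blast
        then have "inverse (1 - s / (t + s)) - 1 \<in> S" using SD(2,4) by blast
        moreover have e: "1 - s / (t + s) = t / (t + s)" using ts0 by (simp add: field_simps)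
        have "inverse (1 - s / (t + s)) - 1 = inverse q" unfolding e using q by (simp add: add_divide_distrib)
        ultimately show ?thesis by simp
      qed
    qed
  qed
qed

lemma valuation: "valuation_ring S"
  unfolding valuation_ring_def
proof (intro conjI allI impI)
  show "subring S" by (rule S_sub)
  fix q :: 'a assume q0: "q \<noteq> 0"
  obtain a b where ab: "a \<in> S" "b \<in> S" "b \<noteq> 0" "q = a / b" using S_quotient by blast
  have a0: "a \<noteq> 0" using ab q0 by auto
  show "q \<in> S \<or> inverse q \<in> S"
  proof (cases "H = {}")
    case True
    then have "free a" "free b" using ab a0 by (auto simp: free_def)
    then show ?thesis using free_pair ab by auto
  next
    case False
    then obtain P where PH: "P \<in> H" by blast
    then have HP: "H \<subseteq> {P}" using H_unique by blast
    note Pp = H_prime[OF PH]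
    have PN: "P \<noteq> N" using PH by (simp add: H_def)
    have h1: "P \<noteq> {0}" "\<And>q. prime_ideal S q \<Longrightarrow> q \<subset> P \<Longrightarrow> q = {0}"
      using height_one_iff[OF S_sub Pp] PH by (auto simp: H_def)
    obtain f where f: "f \<in> P" "f \<noteq> 0" using h1(1) prime_zero_in[OF Pp] by blast
    obtain l where l: "\<And>i. l \<le> i \<Longrightarrow> x i \<notin> P" using not_top_x[OF Pp PN] by blast
    obtain j1 where j1: "\<forall>j\<ge>j1. f \<in> R j" using S_common f prime_S[OF Pp] by blast
    obtain j where j: "j \<ge> max l j1" "a \<in> R j" "b \<in> R j" using S_common2[OF ab(1,2)] by blast
    have lj: "\<And>i. j \<le> i \<Longrightarrow> x i \<notin> P" using l j by auto
    \<comment> \<open>The localizations of \<open>S\<close> and \<open>R j\<close> at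
      \<open>P\<close> agree, and this common ring is a valuation ring; so \<open>q\<close> or its
      inverse has a denominator outside \<open>P\<close>, as \<open>almost_local\<close>
      requires.\<close>
    have "a / b \<in> localize (R j) (P \<inter> R j) \<or> b / a \<in> localize (R j) (P \<inter> R j)"
    proof (rule localize_height_one_valuation[OF sub noe contract_S[OF Pp]])
      show "P \<inter> R j \<noteq> {0}" using f j1 j by auto
      fix q0 assume q0: "prime_ideal (R j) q0" "q0 \<subset> P \<inter> R j"
      obtain q' where q': "prime_ideal S q'" "q' \<subseteq> P" "q' \<inter> R j = q0" using lift_prime[OF Pp lj q0(1)] q0(2) by blast
      have "q' \<subset> P" using q' q0 by blast
      then have "q' = {0}" using h1(2) q' by blast
      then show "q0 = {0}" using q'(3) RD(1) by auto
    qed (use cic j ab a0 in auto)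
    then show ?thesis
    proof
      assume "a / b \<in> localize (R j) (P \<inter> R j)"
      then obtain t s where ts: "q = t / s" "t \<in> R j" "s \<in> R j" "s \<notin> P" using ab by (auto simp: localize_def)
      have "s \<noteq> 0" "t \<noteq> 0" using ts q0 by auto
      then show ?thesis using almost_local[OF ts(1) _ _ _ HP ts(4)] ts R_S by blast
    next
      assume "b / a \<in> localize (R j) (P \<inter> R j)"
      then obtain t s where ts: "inverse q = t / s" "t \<in> R j" "s \<in> R j" "s \<notin> P" using ab by (auto simp: localize_def)
      have "s \<noteq> 0" "t \<noteq> 0" using ts q0 by auto
      then have "inverse q \<in> S \<or> inverse (inverse q) \<in> S"
        using almost_local[OF ts(1) _ _ _ HP ts(4)] ts R_S by blast
      then show ?thesis by auto
    qed
  qed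
qed

end

theorem theorem8p1:
  fixes R :: "nat \<Rightarrow> 'a::field set"
  assumes quot: "has_quotient_field (R 0)"
    and reg: "\<And>i. regular_local_ring (R i)"
    and dim: "\<And>i. krull_dim (R i) \<ge> 2"
    and lqt: "\<And>i. local_quadratic_transform (R i) (R (Suc i))"
    and strict: "\<And>i. R i \<subset> R (Suc i)"
  defines "S \<equiv> (\<Union>i. R i)"
  shows "(valuation_ring S \<longleftrightarrow> finite {P. prime_ideal S P \<and> height S P = 1})
       \<and> (finite {P. prime_ideal S P \<and> height S P = 1} \<longleftrightarrow>
           (krull_dim S = 1 \<or>
            (krull_dim S = 2 \<and> (\<exists>G. rat_subgroup G \<and>
                 value_group_is_Z_lex (boundary_valuation_ring R) G))))"
proof -
  have "\<forall>i. \<exists>x Q. x \<in> max_ideal (R i) \<and> x \<notin> ideal_pow (R i) (max_ideal (R i)) 2 \<and>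
        prime_ideal (ring_adjoin (R i) (max_ideal (R i)) x) Q \<and> max_ideal (R i) \<subseteq> Q \<and>
        R (Suc i) = localize (ring_adjoin (R i) (max_ideal (R i)) x) Q"
    using lqt unfolding local_quadratic_transform_def by blast
  then obtain x Q where xQ: "\<And>i. x i \<in> max_ideal (R i) \<and> x i \<notin> ideal_pow (R i) (max_ideal (R i)) 2 \<and>
        prime_ideal (ring_adjoin (R i) (max_ideal (R i)) (x i)) (Q i) \<and> max_ideal (R i) \<subseteq> Q i \<and>
        R (Suc i) = localize (ring_adjoin (R i) (max_ideal (R i)) (x i)) (Q i)"
    by metis
  interpret qs: quad_seq R x Q
    by unfold_locales (use quot reg xQ in auto)
  have S: "S = qs.S" unfolding S_def qs.S_def ..
  have fv: "valuation_ring qs.S" if "finite qs.height_one_primes"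
  proof -
    interpret qf: quad_seq_fin R x Q by unfold_locales (rule that)
    show ?thesis by (rule qf.valuation)
  qed
  show ?thesis
    unfolding S using fv qs.valuation_ring_finite qs.valuation_ring_dim qs.dim1_finite qs.dim2_finite by blast
qed

end
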